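(* Consider the three-particle Schrödinger operator in $L^2(\mathbb{R}^6)$ $$H=H_0-V_{12}(r_1-r_2)-V_{13}(r_1-r_3)-V_{23}(r_2-r_3),$$ where $H_0$ is the kinetic energy operator with the centre of mass removed. For $\varepsilon\ge 0$ let $h_{12}(\varepsilon):=-\Delta_x-(1+\varepsilon)V_{12}(\alpha x)$ in $L^2(\mathbb{R}^3)$, where $\alpha=\hbar/\sqrt{2\mu_{12}}$. Assume: 1. There are constants $b_1,b_2>0$ with $0\le V_{12}(\alpha x)\le b_1e^{-b_2|x|}$ for all $x \in \mathbb{R}^3$. 2. $h_{12}(0)\ge 0$, and $\sigma(h_{12}(\varepsilon))\cap(-\infty,0)\ne\emptyset$ for every $\varepsilon>0$. 3. $V_{13},V_{23}\in L^2(\mathbb{R}^3)+L^\infty_\infty(\mathbb{R}^3)$, $V_{13},V_{23}\ge 0$ and $V_{23}\neq 0$. Suppose additionally that $H\ge 0$ and that $H\psi_0=0$ for some $\psi_0\in D(H_0)$. Then $\psi_0=0$.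
   Context: Three particles with masses $m_1,m_2,m_3>0$ and position vectors $r_1,r_2,r_3\in\mathbb{R}^3$. After separating the centre of mass, the configuration space is $\mathbb{R}^6$; with Jacobi coordinates $x=\frac{\sqrt{2\mu_{12}}}{\hbar}(r_2-r_1)$, $y=\frac{\sqrt{2M_{12}}}{\hbar}\bigl(r_3-\frac{m_1}{m_1+m_2}r_1-\frac{m_2}{m_1+m_2}r_2\bigr)$, where $\mu_{12}=\frac{m_1m_2}{m_1+m_2}$ and $M_{12}=\frac{(m_1+m_2)m_3}{m_1+m_2+m_3}$, one has $H_0=-\Delta_x-\Delta_y$, with $D(H_0)=H^2(\mathbb{R}^6)$. In these coordinates the interaction of particles 1 and 2 is multiplication by $V_{12}(\alpha x)$, with the convention that the argument of $V_{12}$ is oriented along $r_2-r_1=\alpha x$; the other differences $r_i-r_j$ are linear functions of $(x,y)$. $L^\infty_\infty(\mathbb{R}^3)$ denotes the bounded Borel functions going to zero at infinity. "$V_{23}\ne0$" means not equal to zero almost everywhere. Assumption 2 expresses that the pair $(1,2)$ has no negative energy bound state and has a zero energy resonance. *)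

theory Defs
  imports "HOL-Analysis.Analysis"
begin

section \<open>Square-integrable functions\<close>

text \<open>
  Elements of \<open>L\<^sup>2\<close> are represented by Borel functions (every class modulo null sets
  contains one); equality in \<open>L\<^sup>2\<close> is equality almost everywhere.
\<close>

definition L2 :: "('a::euclidean_space \<Rightarrow> 'b::real_normed_vector) set" where
  "L2 = {f \<in> borel_measurable lborel. integrable lborel (\<lambda>x. (norm (f x))\<^sup>2)}"

definition L2_inner :: "('a::euclidean_space \<Rightarrow> complex) \<Rightarrow> ('a \<Rightarrow> complex) \<Rightarrow> complex" where
  "L2_inner f g = (LINT x|lborel. cnj (f x) * g x)"

definition L2_norm :: "('a::euclidean_space \<Rightarrow> complex) \<Rightarrow> real" where
  "L2_norm f = sqrt (LINT x|lborel. (norm (f x))\<^sup>2)"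

definition Linf_vanishing :: "('a::euclidean_space \<Rightarrow> real) set" where
  "Linf_vanishing =
     {g \<in> borel_measurable borel. bounded (range g) \<and> (g \<longlongrightarrow> 0) at_infinity}"

text \<open>
  Demanding \<open>V = f + g\<close> everywhere rather than almost everywhere is no restriction on a
  Borel function \<open>V\<close>, since \<open>f\<close> may be changed on a null set.
\<close>

definition L2_plus_Linf_vanishing :: "('a::euclidean_space \<Rightarrow> real) set" where
  "L2_plus_Linf_vanishing = {V. \<exists>f\<in>L2. \<exists>g\<in>Linf_vanishing. V = (\<lambda>x. f x + g x)}"


section \<open>Weak derivatives and Sobolev spaces\<close>

text \<open>
  A list of basis vectors plays the role of a multi-index; its length is the order of the
  derivative.
\<close>

definition partials ::
    "'a::euclidean_space list \<Rightarrow> ('a \<Rightarrow> real) \<Rightarrow> 'a \<Rightarrow> real" where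
  "partials bs \<phi> = foldr (\<lambda>b g x. frechet_derivative g (at x) b) bs \<phi>"

definition test_functions :: "('a::euclidean_space \<Rightarrow> real) set" where
  "test_functions =
     {\<phi>. (\<forall>bs\<in>lists Basis. partials bs \<phi> differentiable_on UNIV) \<and>
          compact (closure {x. \<phi> x \<noteq> 0})}"

definition is_weak_partial ::
    "'a::euclidean_space list \<Rightarrow> ('a \<Rightarrow> complex) \<Rightarrow> ('a \<Rightarrow> complex) \<Rightarrow> bool" where
  "is_weak_partial bs f g \<longleftrightarrow>
     (\<forall>\<phi>\<in>test_functions.
        (LINT x|lborel. partials bs \<phi> x *\<^sub>R f x) =
        (-1) ^ length bs * (LINT x|lborel. \<phi> x *\<^sub>R g x))"

definition sobolev :: "nat \<Rightarrow> ('a::euclidean_space \<Rightarrow> complex) set" where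
  "sobolev k =
     {f \<in> L2. \<forall>bs\<in>lists Basis. length bs \<le> k \<longrightarrow> (\<exists>g\<in>L2. is_weak_partial bs f g)}"

text \<open>
  Weak derivatives are unique up to null sets, so the choice below only selects a
  representative.
\<close>

definition weak_partial ::
    "'a::euclidean_space list \<Rightarrow> ('a \<Rightarrow> complex) \<Rightarrow> 'a \<Rightarrow> complex" where
  "weak_partial bs f = (SOME g. g \<in> L2 \<and> is_weak_partial bs f g)"

definition laplacian :: "('a::euclidean_space \<Rightarrow> complex) \<Rightarrow> 'a \<Rightarrow> complex" where
  "laplacian f x = (\<Sum>b\<in>Basis. weak_partial [b, b] f x)"


section \<open>Operators in \<open>L\<^sup>2\<close>\<close>

text \<open>
  An unbounded operator in \<open>L\<^sup>2\<close> is given by its domain \<open>D\<close> and its action \<open>A\<close> on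
  representatives.
\<close>

definition nonneg_operator ::
    "('a::euclidean_space \<Rightarrow> complex) set \<Rightarrow> (('a \<Rightarrow> complex) \<Rightarrow> 'a \<Rightarrow> complex) \<Rightarrow> bool" where
  "nonneg_operator D A \<longleftrightarrow> (\<forall>f\<in>D. L2_inner f (A f) \<in> \<real>\<^sub>\<ge>\<^sub>0)"

text \<open>
  \<open>z\<close> belongs to the resolvent set iff \<open>A - z\<close> is a bijection from \<open>D\<close> onto \<open>L\<^sup>2\<close>
  (modulo null sets) with bounded inverse.
\<close>

definition resolvent_set ::
    "('a::euclidean_space \<Rightarrow> complex) set \<Rightarrow> (('a \<Rightarrow> complex) \<Rightarrow> 'a \<Rightarrow> complex) \<Rightarrow> complex set" where
  "resolvent_set D A =
     {z. \<exists>C. \<forall>g\<in>L2. \<exists>f\<in>D.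
           (AE x in lborel. A f x - z * f x = g x) \<and>
           L2_norm f \<le> C * L2_norm g \<and>
           (\<forall>f'\<in>D. (AE x in lborel. A f' x - z * f' x = g x) \<longrightarrow>
                    (AE x in lborel. f' x = f x))}"

definition spectrum ::
    "('a::euclidean_space \<Rightarrow> complex) set \<Rightarrow> (('a \<Rightarrow> complex) \<Rightarrow> 'a \<Rightarrow> complex) \<Rightarrow> complex set" where
  "spectrum D A = - resolvent_set D A"

text \<open>The action of \<open>-\<Delta> - W\<close>; its domain is always \<open>sobolev 2\<close> here.\<close>

definition schroedinger ::
    "('a::euclidean_space \<Rightarrow> real) \<Rightarrow> ('a \<Rightarrow> complex) \<Rightarrow> 'a \<Rightarrow> complex" where
  "schroedinger W f x = - laplacian f x - complex_of_real (W x) * f x"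


section \<open>Jacobi coordinates and the three-particle Hamiltonian\<close>

definition mu12 :: "real \<Rightarrow> real \<Rightarrow> real" where
  "mu12 m1 m2 = m1 * m2 / (m1 + m2)"

definition M12 :: "real \<Rightarrow> real \<Rightarrow> real \<Rightarrow> real" where
  "M12 m1 m2 m3 = (m1 + m2) * m3 / (m1 + m2 + m3)"

definition jacobi_x :: "real \<Rightarrow> real \<Rightarrow> real \<Rightarrow> real^3 \<Rightarrow> real^3 \<Rightarrow> real^3" where
  "jacobi_x hbar m1 m2 r1 r2 = (sqrt (2 * mu12 m1 m2) / hbar) *\<^sub>R (r2 - r1)"

definition jacobi_y ::
    "real \<Rightarrow> real \<Rightarrow> real \<Rightarrow> real \<Rightarrow> real^3 \<Rightarrow> real^3 \<Rightarrow> real^3 \<Rightarrow> real^3" where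
  "jacobi_y hbar m1 m2 m3 r1 r2 r3 =
     (sqrt (2 * M12 m1 m2 m3) / hbar) *\<^sub>R
       (r3 - (m1 / (m1 + m2)) *\<^sub>R r1 - (m2 / (m1 + m2)) *\<^sub>R r2)"

definition alpha :: "real \<Rightarrow> real \<Rightarrow> real \<Rightarrow> real" where
  "alpha hbar m1 m2 = hbar / sqrt (2 * mu12 m1 m2)"

definition beta :: "real \<Rightarrow> real \<Rightarrow> real \<Rightarrow> real \<Rightarrow> real" where
  "beta hbar m1 m2 m3 = hbar / sqrt (2 * M12 m1 m2 m3)"

text \<open>The differences \<open>r1 - r3\<close> and \<open>r2 - r3\<close> as functions of the Jacobi coordinates.\<close>

definition diff13 :: "real \<Rightarrow> real \<Rightarrow> real \<Rightarrow> real \<Rightarrow> real^3 \<Rightarrow> real^3 \<Rightarrow> real^3" where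
  "diff13 hbar m1 m2 m3 x y =
     - (m2 / (m1 + m2) * alpha hbar m1 m2) *\<^sub>R x - beta hbar m1 m2 m3 *\<^sub>R y"

definition diff23 :: "real \<Rightarrow> real \<Rightarrow> real \<Rightarrow> real \<Rightarrow> real^3 \<Rightarrow> real^3 \<Rightarrow> real^3" where
  "diff23 hbar m1 m2 m3 x y =
     (m1 / (m1 + m2) * alpha hbar m1 m2) *\<^sub>R x - beta hbar m1 m2 m3 *\<^sub>R y"

lemma jacobi_differences:
  fixes r1 r2 r3 :: "real^3"
  assumes pos: "hbar > 0" "m1 > 0" "m2 > 0" "m3 > 0"
  defines "x \<equiv> jacobi_x hbar m1 m2 r1 r2"
    and "y \<equiv> jacobi_y hbar m1 m2 m3 r1 r2 r3"
  shows "alpha hbar m1 m2 *\<^sub>R x = r2 - r1"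
    and "diff13 hbar m1 m2 m3 x y = r1 - r3"
    and "diff23 hbar m1 m2 m3 x y = r2 - r3"
proof -
  have mu: "mu12 m1 m2 > 0" and M: "M12 m1 m2 m3 > 0"
    using pos by (simp_all add: mu12_def M12_def)
  show ax: "alpha hbar m1 m2 *\<^sub>R x = r2 - r1"
    using pos mu by (simp add: x_def alpha_def jacobi_x_def)
  have b: "beta hbar m1 m2 m3 *\<^sub>R y = r3 - (m1 / (m1 + m2)) *\<^sub>R r1 - (m2 / (m1 + m2)) *\<^sub>R r2"
    using pos M by (simp add: y_def beta_def jacobi_y_def)
  define s where "s = m2 / (m1 + m2)"
  have s: "m1 / (m1 + m2) = 1 - s"
    using pos by (simp add: s_def field_simps)
  have ax': "(c * alpha hbar m1 m2) *\<^sub>R x = c *\<^sub>R (r2 - r1)" for c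
    using ax by (metis scaleR_scaleR)
  show "diff13 hbar m1 m2 m3 x y = r1 - r3"
    unfolding diff13_def b s s_def[symmetric] scaleR_minus_left ax'
    by (simp add: algebra_simps)
  show "diff23 hbar m1 m2 m3 x y = r2 - r3"
    unfolding diff23_def b s s_def[symmetric] ax'
    by (simp add: algebra_simps)
qed

definition h12 ::
    "real \<Rightarrow> real \<Rightarrow> real \<Rightarrow> (real^3 \<Rightarrow> real) \<Rightarrow> real \<Rightarrow> (real^3 \<Rightarrow> complex) \<Rightarrow> real^3 \<Rightarrow> complex" where
  "h12 hbar m1 m2 V12 \<epsilon> = schroedinger (\<lambda>x. (1 + \<epsilon>) * V12 (alpha hbar m1 m2 *\<^sub>R x))"

text \<open>
  The configuration space is \<open>(real^3) \<times> (real^3)\<close>, whose Laplacian is \<open>\<Delta>\<^sub>x + \<Delta>\<^sub>y\<close>. The argument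
  of \<open>V12\<close> is oriented along \<open>r2 - r1\<close>, the others along \<open>r1 - r3\<close> and \<open>r2 - r3\<close>.
\<close>

definition hamiltonian ::
    "real \<Rightarrow> real \<Rightarrow> real \<Rightarrow> real \<Rightarrow> (real^3 \<Rightarrow> real) \<Rightarrow> (real^3 \<Rightarrow> real) \<Rightarrow> (real^3 \<Rightarrow> real) \<Rightarrow>
     ((real^3) \<times> (real^3) \<Rightarrow> complex) \<Rightarrow> (real^3) \<times> (real^3) \<Rightarrow> complex" where
  "hamiltonian hbar m1 m2 m3 V12 V13 V23 =
     schroedinger (\<lambda>(x, y). V12 (alpha hbar m1 m2 *\<^sub>R x)
                           + V13 (diff13 hbar m1 m2 m3 x y)
                           + V23 (diff23 hbar m1 m2 m3 x y))"

end

theory Submission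
 imports Defs
begin

text \<open>
  Write \<open>v x\<close> for the pair potential \<open>V12 (\<alpha> x)\<close>. A negative spectrum of \<open>h12 \<epsilon>\<close> for every
  \<open>\<epsilon> > 0\<close> means that the Birman--Schwinger operator \<open>\<surd>v (-\<Delta> + \<kappa>\<^sup>2)\<^bsup>-1\<^esup> \<surd>v\<close> has norm arbitrarily close
  to \<open>1\<close>. Its almost maximisers produce positive functions \<open>h\<close> on \<open>\<real>\<^sup>3\<close> that decay like \<open>1 / \<bar>x\<bar>\<close>, are
  bounded from below by a fixed \<open>m > 0\<close>, and nearly satisfy \<open>-\<Delta> h - v h \<le> 0\<close>: an approximate
  resonance. As \<open>H \<ge> 0\<close>, the absolute value of the real or imaginary part \<open>a\<close> of a zero mode is again
  a weak zero mode. Testing it against \<open>h x\<close> times a cutoff in \<open>ln (1 + \<bar>(x, y)\<bar>\<^sup>2) / L\<close> gives an error of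
  order \<open>\<surd>L / L\<close>, because \<open>1 / (\<bar>x\<bar> (1 + \<bar>(x, y)\<bar>\<^sup>2))\<close> fails to be square integrable on \<open>\<real>\<^sup>6\<close> only
  logarithmically. Hence \<open>(V13 + V23) a = 0\<close>, and \<open>a\<close> is a zero mode of \<open>-\<Delta>\<^sub>x - v x - \<Delta>\<^sub>y\<close>, where
  \<open>-\<Delta>\<^sub>x - v \<ge> 0\<close>. Therefore \<open>\<nabla>\<^sub>y a = 0\<close>, and a square-integrable function that does not depend on
  \<open>y\<close> vanishes.
\<close>

section \<open>Smooth functions and test functions\<close>

text \<open>No exact resonance is constructed; that would require a limit of maximisers of the
  Birman--Schwinger operator. Almost maximisers suffice because the bounds \<open>C\<close> and
  \<open>m\<close> depend neither on \<kappa> nor on the residual \<delta>. The order of limits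
  matters: at a fixed cutoff radius e^L the residual is multiplied by a norm that grows with L, so
  \<delta> is sent to zero before L grows. The lower bound \<open>m\<close> keeps the almost
  maximisers from fading away in this limit; otherwise the tested inequality would say nothing about
  the zero mode.

  The absolute value gives the tested integral a sign, and it is undone once the outer potentials
  are known to annihilate the zero mode. Nonnegativity of an operator is evaluated on explicit
  functions only: on test functions, and on Y * (s g), where it shows that an almost maximiser is
  almost fixed by the Birman--Schwinger operator. A zero mode is known only through its weak
  Laplacian, so its Dirichlet energy is reached through mollified and cut off approximants whose
  energies have the right limit.\<close>

definition pd :: "'a::euclidean_space \<Rightarrow> ('a \<Rightarrow> real) \<Rightarrow> 'a \<Rightarrow> real" where
 "pd b f = (\<lambda>x. frechet_derivative f (at x) b)"

text \<open>Smoothness is split off from compact support because the convolutions with the resolvent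
  kernel, among them the approximate resonances, are smooth without being compactly
  supported.\<close>

definition smooth :: "('a::euclidean_space \<Rightarrow> real) \<Rightarrow> bool" where
 "smooth f \<longleftrightarrow> (\<forall>bs\<in>lists Basis. partials bs f differentiable_on UNIV)"

abbreviation test :: "('a::euclidean_space \<Rightarrow> real) \<Rightarrow> bool" where
 "test \<phi> \<equiv> \<phi> \<in> test_functions"

lemma pd_eq: "(f has_derivative f') (at x) \<Longrightarrow> pd b f x = f' b"
 unfolding pd_def using frechet_derivative_at by metis

lemma partials_Nil [simp]: "partials [] f = f"
 and partials_Cons [simp]: "partials (b # bs) f = pd b (partials bs f)"
 by (simp_all add: partials_def pd_def)

text \<open>The head of the list is the outermost derivative and the last entry the innermost one,
  so induction from the right end replaces \<open>f\<close> by one of its first derivatives.\<close>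

lemma partials_snoc: "partials (bs @ [b]) f = partials bs (pd b f)"
 by (simp add: partials_def pd_def)

lemma smooth_differentiable: "smooth f \<Longrightarrow> f differentiable (at x)"
 unfolding smooth_def by (metis lists.Nil partials_Nil differentiable_on_def UNIV_I)

lemma smooth_has_derivative:
 "smooth f \<Longrightarrow> (f has_derivative frechet_derivative f (at x)) (at x)"
 using smooth_differentiable frechet_derivative_works by blast

lemma smooth_pd: "smooth f \<Longrightarrow> b \<in> Basis \<Longrightarrow> smooth (pd b f)"
 unfolding smooth_def by (metis partials_snoc lists.Nil lists.Cons append_in_lists_conv)

lemma smooth_partials: "smooth f \<Longrightarrow> bs \<in> lists Basis \<Longrightarrow> smooth (partials bs f)"
 by (induction bs) (auto simp: smooth_pd)

lemma smooth_continuous: "smooth f \<Longrightarrow> continuous_on A f"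
 by (meson continuous_at_imp_continuous_on differentiable_imp_continuous_within smooth_differentiable)

lemma smooth_measurable [measurable_dest]: "smooth f \<Longrightarrow> f \<in> borel_measurable borel"
 using borel_measurable_continuous_onI smooth_continuous by blast

text \<open>Smoothness is the greatest property that implies differentiability and is inherited by
  first partial derivatives. Closure properties thus reduce to naming a class \<open>S\<close> that
  is stable under one differentiation, and higher derivatives never appear explicitly.\<close>

lemma smooth_coinduct:
 assumes "f \<in> S" and step: "\<And>f. f \<in> S \<Longrightarrow> (\<forall>x. f differentiable (at x)) \<and> (\<forall>b\<in>Basis. pd b f \<in> S)"
 shows "smooth f"
proof -
 have "partials bs f differentiable_on UNIV" if "bs \<in> lists Basis" "f \<in> S" for bs f
  using that
 proof (induction bs arbitrary: f rule: rev_induct)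
  case Nil
  then show ?case using step by (auto simp: differentiable_on_def)
 next
  case (snoc b bs)
  then show ?case using step by (auto simp: partials_snoc)
 qed
 then show ?thesis using \<open>f \<in> S\<close> by (auto simp: smooth_def)
qed

lemma frechet_derivative_eq_sum_pd:
 assumes "f differentiable (at x)"
 shows "frechet_derivative f (at x) v = (\<Sum>c\<in>Basis. (v \<bullet> c) * pd c f x)"
proof -
 interpret l: linear "frechet_derivative f (at x)"
  by (rule linear_frechet_derivative[OF assms])
 have "frechet_derivative f (at x) v = frechet_derivative f (at x) (\<Sum>c\<in>Basis. (v \<bullet> c) *\<^sub>R c)"
  by (simp add: euclidean_representation)
 also have "\<dots> = (\<Sum>c\<in>Basis. (v \<bullet> c) * pd c f x)"
  by (simp add: l.sum l.scaleR pd_def)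
 finally show ?thesis .
qed

text \<open>The derivatives are carried along as a sequence, and only points of \<open>S\<close>
  matter: \<open>ln\<close>, \<open>inverse\<close> and \<open>sqrt\<close> are treated on
  \<open>{0<..}\<close> and composed with functions that stay positive.\<close>

definition smooth1 :: "real set \<Rightarrow> (real \<Rightarrow> real) \<Rightarrow> bool" where
 "smooth1 S F \<longleftrightarrow>
   (\<exists>D. D 0 = F \<and> (\<forall>n::nat. \<forall>x\<in>S. (D n has_real_derivative D (Suc n) x) (at x)))"

lemma smooth1_deriv:
 assumes "smooth1 S F"
 obtains F' where "smooth1 S F'" "\<And>x. x \<in> S \<Longrightarrow> (F has_real_derivative F' x) (at x)"
proof -
 obtain D where D: "D 0 = F" "\<And>n x. x \<in> S \<Longrightarrow> (D (n::nat) has_real_derivative D (Suc n) x) (at x)"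
  using assms by (auto simp: smooth1_def)
 show thesis
 proof
  show "smooth1 S (D 1)" unfolding smooth1_def
   by (rule exI[of _ "\<lambda>n. D (Suc n)"]) (use D in auto)
  show "(F has_real_derivative D 1 x) (at x)" if "x \<in> S" for x
   using D(2)[of x 0] D(1) that by simp
 qed
qed

lemma smooth1_coinduct:
 assumes "P F" and step: "\<And>F. P F \<Longrightarrow> \<exists>F'. P F' \<and> (\<forall>x\<in>S. (F has_real_derivative F' x) (at x))"
 shows "smooth1 S F"
proof -
 obtain d where d: "\<And>F. P F \<Longrightarrow> P (d F) \<and> (\<forall>x\<in>S. (F has_real_derivative d F x) (at x))"
  using step by metis
 have "P ((d ^^ n) F)" for n by (induction n) (use assms(1) d in auto)
 then show ?thesis unfolding smooth1_def
  by (intro exI[of _ "\<lambda>n. (d ^^ n) F"]) (use d in auto)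
qed

lemma smooth1I_deriv:
 assumes "smooth1 S F'" "\<And>x. x \<in> S \<Longrightarrow> (F has_real_derivative F' x) (at x)"
 shows "smooth1 S F"
proof (rule smooth1_coinduct[where P = "\<lambda>G. smooth1 S G \<or> G = F"])
 fix G assume "smooth1 S G \<or> G = F"
 then show "\<exists>F'. (smooth1 S F' \<or> F' = F) \<and> (\<forall>x\<in>S. (G has_real_derivative F' x) (at x))"
  using assms smooth1_deriv[of S G] by metis
qed simp

lemma smooth1_exp: "smooth1 S exp"
 by (rule smooth1_coinduct[where P = "\<lambda>F. F = exp"]) (auto intro!: derivative_eq_intros)

lemma smooth1_powr: "smooth1 {0<..} (\<lambda>x. c * x powr a)"
proof (rule smooth1_coinduct[where P = "\<lambda>F. \<exists>c a. F = (\<lambda>x. c * x powr a)"])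
 fix F :: "real \<Rightarrow> real" assume "\<exists>c a. F = (\<lambda>x. c * x powr a)"
 then obtain c a where F: "F = (\<lambda>x. c * x powr a)" by auto
 have "(F has_real_derivative (c * a) * x powr (a - 1)) (at x)" if "x > 0" for x
  unfolding F using that by (auto intro!: derivative_eq_intros)
 then show "\<exists>F'. (\<exists>c a. F' = (\<lambda>x. c * x powr a)) \<and> (\<forall>x\<in>{0<..}. (F has_real_derivative F' x) (at x))"
  by (intro exI[of _ "\<lambda>x. (c * a) * x powr (a - 1)"] conjI) auto
qed auto

lemma smooth1_inverse: "smooth1 {0<..} inverse"
 by (rule smooth1I_deriv[OF smooth1_powr[of "-1" "-2"]])
   (auto intro!: derivative_eq_intros simp: powr_minus power2_eq_square inverse_eq_divide)

lemma smooth1_ln: "smooth1 {0<..} ln"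
 by (rule smooth1I_deriv[OF smooth1_inverse]) (auto intro!: derivative_eq_intros simp: inverse_eq_divide)

lemma smooth1_sqrt: "smooth1 {0<..} sqrt"
 by (rule smooth1I_deriv[OF smooth1_powr[of "1/2" "-1/2"]])
   (auto intro!: derivative_eq_intros simp: powr_minus powr_half_sqrt inverse_eq_divide)

text \<open>Closing the functions \<open>f (A x)\<close> under sums, products and one-variable
  smooth functions gives a class that is stable under differentiation, hence one that
  \<open>smooth_coinduct\<close> accepts. A single induction then covers the product and chain rules
  to all orders.\<close>

inductive sm :: "('a::euclidean_space \<Rightarrow> 'b::euclidean_space) \<Rightarrow> ('a \<Rightarrow> real) \<Rightarrow> bool" for A where
 base: "smooth f \<Longrightarrow> sm A (\<lambda>x. f (A x))"
| const: "sm A (\<lambda>x. c)"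
| add: "sm A f \<Longrightarrow> sm A g \<Longrightarrow> sm A (\<lambda>x. f x + g x)"
| mult: "sm A f \<Longrightarrow> sm A g \<Longrightarrow> sm A (\<lambda>x. f x * g x)"
| comp: "sm A f \<Longrightarrow> smooth1 S F \<Longrightarrow> (\<And>x. f x \<in> S) \<Longrightarrow> g = (\<lambda>x. F (f x)) \<Longrightarrow> sm A g"

lemma sm_sum: "finite I \<Longrightarrow> (\<And>i. i \<in> I \<Longrightarrow> sm A (f i)) \<Longrightarrow> sm A (\<lambda>x. \<Sum>i\<in>I. f i x)"
 by (induction I rule: finite_induct) (auto intro: sm.intros)

lemma has_derivative_pd:
 assumes "\<And>x. f differentiable (at x)"
 shows "(f has_derivative (\<lambda>v. frechet_derivative f (at x) v)) (at x)"
 using assms frechet_derivative_works by blast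

text \<open>The derivative \<open>L\<close> of \<open>A\<close> is the same at every point, so
  \<open>A\<close> is affine. Therefore the coefficients \<open>L b \<bullet> c\<close> in the chain
  rule are constants and stay within the class.\<close>

lemma sm_step:
 fixes A :: "'a::euclidean_space \<Rightarrow> 'b::euclidean_space"
 assumes "sm A f" and A: "\<And>x. (A has_derivative L) (at x)"
 shows "(\<forall>x. f differentiable (at x)) \<and> (\<forall>b\<in>Basis. sm A (pd b f))"
 using assms(1)
proof induction
 case (base f)
 have d: "((\<lambda>x. f (A x)) has_derivative (\<lambda>v. frechet_derivative f (at (A x)) (L v))) (at x)" for x
  using diff_chain_at[OF A smooth_has_derivative[OF base]] by (simp add: o_def)
 have "pd b (\<lambda>x. f (A x)) = (\<lambda>x. \<Sum>c\<in>Basis. (L b \<bullet> c) * pd c f (A x))" for b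
  using pd_eq[OF d] frechet_derivative_eq_sum_pd[OF smooth_differentiable[OF base]] by auto
 moreover have "sm A (\<lambda>x. \<Sum>c\<in>Basis. (L b \<bullet> c) * pd c f (A x))" for b
  by (intro sm_sum sm.mult sm.const sm.base smooth_pd base) auto
 ultimately show ?case using d differentiable_def by metis
next
 case (const c)
 have "pd b (\<lambda>x::'a. c) = (\<lambda>x. 0)" for b by (simp add: pd_def)
 then show ?case by (auto intro: sm.const)
next
 case (add f g)
 note d = has_derivative_add[OF has_derivative_pd has_derivative_pd, of f g]
 have "pd b (\<lambda>x. f x + g x) = (\<lambda>x. pd b f x + pd b g x)" for b
  using add pd_eq[OF d] by (auto simp: pd_def)
 moreover have "(\<lambda>x. f x + g x) differentiable (at x)" for x
  using add.IH by (auto intro: differentiable_add)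
 ultimately show ?case using add by (auto intro!: sm.add)
next
 case (mult f g)
 note d = has_derivative_mult[OF has_derivative_pd has_derivative_pd, of f g]
 have "pd b (\<lambda>x. f x * g x) = (\<lambda>x. f x * pd b g x + pd b f x * g x)" for b
  using mult pd_eq[OF d] by (auto simp: pd_def)
 moreover have "(\<lambda>x. f x * g x) differentiable (at x)" for x
  using mult.IH by (auto intro: differentiable_mult)
 ultimately show ?case using mult by (auto intro!: sm.add sm.mult)
next
 case (comp f S F g)
 obtain F' where F': "smooth1 S F'" "\<And>x. x \<in> S \<Longrightarrow> (F has_real_derivative F' x) (at x)"
  using smooth1_deriv[OF comp.hyps(2)] by blast
 have d: "((\<lambda>x. F (f x)) has_derivative (\<lambda>v. F' (f x) * frechet_derivative f (at x) v)) (at x)" for x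
  using diff_chain_at[OF has_derivative_pd[of f x] F'(2)[of "f x", unfolded has_field_derivative_def]] comp
  by (simp add: o_def)
 have eq: "pd b (\<lambda>x. F (f x)) = (\<lambda>x. F' (f x) * pd b f x)" for b
  by (rule ext, rule trans[OF pd_eq[OF d]]) (simp only: pd_def)
 have F'f: "sm A (\<lambda>x. F' (f x))" 
  by (rule sm.comp[of A f S F', OF comp.hyps(1) F'(1) comp.hyps(3) refl])
 show ?case unfolding \<open>g = (\<lambda>x. F (f x))\<close>
 proof (intro conjI allI ballI)
  show "(\<lambda>x. F (f x)) differentiable (at x)" for x
   unfolding differentiable_def by (rule exI) (rule d)
  show "sm A (pd b (\<lambda>x. F (f x)))" if "b \<in> Basis" for b
   unfolding eq by (rule sm.mult[OF F'f]) (use comp.IH that in blast)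
 qed
qed

lemma sm_smooth:
 assumes "sm A f" "\<And>x. (A has_derivative L) (at x)"
 shows "smooth f"
proof (rule smooth_coinduct[of _ "{f. sm A f}"])
 show "(\<forall>x. f differentiable at x) \<and> (\<forall>b\<in>Basis. pd b f \<in> {f. sm A f})" if "f \<in> {f. sm A f}" for f
  using sm_step[OF _ assms(2), of f] that by blast
qed (use assms in simp)

lemma sm_id: "sm (\<lambda>x. x) f \<Longrightarrow> smooth f"
 by (rule sm_smooth[OF _ has_derivative_ident])

lemma smooth_sm: "smooth f \<Longrightarrow> sm (\<lambda>x. x) f"
 by (rule sm.base)

lemma smooth_const: "smooth (\<lambda>x. c)"
 by (rule sm_id) (rule sm.const)

lemma smooth_add: "smooth f \<Longrightarrow> smooth g \<Longrightarrow> smooth (\<lambda>x. f x + g x)"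
 by (rule sm_id[OF sm.add[OF smooth_sm smooth_sm]])

lemma smooth_mult: "smooth f \<Longrightarrow> smooth g \<Longrightarrow> smooth (\<lambda>x. f x * g x)"
 by (rule sm_id[OF sm.mult[OF smooth_sm smooth_sm]])

lemma smooth_minus: "smooth f \<Longrightarrow> smooth (\<lambda>x. - f x)"
 using smooth_mult[OF smooth_const[of "-1"], of f] by simp

lemma smooth_diff: "smooth f \<Longrightarrow> smooth g \<Longrightarrow> smooth (\<lambda>x. f x - g x)"
 using smooth_add[OF _ smooth_minus, of f g] by simp

lemma smooth_sum: "finite I \<Longrightarrow> (\<And>i. i \<in> I \<Longrightarrow> smooth (f i)) \<Longrightarrow> smooth (\<lambda>x. \<Sum>i\<in>I. f i x)"
 by (rule sm_id[OF sm_sum]) (auto intro: smooth_sm)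

lemma smooth_power: "smooth f \<Longrightarrow> smooth (\<lambda>x. f x ^ n)"
 by (induction n) (auto intro: smooth_const smooth_mult)

lemma smooth_compose1:
 "smooth f \<Longrightarrow> smooth1 S F \<Longrightarrow> (\<And>x. f x \<in> S) \<Longrightarrow> smooth (\<lambda>x. F (f x))"
 by (rule sm_id, rule sm.comp[of _ f S F]) (auto intro: smooth_sm)

lemma smooth_affine:
 assumes "smooth f" "\<And>x. (A has_derivative L) (at x)"
 shows "smooth (\<lambda>x. f (A x))"
 by (rule sm_smooth[OF sm.base assms(2)]) (rule assms)

lemma smooth_coord: "smooth (\<lambda>x. x \<bullet> c)"
proof (rule smooth_coinduct[of _ "insert (\<lambda>x. x \<bullet> c) (range (\<lambda>(a::real) x. a))"])
 have "pd b (\<lambda>x. x \<bullet> c) = (\<lambda>x. b \<bullet> c)" "pd b (\<lambda>x::'a. a) = (\<lambda>x. 0)" for b a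
  by (auto intro!: pd_eq derivative_intros)
 then show "(\<forall>x. f differentiable at x) \<and> (\<forall>b\<in>Basis. pd b f \<in> insert (\<lambda>x. x \<bullet> c) (range (\<lambda>a x. a)))"
  if "f \<in> insert (\<lambda>x. x \<bullet> c) (range (\<lambda>(a::real) x. a))" for f
  using that by (auto simp: image_iff intro!: derivative_intros)
qed simp

lemma smooth_norm2: "smooth (\<lambda>x. (norm x)\<^sup>2)"
proof -
 have "smooth (\<lambda>x::'a. \<Sum>b\<in>Basis. (x \<bullet> b)\<^sup>2)"
  by (intro smooth_sum smooth_power smooth_coord) auto
 moreover have "(\<Sum>b\<in>Basis. (x \<bullet> b)\<^sup>2) = (norm x)\<^sup>2" for x :: 'a
  unfolding power2_norm_eq_inner by (subst euclidean_inner) (simp add: power2_eq_square)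
 ultimately show ?thesis by simp
qed

lemma pd_const [simp]: "pd b (\<lambda>x. c) = (\<lambda>x. 0)"
 by (simp add: pd_def)

lemma pd_add: "smooth f \<Longrightarrow> smooth g \<Longrightarrow> pd b (\<lambda>x. f x + g x) x = pd b f x + pd b g x"
 by (rule pd_eq[THEN trans]) (auto intro!: derivative_eq_intros smooth_has_derivative simp: pd_def)

lemma pd_diff: "smooth f \<Longrightarrow> smooth g \<Longrightarrow> pd b (\<lambda>x. f x - g x) x = pd b f x - pd b g x"
 by (rule pd_eq[THEN trans]) (auto intro!: derivative_eq_intros smooth_has_derivative simp: pd_def)

lemma pd_mult: "smooth f \<Longrightarrow> smooth g \<Longrightarrow> pd b (\<lambda>x. f x * g x) x = pd b f x * g x + f x * pd b g x"
 by (rule pd_eq[THEN trans], rule has_derivative_mult)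
   (auto intro!: smooth_has_derivative simp: pd_def)

lemma pd_cmult: "smooth f \<Longrightarrow> pd b (\<lambda>x. c * f x) x = c * pd b f x"
 using pd_mult[OF smooth_const, of f b c x] by (simp)

lemma pd_compose1:
 assumes "smooth f" "(F has_real_derivative D) (at (f x))"
 shows "pd b (\<lambda>x. F (f x)) x = D * pd b f x"
proof -
 have "((\<lambda>x. F (f x)) has_derivative (\<lambda>v. D * frechet_derivative f (at x) v)) (at x)"
  using diff_chain_at[OF smooth_has_derivative[OF assms(1)] assms(2)[unfolded has_field_derivative_def]]
  by (simp add: o_def)
 from pd_eq[OF this] show ?thesis by (simp add: pd_def)
qed

lemma pd_affine:
 assumes "smooth f" "(A has_derivative L) (at x)"
 shows "pd b (\<lambda>x. f (A x)) x = (\<Sum>c\<in>Basis. (L b \<bullet> c) * pd c f (A x))"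
proof -
 have "((\<lambda>x. f (A x)) has_derivative (\<lambda>v. frechet_derivative f (at (A x)) (L v))) (at x)"
  using diff_chain_at[OF assms(2) smooth_has_derivative[OF assms(1)]] by (simp add: o_def)
 from pd_eq[OF this] show ?thesis
  using frechet_derivative_eq_sum_pd[OF smooth_differentiable[OF assms(1)]] by simp
qed

lemma pd_norm2: "pd b (\<lambda>x. (norm x)\<^sup>2) x = 2 * (x \<bullet> b)"
 unfolding power2_norm_eq_inner
 by (rule pd_eq[THEN trans]) (auto intro!: derivative_eq_intros simp: inner_commute)

text \<open>Both iterated derivatives are limits of the same second difference quotient.\<close>

lemma pd_commute:
 assumes f: "smooth f" and b: "b \<in> Basis" and c: "c \<in> Basis"
 shows "pd b (pd c f) x = pd c (pd b f) x"
proof -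
 define Q where "Q s = (f (x + s *\<^sub>R b + s *\<^sub>R c) - f (x + s *\<^sub>R b) - f (x + s *\<^sub>R c) + f x) / s\<^sup>2" for s
 have line: "((\<lambda>t. g (y + t *\<^sub>R d)) has_real_derivative pd d g (y + t *\<^sub>R d)) (at t)"
  if "smooth g" for g y d and t :: real
 proof -
  have "((\<lambda>t. g (y + t *\<^sub>R d)) has_derivative (\<lambda>h. frechet_derivative g (at (y + t *\<^sub>R d)) (h *\<^sub>R d))) (at t)"
   by (rule has_derivative_compose[of "\<lambda>t. y + t *\<^sub>R d", OF _ smooth_has_derivative[OF that]])
     (auto intro!: derivative_eq_intros)
  then show ?thesis
   unfolding has_field_derivative_def pd_def
   by (simp add: linear_scale[OF linear_frechet_derivative[OF smooth_differentiable[OF that]]] mult.commute[of _ "frechet_derivative _ _ _"])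
 qed
 have key: "(Q \<longlongrightarrow> pd d (pd e f) x) (at_right 0)"
  if de: "d \<in> Basis" "e \<in> Basis" and Q: "\<And>s. Q s = (f (x + s *\<^sub>R d + s *\<^sub>R e) - f (x + s *\<^sub>R d) - f (x + s *\<^sub>R e) + f x) / s\<^sup>2" for d e
 proof -
  \<comment> \<open>The mean value theorem is used twice with the same step \<open>s\<close>: in
    direction \<open>e\<close> for the increment of \<open>f\<close> along \<open>d\<close>, and
    then in direction \<open>d\<close>. The intermediate point tends to \<open>x\<close> with
    \<open>s\<close>.\<close>
  have ex: "\<exists>u v. 0 \<le> u \<and> u \<le> s \<and> 0 \<le> v \<and> v \<le> s \<and> Q s = pd d (pd e f) (x + u *\<^sub>R d + v *\<^sub>R e)" if "s > 0" for s
  proof -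
   have "((\<lambda>t. f (x + s *\<^sub>R d + t *\<^sub>R e) - f (x + t *\<^sub>R e)) has_real_derivative
     pd e f (x + s *\<^sub>R d + t *\<^sub>R e) - pd e f (x + t *\<^sub>R e)) (at t)" for t
    by (intro derivative_intros line f)
   from MVT2[OF \<open>s > 0\<close> this] obtain v where v: "0 < v" "v < s"
    "f (x + s *\<^sub>R d + s *\<^sub>R e) - f (x + s *\<^sub>R e) - (f (x + s *\<^sub>R d) - f x) =
     s * (pd e f (x + s *\<^sub>R d + v *\<^sub>R e) - pd e f (x + v *\<^sub>R e))"
    by force
   have "((\<lambda>t. pd e f (x + v *\<^sub>R e + t *\<^sub>R d)) has_real_derivative
     pd d (pd e f) (x + v *\<^sub>R e + t *\<^sub>R d)) (at t)" for t
    using de by (intro line smooth_pd f)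
   from MVT2[OF \<open>s > 0\<close> this] obtain u where u: "0 < u" "u < s"
    "pd e f (x + v *\<^sub>R e + s *\<^sub>R d) - pd e f (x + v *\<^sub>R e) = s * pd d (pd e f) (x + v *\<^sub>R e + u *\<^sub>R d)"
    by force
   have "Q s = pd d (pd e f) (x + u *\<^sub>R d + v *\<^sub>R e)"
    using u v \<open>s > 0\<close> by (simp add: Q field_simps power2_eq_square add_ac)
   then show ?thesis using u v by (intro exI[of _ u] exI[of _ v]) auto
  qed
  then obtain u v where uv: "\<And>s. s > 0 \<Longrightarrow> 0 \<le> u s \<and> u s \<le> s \<and> 0 \<le> v s \<and> v s \<le> s \<and>
    Q s = pd d (pd e f) (x + u s *\<^sub>R d + v s *\<^sub>R e)" by metis
  have ev: "\<forall>\<^sub>F s in at_right 0. 0 < (s::real)" by (simp add: eventually_at_right_less)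
  have id: "((\<lambda>s::real. s) \<longlongrightarrow> 0) (at_right 0)" by (rule tendsto_ident_at)
  have u0: "(u \<longlongrightarrow> 0) (at_right 0)" "(v \<longlongrightarrow> 0) (at_right 0)"
   by (rule tendsto_sandwich[OF _ _ tendsto_const id]; use ev uv in \<open>auto elim!: eventually_mono\<close>)+
  have "((\<lambda>s. x + u s *\<^sub>R d + v s *\<^sub>R e) \<longlongrightarrow> x + 0 *\<^sub>R d + 0 *\<^sub>R e) (at_right 0)"
   by (intro tendsto_intros u0)
  moreover have "isCont (pd d (pd e f)) x"
   using smooth_continuous[OF smooth_pd[OF smooth_pd[OF f de(2)] de(1)], of UNIV]
   by (simp add: continuous_on_eq_continuous_at)
  ultimately have "((\<lambda>s. pd d (pd e f) (x + u s *\<^sub>R d + v s *\<^sub>R e)) \<longlongrightarrow> pd d (pd e f) x) (at_right 0)"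
   by (simp add: isCont_tendsto_compose[of x "pd d (pd e f)"])
  then show ?thesis
   by (rule Lim_transform_eventually) (use ev uv in \<open>auto elim!: eventually_mono\<close>)
 qed
 have "(Q \<longlongrightarrow> pd b (pd c f) x) (at_right 0)"
  by (rule key) (auto simp: b c Q_def)
 moreover have "(Q \<longlongrightarrow> pd c (pd b f) x) (at_right 0)"
  by (rule key) (auto simp: b c Q_def algebra_simps)
 ultimately show ?thesis
  by (rule tendsto_unique[rotated]) simp
qed

section \<open>Test functions\<close>

lemma test_functions_iff:
 "test \<phi> \<longleftrightarrow> smooth \<phi> \<and> (\<exists>r. \<forall>x. norm x > r \<longrightarrow> \<phi> x = 0)"
proof -
 have "compact (closure {x. \<phi> x \<noteq> 0}) \<longleftrightarrow> bounded {x. \<phi> x \<noteq> 0}"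
  using compact_closure by blast
 also have "\<dots> \<longleftrightarrow> (\<exists>r. \<forall>x. norm x > r \<longrightarrow> \<phi> x = 0)"
  unfolding bounded_iff by (meson mem_Collect_eq not_le)
 finally show ?thesis by (simp add: test_functions_def smooth_def)
qed

lemma test_smooth: "test \<phi> \<Longrightarrow> smooth \<phi>"
 by (simp add: test_functions_iff)

lemma test_measurable: "test \<phi> \<Longrightarrow> \<phi> \<in> borel_measurable borel"
 by (rule smooth_measurable[OF test_smooth])

lemma test_supportE:
 assumes "test \<phi>"
 obtains r where "r > 0" "\<And>x. norm x > r \<Longrightarrow> \<phi> x = 0"
proof -
 obtain r where "\<And>x. norm x > r \<Longrightarrow> \<phi> x = 0"
  using assms by (auto simp: test_functions_iff)
 then show thesis using that[of "max r 1"] by auto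
qed

lemma test_pd:
 assumes "test \<phi>" "b \<in> Basis"
 shows "test (pd b \<phi>)"
proof -
 obtain r where r: "\<And>x. norm x > r \<Longrightarrow> \<phi> x = 0"
  using assms by (auto simp: test_functions_iff)
 have "pd b \<phi> x = 0" if "norm x > r" for x
 proof -
  have "open {x::'a. norm x > r}" by (intro open_Collect_less continuous_intros)
  then have "((\<lambda>x. 0) has_derivative (\<lambda>_. 0)) (at x) \<Longrightarrow> (\<phi> has_derivative (\<lambda>_. 0)) (at x)"
   using has_derivative_transform_within_open[of "\<lambda>x. 0" "\<lambda>_. 0" x UNIV "{x. norm x > r}" \<phi>] that r
   by auto
  then show ?thesis by (intro pd_eq) auto
 qed
 then show ?thesis using assms by (auto simp: test_functions_iff smooth_pd)
qed

lemma test_partials: "test \<phi> \<Longrightarrow> bs \<in> lists Basis \<Longrightarrow> test (partials bs \<phi>)"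
 by (induction bs) (auto simp: test_pd)

lemma test_add:
 assumes f: "test f" and g: "test g"
 shows "test (\<lambda>x. f x + g x)"
proof -
 obtain r s where "\<And>x. norm x > r \<Longrightarrow> f x = 0" "\<And>x. norm x > s \<Longrightarrow> g x = 0"
  using test_supportE[OF f] test_supportE[OF g] by metis
 then show ?thesis using f g
  by (auto simp: test_functions_iff smooth_add intro!: exI[of _ "max r s"])
qed

lemma test_mult: "smooth f \<Longrightarrow> test g \<Longrightarrow> test (\<lambda>x. f x * g x)"
 by (auto simp: test_functions_iff smooth_mult)

lemma test_mult': "test f \<Longrightarrow> smooth g \<Longrightarrow> test (\<lambda>x. f x * g x)"
 by (auto simp: test_functions_iff smooth_mult)

lemma test_cmult: "test g \<Longrightarrow> test (\<lambda>x. c * g x)"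
 by (rule test_mult[OF smooth_const])

lemma test_diff: "test f \<Longrightarrow> test g \<Longrightarrow> test (\<lambda>x. f x - g x)"
 using test_add[OF _ test_cmult[of g "-1"], of f] by simp

lemma test_sum:
 "finite I \<Longrightarrow> (\<And>i. i \<in> I \<Longrightarrow> test (f i)) \<Longrightarrow> test (\<lambda>x. \<Sum>i\<in>I. f i x)"
proof (induction I rule: finite_induct)
 case (insert i I)
 then show ?case using test_add[of "f i" "\<lambda>x. \<Sum>i\<in>I. f i x"] by auto
qed (simp add: test_functions_iff smooth_const)

lemma test_bounded:
 assumes "test \<phi>"
 obtains B where "B > 0" "\<And>x. \<bar>\<phi> x\<bar> \<le> B"
proof -
 obtain r where r: "r > 0" "\<And>x. norm x > r \<Longrightarrow> \<phi> x = 0" using test_supportE[OF assms] by blast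
 have "compact (\<phi> ` cball 0 r)"
  by (intro compact_continuous_image smooth_continuous test_smooth assms) simp
 then have "bounded (\<phi> ` cball 0 r)" by (rule compact_imp_bounded)
 then obtain B where B: "\<And>x. x \<in> cball 0 r \<Longrightarrow> \<bar>\<phi> x\<bar> \<le> B"
  unfolding bounded_iff by fastforce
 have "\<bar>\<phi> x\<bar> \<le> max B 1" for x
  using B[of x] r(2)[of x] by (cases "norm x > r") (auto simp: max_def)
 then show thesis using that[of "max B 1"] by auto
qed

section \<open>Square-integrable functions\<close>

text \<open>Agrees with \<open>L2_norm\<close> on complex functions but is available for any normed
  codomain, so that real and complex functions share all estimates.\<close>

definition n2 :: "('a::euclidean_space \<Rightarrow> 'b::real_normed_vector) \<Rightarrow> real" where
 "n2 f = sqrt (LBINT x. (norm (f x))\<^sup>2)"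

lemma L2_norm_n2: "L2_norm f = n2 f"
 by (simp add: L2_norm_def n2_def)

lemma n2_nonneg [simp]: "n2 f \<ge> 0"
 by (simp add: n2_def)

lemma n2_sq: "(n2 f)\<^sup>2 = (LBINT x. (norm (f x))\<^sup>2)"
 by (simp add: n2_def)

lemma L2_measurable [measurable_dest]: "f \<in> L2 \<Longrightarrow> f \<in> borel_measurable borel"
 by (simp add: L2_def)

lemma L2_integrable: "f \<in> L2 \<Longrightarrow> integrable lborel (\<lambda>x. (norm (f x))\<^sup>2)"
 by (simp add: L2_def)

lemma L2I: "f \<in> borel_measurable borel \<Longrightarrow> integrable lborel (\<lambda>x. (norm (f x))\<^sup>2) \<Longrightarrow> f \<in> L2"
 by (simp add: L2_def)

lemma nn_integral_L2: "f \<in> L2 \<Longrightarrow> (\<integral>\<^sup>+x. ennreal ((norm (f x))\<^sup>2) \<partial>lborel) = ennreal ((n2 f)\<^sup>2)"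
 unfolding n2_sq by (rule nn_integral_eq_integral) (auto intro: L2_integrable)

lemma L2_nnI:
 fixes f :: "'a::euclidean_space \<Rightarrow> 'b::{banach,second_countable_topology}"
 assumes [measurable]: "f \<in> borel_measurable borel"
  and le: "(\<integral>\<^sup>+x. ennreal ((norm (f x))\<^sup>2) \<partial>lborel) \<le> ennreal (C\<^sup>2)" and "C \<ge> 0"
 shows "f \<in> L2" "n2 f \<le> C"
proof -
 have "integrable lborel (\<lambda>x. (norm (f x))\<^sup>2)"
  by (rule integrableI_bounded) (use le in \<open>auto simp: top.not_eq_extremum intro: le_less_trans\<close>)
 then show L: "f \<in> L2" by (intro L2I) auto
 have "(n2 f)\<^sup>2 \<le> C\<^sup>2" using nn_integral_L2[OF L] le by (simp add: ennreal_le_iff)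
 then show "n2 f \<le> C" using \<open>C \<ge> 0\<close> by (rule power2_le_imp_le)
qed

lemma L2_mono_AE:
 fixes f :: "'a::euclidean_space \<Rightarrow> 'b::{banach,second_countable_topology}"
  and g :: "'a \<Rightarrow> 'c::{banach,second_countable_topology}"
 assumes f [measurable]: "f \<in> borel_measurable borel" and g: "g \<in> L2"
  and le: "AE x in lborel. norm (f x) \<le> norm (g x)"
 shows "f \<in> L2" "n2 f \<le> n2 g"
proof -
 have "(\<integral>\<^sup>+x. ennreal ((norm (f x))\<^sup>2) \<partial>lborel) \<le> (\<integral>\<^sup>+x. ennreal ((norm (g x))\<^sup>2) \<partial>lborel)"
  by (rule nn_integral_mono_AE) (use le in eventually_elim, auto intro!: ennreal_leI power_mono)
 then have "(\<integral>\<^sup>+x. ennreal ((norm (f x))\<^sup>2) \<partial>lborel) \<le> ennreal ((n2 g)\<^sup>2)"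
  using nn_integral_L2[OF g] by simp
 from L2_nnI[OF f this] show "f \<in> L2" "n2 f \<le> n2 g" by auto
qed

lemma L2_mono:
 fixes f :: "'a::euclidean_space \<Rightarrow> 'b::{banach,second_countable_topology}"
  and g :: "'a \<Rightarrow> 'c::{banach,second_countable_topology}"
 assumes "f \<in> borel_measurable borel" "g \<in> L2" "\<And>x. norm (f x) \<le> norm (g x)"
 shows "f \<in> L2" "n2 f \<le> n2 g"
 using L2_mono_AE[OF assms(1,2)] assms(3) by auto

lemma L2_cong_AE:
 fixes f g :: "'a::euclidean_space \<Rightarrow> 'b::{banach,second_countable_topology}"
 assumes "f \<in> borel_measurable borel" "g \<in> L2" "AE x in lborel. f x = g x"
 shows "f \<in> L2" "n2 f = n2 g"
proof -
 show f: "f \<in> L2" using assms by (intro L2_mono_AE[of f g]) auto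
 have "n2 f \<le> n2 g" "n2 g \<le> n2 f"
 proof -
  have "AE x in lborel. norm (f x) \<le> norm (g x)" "AE x in lborel. norm (g x) \<le> norm (f x)"
   using assms(3) by (eventually_elim, simp)+
  then show "n2 f \<le> n2 g" "n2 g \<le> n2 f"
   using L2_mono_AE(2)[OF assms(1,2)] L2_mono_AE(2)[OF L2_measurable[OF assms(2)] f] by blast+
 qed
 then show "n2 f = n2 g" by simp
qed

lemma L2_norm_fun:
 fixes f :: "'a::euclidean_space \<Rightarrow> 'b::{banach,second_countable_topology}"
 shows "f \<in> L2 \<Longrightarrow> (\<lambda>x. norm (f x)) \<in> L2" and "n2 (\<lambda>x. norm (f x)) = n2 f"
 by (auto simp: n2_def L2_def)

lemma L2_scaleR_const:
 fixes f :: "'a::euclidean_space \<Rightarrow> 'b::{banach,second_countable_topology}"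
 assumes "f \<in> L2" shows "(\<lambda>x. c *\<^sub>R f x) \<in> L2" "n2 (\<lambda>x. c *\<^sub>R f x) = \<bar>c\<bar> * n2 f"
 using assms by (auto intro!: L2I simp: power_mult_distrib L2_integrable n2_def real_sqrt_mult)

lemma L2_bounded_scaleR:
 fixes f :: "'a::euclidean_space \<Rightarrow> 'b::{banach,second_countable_topology}"
 assumes f: "f \<in> L2" and k [measurable]: "k \<in> borel_measurable borel" and B: "\<And>x. \<bar>k x\<bar> \<le> B"
 shows "(\<lambda>x. k x *\<^sub>R f x) \<in> L2" "n2 (\<lambda>x. k x *\<^sub>R f x) \<le> B * n2 f"
proof -
 note [measurable] = L2_measurable[OF f]
 have "0 \<le> B" using B[of undefined] by linarith
 have *: "norm (k x *\<^sub>R f x) \<le> norm (B *\<^sub>R f x)" for x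
  using B[of x] \<open>0 \<le> B\<close> by (auto intro!: mult_right_mono)
 show "(\<lambda>x. k x *\<^sub>R f x) \<in> L2"
  by (rule L2_mono(1)[OF _ L2_scaleR_const(1)[OF f] *]) measurable
 have "n2 (\<lambda>x. k x *\<^sub>R f x) \<le> n2 (\<lambda>x. B *\<^sub>R f x)"
  by (rule L2_mono(2)[OF _ L2_scaleR_const(1)[OF f] *]) measurable
 then show "n2 (\<lambda>x. k x *\<^sub>R f x) \<le> B * n2 f"
  using L2_scaleR_const(2)[OF f, of B] \<open>0 \<le> B\<close> by simp
qed

lemma L2_mult_integrable:
 fixes f :: "'a::euclidean_space \<Rightarrow> 'b::{banach,second_countable_topology}"
  and g :: "'a \<Rightarrow> 'c::{banach,second_countable_topology}"
 assumes f: "f \<in> L2" and g: "g \<in> L2"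
 shows "integrable lborel (\<lambda>x. norm (f x) * norm (g x))"
  and "(LBINT x. norm (f x) * norm (g x)) \<le> n2 f * n2 g"
proof -
 note [measurable] = L2_measurable[OF f] L2_measurable[OF g]
 have CS: "(\<integral>\<^sup>+x. ennreal (norm (f x)) * ennreal (norm (g x)) \<partial>lborel)\<^sup>2 \<le> ennreal ((n2 f)\<^sup>2) * ennreal ((n2 g)\<^sup>2)"
  using Cauchy_Schwarz_nn_integral[of "\<lambda>x. ennreal (norm (f x))" lborel "\<lambda>x. ennreal (norm (g x))"]
  by (simp add: nn_integral_L2[OF f, symmetric] nn_integral_L2[OF g, symmetric] ennreal_power)
 then have "(\<integral>\<^sup>+x. ennreal (norm (f x) * norm (g x)) \<partial>lborel)\<^sup>2 \<le> ennreal ((n2 f * n2 g)\<^sup>2)"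
  by (simp add: ennreal_mult power_mult_distrib)
 then have le: "(\<integral>\<^sup>+x. ennreal (norm (f x) * norm (g x)) \<partial>lborel) \<le> ennreal (n2 f * n2 g)"
 proof (cases "\<integral>\<^sup>+x. ennreal (norm (f x) * norm (g x)) \<partial>lborel" rule: ennreal_cases)
  case (real r)
  then show ?thesis
   using \<open>_\<^sup>2 \<le> ennreal ((n2 f * n2 g)\<^sup>2)\<close>
   by (auto simp: ennreal_power ennreal_le_iff intro!: ennreal_leI power2_le_imp_le)
 next
  case top
  then show ?thesis using \<open>_\<^sup>2 \<le> ennreal ((n2 f * n2 g)\<^sup>2)\<close> by (simp add: top_unique)
 qed
 show I: "integrable lborel (\<lambda>x. norm (f x) * norm (g x))"
  by (rule integrableI_bounded) (use le in \<open>auto simp: top.not_eq_extremum intro: le_less_trans\<close>)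
 show "(LBINT x. norm (f x) * norm (g x)) \<le> n2 f * n2 g"
  using le nn_integral_eq_integral[OF I] by (simp add: ennreal_le_iff)
qed

lemma L2_scaleR_integrable:
 fixes f :: "'a::euclidean_space \<Rightarrow> real" and g :: "'a \<Rightarrow> 'c::{banach,second_countable_topology}"
 assumes f: "f \<in> L2" and g: "g \<in> L2"
 shows "integrable lborel (\<lambda>x. f x *\<^sub>R g x)"
  and "norm (LBINT x. f x *\<^sub>R g x) \<le> n2 f * n2 g"
proof -
 note [measurable] = L2_measurable[OF f] L2_measurable[OF g]
 note I = L2_mult_integrable[OF f g]
 show "integrable lborel (\<lambda>x. f x *\<^sub>R g x)"
  by (rule Bochner_Integration.integrable_bound[OF I(1)]) auto
 have "norm (LBINT x. f x *\<^sub>R g x) \<le> (LBINT x. norm (f x *\<^sub>R g x))"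
  by (rule integral_norm_bound)
 then show "norm (LBINT x. f x *\<^sub>R g x) \<le> n2 f * n2 g" using I(2) by simp
qed

lemma L2_prod_integrable:
 fixes f g :: "'a::euclidean_space \<Rightarrow> real"
 assumes "f \<in> L2" "g \<in> L2"
 shows "integrable lborel (\<lambda>x. f x * g x)" "\<bar>LBINT x. f x * g x\<bar> \<le> n2 f * n2 g"
 using L2_scaleR_integrable[OF assms] by auto

lemma L2_add:
 fixes f g :: "'a::euclidean_space \<Rightarrow> 'b::{banach,second_countable_topology}"
 assumes f: "f \<in> L2" and g: "g \<in> L2"
 shows "(\<lambda>x. f x + g x) \<in> L2" "n2 (\<lambda>x. f x + g x) \<le> n2 f + n2 g"
proof -
 note [measurable] = L2_measurable[OF f] L2_measurable[OF g]
 have I: "integrable lborel (\<lambda>x. (norm (f x))\<^sup>2 + 2 * (norm (f x) * norm (g x)) + (norm (g x))\<^sup>2)"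
  by (intro Bochner_Integration.integrable_add integrable_mult_right L2_integrable L2_mult_integrable f g)
 have le: "(norm (f x + g x))\<^sup>2 \<le> (norm (f x))\<^sup>2 + 2 * (norm (f x) * norm (g x)) + (norm (g x))\<^sup>2" for x
 proof -
  have "(norm (f x + g x))\<^sup>2 \<le> (norm (f x) + norm (g x))\<^sup>2"
   by (intro power_mono norm_triangle_ineq) auto
  then show ?thesis by (simp add: power2_sum)
 qed
 have J: "integrable lborel (\<lambda>x. (norm (f x + g x))\<^sup>2)"
 proof (rule Bochner_Integration.integrable_bound[OF I])
  show "AE x in lborel. norm ((norm (f x + g x))\<^sup>2) \<le>
    norm ((norm (f x))\<^sup>2 + 2 * (norm (f x) * norm (g x)) + (norm (g x))\<^sup>2)"
   using le by (intro always_eventually allI) (smt (verit) real_norm_def zero_le_power2)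
 qed measurable
 then show "(\<lambda>x. f x + g x) \<in> L2" by (intro L2I) auto
 have "(n2 (\<lambda>x. f x + g x))\<^sup>2 \<le> (LBINT x. (norm (f x))\<^sup>2 + 2 * (norm (f x) * norm (g x)) + (norm (g x))\<^sup>2)"
  unfolding n2_sq by (rule integral_mono[OF J I le])
 also have "\<dots> = (n2 f)\<^sup>2 + 2 * (LBINT x. norm (f x) * norm (g x)) + (n2 g)\<^sup>2"
  unfolding n2_sq by (simp add: L2_integrable L2_mult_integrable f g)
 also have "\<dots> \<le> (n2 f + n2 g)\<^sup>2"
  using L2_mult_integrable(2)[OF f g] by (simp add: power2_sum)
 finally show "n2 (\<lambda>x. f x + g x) \<le> n2 f + n2 g"
  by (rule power2_le_imp_le) auto
qed

lemma L2_minus: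
 fixes f :: "'a::euclidean_space \<Rightarrow> 'b::{banach,second_countable_topology}"
 shows "f \<in> L2 \<Longrightarrow> (\<lambda>x. - f x) \<in> L2" "n2 (\<lambda>x. - f x) = n2 f"
 by (auto simp: L2_def n2_def)

lemma L2_diff:
 fixes f g :: "'a::euclidean_space \<Rightarrow> 'b::{banach,second_countable_topology}"
 assumes f: "f \<in> L2" and g: "g \<in> L2"
 shows "(\<lambda>x. f x - g x) \<in> L2" "n2 (\<lambda>x. f x - g x) \<le> n2 f + n2 g"
 using L2_add[OF f L2_minus(1)[OF g]] L2_minus(2)[of g] by auto

lemma L2_zero: "(\<lambda>x. 0) \<in> L2" "n2 (\<lambda>x. 0) = 0"
 by (auto simp: L2_def n2_def)

lemma L2_sum:
 fixes f :: "'i \<Rightarrow> 'a::euclidean_space \<Rightarrow> 'b::{banach,second_countable_topology}"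
 shows "finite I \<Longrightarrow> (\<And>i. i \<in> I \<Longrightarrow> f i \<in> L2) \<Longrightarrow> (\<lambda>x. \<Sum>i\<in>I. f i x) \<in> L2"
 by (induction I rule: finite_induct) (auto simp: L2_zero intro: L2_add)

lemma n2_triangle:
 fixes f g h :: "'a::euclidean_space \<Rightarrow> 'b::{banach,second_countable_topology}"
 assumes "f \<in> L2" "g \<in> L2" "h \<in> L2"
 shows "n2 (\<lambda>x. f x - h x) \<le> n2 (\<lambda>x. f x - g x) + n2 (\<lambda>x. g x - h x)"
 using L2_add(2)[OF L2_diff(1)[OF assms(1,2)] L2_diff(1)[OF assms(2,3)]] by simp

lemma n2_commute: "n2 (\<lambda>x. f x - g x) = n2 (\<lambda>x. g x - f x)"
 by (simp add: n2_def norm_minus_commute)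

lemma n2_diff_abs:
 fixes f g :: "'a::euclidean_space \<Rightarrow> 'b::{banach,second_countable_topology}"
 assumes f: "f \<in> L2" and g: "g \<in> L2"
 shows "\<bar>n2 f - n2 g\<bar> \<le> n2 (\<lambda>x. f x - g x)"
 using n2_triangle[OF f g L2_zero(1)] n2_triangle[OF g f L2_zero(1)] n2_commute[of f g] by simp

lemma n2_eq_0_AE:
 fixes f :: "'a::euclidean_space \<Rightarrow> 'b::{banach,second_countable_topology}"
 assumes f: "f \<in> L2" and "n2 f = 0"
 shows "AE x in lborel. f x = 0"
proof -
 have "(LBINT x. (norm (f x))\<^sup>2) = 0" using n2_sq[of f] assms by simp
 then have "AE x in lborel. (norm (f x))\<^sup>2 = 0"
  using integral_nonneg_eq_0_iff_AE[OF L2_integrable[OF f]] by simp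
 then show ?thesis by simp
qed

section \<open>Almost everywhere convergence and completeness\<close>

lemma summable_AE:
 fixes h :: "nat \<Rightarrow> 'a::euclidean_space \<Rightarrow> real"
 assumes h: "\<And>n. integrable lborel (h n)" "\<And>n x. h n x \<ge> 0"
  and s: "summable (\<lambda>n. LBINT x. h n x)"
 shows "AE x in lborel. summable (\<lambda>n. h n x)"
proof -
 note [measurable] = borel_measurable_integrable[OF h(1)]
 have "(\<integral>\<^sup>+x. (\<Sum>n. ennreal (h n x)) \<partial>lborel) = (\<Sum>n. \<integral>\<^sup>+x. ennreal (h n x) \<partial>lborel)"
  by (rule nn_integral_suminf) measurable
 also have "\<dots> = (\<Sum>n. ennreal (LBINT x. h n x))"
  by (intro suminf_cong nn_integral_eq_integral h) (auto simp: h)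
 also have "\<dots> \<noteq> \<infinity>"
  using h s by (subst suminf_ennreal2) auto
 finally have "AE x in lborel. (\<Sum>n. ennreal (h n x)) \<noteq> \<infinity>"
  by (intro nn_integral_PInf_AE) auto
 then show ?thesis
  by eventually_elim (use h in \<open>auto intro!: summable_suminf_not_top\<close>)
qed

text \<open>At a geometric rate the squared errors have summable integrals, so their series
  converges at almost every point and its terms tend to zero there. Thus the whole sequence
  converges, not just a subsequence.\<close>

lemma n2_tendsto_AE:
 fixes f :: "nat \<Rightarrow> 'a::euclidean_space \<Rightarrow> 'b::{banach,second_countable_topology}"
 assumes f: "\<And>n. f n \<in> L2" and g: "g \<in> L2" and le: "\<And>n. n2 (\<lambda>x. f n x - g x) \<le> C * (1/2)^n"
 shows "AE x in lborel. (\<lambda>n. f n x) \<longlonglongrightarrow> g x"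
proof -
 have L: "(\<lambda>x. f n x - g x) \<in> L2" for n by (intro L2_diff f g)
 have "(LBINT x. (norm (f n x - g x))\<^sup>2) \<le> C\<^sup>2 * (1/4)^n" for n
 proof -
  have "(n2 (\<lambda>x. f n x - g x))\<^sup>2 \<le> (C * (1/2)^n)\<^sup>2" by (intro power_mono le) auto
  also have "\<dots> = C\<^sup>2 * (1/4)^n"
  proof -
   have "((1/2::real)^n)\<^sup>2 = (1/4)^n"
    by (subst power_mult[symmetric], subst mult.commute, subst power_mult) (simp add: power2_eq_square)
   then show ?thesis by (simp add: power_mult_distrib)
  qed
  finally show ?thesis by (simp add: n2_sq)
 qed
 moreover have "summable (\<lambda>n. C\<^sup>2 * (1/4)^n)" by (intro summable_mult summable_geometric) simp
 ultimately have "summable (\<lambda>n. LBINT x. (norm (f n x - g x))\<^sup>2)"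
  by (intro summable_comparison_test'[OF \<open>summable (\<lambda>n. C\<^sup>2 * (1/4)^n)\<close>, where N=0]) auto
 then have "AE x in lborel. summable (\<lambda>n. (norm (f n x - g x))\<^sup>2)"
  by (intro summable_AE L2_integrable L) auto
 then show ?thesis
 proof eventually_elim
  case (elim x)
  then have "(\<lambda>n. sqrt ((norm (f n x - g x))\<^sup>2)) \<longlonglongrightarrow> sqrt 0"
   by (intro tendsto_real_sqrt summable_LIMSEQ_zero)
  then have "(\<lambda>n. norm (f n x - g x)) \<longlonglongrightarrow> 0" by simp
  then show ?case by (rule tendsto_norm_zero_cancel[THEN LIM_zero_cancel])
 qed
qed

text \<open>Lower semicontinuity of the norm under convergence almost everywhere, by Fatou's lemma
  for the squares. A bound from some index on is enough, because the right-hand side passes through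
  a limes superior.\<close>

lemma L2_Fatou:
 fixes f :: "nat \<Rightarrow> 'a::euclidean_space \<Rightarrow> 'b::{banach,second_countable_topology}"
 assumes f: "\<And>n. f n \<in> L2" and g [measurable]: "g \<in> borel_measurable borel"
  and lim: "AE x in lborel. (\<lambda>n. f n x) \<longlonglongrightarrow> g x"
  and le: "\<And>n. n \<ge> N \<Longrightarrow> n2 (f n) \<le> C"
 shows "g \<in> L2" "n2 g \<le> C"
proof -
 note [measurable] = L2_measurable[OF f]
 have "C \<ge> 0" using le[of N] n2_nonneg[of "f N"] by linarith
 have "(\<integral>\<^sup>+x. ennreal ((norm (g x))\<^sup>2) \<partial>lborel) = (\<integral>\<^sup>+x. liminf (\<lambda>n. ennreal ((norm (f n x))\<^sup>2)) \<partial>lborel)"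
 proof (rule nn_integral_cong_AE, use lim in eventually_elim)
  case (elim x)
  have "(\<lambda>n. ennreal ((norm (f n x))\<^sup>2)) \<longlonglongrightarrow> ennreal ((norm (g x))\<^sup>2)"
   by (intro tendsto_intros elim)
  from lim_imp_Liminf[OF _ this] show ?case by simp
 qed
 also have "\<dots> \<le> liminf (\<lambda>n. \<integral>\<^sup>+x. ennreal ((norm (f n x))\<^sup>2) \<partial>lborel)"
  by (rule nn_integral_liminf) measurable
 also have "\<dots> = liminf (\<lambda>n. ennreal ((n2 (f n))\<^sup>2))"
  by (simp add: nn_integral_L2[OF f])
 also have "\<dots> \<le> limsup (\<lambda>n. ennreal ((n2 (f n))\<^sup>2))"
  by (rule Liminf_le_Limsup) simp
 also have "\<dots> \<le> ennreal (C\<^sup>2)"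
  by (rule Limsup_bounded)
    (auto simp: eventually_sequentially intro!: exI[of _ N] ennreal_leI power_mono le)
 finally have *: "(\<integral>\<^sup>+x. ennreal ((norm (g x))\<^sup>2) \<partial>lborel) \<le> ennreal (C\<^sup>2)" .
 show "g \<in> L2" "n2 g \<le> C" using L2_nnI[OF g * \<open>C \<ge> 0\<close>] by auto
qed

lemma L2_complete:
 fixes f :: "nat \<Rightarrow> 'a::euclidean_space \<Rightarrow> 'b::{banach,second_countable_topology}"
 assumes f: "\<And>n. f n \<in> L2"
  and Cauchy: "\<And>e. e > 0 \<Longrightarrow> \<exists>N. \<forall>m\<ge>N. \<forall>n\<ge>N. n2 (\<lambda>x. f m x - f n x) < e"
 obtains g where "g \<in> L2" "(\<lambda>n. n2 (\<lambda>x. f n x - g x)) \<longlonglongrightarrow> 0"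
proof -
 obtain N where N: "\<And>k m n. m \<ge> N k \<Longrightarrow> n \<ge> N k \<Longrightarrow> n2 (\<lambda>x. f m x - f n x) < (1/2)^k"
 proof -
  have "\<forall>k. \<exists>N. \<forall>m\<ge>N. \<forall>n\<ge>N. n2 (\<lambda>x. f m x - f n x) < (1/2)^k"
   using Cauchy by auto
  then show thesis using that by metis
 qed
 \<comment> \<open>The sum makes \<open>M k\<close> at least \<open>N i\<close> for every
   \<open>i \<le> k\<close>, so the subsequence \<open>F\<close> keeps the Cauchy estimates of all
   earlier levels.\<close>
 define M where "M k = (\<Sum>i\<le>k. N i) + k" for k
 have MN: "M k \<ge> N k" and MS: "M (Suc k) \<ge> N k" for k
  using member_le_sum[of k "{..k}" N] by (auto simp: M_def)
 define F where "F k = f (M k)" for k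
 have F: "F k \<in> L2" for k by (simp add: F_def f)
 note [measurable] = L2_measurable[OF F]
 define d where "d k x = F (Suc k) x - F k x" for k x
 have d: "d k \<in> L2" for k unfolding d_def by (intro L2_diff F)
 \<comment> \<open>The squared increments integrate to at most (1/4)^k, which leaves room for the
   weight 2^k. The weight is spent pointwise below, through t \<le> p t^2 + 1/p with p = 2^k, to
   pass from summable weighted squares to absolute summability.\<close>
 have "(LBINT x. 2^k * (norm (d k x))\<^sup>2) \<le> (1/2)^k" for k
 proof -
  have "(n2 (d k))\<^sup>2 \<le> ((1/2)^k)\<^sup>2"
   unfolding d_def F_def by (intro power_mono less_imp_le[OF N] MN MS) auto
  then have "2^k * (n2 (d k))\<^sup>2 \<le> 2^k * ((1/2)^k)\<^sup>2" by simp
  also have "\<dots> = (2 * (1/2) * (1/2))^k"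
   by (simp only: power2_eq_square power_mult_distrib mult.assoc)
  finally show ?thesis by (simp add: n2_sq)
 qed
 then have "summable (\<lambda>k. LBINT x. 2^k * (norm (d k x))\<^sup>2)"
  by (intro summable_comparison_test'[OF summable_geometric[of "1/2"], where N=0]) auto
 then have "AE x in lborel. summable (\<lambda>k. 2^k * (norm (d k x))\<^sup>2)"
  by (intro summable_AE integrable_mult_right L2_integrable d) auto
 then have conv: "AE x in lborel. convergent (\<lambda>k. F k x)"
 proof eventually_elim
  case (elim x)
  have "summable (\<lambda>k. norm (d k x))"
  proof (rule summable_comparison_test'[where N=0])
   have "summable (\<lambda>k. (1/2::real)^k)" by (intro summable_geometric) simp
   then show "summable (\<lambda>k. 2^k * (norm (d k x))\<^sup>2 + (1/2)^k)" by (intro summable_add elim)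
   show "norm (norm (d k x)) \<le> 2^k * (norm (d k x))\<^sup>2 + (1/2)^k" for k
   proof -
    define t where "t = norm (d k x)"
    define p where "p = (2::real)^k"
    have "p > 0" "(1/2)^k = 1/p" by (auto simp: p_def power_divide)
    have "0 \<le> (p * t - 1)\<^sup>2 + p * t" using \<open>p > 0\<close> by (simp add: t_def)
    then have "p * t \<le> (p * t)\<^sup>2 + 1" by (simp add: power2_diff)
    then have "p * t \<le> p * (p * t\<^sup>2 + 1/p)"
     using \<open>p > 0\<close> by (simp add: distrib_left power_mult_distrib power2_eq_square mult_ac)
    then have "t \<le> p * t\<^sup>2 + 1/p" using \<open>p > 0\<close> by simp
    then show ?thesis using \<open>(1/2)^k = 1/p\<close> by (simp add: t_def p_def)
   qed
  qed
  then have "summable (\<lambda>k. F (Suc k) x - F k x)" unfolding d_def by (rule summable_norm_cancel)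
  then have "convergent (\<lambda>n. (\<Sum>k<n. F (Suc k) x - F k x) + F 0 x)"
   by (intro convergent_add convergent_const) (simp add: summable_iff_convergent)
  moreover have "(\<lambda>n. (\<Sum>k<n. F (Suc k) x - F k x) + F 0 x) = (\<lambda>n. F n x)"
   using sum_lessThan_telescope[of "\<lambda>k. F k x"] by auto
  ultimately show ?case by simp
 qed
 define g where "g x = lim (\<lambda>k. F k x)" for x
 have [measurable]: "g \<in> borel_measurable borel" unfolding g_def by measurable
 have lim: "AE x in lborel. (\<lambda>k. F k x) \<longlonglongrightarrow> g x"
  using conv by eventually_elim (simp add: g_def convergent_LIMSEQ_iff)
 have key: "(\<lambda>x. f n x - g x) \<in> L2 \<and> n2 (\<lambda>x. f n x - g x) \<le> (1/2)^k" if "n \<ge> N k" for n k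
 proof -
  have "AE x in lborel. (\<lambda>j. f n x - F j x) \<longlonglongrightarrow> f n x - g x"
   using lim by eventually_elim (intro tendsto_intros)
  moreover have "n2 (\<lambda>x. f n x - F j x) \<le> (1/2)^k" if "j \<ge> k" for j
  proof -
   have "(\<Sum>i\<le>k. N i) \<le> (\<Sum>i\<le>j. N i)" using that by (intro sum_mono2) auto
   then have "M j \<ge> N k" using member_le_sum[of k "{..k}" N] by (auto simp: M_def)
   then show ?thesis using N[OF \<open>n \<ge> N k\<close>] by (simp add: F_def less_imp_le)
  qed
  ultimately show ?thesis
   using L2_Fatou[of "\<lambda>j x. f n x - F j x" "\<lambda>x. f n x - g x" k "(1/2)^k"]
    L2_diff(1)[OF f[of n] F] L2_measurable[OF f[of n]] by simp
 qed
 show thesis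
 proof
  show "g \<in> L2" using L2_diff(1)[OF f[of "N 0"] key[of 0 "N 0", THEN conjunct1]] by simp
  show "(\<lambda>n. n2 (\<lambda>x. f n x - g x)) \<longlonglongrightarrow> 0"
  proof (rule LIMSEQ_I)
   fix r :: real assume "r > 0"
   then obtain k where k: "(1/2::real)^k < r" using real_arch_pow_inv[of r "1/2"] by auto
   show "\<exists>no. \<forall>n\<ge>no. norm (n2 (\<lambda>x. f n x - g x) - 0) < r"
    using key[of k] k by (intro exI[of _ "N k"]) (auto intro: le_less_trans)
  qed
 qed
qed

lemma L2_tendsto_integral:
 fixes f :: "nat \<Rightarrow> 'a::euclidean_space \<Rightarrow> real" and g :: "nat \<Rightarrow> 'a \<Rightarrow> 'c::{banach,second_countable_topology}"
 assumes L: "\<And>n. f n \<in> L2" "F \<in> L2" "\<And>n. g n \<in> L2" "G \<in> L2"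
  and f: "(\<lambda>n. n2 (\<lambda>x. f n x - F x)) \<longlonglongrightarrow> 0" and g: "(\<lambda>n. n2 (\<lambda>x. g n x - G x)) \<longlonglongrightarrow> 0"
 shows "(\<lambda>n. LBINT x. f n x *\<^sub>R g n x) \<longlonglongrightarrow> (LBINT x. F x *\<^sub>R G x)"
proof (rule LIM_zero_cancel, rule tendsto_norm_zero_cancel, rule tendsto_sandwich[OF _ _ tendsto_const])
 let ?b = "\<lambda>n. n2 (\<lambda>x. f n x - F x) * n2 (\<lambda>x. g n x - G x) + n2 (\<lambda>x. f n x - F x) * n2 G + n2 F * n2 (\<lambda>x. g n x - G x)"
 show "?b \<longlonglongrightarrow> 0"
  using tendsto_add[OF tendsto_add[OF tendsto_mult[OF f g] tendsto_mult[OF f tendsto_const]] tendsto_mult[OF tendsto_const g]]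
  by simp
 have "norm ((LBINT x. f n x *\<^sub>R g n x) - (LBINT x. F x *\<^sub>R G x)) \<le> ?b n" for n
 proof -
  note d = L2_diff(1)[OF L(1)[of n] L(2)] L2_diff(1)[OF L(3)[of n] L(4)]
  have "(LBINT x. f n x *\<^sub>R g n x) - (LBINT x. F x *\<^sub>R G x)
   = (LBINT x. (f n x - F x) *\<^sub>R (g n x - G x)) + (LBINT x. (f n x - F x) *\<^sub>R G x)
    + (LBINT x. F x *\<^sub>R (g n x - G x))"
   by (subst Bochner_Integration.integral_diff[symmetric]
      Bochner_Integration.integral_add[symmetric];
     (intro L2_scaleR_integrable Bochner_Integration.integrable_add L d)?)+
     (simp add: algebra_simps)
  also have "norm \<dots> \<le> ?b n"
   by (intro norm_triangle_le add_mono L2_scaleR_integrable(2) L d)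
  finally show ?thesis .
 qed
 then show "\<forall>\<^sub>F n in sequentially. norm ((LBINT x. f n x *\<^sub>R g n x) - (LBINT x. F x *\<^sub>R G x)) \<le> ?b n"
  by simp
qed simp

lemma L2_tendsto_integral_const:
 fixes f :: "nat \<Rightarrow> 'a::euclidean_space \<Rightarrow> 'b::{banach,second_countable_topology}"
 assumes "\<And>n. f n \<in> L2" "F \<in> L2" "g \<in> L2" "(\<lambda>n. n2 (\<lambda>x. f n x - F x)) \<longlonglongrightarrow> 0"
 shows "(\<lambda>n. LBINT x. g x *\<^sub>R f n x) \<longlonglongrightarrow> (LBINT x. g x *\<^sub>R F x)"
 using L2_tendsto_integral[of "\<lambda>_. g" g f F] assms by (simp add: L2_zero)

lemma n2_tendsto:
 fixes f :: "nat \<Rightarrow> 'a::euclidean_space \<Rightarrow> 'b::{banach,second_countable_topology}"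
 assumes "\<And>n. f n \<in> L2" "F \<in> L2" "(\<lambda>n. n2 (\<lambda>x. f n x - F x)) \<longlonglongrightarrow> 0"
 shows "(\<lambda>n. n2 (f n)) \<longlonglongrightarrow> n2 F"
 by (rule LIM_zero_cancel, rule Lim_null_comparison[OF _ assms(3)])
   (use n2_diff_abs[OF assms(1,2)] in auto)

section \<open>Affine substitutions\<close>

lemma lborel_nn_integral_affine:
 fixes f :: "'a::euclidean_space \<Rightarrow> ennreal" and t :: 'a
 assumes [measurable]: "f \<in> borel_measurable borel" and c: "c \<noteq> 0"
 shows "(\<integral>\<^sup>+x. f x \<partial>lborel) = ennreal (\<bar>c\<bar>^DIM('a)) * (\<integral>\<^sup>+x. f (t + c *\<^sub>R x) \<partial>lborel)"
 by (subst lborel_affine[OF c, of t])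
   (simp add: nn_integral_density nn_integral_distr nn_integral_cmult)

lemma lborel_integrable_affine:
 fixes f :: "'a::euclidean_space \<Rightarrow> 'b::{banach,second_countable_topology}" and t :: 'a
 assumes f: "integrable lborel f" and c: "c \<noteq> 0"
 shows "integrable lborel (\<lambda>x. f (t + c *\<^sub>R x))"
proof -
 note [measurable] = borel_measurable_integrable[OF f]
 have "(\<integral>\<^sup>+x. ennreal (norm (f x)) \<partial>lborel) = ennreal (\<bar>c\<bar>^DIM('a)) * (\<integral>\<^sup>+x. ennreal (norm (f (t + c *\<^sub>R x))) \<partial>lborel)"
  by (rule lborel_nn_integral_affine[OF _ c]) measurable
 moreover have "(\<integral>\<^sup>+x. ennreal (norm (f x)) \<partial>lborel) < \<infinity>"
  using f by (simp add: integrable_iff_bounded)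
 ultimately show ?thesis
  using c by (auto simp: integrable_iff_bounded ennreal_mult_less_top)
qed

lemma lborel_integral_affine:
 fixes f :: "'a::euclidean_space \<Rightarrow> 'b::{banach,second_countable_topology}" and t :: 'a
 assumes f [measurable]: "f \<in> borel_measurable borel" and c: "c \<noteq> 0"
 shows "(LBINT x. f x) = \<bar>c\<bar>^DIM('a) *\<^sub>R (LBINT x. f (t + c *\<^sub>R x))"
 by (subst lborel_affine[OF c, of t])
   (simp add: integral_density integral_distr)

lemma lborel_integral_reflect:
 fixes f :: "'a::euclidean_space \<Rightarrow> 'b::{banach,second_countable_topology}"
 assumes "f \<in> borel_measurable borel"
 shows "(LBINT y. f (x - y)) = (LBINT y. f y)"
 using lborel_integral_affine[OF assms, of "-1" x] by simp

lemma lborel_integrable_reflect: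
 fixes f :: "'a::euclidean_space \<Rightarrow> 'b::{banach,second_countable_topology}"
 shows "integrable lborel f \<Longrightarrow> integrable lborel (\<lambda>y. f (x - y))"
 using lborel_integrable_affine[of f "-1" x] by simp

lemma lborel_nn_integral_reflect:
 fixes f :: "'a::euclidean_space \<Rightarrow> ennreal"
 assumes "f \<in> borel_measurable borel"
 shows "(\<integral>\<^sup>+y. f (x - y) \<partial>lborel) = (\<integral>\<^sup>+y. f y \<partial>lborel)"
 using lborel_nn_integral_affine[OF assms, of "-1" x] by simp

lemma L2_reflect:
 fixes f :: "'a::euclidean_space \<Rightarrow> 'b::{banach,second_countable_topology}"
 assumes f: "f \<in> L2"
 shows "(\<lambda>y. f (x - y)) \<in> L2" "n2 (\<lambda>y. f (x - y)) = n2 f"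
proof -
 note [measurable] = L2_measurable[OF f]
 show "(\<lambda>y. f (x - y)) \<in> L2"
  by (rule L2I[OF _ lborel_integrable_reflect[OF L2_integrable[OF f]]]) measurable
 show "n2 (\<lambda>y. f (x - y)) = n2 f"
  unfolding n2_def by (subst lborel_integral_reflect[of "\<lambda>y. (norm (f y))\<^sup>2"]) auto
qed

section \<open>Cutoffs and integration by parts\<close>

lemma poly_times_exp_tendsto_0: "((\<lambda>u. poly q u * exp (- u)) \<longlongrightarrow> (0::real)) at_top"
proof -
 have "((\<lambda>u. \<Sum>i\<le>degree q. coeff q i * (u ^ i / exp u)) \<longlongrightarrow> (\<Sum>i\<le>degree q. coeff q i * 0)) at_top"
  by (intro tendsto_sum tendsto_mult tendsto_const tendsto_power_div_exp_0)
 moreover have "(\<lambda>u. \<Sum>i\<le>degree q. coeff q i * (u ^ i / exp u)) = (\<lambda>u. poly q u * exp (- u))"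
  by (simp add: poly_altdef sum_distrib_right exp_minus divide_inverse mult.assoc)
 ultimately show ?thesis by simp
qed

text \<open>A family stable under differentiation that contains exp (-1/x), extended by zero, as the
  case \<open>p = 1\<close>.\<close>

definition flat :: "real poly \<Rightarrow> real \<Rightarrow> real" where
 "flat p x = (if x \<le> 0 then 0 else poly p (1/x) * exp (- (1/x)))"

text \<open>For x > 0 the derivative of p(1/x) exp(-1/x) has the factor 1/x^2 and p replaced by p -
  p'; \<open>monom 1 2\<close> is that factor, as the polynomial X^2 evaluated at 1/x. At the origin
  exponential decay beats every polynomial in 1/x.\<close>

lemma flat_deriv: "(flat p has_real_derivative flat (monom 1 2 * (p - pderiv p)) x) (at x)"
proof -
 consider "x < 0" | "x = 0" | "x > 0" by linarith
 then show ?thesis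
 proof cases
  case 1
  have "(flat p has_real_derivative 0) (at x)"
   by (rule DERIV_cong_ev[THEN iffD2, OF refl _ refl DERIV_const[of 0]])
     (use eventually_nhds_in_open[of "{..<0}" x] 1 in \<open>auto simp: flat_def elim!: eventually_mono\<close>)
  then show ?thesis using 1 by (simp add: flat_def)
 next
  case 3
  have "((\<lambda>x. poly p (1/x) * exp (- (1/x))) has_real_derivative
    poly p (1/x) * (exp (- (1/x)) * (1/x\<^sup>2)) + (poly (pderiv p) (1/x) * - (1/x\<^sup>2)) * exp (- (1/x))) (at x)"
   using 3 by (auto intro!: derivative_eq_intros DERIV_chain2[OF poly_DERIV] simp: power2_eq_square field_simps)
  then have "((\<lambda>x. poly p (1/x) * exp (- (1/x))) has_real_derivative flat (monom 1 2 * (p - pderiv p)) x) (at x)"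
   by (rule DERIV_cong) (use 3 in \<open>auto simp: flat_def poly_monom power2_eq_square field_simps\<close>)
  moreover have "\<forall>\<^sub>F y in nhds x. flat p y = poly p (1/y) * exp (- (1/y))"
   using eventually_nhds_in_open[of "{0<..}" x] 3 by (auto simp: flat_def elim!: eventually_mono)
  ultimately show ?thesis by (subst DERIV_cong_ev[OF refl _ refl])
 next
  case 2
  have "((\<lambda>h. flat p h / h) \<longlongrightarrow> 0) (at 0)"
  proof (rule filterlim_split_at)
   show "((\<lambda>h. flat p h / h) \<longlongrightarrow> 0) (at_left 0)"
    by (rule tendsto_eventually) (auto simp: flat_def eventually_at_filter)
   \<comment> \<open>\<open>pCons 0 p\<close> is X p, which absorbs the division by
     \<open>h\<close>.\<close>
   have "((\<lambda>h. poly (pCons 0 p) (inverse h) * exp (- inverse h)) \<longlongrightarrow> 0) (at_right (0::real))"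
    by (rule filterlim_compose[OF poly_times_exp_tendsto_0 filterlim_inverse_at_top_right])
   then show "((\<lambda>h. flat p h / h) \<longlongrightarrow> 0) (at_right 0)"
    by (rule Lim_transform_eventually)
      (auto simp: eventually_at_filter flat_def field_simps)
  qed
  then show ?thesis using 2 by (simp add: DERIV_def flat_def)
 qed
qed

lemma smooth1_flat: "smooth1 S (flat p)"
 by (rule smooth1_coinduct[where P = "\<lambda>F. \<exists>p. F = flat p"]) (use flat_deriv in blast)+

lemma smooth_real_deriv: "smooth f \<Longrightarrow> (f has_real_derivative pd 1 f x) (at x)" for f :: "real \<Rightarrow> real"
proof -
 assume f: "smooth f"
 have "frechet_derivative f (at x) = (*) (pd 1 f x)"
  using frechet_derivative_eq_sum_pd[OF smooth_differentiable[OF f], of x]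
  by (auto simp: mult.commute)
 then show ?thesis
  using smooth_has_derivative[OF f, of x] by (simp add: has_field_derivative_def)
qed

lemma smooth_imp_smooth1: "smooth f \<Longrightarrow> smooth1 S f"
 by (rule smooth1_coinduct[where P = smooth]) (use smooth_real_deriv smooth_pd[of _ "1::real"] in auto)

lemma smooth1_imp_smooth: "smooth1 UNIV f \<Longrightarrow> smooth f" for f :: "real \<Rightarrow> real"
 using smooth_compose1[of "\<lambda>x::real. x" UNIV f] smooth_coord[of "1::real"] by simp

text \<open>The function is one minus the normalised primitive of a bump that lives on the interval
  from 1 to 2.\<close>

lemma cut_ex:
 "\<exists>F::real \<Rightarrow> real. smooth F \<and> (\<forall>t\<le>1. F t = 1) \<and> (\<forall>t\<ge>2. F t = 0) \<and> (\<forall>t. 0 \<le> F t \<and> F t \<le> 1)"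
proof -
 define b where "b s = flat 1 (s - 1) * flat 1 (2 - s)" for s
 have pos: "flat 1 t > 0 \<longleftrightarrow> t > 0" "flat 1 t \<ge> 0" for t by (auto simp: flat_def)
 have b0: "b s \<ge> 0" for s by (simp add: b_def pos)
 have bz: "b s = 0" if "s \<le> 1 \<or> s \<ge> 2" for s using that by (auto simp: b_def flat_def)
 have smb: "smooth b"
 proof -
  have lin: "smooth (\<lambda>s::real. s - 1)" "smooth (\<lambda>s::real. 2 - s)"
   using smooth_coord[of "1::real"] by (auto intro!: smooth_diff smooth_const)
  show ?thesis unfolding b_def
   by (intro smooth_mult smooth_compose1[OF lin(1) smooth1_flat[of UNIV]]
     smooth_compose1[OF lin(2) smooth1_flat[of UNIV]]) auto
 qed
 have cont: "continuous_on A b" for A by (rule smooth_continuous[OF smb])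
 \<comment> \<open>The lower limit 0 lies left of the support of \<open>b\<close>, and for negative
   \<open>t\<close> the interval is empty; so \<open>G\<close> vanishes for all t \<le> 1.\<close>
 define G where "G t = integral {0..t} b" for t
 have G1: "G t = 0" if "t \<le> 1" for t
 proof -
  have "integral {0..t} b = integral {0..t} (\<lambda>_. 0)" using bz that by (intro integral_cong) auto
  then show ?thesis by (simp add: G_def)
 qed
 have G': "(G has_real_derivative b t) (at t)" for t
 proof (cases "t > 0")
  case True
  have "(G has_real_derivative b t) (at t within {0..t+1})"
   unfolding G_def by (rule integral_has_real_derivative) (use cont True in auto)
  moreover have "at t within {0..t+1} = at t"
   by (rule at_within_interior) (use True in auto)
  ultimately show ?thesis by simp
 next
  case False
  have "G s = 0" if "s < 1" for s using G1[of s] that by simp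
  then have "(G has_real_derivative 0) (at t)"
   by (intro DERIV_cong_ev[THEN iffD2, OF refl _ refl DERIV_const[of 0]])
     (use eventually_nhds_in_open[of "{..<1}" t] False in \<open>auto elim!: eventually_mono\<close>)
  then show ?thesis using bz[of t] False by simp
 qed
 have mono: "G s \<le> G t" if "s \<le> t" for s t
  by (rule DERIV_nonneg_imp_nondecreasing[OF that]) (use G' b0 in blast)
 have G2: "G t = G 2" if "t \<ge> 2" for t
 proof -
  have "G t = G 2"
  proof (cases "t = 2")
   case False
   with that have "2 < t" by simp
   then obtain z where "2 < z" "G t - G 2 = (t - 2) * b z" using MVT2[of 2 t G b] G' by auto
   then show ?thesis using bz[of z] by simp
  qed simp
  then show ?thesis .
 qed
 obtain z where z: "1 < z" "z < 2" "G 2 - G 1 = (2 - 1) * b z" using MVT2[of 1 2 G b] G' by auto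
 then have c: "G 2 > 0" using G1[of 1] pos by (auto simp: b_def)
 have "smooth (\<lambda>t. 1 - G t * (1 / G 2))"
 proof -
  have "smooth G"
   by (rule smooth1_imp_smooth, rule smooth1I_deriv[OF smooth_imp_smooth1[OF smb]]) (rule G')
  then show ?thesis by (intro smooth_diff smooth_mult smooth_const)
 qed
 moreover have "1 - G t * (1 / G 2) = 1" if "t \<le> 1" for t using G1[OF that] by simp
 moreover have "1 - G t * (1 / G 2) = 0" if "t \<ge> 2" for t using c by (simp add: G2[OF that])
 moreover have "0 \<le> 1 - G t * (1 / G 2)" "1 - G t * (1 / G 2) \<le> 1" for t
 proof -
  have "G (min t 1) = 0" "G (max t 2) = G 2" by (rule G1, simp, rule G2, simp)
  then have "0 \<le> G t" "G t \<le> G 2"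
   using mono[of "min t 1" t] mono[of t "max t 2"] by auto
  then show "0 \<le> 1 - G t * (1 / G 2)" "1 - G t * (1 / G 2) \<le> 1" using c by auto
 qed
 ultimately show ?thesis by blast
qed

definition cutoff :: "real \<Rightarrow> real" where
 "cutoff = (SOME F. smooth F \<and> (\<forall>t\<le>1. F t = 1) \<and> (\<forall>t\<ge>2. F t = 0) \<and> (\<forall>t. 0 \<le> F t \<and> F t \<le> 1))"

lemma cutoff: "smooth cutoff" "t \<le> 1 \<Longrightarrow> cutoff t = 1" "t \<ge> 2 \<Longrightarrow> cutoff t = 0" "0 \<le> cutoff t" "cutoff t \<le> 1"
proof -
 have "smooth cutoff \<and> (\<forall>t\<le>1. cutoff t = 1) \<and> (\<forall>t\<ge>2. cutoff t = 0) \<and> (\<forall>t. 0 \<le> cutoff t \<and> cutoff t \<le> 1)"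
  unfolding cutoff_def by (rule someI_ex[OF cut_ex])
 then show "smooth cutoff" "t \<le> 1 \<Longrightarrow> cutoff t = 1" "t \<ge> 2 \<Longrightarrow> cutoff t = 0" "0 \<le> cutoff t" "cutoff t \<le> 1"
  by blast+
qed

text \<open>\<open>cutoff\<close> is 1 on a whole half-line and hence no test function.
  \<open>c0\<close> cuts it off on the left: it agrees with \<open>cutoff\<close> for t > -1 and
  vanishes for t < -2, while both derivatives of \<open>cutoff\<close> vanish for t < 1. So the
  bounds for the test function \<open>c0\<close> carry over.\<close>

lemma cut_derivs:
 obtains C where "C > 0" "\<And>t. \<bar>pd 1 cutoff t\<bar> \<le> C" "\<And>t. \<bar>pd 1 (pd 1 cutoff) t\<bar> \<le> C"
proof -
 define c0 where "c0 t = cutoff t * (1 - cutoff (t + 3))" for t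
 have aff: "smooth (\<lambda>t. cutoff (t + 3))"
  by (rule smooth_affine[OF cutoff(1), of "\<lambda>t. t + 3" "\<lambda>t. t"]) (auto intro!: derivative_eq_intros)
 have "test c0"
  unfolding test_functions_iff
 proof
  show "smooth c0" unfolding c0_def by (intro smooth_mult smooth_diff smooth_const cutoff aff)
  show "\<exists>r. \<forall>x. norm x > r \<longrightarrow> c0 x = 0"
   by (intro exI[of _ 2]) (auto simp: c0_def cutoff abs_if split: if_splits)
 qed
 then have t: "test (pd 1 c0)" "test (pd 1 (pd 1 c0))"
  by (auto intro!: test_pd)
 obtain B1 where B1: "B1 > 0" "\<And>t. \<bar>pd 1 c0 t\<bar> \<le> B1" using test_bounded[OF t(1)] by blast
 obtain B2 where B2: "B2 > 0" "\<And>t. \<bar>pd 1 (pd 1 c0) t\<bar> \<le> B2" using test_bounded[OF t(2)] by blast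
 have loc: "pd 1 f t = pd 1 g t" if "open S" "t \<in> S" "\<And>s. s \<in> S \<Longrightarrow> f s = g s" "smooth g" for f g :: "real \<Rightarrow> real" and S t
  using has_derivative_transform_within_open[OF smooth_has_derivative[OF that(4)] that(1,2), of f] that(3)
  by (subst pd_eq, auto simp: pd_def)
 have E: "c0 s = cutoff s" if "s > -1" for s using that by (simp add: c0_def cutoff)
 have F: "cutoff s = 1" if "s < 1" for s using that by (simp add: cutoff)
 have d1: "pd 1 cutoff t = (if t > -1 then pd 1 c0 t else 0)" for t
  using loc[of "{-1<..}" t cutoff c0] loc[of "{..<1}" t cutoff "\<lambda>_. 1"] E F \<open>test c0\<close>
  by (auto simp: test_smooth smooth_const)
 have d2: "pd 1 (pd 1 cutoff) t = (if t > -1 then pd 1 (pd 1 c0) t else 0)" for t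
 proof -
  have "pd 1 cutoff s = 0" if "s < 1" for s
   using loc[of "{..<1}" s cutoff "\<lambda>_. 1"] F that by (auto simp: smooth_const)
  then show ?thesis
   using loc[of "{-1<..}" t "pd 1 cutoff" "pd 1 c0"] loc[of "{..<1}" t "pd 1 cutoff" "\<lambda>_. 0"] d1 t
   by (auto simp: test_smooth smooth_const)
 qed
 show thesis
 proof (rule that[of "B1 + B2"])
  show "\<bar>pd 1 cutoff t\<bar> \<le> B1 + B2" "\<bar>pd 1 (pd 1 cutoff) t\<bar> \<le> B1 + B2" for t
   using B1(1) B1(2)[of t] B2(1) B2(2)[of t] by (auto simp: d1 d2)
 qed (use B1 B2 in auto)
qed

text \<open>The transition from 1 to 0 takes place between radii of about e^(L/2) and e^L. On this
  logarithmic scale the first and second derivatives are of size 1/(L |z|) and 1/(L |z|^2): the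
  factor 1/L is gained at all radii at once.\<close>

definition chi :: "real \<Rightarrow> 'a::euclidean_space \<Rightarrow> real" where
 "chi L z = cutoff (ln (1 + (norm z)\<^sup>2) / L)"

lemma one_plus_norm2_pos: "0 < 1 + (norm z)\<^sup>2"
 by (simp add: add_pos_nonneg)

lemma smooth_ln_norm: "smooth (\<lambda>z::'a::euclidean_space. ln (1 + (norm z)\<^sup>2) / L)"
proof -
 have "smooth (\<lambda>z::'a. ln (1 + (norm z)\<^sup>2))"
  by (rule smooth_compose1[OF _ smooth1_ln])
    (auto intro!: smooth_add smooth_const smooth_norm2 simp: one_plus_norm2_pos)
 from smooth_mult[OF this smooth_const[of "1/L"]] show ?thesis by simp
qed

lemma chi_smooth: "smooth (chi L)"
 unfolding chi_def by (rule smooth_compose1[OF smooth_ln_norm smooth_imp_smooth1[OF cutoff(1)]]) auto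

lemma chi_bounds [simp]: "0 \<le> chi L z" "chi L z \<le> 1"
 by (auto simp: chi_def cutoff)

lemma chi_eq_0: "L > 0 \<Longrightarrow> 1 + (norm z)\<^sup>2 \<ge> exp (2 * L) \<Longrightarrow> chi L z = 0"
 unfolding chi_def by (rule cutoff) (simp add: field_simps ln_ge_iff one_plus_norm2_pos mult.commute)

lemma chi_eq_1: "L > 0 \<Longrightarrow> 1 + (norm z)\<^sup>2 \<le> exp L \<Longrightarrow> chi L z = 1"
 unfolding chi_def using ln_le_cancel_iff[of "1 + (norm z)\<^sup>2" "exp L"] one_plus_norm2_pos[of z]
 by (intro cutoff) (simp add: field_simps)

lemma chi_test: "L > 0 \<Longrightarrow> test (chi L)"
 unfolding test_functions_iff
proof (intro conjI chi_smooth exI[of _ "exp (2 * L)"] allI impI)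
 fix z :: 'a assume L: "L > 0" and "norm z > exp (2 * L)"
 then have "exp (2 * L) * exp (2 * L) \<le> norm z * norm z" by (intro mult_mono) auto
 moreover have "exp (2 * L) * 1 \<le> exp (2 * L) * exp (2 * L)" using L by (intro mult_left_mono) auto
 ultimately have "exp (2 * L) \<le> (norm z)\<^sup>2" unfolding power2_eq_square by linarith
 then show "chi L z = 0" by (intro chi_eq_0 L) simp
qed

lemma chi_tendsto: "(\<lambda>n. chi (real (Suc n)) z) \<longlonglongrightarrow> 1"
proof (rule tendsto_eventually)
 have "\<forall>\<^sub>F n in sequentially. real n \<ge> 1 + (norm z)\<^sup>2"
  by (rule eventually_ge_at_top[THEN eventually_mono[where P="\<lambda>n. n \<ge> nat \<lceil>1 + (norm z)\<^sup>2\<rceil>"]]) linarith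
 then show "\<forall>\<^sub>F n in sequentially. chi (real (Suc n)) z = 1"
 proof eventually_elim
  case (elim n)
  show ?case using elim exp_ge_add_one_self[of "real (Suc n)"] by (intro chi_eq_1) auto
 qed
qed

lemma pd_ln_norm: 
 "pd b (\<lambda>z::'a::euclidean_space. ln (1 + (norm z)\<^sup>2) / L) z = 2 * (z \<bullet> b) / (1 + (norm z)\<^sup>2) / L"
proof -
 have "pd b (\<lambda>z::'a. 1 + (norm z)\<^sup>2) z = 2 * (z \<bullet> b)" 
  by (subst pd_add) (auto simp: smooth_const smooth_norm2 pd_norm2)
 moreover have "((\<lambda>x. ln x / L) has_real_derivative 1 / (1 + (norm z)\<^sup>2) / L) (at (1 + (norm z)\<^sup>2))"
  by (rule DERIV_cdivide[OF DERIV_ln_divide[OF one_plus_norm2_pos]])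
 ultimately show ?thesis
  by (subst pd_compose1[of "\<lambda>z. 1 + (norm z)\<^sup>2" "\<lambda>x. ln x / L"])
    (auto intro!: smooth_add smooth_const smooth_norm2)
qed

lemma pd_chi:
 "pd b (chi L) z = pd 1 cutoff (ln (1 + (norm z)\<^sup>2) / L) * (2 * (z \<bullet> b) / (1 + (norm z)\<^sup>2) / L)"
 unfolding chi_def
 by (subst pd_compose1[OF smooth_ln_norm smooth_real_deriv[OF cutoff(1)]]) (simp add: pd_ln_norm)

lemma pd_pd_chi:
 assumes b: "b \<in> Basis"
 shows "pd b (pd b (chi L)) z =
  pd 1 (pd 1 cutoff) (ln (1 + (norm z)\<^sup>2) / L) * (2 * (z \<bullet> b) / (1 + (norm z)\<^sup>2) / L)\<^sup>2 +
  pd 1 cutoff (ln (1 + (norm z)\<^sup>2) / L) * ((2 / (1 + (norm z)\<^sup>2) - 4 * (z \<bullet> b)\<^sup>2 / (1 + (norm z)\<^sup>2)\<^sup>2) / L)"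
proof -
 define w where "w z = ln (1 + (norm z)\<^sup>2) / L" for z :: 'a
 define q where "q z = 2 * (z \<bullet> b) / (1 + (norm z)\<^sup>2) / L" for z :: 'a
 have w: "smooth w" unfolding w_def by (rule smooth_ln_norm)
 have pdw: "pd b w = q" unfolding w_def[abs_def] q_def[abs_def] by (rule ext) (rule pd_ln_norm)
 have q: "smooth q" using smooth_pd[OF w b] by (simp add: pdw)
 have c1: "smooth (pd 1 cutoff)" using smooth_pd[OF cutoff(1), of "1::real"] by simp
 have "smooth (\<lambda>z::'a. 1 + (norm z)\<^sup>2)" by (intro smooth_add smooth_const smooth_norm2)
 then have sm2: "smooth (\<lambda>z::'a. inverse (1 + (norm z)\<^sup>2))"
  by (rule smooth_compose1[OF _ smooth1_inverse]) (simp add: one_plus_norm2_pos)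
 have sm1: "smooth (\<lambda>z::'a. 2 / L * (z \<bullet> b))" by (intro smooth_mult smooth_const smooth_coord)
 have p1: "pd b (\<lambda>z::'a. 2 / L * (z \<bullet> b)) z = 2 / L"
  using b by (subst pd_cmult[OF smooth_coord], subst pd_eq[where f'="\<lambda>v. v \<bullet> b"]) (auto intro!: derivative_intros)
 have "pd b (\<lambda>z::'a. 1 + (norm z)\<^sup>2) z = 2 * (z \<bullet> b)"
  by (subst pd_add) (auto simp: smooth_const smooth_norm2 pd_norm2)
 then have p2: "pd b (\<lambda>z::'a. inverse (1 + (norm z)\<^sup>2)) z = - (inverse (1 + (norm z)\<^sup>2))\<^sup>2 * (2 * (z \<bullet> b))"
  using one_plus_norm2_pos[of z]
  by (subst pd_compose1[OF \<open>smooth (\<lambda>z. 1 + (norm z)\<^sup>2)\<close> DERIV_inverse]) (auto simp: numeral_2_eq_2)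
 have q_eq: "q = (\<lambda>z. 2 / L * (z \<bullet> b) * inverse (1 + (norm z)\<^sup>2))"
  by (auto simp: q_def divide_inverse)
 have pdq: "pd b q z = (2 / (1 + (norm z)\<^sup>2) - 4 * (z \<bullet> b)\<^sup>2 / (1 + (norm z)\<^sup>2)\<^sup>2) / L"
 proof -
  have alg: "2 / L * r + 2 / L * t * (- r\<^sup>2 * (2 * t)) = (2 * r - 4 * t\<^sup>2 * r\<^sup>2) / L" for r t :: real
   by (simp add: divide_inverse algebra_simps power2_eq_square)
  have "pd b q z = 2 / L * inverse (1 + (norm z)\<^sup>2) +
    2 / L * (z \<bullet> b) * (- (inverse (1 + (norm z)\<^sup>2))\<^sup>2 * (2 * (z \<bullet> b)))"
   unfolding q_eq pd_mult[OF sm1 sm2] p1 p2 ..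
  also have "\<dots> = (2 * inverse (1 + (norm z)\<^sup>2) - 4 * (z \<bullet> b)\<^sup>2 * (inverse (1 + (norm z)\<^sup>2))\<^sup>2) / L"
   by (rule alg)
  finally show ?thesis by (simp only: divide_inverse power_inverse)
 qed
 have "pd b (chi L) = (\<lambda>z. pd 1 cutoff (w z) * q z)" by (auto simp: pd_chi w_def q_def)
 moreover have sm: "smooth (\<lambda>z. pd 1 cutoff (w z))"
  by (rule smooth_compose1[OF w smooth_imp_smooth1[OF c1]]) auto
 moreover have "pd b (\<lambda>z. pd 1 cutoff (w z)) z = pd 1 (pd 1 cutoff) (w z) * q z"
  by (subst pd_compose1[OF w smooth_real_deriv[OF c1]]) (simp add: pdw)
 ultimately have "pd b (pd b (chi L)) z = pd 1 (pd 1 cutoff) (w z) * q z * q z + pd 1 cutoff (w z) * pd b q z"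
  by (simp add: pd_mult[OF sm q])
 then show ?thesis unfolding pdq w_def q_def by (simp add: power2_eq_square)
qed

text \<open>The factor \<open>\<bar>z \<bullet> b\<bar>\<close> is kept in the first bound: for
  \<open>b\<close> in an x-direction it is at most |x|, and this cancels one power of the
  singularity 1/|x|^2 of the gradient of an approximate resonance. The constant is ten times that of
  \<open>cut_derivs\<close>, for the two contributions 4 and 6 to the second derivative.\<close>

lemma chi_derivs:
 obtains C where "C > 0"
  "\<And>L (z::'a::euclidean_space) b. L \<ge> 1 \<Longrightarrow> b \<in> Basis \<Longrightarrow> \<bar>pd b (chi L) z\<bar> \<le> C * \<bar>z \<bullet> b\<bar> / (L * (1 + (norm z)\<^sup>2))"
  "\<And>L (z::'a) b. L \<ge> 1 \<Longrightarrow> b \<in> Basis \<Longrightarrow> \<bar>pd b (chi L) z\<bar> \<le> C / L"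
  "\<And>L (z::'a) b. L \<ge> 1 \<Longrightarrow> b \<in> Basis \<Longrightarrow> \<bar>pd b (pd b (chi L)) z\<bar> \<le> C / (L * (1 + (norm z)\<^sup>2))"
proof -
 obtain C where C: "C > 0" "\<And>t. \<bar>pd 1 cutoff t\<bar> \<le> C" "\<And>t. \<bar>pd 1 (pd 1 cutoff) t\<bar> \<le> C"
  using cut_derivs by blast
 have zb: "\<bar>z \<bullet> b\<bar> \<le> norm z" if "b \<in> Basis" for z b :: 'a using Basis_le_norm[OF that] by simp
 have zb2: "(z \<bullet> b)\<^sup>2 \<le> 1 + (norm z)\<^sup>2" if "b \<in> Basis" for z b :: 'a
  using power_mono[OF zb[OF that, of z], of 2] by simp
 have b1: "\<bar>pd b (chi L) z\<bar> \<le> 10 * C * \<bar>z \<bullet> b\<bar> / (L * (1 + (norm z)\<^sup>2))" if "L \<ge> 1" "b \<in> Basis" for L and z b :: 'a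
 proof -
  have "\<bar>pd b (chi L) z\<bar> = \<bar>pd 1 cutoff (ln (1 + (norm z)\<^sup>2) / L)\<bar> * (2 * \<bar>z \<bullet> b\<bar> / (L * (1 + (norm z)\<^sup>2)))"
   using one_plus_norm2_pos[of z] that by (simp add: pd_chi abs_mult mult.commute)
  also have "\<dots> \<le> (5 * C) * (2 * \<bar>z \<bullet> b\<bar> / (L * (1 + (norm z)\<^sup>2)))"
   using C(1) C(2)[of "ln (1 + (norm z)\<^sup>2) / L"] one_plus_norm2_pos[of z] that by (intro mult_right_mono) auto
  finally show ?thesis by simp
 qed
 have b2: "\<bar>pd b (chi L) z\<bar> \<le> 10 * C / L" if "L \<ge> 1" "b \<in> Basis" for L and z b :: 'a
 proof -
  have "\<bar>z \<bullet> b\<bar> \<le> 1 + (norm z)\<^sup>2" using zb[OF that(2), of z] zero_le_power2[of "norm z - 1"] by (simp add: power2_diff)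
  then have "\<bar>z \<bullet> b\<bar> / (1 + (norm z)\<^sup>2) \<le> 1" using one_plus_norm2_pos[of z] by simp
  then have "10 * C / L * (\<bar>z \<bullet> b\<bar> / (1 + (norm z)\<^sup>2)) \<le> 10 * C / L * 1"
   using C(1) that by (intro mult_left_mono) auto
  then show ?thesis using b1[OF that, of z] by simp
 qed
 have b3: "\<bar>pd b (pd b (chi L)) z\<bar> \<le> 10 * C / (L * (1 + (norm z)\<^sup>2))" if "L \<ge> 1" "b \<in> Basis" for L and z b :: 'a
 proof -
  define s where "s = 1 + (norm z)\<^sup>2"
  have s: "s > 0" unfolding s_def by (rule one_plus_norm2_pos)
  have r: "(z \<bullet> b)\<^sup>2 / s\<^sup>2 \<le> 1 / s"
  proof -
   have "(z \<bullet> b)\<^sup>2 / s\<^sup>2 \<le> s / s\<^sup>2"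
    using zb2[OF that(2), of z] unfolding s_def by (rule divide_right_mono) simp
   then show ?thesis using s by (simp add: power2_eq_square)
  qed
  have "(2 * (z \<bullet> b) / s / L)\<^sup>2 = 4 * ((z \<bullet> b)\<^sup>2 / s\<^sup>2) * (1 / L\<^sup>2)" by (simp add: power_divide power_mult_distrib)
  also have "\<dots> \<le> 4 * (1 / s) * (1 / L)"
   using r s that by (intro mult_mono mult_left_mono) (auto simp: power2_eq_square field_simps)
  finally have A: "\<bar>(2 * (z \<bullet> b) / s / L)\<^sup>2\<bar> \<le> 4 / (L * s)" by (simp add: mult.commute)
  have "\<bar>2 / s - 4 * (z \<bullet> b)\<^sup>2 / s\<^sup>2\<bar> \<le> 6 / s"
   using r s zero_le_divide_iff[of "(z \<bullet> b)\<^sup>2" "s\<^sup>2"] by (auto simp: abs_if field_simps)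
  then have "\<bar>2 / s - 4 * (z \<bullet> b)\<^sup>2 / s\<^sup>2\<bar> / L \<le> 6 / s / L" using that by (intro divide_right_mono) auto
  then have B: "\<bar>(2 / s - 4 * (z \<bullet> b)\<^sup>2 / s\<^sup>2) / L\<bar> \<le> 6 / (L * s)" using that by (simp add: mult.commute)
  have "\<bar>pd b (pd b (chi L)) z\<bar> \<le> C * (4 / (L * s)) + C * (6 / (L * s))"
   unfolding pd_pd_chi[OF that(2)] s_def[symmetric]
   by (rule order.trans[OF abs_triangle_ineq], unfold abs_mult)
     (intro add_mono mult_mono C A B; use C in simp)
  then show ?thesis by (simp add: s_def[symmetric] add_divide_distrib[symmetric])
 qed
 show thesis by (rule that[of "10 * C"]) (use C b1 b2 b3 in auto)
qed

section \<open>Integration by parts\<close>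

lemma test_set_integrable:
 fixes g :: "'a::euclidean_space \<Rightarrow> 'b::{banach,second_countable_topology}"
 assumes \<phi>: "test \<phi>" and g: "\<And>r. set_integrable lborel (cball 0 r) g"
  and [measurable]: "g \<in> borel_measurable borel"
 shows "integrable lborel (\<lambda>x. \<phi> x *\<^sub>R g x)"
proof -
 obtain r where r: "\<And>x. norm x > r \<Longrightarrow> \<phi> x = 0" using test_supportE[OF \<phi>] by blast
 obtain B where B: "B > 0" "\<And>x. \<bar>\<phi> x\<bar> \<le> B" using test_bounded[OF \<phi>] by blast
 note [measurable] = test_measurable[OF \<phi>]
 have I: "integrable lborel (\<lambda>x. B * norm (indicator (cball 0 r) x *\<^sub>R g x))"
  by (intro integrable_mult_right integrable_norm g[of r, unfolded set_integrable_def])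
 show ?thesis
 proof (rule Bochner_Integration.integrable_bound[OF I])
  show "AE x in lborel. norm (\<phi> x *\<^sub>R g x) \<le> norm (B * norm (indicator (cball 0 r) x *\<^sub>R g x))"
  proof (intro always_eventually allI)
   fix x show "norm (\<phi> x *\<^sub>R g x) \<le> norm (B * norm (indicator (cball 0 r) x *\<^sub>R g x))"
    using B(1) B(2)[of x] r[of x] by (cases "norm x > r") (auto intro!: mult_right_mono)
  qed
 qed measurable
qed

lemma set_integrable_bounded:
 fixes f :: "'a::euclidean_space \<Rightarrow> real"
 assumes [measurable]: "f \<in> borel_measurable borel" and B: "\<And>x. \<bar>f x\<bar> \<le> B"
 shows "set_integrable lborel (cball 0 r) f"
 unfolding set_integrable_def
proof (rule Bochner_Integration.integrable_bound)
 show "integrable lborel (\<lambda>x::'a. indicator (cball 0 r) x * B)"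
  by (intro integrable_mult_left integrable_real_indicator) (use emeasure_bounded_finite[OF bounded_cball] in auto)
 have "0 \<le> B" using B[of 0] by linarith
 then show "AE x in lborel. norm (indicator (cball 0 r) x *\<^sub>R f x) \<le> norm (indicator (cball 0 r) x * B)"
  using B by (auto simp: indicator_def)
qed (use assms(1) in \<open>auto intro!: borel_measurable_times borel_measurable_indicator\<close>)

lemma test_integrable: "test \<phi> \<Longrightarrow> integrable lborel \<phi>"
 using test_set_integrable[OF _ set_integrable_bounded[of "\<lambda>_. 1" 1], of \<phi>] by simp

lemma test_L2: "test \<phi> \<Longrightarrow> \<phi> \<in> L2"
 using test_integrable[OF test_mult[OF test_smooth, of \<phi> \<phi>]]
 by (intro L2I) (auto simp: power2_eq_square intro: smooth_measurable test_smooth)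

lemma smooth_line_deriv:
 assumes "smooth g"
 shows "((\<lambda>t. g (y + t *\<^sub>R d)) has_real_derivative pd d g (y + t *\<^sub>R d)) (at t)"
proof -
 have "((\<lambda>t. g (y + t *\<^sub>R d)) has_derivative (\<lambda>h. frechet_derivative g (at (y + t *\<^sub>R d)) (h *\<^sub>R d))) (at t)"
  by (rule has_derivative_compose[of "\<lambda>t. y + t *\<^sub>R d", OF _ smooth_has_derivative[OF assms]])
    (auto intro!: derivative_eq_intros)
 then show ?thesis
  unfolding has_field_derivative_def pd_def
  by (simp add: linear_scale[OF linear_frechet_derivative[OF smooth_differentiable[OF assms]]] mult.commute[of _ "frechet_derivative _ _ _"])
qed

text \<open>The integral of a difference quotient vanishes by translation invariance.\<close>

lemma integral_pd_test:
 assumes u: "test u" and b: "b \<in> Basis"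
 shows "(LBINT x. pd b u x) = 0"
proof -
 obtain r where r: "r > 0" "\<And>x. norm x > r \<Longrightarrow> u x = 0" using test_supportE[OF u] by blast
 obtain B where B: "B > 0" "\<And>x. \<bar>pd b u x\<bar> \<le> B" using test_bounded[OF test_pd[OF u b]] by blast
 note [measurable] = test_measurable[OF u] test_measurable[OF test_pd[OF u b]]
 define h where "h n = inverse (real (Suc n))" for n
 have h: "h n > 0" "h n \<le> 1" for n by (auto simp: h_def inverse_eq_divide)
 \<comment> \<open>Steps of length at most one keep the support of the difference quotients inside
   the ball of radius \<open>r + 1\<close>, and the mean value theorem bounds them by
   \<open>B\<close>.\<close>
 define q where "q n x = (u (x + h n *\<^sub>R b) - u x) / h n" for n x
 have "(\<lambda>n. LBINT x. q n x) \<longlonglongrightarrow> (LBINT x. pd b u x)"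
 proof (rule integral_dominated_convergence)
  show "integrable lborel (\<lambda>x. indicator (cball 0 (r + 1)) x * B)"
   by (intro integrable_mult_left integrable_real_indicator) (use emeasure_bounded_finite[OF bounded_cball] in auto)
  show "AE x in lborel. (\<lambda>n. q n x) \<longlonglongrightarrow> pd b u x"
  proof (intro always_eventually allI)
   fix x
   have "((\<lambda>t. (u (x + t *\<^sub>R b) - u x) / t) \<longlongrightarrow> pd b u x) (at 0)"
    using smooth_line_deriv[OF test_smooth[OF u], of x b 0] by (simp add: DERIV_def)
   moreover have "filterlim h (at 0) sequentially"
    unfolding filterlim_at h_def using LIMSEQ_inverse_real_of_nat by auto
   ultimately show "(\<lambda>n. q n x) \<longlonglongrightarrow> pd b u x"
    unfolding q_def by (rule filterlim_compose)
  qed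
  show "AE x in lborel. norm (q n x) \<le> indicator (cball 0 (r + 1)) x * B" for n
  proof (intro always_eventually allI)
   fix x
   obtain z where "u (x + h n *\<^sub>R b) - u (x + 0 *\<^sub>R b) = (h n - 0) * pd b u (x + z *\<^sub>R b)"
    using MVT2[OF h(1)[of n], of "\<lambda>t. u (x + t *\<^sub>R b)" "\<lambda>t. pd b u (x + t *\<^sub>R b)"]
     smooth_line_deriv[OF test_smooth[OF u]] by blast
   then have "q n x = pd b u (x + z *\<^sub>R b)" using h(1)[of n] by (simp add: q_def)
   moreover have "q n x = 0" if "norm x > r + 1"
   proof -
    have "norm (h n *\<^sub>R b) \<le> 1" using h[of n] b by simp
    then have "norm (x + h n *\<^sub>R b) > r" using norm_diff_ineq[of x "h n *\<^sub>R b"] that by linarith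
    then show ?thesis using r that by (simp add: q_def)
   qed
   ultimately show "norm (q n x) \<le> indicator (cball 0 (r + 1)) x * B"
    using B by (auto simp: indicator_def)
  qed
 qed (auto simp: q_def)
 moreover have "(LBINT x. q n x) = 0" for n
 proof -
  have "integrable lborel (\<lambda>x. u (x + h n *\<^sub>R b))"
   using lborel_integrable_affine[OF test_integrable[OF u], of 1 "h n *\<^sub>R b"] by (simp add: add.commute)
  moreover have "(LBINT x. u (x + h n *\<^sub>R b)) = (LBINT x. u x)"
   using lborel_integral_affine[of u 1 "h n *\<^sub>R b"] by (simp add: add.commute)
  ultimately show ?thesis by (simp add: q_def test_integrable[OF u])
 qed
 ultimately have "(\<lambda>n::nat. 0) \<longlonglongrightarrow> (LBINT x. pd b u x)" by simp
 then show ?thesis by (simp add: LIMSEQ_const_iff)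
qed

lemma ibp_test:
 assumes f: "smooth f" and \<phi>: "test \<phi>" and b: "b \<in> Basis"
 shows "(LBINT x. pd b f x * \<phi> x) = - (LBINT x. f x * pd b \<phi> x)"
proof -
 have "integrable lborel (\<lambda>x. pd b f x * \<phi> x)" "integrable lborel (\<lambda>x. f x * pd b \<phi> x)"
  by (intro test_integrable test_mult smooth_pd test_pd assms)+
 moreover have "(LBINT x. pd b f x * \<phi> x + f x * pd b \<phi> x) = 0"
  using integral_pd_test[OF test_mult[OF f \<phi>] b] by (simp add: pd_mult[OF f test_smooth[OF \<phi>]])
 ultimately show ?thesis by (simp add: eq_neg_iff_add_eq_0)
qed

text \<open>Integration by parts without compact support, by inserting the cutoff \<open>chi\<close>.\<close>

lemma integral_pd_eq_0:
 assumes f: "smooth f" and b: "b \<in> Basis" and I: "integrable lborel f" "integrable lborel (pd b f)"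
 shows "(LBINT x. pd b f x) = 0"
proof -
 obtain C where C: "C > 0" "\<And>L z. L \<ge> 1 \<Longrightarrow> \<bar>pd b (chi L) z\<bar> \<le> C / L"
  using chi_derivs b by metis
 let ?c = "\<lambda>n. chi (real (Suc n)) :: 'a \<Rightarrow> real"
 note [measurable] = borel_measurable_integrable[OF I(1)] borel_measurable_integrable[OF I(2)]
  smooth_measurable[OF chi_smooth] smooth_measurable[OF smooth_pd[OF chi_smooth b]]
 have "(\<lambda>n. LBINT x. pd b f x * ?c n x) \<longlonglongrightarrow> (LBINT x. pd b f x * 1)"
 proof (rule integral_dominated_convergence[where w="\<lambda>x. norm (pd b f x)"])
  show "AE x in lborel. (\<lambda>n. pd b f x * ?c n x) \<longlonglongrightarrow> pd b f x * 1"
   by (intro always_eventually allI tendsto_mult tendsto_const chi_tendsto)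
 qed (use I in \<open>auto intro!: mult_left_le simp: abs_mult\<close>)
 moreover have "(\<lambda>n. LBINT x. f x * pd b (?c n) x) \<longlonglongrightarrow> (LINT (x::'a)|lborel. 0)"
 proof (rule integral_dominated_convergence[where w="\<lambda>x. C * norm (f x)"])
  have bd: "norm (f x * pd b (?c n) x) \<le> C * norm (f x) * inverse (real (Suc n))" for n x
   using mult_left_mono[OF C(2)[of "real (Suc n)" x], of "\<bar>f x\<bar>"] by (simp add: abs_mult field_simps)
  show "AE x in lborel. (\<lambda>n. f x * pd b (?c n) x) \<longlonglongrightarrow> 0"
   by (intro always_eventually allI Lim_null_comparison[OF always_eventually[OF allI[OF bd]]]
     tendsto_mult_right_zero LIMSEQ_inverse_real_of_nat)
  show "AE x in lborel. norm (f x * pd b (?c n) x) \<le> C * norm (f x)" for n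
  proof (intro always_eventually allI)
   fix x
   have "C * norm (f x) * inverse (real (Suc n)) \<le> C * norm (f x) * 1"
    using C(1) by (intro mult_left_mono) (auto simp: inverse_eq_divide)
   then show "norm (f x * pd b (?c n) x) \<le> C * norm (f x)" using bd[of x n] by simp
  qed
 qed (use I in auto)
 moreover have "(LBINT x. pd b f x * ?c n x) = - (LBINT x. f x * pd b (?c n) x)" for n
  by (rule ibp_test[OF f chi_test b]) simp
 ultimately have "(\<lambda>n. - (LBINT x. f x * pd b (?c n) x)) \<longlonglongrightarrow> (LBINT x. pd b f x)"
  "(\<lambda>n. - (LBINT x. f x * pd b (?c n) x)) \<longlonglongrightarrow> 0"
  by (auto dest: tendsto_minus)
 then show ?thesis using LIMSEQ_unique by blast
qed

lemma ibp:
 assumes f: "smooth f" and g: "smooth g" and b: "b \<in> Basis"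
  and I: "integrable lborel (\<lambda>x. f x * g x)" "integrable lborel (\<lambda>x. pd b f x * g x)" "integrable lborel (\<lambda>x. f x * pd b g x)"
 shows "(LBINT x. pd b f x * g x) = - (LBINT x. f x * pd b g x)"
proof -
 have eq: "pd b (\<lambda>x. f x * g x) = (\<lambda>x. pd b f x * g x + f x * pd b g x)"
  by (auto simp: pd_mult[OF f g])
 have "(LBINT x. pd b (\<lambda>x. f x * g x) x) = 0"
  by (rule integral_pd_eq_0[OF smooth_mult[OF f g] b I(1)]) (use I eq in simp)
 then show ?thesis using I by (simp add: eq eq_neg_iff_add_eq_0)
qed

section \<open>Convolution and mollification\<close>

text \<open>The kernel is real and the function takes values in a Banach space, so that one notion
  serves the complex resolvent and the real positivity arguments.\<close>

definition cv :: "('a::euclidean_space \<Rightarrow> real) \<Rightarrow> ('a \<Rightarrow> 'b::{banach,second_countable_topology}) \<Rightarrow> 'a \<Rightarrow> 'b" where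
 "cv k g x = (LBINT y. k (x - y) *\<^sub>R g y)"

lemma pd_eq_0_outside:
 assumes "\<And>x. norm x > r \<Longrightarrow> f x = 0" "norm x > r"
 shows "pd b f x = 0"
proof -
 have "open {x::'a. norm x > r}" by (intro open_Collect_less continuous_intros)
 then have "(f has_derivative (\<lambda>_. 0)) (at x)"
  using has_derivative_transform_within_open[of "\<lambda>x. 0" "\<lambda>_. 0" x UNIV "{x. norm x > r}" f] assms
  by auto
 then show ?thesis by (intro pd_eq) auto
qed

lemma test_reflect:
 assumes "test \<phi>" shows "test (\<lambda>y. \<phi> (x - y))"
 unfolding test_functions_iff
proof
 show "smooth (\<lambda>y. \<phi> (x - y))"
  by (rule smooth_affine[OF test_smooth[OF assms], of "\<lambda>y. x - y" uminus]) (auto intro!: derivative_eq_intros)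
 obtain r where r: "\<And>x. norm x > r \<Longrightarrow> \<phi> x = 0" using test_supportE[OF assms] by blast
 have "\<phi> (x - y) = 0" if "norm y > r + norm x" for y
  by (rule r) (use that norm_triangle_ineq2[of y x] in \<open>simp add: norm_minus_commute\<close>)
 then show "\<exists>r. \<forall>y. norm y > r \<longrightarrow> \<phi> (x - y) = 0" by blast
qed

lemma pd_reflect:
 assumes "smooth \<phi>" shows "pd b (\<lambda>y. \<phi> (x - y)) y = - pd b \<phi> (x - y)"
proof -
 have "((\<lambda>y. \<phi> (x - y)) has_derivative (\<lambda>v. frechet_derivative \<phi> (at (x - y)) (- v))) (at y)"
  by (rule has_derivative_compose[of "\<lambda>y. x - y", OF _ smooth_has_derivative[OF assms]])
    (auto intro!: derivative_eq_intros)
 from pd_eq[OF this] show ?thesis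
  using linear_neg[OF linear_frechet_derivative[OF smooth_differentiable[OF assms]]]
  by (simp add: pd_def)
qed

lemma indicator_L2:
 assumes "S \<in> sets borel" "bounded S" shows "(indicator S :: 'a::euclidean_space \<Rightarrow> real) \<in> L2"
proof (rule L2I)
 have "(\<lambda>x. (norm (indicator S x :: real))\<^sup>2) = indicator S" by (auto simp: indicator_def)
 then show "integrable lborel (\<lambda>x. (norm (indicator S x :: real))\<^sup>2)"
  using assms emeasure_bounded_finite[of S] by simp
qed (use assms in simp)

lemma L2_set_integrable:
 fixes g :: "'a::euclidean_space \<Rightarrow> 'b::{banach,second_countable_topology}"
 assumes "g \<in> L2" shows "set_integrable lborel (cball 0 r) g"
 unfolding set_integrable_def
 by (rule L2_scaleR_integrable(1)[OF indicator_L2 assms]) auto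

lemma integrable_set_integrable:
 fixes g :: "'a::euclidean_space \<Rightarrow> 'b::{banach,second_countable_topology}"
 assumes "integrable lborel g" shows "set_integrable lborel (cball 0 r) g"
 unfolding set_integrable_def by (rule integrable_mult_indicator[OF _ assms]) simp

lemma test_lipschitz:
 assumes \<phi>: "test \<phi>"
 obtains M where "M > 0" "\<And>z v. \<bar>\<Sum>c\<in>Basis. (v \<bullet> c) * pd c \<phi> z\<bar> \<le> M * norm v"
  "\<And>z v. \<bar>\<phi> (z + v) - \<phi> z\<bar> \<le> M * norm v"
proof -
 have "\<forall>c\<in>Basis. \<exists>B>0. \<forall>x. \<bar>pd c \<phi> x\<bar> \<le> B" using test_bounded[OF test_pd[OF \<phi>]] by metis
 then obtain B where B: "\<And>c. c \<in> Basis \<Longrightarrow> B c > 0 \<and> (\<forall>x. \<bar>pd c \<phi> x\<bar> \<le> B c)" by metis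
 define M where "M = (\<Sum>c\<in>(Basis::'a set). B c)"
 have M: "M > 0" unfolding M_def using B by (intro sum_pos) auto
 have 1: "\<bar>\<Sum>c\<in>Basis. (v \<bullet> c) * pd c \<phi> z\<bar> \<le> M * norm v" for z v
 proof -
  have "\<bar>\<Sum>c\<in>Basis. (v \<bullet> c) * pd c \<phi> z\<bar> \<le> (\<Sum>c\<in>Basis. \<bar>(v \<bullet> c) * pd c \<phi> z\<bar>)" by (rule sum_abs)
  also have "\<dots> \<le> (\<Sum>c\<in>Basis. norm v * B c)"
   using B by (intro sum_mono) (auto simp: abs_mult Basis_le_norm intro!: mult_mono)
  finally show ?thesis by (simp add: M_def sum_distrib_left mult.commute)
 qed
 have 2: "\<bar>\<phi> (z + v) - \<phi> z\<bar> \<le> M * norm v" for z v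
 proof -
  obtain s where "\<phi> (z + 1 *\<^sub>R v) - \<phi> (z + 0 *\<^sub>R v) = (1 - 0) * pd v \<phi> (z + s *\<^sub>R v)"
   using MVT2[of 0 1 "\<lambda>t. \<phi> (z + t *\<^sub>R v)" "\<lambda>t. pd v \<phi> (z + t *\<^sub>R v)"]
    smooth_line_deriv[OF test_smooth[OF \<phi>]] by auto
  then have "\<phi> (z + v) - \<phi> z = (\<Sum>c\<in>Basis. (v \<bullet> c) * pd c \<phi> (z + s *\<^sub>R v))"
   by (simp add: pd_def[of v \<phi>] frechet_derivative_eq_sum_pd[OF smooth_differentiable[OF test_smooth[OF \<phi>]]])
  then show ?thesis using 1 by simp
 qed
 show thesis by (rule that[OF M 1 2])
qed

text \<open>Differentiation under the integral by dominated convergence along an arbitrary sequence.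
  Local integrability of \<open>g\<close> is the right generality: \<open>g\<close> will also be the
  Yukawa kernel, singular at the origin, with the test function as the smooth factor.\<close>

lemma cv_has_derivative:
 fixes g :: "'a::euclidean_space \<Rightarrow> real"
 assumes \<phi>: "test \<phi>" and g: "\<And>r. set_integrable lborel (cball 0 r) g"
  and gm [measurable]: "g \<in> borel_measurable borel"
 shows "(cv \<phi> g has_derivative (\<lambda>v. \<Sum>c\<in>Basis. (v \<bullet> c) * cv (pd c \<phi>) g x)) (at x)"
proof -
 obtain r where r: "r > 0" "\<And>x. norm x > r \<Longrightarrow> \<phi> x = 0" using test_supportE[OF \<phi>] by blast
 obtain M where M: "M > 0" "\<And>z v. \<bar>\<Sum>c\<in>Basis. (v \<bullet> c) * pd c \<phi> z\<bar> \<le> M * norm v"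
  "\<And>z v. \<bar>\<phi> (z + v) - \<phi> z\<bar> \<le> M * norm v" using test_lipschitz[OF \<phi>] by blast
 note sm = test_smooth[OF \<phi>]
 note [measurable] = smooth_measurable[OF sm] smooth_measurable[OF smooth_pd[OF sm]]
 have I: "integrable lborel (\<lambda>y. \<theta> (x - y) * g y)" if "test \<theta>" for \<theta> x
  using test_set_integrable[OF test_reflect[OF that] g gm] by simp
 have IS: "integrable lborel (\<lambda>y. (\<Sum>c\<in>Basis. (v \<bullet> c) * pd c \<phi> (x - y)) * g y)" for v x
  unfolding sum_distrib_right mult.assoc
  by (intro Bochner_Integration.integrable_sum integrable_mult_right I test_pd \<phi>)
 show ?thesis unfolding has_derivative_iff_norm
 proof
  show "bounded_linear (\<lambda>v. \<Sum>c\<in>Basis. (v \<bullet> c) * cv (pd c \<phi>) g x)"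
   by (intro bounded_linear_sum bounded_linear_mult_left bounded_linear_compose[OF bounded_linear_mult_left bounded_linear_inner_left])
  show "((\<lambda>y. norm (cv \<phi> g y - cv \<phi> g x - (\<Sum>c\<in>Basis. ((y - x) \<bullet> c) * cv (pd c \<phi>) g x)) / norm (y - x)) \<longlongrightarrow> 0) (at x)"
   unfolding tendsto_at_iff_sequentially o_def
  proof (intro allI impI)
   fix X :: "nat \<Rightarrow> 'a" assume X: "\<forall>i. X i \<in> UNIV - {x}" and lim: "X \<longlonglongrightarrow> x"
   obtain K where K: "\<And>i. norm (X i) \<le> K" using convergent_imp_Bseq[of X] lim
    by (auto simp: convergent_def Bseq_def)
   define R where "R = max K (norm x) + r"
   \<comment> \<open>The normalised first-order Taylor remainder of \<phi>. It is bounded by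
     \<open>2 * M\<close> and vanishes for |y| > \<open>R\<close>; its integral against
     \<open>g\<close> is the normalised remainder of the convolution.\<close>
   define E where "E i y = (\<phi> (X i - y) - \<phi> (x - y) - (\<Sum>c\<in>Basis. ((X i - x) \<bullet> c) * pd c \<phi> (x - y))) / norm (X i - x)" for i y
   have ne: "norm (X i - x) > 0" for i using X by auto
   have "(\<lambda>i. LBINT y. E i y * g y) \<longlonglongrightarrow> (LINT (y::'a)|lborel. 0)"
   proof (rule integral_dominated_convergence)
    show "integrable lborel (\<lambda>y. 2 * M * norm (indicator (cball 0 R) y *\<^sub>R g y))"
     by (intro integrable_mult_right integrable_norm g[unfolded set_integrable_def])
    show "AE y in lborel. (\<lambda>i. E i y * g y) \<longlonglongrightarrow> 0"
    proof (intro always_eventually allI tendsto_mult_left_zero)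
     fix y
     have "((\<lambda>z. norm (\<phi> z - \<phi> (x - y) - (\<Sum>c\<in>Basis. ((z - (x - y)) \<bullet> c) * pd c \<phi> (x - y))) / norm (z - (x - y))) \<longlongrightarrow> 0) (at (x - y))"
      using smooth_has_derivative[OF sm, of "x - y"]
       frechet_derivative_eq_sum_pd[OF smooth_differentiable[OF sm], of "x - y"]
      unfolding has_derivative_iff_norm by simp
     moreover have "(\<lambda>i. X i - y) \<longlonglongrightarrow> x - y" by (intro tendsto_intros lim)
     moreover have "\<forall>i. X i - y \<in> UNIV - {x - y}" using X by auto
     ultimately have "(\<lambda>i. norm (\<phi> (X i - y) - \<phi> (x - y) - (\<Sum>c\<in>Basis. ((X i - y - (x - y)) \<bullet> c) * pd c \<phi> (x - y))) / norm (X i - y - (x - y))) \<longlonglongrightarrow> 0"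
      unfolding tendsto_at_iff_sequentially o_def by (elim allE[of _ "\<lambda>i. X i - y"]) blast
     then have "(\<lambda>i. norm (E i y)) \<longlonglongrightarrow> 0" by (simp add: E_def)
     then show "(\<lambda>i. E i y) \<longlonglongrightarrow> 0" by (rule tendsto_norm_zero_cancel)
    qed
    show "AE y in lborel. norm (E i y * g y) \<le> 2 * M * norm (indicator (cball 0 R) y *\<^sub>R g y)" for i
    proof (intro always_eventually allI)
     fix y
     have "\<bar>\<phi> (X i - y) - \<phi> (x - y) - (\<Sum>c\<in>Basis. ((X i - x) \<bullet> c) * pd c \<phi> (x - y))\<bar> \<le> 2 * M * norm (X i - x)"
      using M(2)[of "X i - x" "x - y"] M(3)[of "x - y" "X i - x"] by simp
     then have "\<bar>E i y\<bar> \<le> 2 * M" using ne[of i] by (simp add: E_def divide_le_eq)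
     moreover have "E i y = 0" if "norm y > R"
     proof -
      have "norm (X i - y) > r" "norm (x - y) > r"
       using that K[of i] norm_triangle_ineq2[of y "X i"] norm_triangle_ineq2[of y x]
       by (auto simp: R_def norm_minus_commute)
      then show ?thesis using r(2) pd_eq_0_outside[of r \<phi>] by (simp add: E_def)
     qed
     ultimately show "norm (E i y * g y) \<le> 2 * M * norm (indicator (cball 0 R) y *\<^sub>R g y)"
      by (cases "norm y > R") (auto simp: abs_mult intro!: mult_right_mono)
    qed
   qed (simp, simp add: E_def)
   moreover have "(LBINT y. E i y * g y) =
     (cv \<phi> g (X i) - cv \<phi> g x - (\<Sum>c\<in>Basis. ((X i - x) \<bullet> c) * cv (pd c \<phi>) g x)) / norm (X i - x)" for i
   proof -
    have "(LBINT y. E i y * g y) = (LBINT y. (\<phi> (X i - y) * g y - \<phi> (x - y) * g y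
       - (\<Sum>c\<in>Basis. ((X i - x) \<bullet> c) * pd c \<phi> (x - y)) * g y) / norm (X i - x))"
     unfolding E_def by (simp add: left_diff_distrib)
    also have "\<dots> = (cv \<phi> g (X i) - cv \<phi> g x - (LBINT y. (\<Sum>c\<in>Basis. ((X i - x) \<bullet> c) * pd c \<phi> (x - y)) * g y)) / norm (X i - x)"
     using I[OF \<phi>] IS by (simp add: cv_def)
    also have "(LBINT y. (\<Sum>c\<in>Basis. ((X i - x) \<bullet> c) * pd c \<phi> (x - y)) * g y)
      = (\<Sum>c\<in>Basis. ((X i - x) \<bullet> c) * cv (pd c \<phi>) g x)"
     unfolding sum_distrib_right mult.assoc
     by (subst Bochner_Integration.integral_sum)
       (auto simp: cv_def intro!: integrable_mult_right I test_pd \<phi>)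
    finally show ?thesis .
   qed
   ultimately have "(\<lambda>i. (cv \<phi> g (X i) - cv \<phi> g x - (\<Sum>c\<in>Basis. ((X i - x) \<bullet> c) * cv (pd c \<phi>) g x)) / norm (X i - x)) \<longlonglongrightarrow> 0"
    by simp
   from tendsto_norm_zero[OF this]
   show "(\<lambda>i. norm (cv \<phi> g (X i) - cv \<phi> g x - (\<Sum>c\<in>Basis. ((X i - x) \<bullet> c) * cv (pd c \<phi>) g x)) / norm (X i - x)) \<longlonglongrightarrow> 0"
    by simp
  qed
 qed
qed

text \<open>The convolutions of \<open>g\<close> with all test functions form a class closed under
  partial derivatives, since these fall on the test function; smoothness then follows
  coinductively.\<close>

lemma
 fixes g :: "'a::euclidean_space \<Rightarrow> real"
 assumes \<phi>: "test \<phi>" and g: "\<And>r. set_integrable lborel (cball 0 r) g"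
  and gm: "g \<in> borel_measurable borel"
 shows cv_smooth: "smooth (cv \<phi> g)"
  and pd_cv: "b \<in> Basis \<Longrightarrow> pd b (cv \<phi> g) = cv (pd b \<phi>) g"
proof -
 have pd: "pd b (cv \<theta> g) = cv (pd b \<theta>) g" if "test \<theta>" "b \<in> Basis" for \<theta> b
 proof
  fix x
  have "(\<Sum>c\<in>Basis. (b \<bullet> c) * cv (pd c \<theta>) g x) = (\<Sum>c\<in>Basis. if c = b then cv (pd c \<theta>) g x else 0)"
   using that by (intro sum.cong) (auto simp: inner_Basis)
  then show "pd b (cv \<theta> g) x = cv (pd b \<theta>) g x"
   using pd_eq[OF cv_has_derivative[OF that(1) g gm], of b x] that by simp
 qed
 show "pd b (cv \<phi> g) = cv (pd b \<phi>) g" if "b \<in> Basis" using pd[OF \<phi> that] .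
 show "smooth (cv \<phi> g)"
 proof (rule smooth_coinduct[of _ "(\<lambda>\<phi>. cv \<phi> g) ` test_functions"])
  fix f assume "f \<in> (\<lambda>\<phi>. cv \<phi> g) ` test_functions"
  then obtain \<theta> where \<theta>: "test \<theta>" "f = cv \<theta> g" by auto
  then show "(\<forall>x. f differentiable at x) \<and> (\<forall>b\<in>Basis. pd b f \<in> (\<lambda>\<phi>. cv \<phi> g) ` test_functions)"
   using cv_has_derivative[OF \<theta>(1) g gm] pd test_pd unfolding differentiable_def by blast
 qed (use \<phi> in simp)
qed

lemma cv_commute:
 fixes k g :: "'a::euclidean_space \<Rightarrow> real"
 assumes [measurable]: "k \<in> borel_measurable borel" "g \<in> borel_measurable borel"
 shows "cv k g = cv g k"
proof
 fix x
 show "cv k g x = cv g k x"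
  unfolding cv_def using lborel_integral_reflect[of "\<lambda>y. k (x - y) * g y" x] by (simp add: mult.commute)
qed

lemma cv_measurable:
 fixes g :: "'a::euclidean_space \<Rightarrow> 'b::{banach,second_countable_topology}"
 assumes [measurable]: "k \<in> borel_measurable borel" "g \<in> borel_measurable borel"
 shows "cv k g \<in> borel_measurable borel"
proof -
 have "(\<lambda>x. LBINT y. k (x - y) *\<^sub>R g y) \<in> borel_measurable lborel"
  by (rule lborel.borel_measurable_lebesgue_integral) measurable
 then show ?thesis unfolding cv_def[abs_def] by simp
qed

text \<open>Cauchy--Schwarz with |k| = sqrt |k| sqrt |k|, then Tonelli. The assumption
  \<open>k \<in> L2\<close> makes the integral converge at every \<open>x\<close> rather than at
  almost every one, so \<open>cv k g\<close> comes without an exceptional set.\<close>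

lemma young:
 fixes g :: "'a::euclidean_space \<Rightarrow> 'b::{banach,second_countable_topology}"
 assumes kI: "integrable lborel k" and k2: "k \<in> L2" and g: "g \<in> L2"
 shows "integrable lborel (\<lambda>y. k (x - y) *\<^sub>R g y)"
  and "cv k g \<in> L2" "n2 (cv k g) \<le> (LBINT x. \<bar>k x\<bar>) * n2 g"
proof -
 show I: "integrable lborel (\<lambda>y. k (x - y) *\<^sub>R g y)" for x
  by (rule L2_scaleR_integrable[OF L2_reflect(1)[OF k2] g])
 note [measurable] = L2_measurable[OF k2] L2_measurable[OF g]
 define K where "K = (LBINT x. \<bar>k x\<bar>)"
 have K0: "K \<ge> 0" unfolding K_def by simp
 have K: "(\<integral>\<^sup>+y. ennreal \<bar>k (x - y)\<bar> \<partial>lborel) = ennreal K" for x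
  using lborel_nn_integral_reflect[of "\<lambda>y. ennreal \<bar>k y\<bar>" x] nn_integral_eq_integral[OF integrable_abs[OF kI]]
  by (simp add: K_def)
 have pw: "ennreal ((norm (cv k g x))\<^sup>2) \<le> ennreal K * (\<integral>\<^sup>+y. ennreal (\<bar>k (x - y)\<bar> * (norm (g y))\<^sup>2) \<partial>lborel)" for x
 proof -
  have "ennreal (norm (cv k g x)) \<le> (\<integral>\<^sup>+y. ennreal (norm (k (x - y) *\<^sub>R g y)) \<partial>lborel)"
   unfolding cv_def by (rule integral_norm_bound_ennreal[OF I])
  also have "\<dots> = (\<integral>\<^sup>+y. ennreal (sqrt \<bar>k (x - y)\<bar>) * ennreal (sqrt \<bar>k (x - y)\<bar> * norm (g y)) \<partial>lborel)"
   by (intro nn_integral_cong) (simp add: ennreal_mult[symmetric] mult.assoc[symmetric])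
  finally have "(ennreal (norm (cv k g x)))\<^sup>2 \<le> (\<integral>\<^sup>+y. ennreal (sqrt \<bar>k (x - y)\<bar>) * ennreal (sqrt \<bar>k (x - y)\<bar> * norm (g y)) \<partial>lborel)\<^sup>2"
   by (rule power_mono) simp
  also have "\<dots> \<le> (\<integral>\<^sup>+y. (ennreal (sqrt \<bar>k (x - y)\<bar>))\<^sup>2 \<partial>lborel) * (\<integral>\<^sup>+y. (ennreal (sqrt \<bar>k (x - y)\<bar> * norm (g y)))\<^sup>2 \<partial>lborel)"
   by (rule Cauchy_Schwarz_nn_integral) measurable
  also have "\<dots> = ennreal K * (\<integral>\<^sup>+y. ennreal (\<bar>k (x - y)\<bar> * (norm (g y))\<^sup>2) \<partial>lborel)"
   by (simp add: ennreal_power power_mult_distrib K)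
  finally show ?thesis by (simp add: ennreal_power)
 qed
 have "(\<integral>\<^sup>+x. ennreal ((norm (cv k g x))\<^sup>2) \<partial>lborel) \<le>
   (\<integral>\<^sup>+x. ennreal K * (\<integral>\<^sup>+y. ennreal (\<bar>k (x - y)\<bar> * (norm (g y))\<^sup>2) \<partial>lborel) \<partial>lborel)"
  by (intro nn_integral_mono pw)
 also have "\<dots> = ennreal K * (\<integral>\<^sup>+x. (\<integral>\<^sup>+y. ennreal (\<bar>k (x - y)\<bar> * (norm (g y))\<^sup>2) \<partial>lborel) \<partial>lborel)"
  by (intro nn_integral_cmult) measurable
 also have "(\<integral>\<^sup>+x. (\<integral>\<^sup>+y. ennreal (\<bar>k (x - y)\<bar> * (norm (g y))\<^sup>2) \<partial>lborel) \<partial>lborel) =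
   (\<integral>\<^sup>+y. (\<integral>\<^sup>+x. ennreal (\<bar>k (x - y)\<bar> * (norm (g y))\<^sup>2) \<partial>lborel) \<partial>lborel)"
  by (rule lborel_pair.Fubini') measurable
 also have "\<dots> = (\<integral>\<^sup>+y. ennreal K * ennreal ((norm (g y))\<^sup>2) \<partial>lborel)"
 proof (intro nn_integral_cong)
  fix y
  have "(\<integral>\<^sup>+x. ennreal (\<bar>k (x - y)\<bar> * (norm (g y))\<^sup>2) \<partial>lborel) = (\<integral>\<^sup>+x. ennreal \<bar>k (x - y)\<bar> \<partial>lborel) * ennreal ((norm (g y))\<^sup>2)"
   by (simp add: ennreal_mult nn_integral_multc)
  also have "(\<integral>\<^sup>+x. ennreal \<bar>k (x - y)\<bar> \<partial>lborel) = ennreal K"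
   using lborel_nn_integral_affine[of "\<lambda>x. ennreal \<bar>k x\<bar>" 1 "- y"] K[of 0]
    lborel_nn_integral_reflect[of "\<lambda>x. ennreal \<bar>k x\<bar>" 0] by simp
  finally show "(\<integral>\<^sup>+x. ennreal (\<bar>k (x - y)\<bar> * (norm (g y))\<^sup>2) \<partial>lborel) = ennreal K * ennreal ((norm (g y))\<^sup>2)" .
 qed
 also have "\<dots> = ennreal K * ennreal ((n2 g)\<^sup>2)"
  by (simp add: nn_integral_cmult nn_integral_L2[OF g])
 also have "ennreal K * (ennreal K * ennreal ((n2 g)\<^sup>2)) = ennreal ((K * n2 g)\<^sup>2)"
  using K0 by (simp add: ennreal_mult[symmetric] power2_eq_square mult_ac)
 finally have le: "(\<integral>\<^sup>+x. ennreal ((norm (cv k g x))\<^sup>2) \<partial>lborel) \<le> ennreal ((K * n2 g)\<^sup>2)" .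
 have "cv k g \<in> borel_measurable borel" by (rule cv_measurable) measurable
 from L2_nnI[OF this le] K0 show "cv k g \<in> L2" "n2 (cv k g) \<le> (LBINT x. \<bar>k x\<bar>) * n2 g"
  by (auto simp: K_def)
qed

lemma cv_add:
 fixes f g :: "'a::euclidean_space \<Rightarrow> 'b::{banach,second_countable_topology}"
 assumes "integrable lborel k" "k \<in> L2" "f \<in> L2" "g \<in> L2"
 shows "cv k (\<lambda>x. f x + g x) x = cv k f x + cv k g x"
 using young(1)[OF assms(1,2,3), of x] young(1)[OF assms(1,2,4), of x]
 by (simp add: cv_def scaleR_add_right)

lemma cv_cmult: "cv k (\<lambda>x. c *\<^sub>R g x) x = c *\<^sub>R cv k g x"
 unfolding cv_def by (subst integral_scaleR_right[symmetric]) (simp add: mult.commute)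

lemma cv_diff:
 fixes f g :: "'a::euclidean_space \<Rightarrow> 'b::{banach,second_countable_topology}"
 assumes "integrable lborel k" "k \<in> L2" "f \<in> L2" "g \<in> L2"
 shows "cv k (\<lambda>x. f x - g x) x = cv k f x - cv k g x"
 using young(1)[OF assms(1,2,3), of x] young(1)[OF assms(1,2,4), of x]
 by (simp add: cv_def scaleR_diff_right)

lemma cv_cong_AE:
 assumes "AE x in lborel. f x = g x" "f \<in> borel_measurable borel" "g \<in> borel_measurable borel" "k \<in> borel_measurable borel"
 shows "cv k f x = cv k g x"
 unfolding cv_def
proof (rule integral_cong_AE)
 note [measurable] = assms(2-4)
 show "(\<lambda>y. k (x - y) *\<^sub>R f y) \<in> borel_measurable lborel" "(\<lambda>y. k (x - y) *\<^sub>R g y) \<in> borel_measurable lborel"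
  by measurable
 show "AE y in lborel. k (x - y) *\<^sub>R f y = k (x - y) *\<^sub>R g y"
  using assms(1) by eventually_elim simp
qed

text \<open>Fubini's theorem for an even kernel; absolute integrability of the double integral is
  Young's inequality for |k| and |g|.\<close>

lemma cv_adjoint:
 fixes g :: "'a::euclidean_space \<Rightarrow> 'b::{banach,second_countable_topology}"
 assumes kI: "integrable lborel k" and k2: "k \<in> L2" and even: "\<And>x. k (- x) = k x"
  and f: "f \<in> L2" and g: "g \<in> L2"
 shows "(LBINT x. f x *\<^sub>R cv k g x) = (LBINT y. cv k f y *\<^sub>R g y)"
proof -
 note [measurable] = L2_measurable[OF k2] L2_measurable[OF f] L2_measurable[OF g]
 define h where "h = (\<lambda>(x, y). f x *\<^sub>R k (x - y) *\<^sub>R g y)"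
 have ak: "integrable lborel (\<lambda>x. \<bar>k x\<bar>)" "(\<lambda>x. \<bar>k x\<bar>) \<in> L2"
  using kI L2_norm_fun(1)[OF k2] by auto
 note y = young[OF ak L2_norm_fun(1)[OF g]]
 have "integrable (lborel \<Otimes>\<^sub>M lborel) h"
 proof (rule lborel_pair.Fubini_integrable)
  show "h \<in> borel_measurable (lborel \<Otimes>\<^sub>M lborel)" unfolding h_def by measurable
  have "(LBINT y. norm (h (x, y))) = \<bar>f x\<bar> * cv (\<lambda>x. \<bar>k x\<bar>) (\<lambda>y. norm (g y)) x" for x
   by (simp add: h_def cv_def abs_mult mult.assoc)
  then show "integrable lborel (\<lambda>x. LBINT y. norm (h (x, y)))"
   using L2_prod_integrable(1)[OF L2_norm_fun(1)[OF f] y(2)] by simp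
  show "AE x in lborel. integrable lborel (\<lambda>y. h (x, y))"
   unfolding h_def prod.case
   by (intro always_eventually allI integrable_scaleR_right young(1)[OF kI k2 g])
 qed
 from lborel_pair.Fubini_integral[of "\<lambda>x y. h (x, y)"] this
 have "(LBINT y. (LBINT x. h (x, y))) = (LBINT x. (LBINT y. h (x, y)))" by simp
 moreover have "(LBINT x. h (x, y)) = cv k f y *\<^sub>R g y" for y
 proof -
  have "(LBINT x. h (x, y)) = (LBINT x. (k (y - x) * f x) *\<^sub>R g y)"
   using even[of "_ - _"] by (simp add: h_def mult.commute)
  also have "\<dots> = cv k f y *\<^sub>R g y"
   using young(1)[OF kI k2 f, of y] by (simp add: cv_def)
  finally show ?thesis .
 qed
 moreover have "(LBINT y. h (x, y)) = f x *\<^sub>R cv k g x" for x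
  unfolding h_def prod.case cv_def by (rule integral_scaleR_right)
 ultimately show ?thesis by simp
qed

section \<open>Mollifiers and density of test functions\<close>

lemma mollifier_ex:
 "\<exists>\<eta>::nat \<Rightarrow> 'a::euclidean_space \<Rightarrow> real. \<forall>n. \<eta> n \<in> test_functions \<and> (\<forall>x. 0 \<le> \<eta> n x) \<and>
   (\<forall>x. norm x > inverse (real (Suc n)) \<longrightarrow> \<eta> n x = 0) \<and> (LBINT x. \<eta> n x) = 1 \<and> (\<forall>x. \<eta> n (- x) = \<eta> n x)"
proof -
 \<comment> \<open>\<open>e\<close> is 1 for |x| \<le> 1/2 and 0 for |x| \<ge> 1; using the square
   of the norm keeps it smooth at the origin.\<close>
 define e where "e x = cutoff (2 * (norm x)\<^sup>2)" for x :: 'a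
 have e0: "e x = 0" if "norm x \<ge> 1" for x
  using power_mono[OF that, of 2] by (simp add: e_def cutoff)
 have sm: "smooth e"
  unfolding e_def by (rule smooth_compose1[OF _ smooth_imp_smooth1[OF cutoff(1)]])
   (auto intro!: smooth_mult smooth_const smooth_norm2)
 have et: "test e" using sm e0 by (auto simp: test_functions_iff intro!: exI[of _ 1])
 define c where "c = (LBINT x. e x)"
 have "0 < measure lborel (cball (0::'a) (1/2))" by (rule content_cball_pos) simp
 also have "\<dots> = (LBINT x. indicator (cball (0::'a) (1/2)) x)" by simp
 also have "\<dots> \<le> c" unfolding c_def
 proof (rule integral_mono[OF _ test_integrable[OF et]])
  show "integrable lborel (indicator (cball (0::'a) (1/2)) :: 'a \<Rightarrow> real)"
   using emeasure_bounded_finite[OF bounded_cball[of "0::'a" "1/2"]] by simp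
  show "indicator (cball 0 (1/2)) x \<le> e x" for x
  proof (cases "norm x \<le> 1/2")
   case True
   then have "(norm x)\<^sup>2 \<le> (1/2)\<^sup>2" by (intro power_mono) auto
   then have "e x = 1" by (simp add: e_def cutoff power2_eq_square)
   then show ?thesis by (simp add: indicator_def)
  qed (simp add: e_def cutoff)
 qed
 finally have c: "c > 0" .
 define \<eta> where "\<eta> n x = (real (Suc n) ^ DIM('a) / c) * e (real (Suc n) *\<^sub>R x)" for n x
 have "test (\<eta> n) \<and> (\<forall>x. 0 \<le> \<eta> n x) \<and>
   (\<forall>x. norm x > inverse (real (Suc n)) \<longrightarrow> \<eta> n x = 0) \<and> (LBINT x. \<eta> n x) = 1 \<and> (\<forall>x. \<eta> n (- x) = \<eta> n x)" for n
 proof (intro conjI)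
  have out: "\<eta> n x = 0" if "norm x > inverse (real (Suc n))" for x
   using that by (simp add: \<eta>_def e0 field_simps del: of_nat_Suc)
  show "\<forall>x. norm x > inverse (real (Suc n)) \<longrightarrow> \<eta> n x = 0" using out by blast
  have "smooth (\<lambda>x. e (real (Suc n) *\<^sub>R x))"
   by (rule smooth_affine[OF sm, of _ "\<lambda>v. real (Suc n) *\<^sub>R v"]) (auto intro!: derivative_eq_intros simp del: of_nat_Suc)
  then have "smooth (\<eta> n)" unfolding \<eta>_def by (intro smooth_mult smooth_const)
  then show "test (\<eta> n)" using out by (auto simp: test_functions_iff)
  show "\<forall>x. 0 \<le> \<eta> n x" using c by (simp add: \<eta>_def e_def cutoff)
  show "(LBINT x. \<eta> n x) = 1"
  proof -
   have "(LBINT x. \<eta> n x) = (real (Suc n) ^ DIM('a) * (LBINT x. e (real (Suc n) *\<^sub>R x))) / c"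
    by (simp add: \<eta>_def del: of_nat_Suc)
   also have "real (Suc n) ^ DIM('a) * (LBINT x. e (real (Suc n) *\<^sub>R x)) = c"
    using lborel_integral_affine[of e "real (Suc n)" 0] smooth_measurable[OF sm]
    by (simp add: c_def del: of_nat_Suc)
   finally show ?thesis using c by simp
  qed
  show "\<forall>x. \<eta> n (- x) = \<eta> n x" by (simp add: \<eta>_def e_def)
 qed
 then show ?thesis by blast
qed

definition moll :: "nat \<Rightarrow> 'a::euclidean_space \<Rightarrow> real" where
 "moll = (SOME \<eta>. \<forall>n. \<eta> n \<in> test_functions \<and> (\<forall>x. 0 \<le> \<eta> n x) \<and>
   (\<forall>x. norm x > inverse (real (Suc n)) \<longrightarrow> \<eta> n x = 0) \<and> (LBINT x. \<eta> n x) = 1 \<and> (\<forall>x. \<eta> n (- x) = \<eta> n x))"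

lemma
 moll_test: "test (moll n)" and moll_nonneg: "0 \<le> moll n x"
 and moll_outside: "norm x > inverse (real (Suc n)) \<Longrightarrow> moll n x = 0"
 and moll_integral: "(LBINT x. moll n x) = 1" and moll_even: "moll n (- x) = moll n x"
 using someI_ex[OF mollifier_ex, folded moll_def] by blast+

lemma moll_young:
 fixes g :: "'a::euclidean_space \<Rightarrow> 'b::{banach,second_countable_topology}"
 assumes "g \<in> L2" shows "cv (moll n) g \<in> L2" "n2 (cv (moll n) g) \<le> n2 g"
proof -
 note y = young[OF test_integrable[OF moll_test] test_L2[OF moll_test] assms, of n]
 show "cv (moll n) g \<in> L2" by (rule y(2))
 have "(LBINT x. \<bar>moll n (x::'a)\<bar>) = 1" by (simp add: moll_integral moll_nonneg)
 then show "n2 (cv (moll n) g) \<le> n2 g" using y(3) by simp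
qed

lemma moll_nonneg_cv: "(\<And>x. 0 \<le> g x) \<Longrightarrow> 0 \<le> cv (moll n) g x" for g :: "'a::euclidean_space \<Rightarrow> real"
 unfolding cv_def by (intro Bochner_Integration.integral_nonneg) (simp add: moll_nonneg)

text \<open>A weighted mean of values within \<open>B\<close> of \<open>a\<close> stays within
  \<open>B\<close> of \<open>a\<close>. It is used with \<open>a = g x\<close> for uniform
  approximation and with \<open>a = 0\<close> to carry decay over to a mollified function.\<close>

lemma moll_bound:
 fixes g :: "'a::euclidean_space \<Rightarrow> real"
 assumes gm [measurable]: "g \<in> borel_measurable borel"
  and g: "\<And>y. norm (x - y) \<le> inverse (real (Suc n)) \<Longrightarrow> \<bar>g y - a\<bar> \<le> B" and "B \<ge> 0"
  and I: "integrable lborel (\<lambda>y. moll n (x - y) * g y)"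
 shows "\<bar>cv (moll n) g x - a\<bar> \<le> B"
proof -
 have J: "integrable lborel (\<lambda>y. moll n (x - y))" "(LBINT y. moll n (x - y)) = 1"
  by (rule lborel_integrable_reflect[OF test_integrable[OF moll_test]])
    (simp add: lborel_integral_reflect[OF test_measurable[OF moll_test]] moll_integral)
 have "cv (moll n) g x - a = (LBINT y. moll n (x - y) * (g y - a))"
  using I J by (simp add: cv_def right_diff_distrib)
 also have "norm \<dots> \<le> (LBINT y. moll n (x - y) * B)"
 proof (rule Bochner_Integration.integral_norm_bound_integral)
  show "norm (moll n (x - y) * (g y - a)) \<le> moll n (x - y) * B" for y
   using g[of y] moll_nonneg[of n "x - y"] moll_outside[of n "x - y"]
   by (cases "norm (x - y) \<le> inverse (real (Suc n))") (auto simp: abs_mult intro!: mult_left_mono)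
 qed (use I J in \<open>auto simp: right_diff_distrib\<close>)
 also have "\<dots> = B" using J by simp
 finally show ?thesis by simp
qed

lemma cv_moll_test:
 assumes g: "\<And>r. set_integrable lborel (cball 0 r) g" and gm: "g \<in> borel_measurable borel"
  and out: "\<And>x. norm x > r \<Longrightarrow> g x = (0::real)"
 shows "test (cv (moll n) g)"
 unfolding test_functions_iff
proof (intro conjI exI[of _ "r + 1"] allI impI)
 show "smooth (cv (moll n) g)" by (rule cv_smooth[OF moll_test g gm])
 fix x :: 'a assume x: "norm x > r + 1"
 have "moll n (x - y) * g y = 0" for y
 proof (cases "norm y > r")
  case False
  then have "norm (x - y) > 1" using x norm_triangle_ineq2[of x y] by linarith
  moreover have "inverse (real (Suc n)) \<le> 1" by (simp add: inverse_eq_divide)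
  ultimately have "moll n (x - y) = 0" by (intro moll_outside) linarith
  then show ?thesis by simp
 qed (simp add: out)
 then have "(\<lambda>y. moll n (x - y) *\<^sub>R g y) = (\<lambda>_. 0)" by auto
 then show "cv (moll n) g x = 0" by (simp add: cv_def)
qed

lemma L2_dominated_convergence:
 fixes f :: "nat \<Rightarrow> 'a::euclidean_space \<Rightarrow> real"
 assumes fm: "\<And>n. f n \<in> borel_measurable borel" and gm: "g \<in> borel_measurable borel" and w: "w \<in> L2"
  and lim: "AE x in lborel. (\<lambda>n. f n x) \<longlonglongrightarrow> g x" and le: "\<And>n x. \<bar>f n x\<bar> \<le> w x"
 shows "\<And>n. f n \<in> L2" "g \<in> L2" "(\<lambda>n. n2 (\<lambda>x. f n x - g x)) \<longlonglongrightarrow> 0"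
proof -
 note [measurable] = fm gm L2_measurable[OF w]
 have le': "\<bar>f n x\<bar> \<le> norm (w x)" for n x using le[of n x] by simp
 show f: "f n \<in> L2" for n by (rule L2_mono[OF fm w]) (use le' in simp)
 have gle: "AE x in lborel. norm (g x) \<le> norm (w x)"
  using lim
 proof eventually_elim
  case (elim x)
  show ?case by (rule LIMSEQ_le_const2[OF tendsto_norm[OF elim]]) (use le' in auto)
 qed
 show g: "g \<in> L2" by (rule L2_mono_AE[OF gm w gle])
 have "(\<lambda>n. LBINT x. (norm (f n x - g x))\<^sup>2) \<longlonglongrightarrow> (LINT (x::'a)|lborel. 0)"
 proof (rule integral_dominated_convergence)
  show "integrable lborel (\<lambda>x. 4 * (norm (w x))\<^sup>2)" by (intro integrable_mult_right L2_integrable w)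
  show "AE x in lborel. (\<lambda>n. (norm (f n x - g x))\<^sup>2) \<longlonglongrightarrow> 0"
   using lim
  proof eventually_elim
   case (elim x)
   have "(\<lambda>n. (norm (f n x - g x))\<^sup>2) \<longlonglongrightarrow> (norm (g x - g x))\<^sup>2" by (intro tendsto_intros elim)
   then show ?case by simp
  qed
  show "AE x in lborel. norm ((norm (f n x - g x))\<^sup>2) \<le> 4 * (norm (w x))\<^sup>2" for n
   using gle
  proof eventually_elim
   case (elim x)
   have "norm (f n x - g x) \<le> 2 * norm (w x)" using elim le'[of n x] by simp
   then have "(norm (f n x - g x))\<^sup>2 \<le> (2 * norm (w x))\<^sup>2" by (intro power_mono) auto
   then show ?case by (simp add: power_mult_distrib)
  qed
 qed auto
 from tendsto_real_sqrt[OF this] show "(\<lambda>n. n2 (\<lambda>x. f n x - g x)) \<longlonglongrightarrow> 0" by (simp add: n2_def)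
qed

lemma moll_tendsto_continuous:
 fixes g :: "'a::euclidean_space \<Rightarrow> real"
 assumes g: "continuous_on UNIV g" and out: "\<And>x. norm x > r \<Longrightarrow> g x = 0"
 shows "g \<in> L2" "(\<lambda>n. n2 (\<lambda>x. cv (moll n) g x - g x)) \<longlonglongrightarrow> 0"
proof -
 have gm [measurable]: "g \<in> borel_measurable borel" using g by (rule borel_measurable_continuous_onI)
 have "bounded (g ` cball 0 r)"
  by (intro compact_imp_bounded compact_continuous_image continuous_on_subset[OF g]) auto
 then obtain B where B: "\<And>x. x \<in> cball 0 r \<Longrightarrow> \<bar>g x\<bar> \<le> B" unfolding bounded_iff by fastforce
 have iL: "(indicator (cball (0::'a) s) :: 'a \<Rightarrow> real) \<in> L2" for s
  by (rule indicator_L2) auto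
 have le: "norm (g x) \<le> norm (B *\<^sub>R (indicator (cball 0 r) x :: real))" for x
  using B[of x] out[of x] by (cases "norm x > r") (auto simp: indicator_def)
 show gL: "g \<in> L2" by (rule L2_mono(1)[OF gm L2_scaleR_const(1)[OF iL] le])
 define i where "i = (indicator (cball (0::'a) (r + 1)) :: 'a \<Rightarrow> real)"
 show "(\<lambda>n. n2 (\<lambda>x. cv (moll n) g x - g x)) \<longlonglongrightarrow> 0"
 proof (rule LIMSEQ_I)
  fix e :: real assume "e > 0"
  \<comment> \<open>A uniform error \<open>e'\<close> on the ball of radius \<open>r + 1\<close> has
    norm \<open>e' * n2 i\<close>, which this choice keeps at most \<open>e / 2\<close>.\<close>
  define e' where "e' = e / (2 * (1 + n2 i))"
  have "e' > 0" using \<open>e > 0\<close> by (simp add: e'_def add_pos_nonneg)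
  have "uniformly_continuous_on (cball 0 (r + 2)) g"
   by (intro compact_uniformly_continuous continuous_on_subset[OF g]) auto
  then obtain d where d: "d > 0" "\<And>x y. x \<in> cball 0 (r + 2) \<Longrightarrow> y \<in> cball 0 (r + 2) \<Longrightarrow> dist y x < d \<Longrightarrow> dist (g y) (g x) < e'"
   using \<open>e' > 0\<close> unfolding uniformly_continuous_on_def by metis
  obtain N where N: "inverse (real (Suc N)) < d" using reals_Archimedean[OF \<open>d > 0\<close>] by blast
  have "n2 (\<lambda>x. cv (moll n) g x - g x) < e" if "n \<ge> N" for n
  proof -
   have dn: "inverse (real (Suc n)) < d"
    using N that by (meson le_less_trans of_nat_mono Suc_le_mono le_imp_inverse_le of_nat_0_less_iff zero_less_Suc)
   have n1: "inverse (real (Suc n)) \<le> 1" by (simp add: inverse_eq_divide)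
   have t: "test (cv (moll n) g)"
    by (rule cv_moll_test[OF L2_set_integrable[OF gL] gm out])
   have b: "\<bar>cv (moll n) g x - g x\<bar> \<le> norm (e' *\<^sub>R i x)" for x
   proof (cases "norm x > r + 1")
    case True
    have "\<bar>cv (moll n) g x - g x\<bar> \<le> 0"
    proof (rule moll_bound[OF gm])
     fix y assume "norm (x - y) \<le> inverse (real (Suc n))"
     then have "norm y > r" using True n1 norm_triangle_ineq2[of x y] by linarith
     then show "\<bar>g y - g x\<bar> \<le> 0" using out[of x] out[of y] True by simp
    qed (use young(1)[OF test_integrable[OF moll_test] test_L2[OF moll_test] gL] in auto)
    then show ?thesis by simp
   next
    case False
    have "\<bar>cv (moll n) g x - g x\<bar> \<le> e'"
    proof (rule moll_bound[OF gm])
     fix y assume y: "norm (x - y) \<le> inverse (real (Suc n))"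
     then have "norm y \<le> r + 2" using False n1 norm_triangle_ineq2[of y x] by (simp add: norm_minus_commute)
     then have "dist (g y) (g x) < e'"
      using y dn False by (intro d) (auto simp: dist_norm norm_minus_commute)
     then show "\<bar>g y - g x\<bar> \<le> e'" by (simp add: dist_real_def)
    qed (use young(1)[OF test_integrable[OF moll_test] test_L2[OF moll_test] gL] \<open>e' > 0\<close> in auto)
    then show ?thesis using False \<open>e' > 0\<close> by (simp add: i_def)
   qed
   have iL': "i \<in> L2" unfolding i_def by (rule iL)
   have "n2 (\<lambda>x. cv (moll n) g x - g x) \<le> n2 (\<lambda>x. e' *\<^sub>R i x)"
    using b test_measurable[OF t]
    by (intro L2_mono(2)[OF _ L2_scaleR_const(1)[OF iL']]) auto
   also have "\<dots> = e' * n2 i" using L2_scaleR_const(2)[OF iL', of e'] \<open>e' > 0\<close> by simp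
   also have "\<dots> < e"
   proof -
    have "e' * n2 i \<le> e' * (1 + n2 i)" using \<open>e' > 0\<close> by simp
    also have "\<dots> = e / 2" using n2_nonneg[of i] by (simp add: e'_def field_simps add_nonneg_eq_0_iff)
    finally show ?thesis using \<open>e > 0\<close> by simp
   qed
   finally show ?thesis .
  qed
  then show "\<exists>no. \<forall>n\<ge>no. norm (n2 (\<lambda>x. cv (moll n) g x - g x) - 0) < e" by auto
 qed
qed

text \<open>Truncation in value and a cutoff in space cost less than \<open>e / 2\<close>. A
  measurable function is an almost everywhere limit of continuous ones, which need not be
  controlled; applying the same truncation and cutoff to them makes them compactly supported and
  dominated.\<close>

lemma continuous_dense_L2:
 fixes g :: "'a::euclidean_space \<Rightarrow> real"
 assumes g: "g \<in> L2" and "e > 0"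
 obtains c r where "continuous_on UNIV c" "\<And>x. norm x > r \<Longrightarrow> c x = 0" "n2 (\<lambda>x. c x - g x) < e"
proof -
 note [measurable] = L2_measurable[OF g]
 define cl where "cl m t = max (- real m) (min (real m) t)" for m and t :: real
 define X where "X m = (chi (real (Suc m)) :: 'a \<Rightarrow> real)" for m
 have X: "test (X m)" for m unfolding X_def by (rule chi_test) simp
 note [measurable] = test_measurable[OF X]
 have clle: "\<bar>cl m t\<bar> \<le> \<bar>t\<bar>" "\<bar>cl m t\<bar> \<le> real m" for m t by (auto simp: cl_def)
 have Xb: "0 \<le> X m x" "X m x \<le> 1" for m x by (auto simp: X_def)
 have "(\<lambda>m. n2 (\<lambda>x. cl m (g x) * X m x - g x)) \<longlonglongrightarrow> 0"
 proof (rule L2_dominated_convergence(3))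
  show "(\<lambda>x. \<bar>g x\<bar>) \<in> L2" using L2_norm_fun(1)[OF g] by simp
  show "AE x in lborel. (\<lambda>m. cl m (g x) * X m x) \<longlonglongrightarrow> g x"
  proof (intro always_eventually allI)
   fix x
   have "\<forall>\<^sub>F m in sequentially. cl m (g x) = g x"
    using eventually_ge_at_top[of "nat \<lceil>\<bar>g x\<bar>\<rceil>"]
   proof eventually_elim
    case (elim m)
    then have "\<bar>g x\<bar> \<le> real m" by linarith
    then show ?case by (auto simp: cl_def)
   qed
   then have "(\<lambda>m. cl m (g x)) \<longlonglongrightarrow> g x" by (rule tendsto_eventually)
   from tendsto_mult[OF this chi_tendsto[of x]] show "(\<lambda>m. cl m (g x) * X m x) \<longlonglongrightarrow> g x"
    by (simp add: X_def del: of_nat_Suc)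
  qed
  show "\<bar>cl m (g x) * X m x\<bar> \<le> \<bar>g x\<bar>" for m x
   using mult_mono[OF clle(1)[of m "g x"] Xb(2)[of m x]] Xb(1)[of m x] by (simp add: abs_mult)
 qed (auto simp: cl_def)
 then obtain m where m: "n2 (\<lambda>x. cl m (g x) * X m x - g x) < e / 2"
  using LIMSEQ_D[of _ 0 "e / 2"] \<open>e > 0\<close> by fastforce
 have "g measurable_on UNIV"
  using measurable_lborel1 by (intro lebesgue_measurable_imp_measurable_on_real) (auto intro: measurable_completion)
 then obtain N h where N: "negligible N" and h: "\<And>n. continuous_on UNIV (h n)" "\<And>x. x \<notin> N \<Longrightarrow> (\<lambda>n. h n x) \<longlonglongrightarrow> g x"
  unfolding measurable_on_def by auto
 note [measurable] = borel_measurable_continuous_onI[OF h(1)]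
 define c where "c n x = cl m (h n x) * X m x" for n x
 have mX: "(\<lambda>x. real m *\<^sub>R X m x) \<in> L2" by (intro L2_scaleR_const test_L2 X)
 have AEh: "AE x in lborel. (\<lambda>n. h n x) \<longlonglongrightarrow> g x"
 proof -
  have "AE x in lebesgue. x \<notin> N" using N by (simp add: negligible_iff_null_sets AE_not_in)
  then have "AE x in lebesgue. (\<lambda>n. h n x) \<longlonglongrightarrow> g x" by eventually_elim (rule h)
  then show ?thesis by (subst (asm) AE_completion_iff) auto
 qed
 have cg: "(\<lambda>n. n2 (\<lambda>x. c n x - cl m (g x) * X m x)) \<longlonglongrightarrow> 0" and cL: "\<And>n. c n \<in> L2" and gL: "(\<lambda>x. cl m (g x) * X m x) \<in> L2"
 proof -
  have *: "AE x in lborel. (\<lambda>n. c n x) \<longlonglongrightarrow> cl m (g x) * X m x"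
   using AEh by eventually_elim (auto simp: c_def cl_def intro!: tendsto_intros)
  have **: "\<bar>c n x\<bar> \<le> real m *\<^sub>R X m x" for n x
   using mult_right_mono[OF clle(2) Xb(1)] Xb(1) by (simp add: c_def abs_mult)
  note D = L2_dominated_convergence[OF _ _ mX * **]
  show "(\<lambda>n. n2 (\<lambda>x. c n x - cl m (g x) * X m x)) \<longlonglongrightarrow> 0" by (rule D(3)) (auto simp: c_def cl_def)
  show "c n \<in> L2" for n by (rule D(1)) (auto simp: c_def cl_def)
  show "(\<lambda>x. cl m (g x) * X m x) \<in> L2" by (rule D(2)) (auto simp: c_def cl_def)
 qed
 then obtain n where n: "n2 (\<lambda>x. c n x - cl m (g x) * X m x) < e / 2"
  using LIMSEQ_D[of _ 0 "e / 2"] \<open>e > 0\<close> by fastforce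
 obtain r where r: "\<And>x. norm x > r \<Longrightarrow> X m x = 0" using test_supportE[OF X] by blast
 show thesis
 proof
  show "continuous_on UNIV (c n)"
   unfolding c_def cl_def by (intro continuous_intros h smooth_continuous test_smooth X)
  show "c n x = 0" if "norm x > r" for x using r[OF that] by (simp add: c_def)
  show "n2 (\<lambda>x. c n x - g x) < e"
   using n2_triangle[OF cL[of n] gL g] n m by linarith
 qed
qed

lemma test_dense_L2:
 fixes g :: "'a::euclidean_space \<Rightarrow> real"
 assumes g: "g \<in> L2" and "e > 0"
 obtains \<phi> where "test \<phi>" "n2 (\<lambda>x. \<phi> x - g x) < e"
proof -
 obtain c r where c: "continuous_on UNIV c" "\<And>x. norm x > r \<Longrightarrow> c x = 0" "n2 (\<lambda>x. c x - g x) < e / 2"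
  using continuous_dense_L2[OF g, of "e / 2"] \<open>e > 0\<close> by auto
 note m = moll_tendsto_continuous[where r=r, OF c(1) c(2)]
 obtain n where n: "n2 (\<lambda>x. cv (moll n) c x - c x) < e / 2"
  using LIMSEQ_D[OF m(2), of "e / 2"] \<open>e > 0\<close> by fastforce
 have t: "test (cv (moll n) c)"
  by (rule cv_moll_test[OF L2_set_integrable[OF m(1)] L2_measurable[OF m(1)] c(2)])
 show thesis
  by (rule that[OF t]) (use n2_triangle[OF test_L2[OF t] m(1) g] n c(3) in linarith)
qed

lemma test_seq_L2:
 fixes g :: "'a::euclidean_space \<Rightarrow> real"
 assumes g: "g \<in> L2"
 obtains \<phi> where "\<And>n. test (\<phi> n)" "(\<lambda>n. n2 (\<lambda>x. \<phi> n x - g x)) \<longlonglongrightarrow> 0"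
proof -
 have "\<exists>\<phi>. \<phi> \<in> test_functions \<and> n2 (\<lambda>x. \<phi> x - g x) < inverse (real (Suc n))" for n
  using test_dense_L2[OF g, of "inverse (real (Suc n))"] by auto
 then obtain \<phi> where \<phi>: "\<And>n. test (\<phi> n)" "\<And>n. n2 (\<lambda>x. \<phi> n x - g x) < inverse (real (Suc n))" by metis
 have "(\<lambda>n. n2 (\<lambda>x. \<phi> n x - g x)) \<longlonglongrightarrow> 0"
  by (rule Lim_null_comparison[OF always_eventually LIMSEQ_inverse_real_of_nat])
    (use \<phi>(2) in \<open>auto intro: less_imp_le simp del: of_nat_Suc\<close>)
 then show thesis using that \<phi>(1) by blast
qed

lemma moll_tendsto:
 fixes g :: "'a::euclidean_space \<Rightarrow> real"
 assumes g: "g \<in> L2"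
 shows "(\<lambda>n. n2 (\<lambda>x. cv (moll n) g x - g x)) \<longlonglongrightarrow> 0"
proof (rule LIMSEQ_I)
 fix e :: real assume "e > 0"
 obtain \<phi> where \<phi>: "test \<phi>" "n2 (\<lambda>x. \<phi> x - g x) < e / 3"
  using test_dense_L2[OF g, of "e / 3"] \<open>e > 0\<close> by auto
 obtain r where r: "\<And>x. norm x > r \<Longrightarrow> \<phi> x = 0" using test_supportE[OF \<phi>(1)] by blast
 obtain N where N: "\<And>n. n \<ge> N \<Longrightarrow> n2 (\<lambda>x. cv (moll n) \<phi> x - \<phi> x) < e / 3"
  using LIMSEQ_D[OF moll_tendsto_continuous(2)[where r=r, OF smooth_continuous[OF test_smooth[OF \<phi>(1)]] r], of "e / 3"] \<open>e > 0\<close>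
  by auto
 note p = test_L2[OF \<phi>(1)]
 have "n2 (\<lambda>x. cv (moll n) g x - g x) < e" if "n \<ge> N" for n
 proof -
  note cp = moll_young(1)[OF p, of n] and cg = moll_young(1)[OF g, of n]
  have "n2 (\<lambda>x. cv (moll n) g x - cv (moll n) \<phi> x) = n2 (cv (moll n) (\<lambda>x. g x - \<phi> x))"
   using cv_diff[OF test_integrable[OF moll_test] test_L2[OF moll_test] g p] by presburger
  also have "\<dots> \<le> n2 (\<lambda>x. g x - \<phi> x)" by (rule moll_young(2)[OF L2_diff(1)[OF g p]])
  also have "\<dots> < e / 3" using \<phi>(2) by (simp add: n2_commute[of g])
  finally show ?thesis
   using n2_triangle[OF cg cp g] n2_triangle[OF cp p g] N[OF that] \<phi>(2) by linarith
 qed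
 then show "\<exists>no. \<forall>n\<ge>no. norm (n2 (\<lambda>x. cv (moll n) g x - g x) - 0) < e" by auto
qed

text \<open>Test functions that tend to \<open>d\<close> in norm turn the hypothesis into
  \<integral> d^2 = 0.\<close>

lemma fundamental_lemma_real:
 fixes d :: "'a::euclidean_space \<Rightarrow> real"
 assumes d: "d \<in> L2" and z: "\<And>\<phi>. test \<phi> \<Longrightarrow> (LBINT x. \<phi> x * d x) = 0"
 shows "AE x in lborel. d x = 0"
proof -
 obtain \<phi> where \<phi>: "\<And>n. test (\<phi> n)" "(\<lambda>n. n2 (\<lambda>x. \<phi> n x - d x)) \<longlonglongrightarrow> 0"
  using test_seq_L2[OF d] by blast
 have "(\<lambda>n. LBINT x. d x *\<^sub>R \<phi> n x) \<longlonglongrightarrow> (LBINT x. d x *\<^sub>R d x)"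
  by (rule L2_tendsto_integral_const[OF test_L2[OF \<phi>(1)] d d \<phi>(2)])
 moreover have "(LBINT x. d x *\<^sub>R \<phi> n x) = 0" for n
  using z[OF \<phi>(1)[of n]] by (simp add: mult.commute)
 ultimately have "(LBINT x. d x * d x) = 0" by (simp add: LIMSEQ_const_iff)
 then have "n2 d = 0" by (simp add: n2_def power2_eq_square)
 then show ?thesis by (rule n2_eq_0_AE[OF d])
qed

lemma L2_Re_Im:
 assumes "f \<in> L2" shows "(\<lambda>x. Re (f x)) \<in> L2" "(\<lambda>x. Im (f x)) \<in> L2"
proof -
 note [measurable] = L2_measurable[OF assms]
 show "(\<lambda>x. Re (f x)) \<in> L2" by (rule L2_mono(1)[OF _ assms]) (auto simp: abs_Re_le_cmod)
 show "(\<lambda>x. Im (f x)) \<in> L2" by (rule L2_mono(1)[OF _ assms]) (auto simp: abs_Im_le_cmod)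
qed

lemma fundamental_lemma:
 fixes d :: "'a::euclidean_space \<Rightarrow> complex"
 assumes d: "d \<in> L2" and z: "\<And>\<phi>. test \<phi> \<Longrightarrow> (LBINT x. \<phi> x *\<^sub>R d x) = 0"
 shows "AE x in lborel. d x = 0"
proof -
 have I: "integrable lborel (\<lambda>x. \<phi> x *\<^sub>R d x)" if "test \<phi>" for \<phi>
  by (rule L2_scaleR_integrable[OF test_L2[OF that] d])
 have "AE x in lborel. Re (d x) = 0"
  by (rule fundamental_lemma_real[OF L2_Re_Im(1)[OF d]])
    (use integral_Re[OF I] z in fastforce)
 moreover have "AE x in lborel. Im (d x) = 0"
  by (rule fundamental_lemma_real[OF L2_Re_Im(2)[OF d]])
    (use integral_Im[OF I] z in fastforce)
 ultimately show ?thesis by eventually_elim (simp add: complex_eq_iff)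
qed

section \<open>The Yukawa kernel\<close>

text \<open>The classical Laplacian of smooth functions, as opposed to the weak
  \<open>laplacian\<close>, which is determined only up to null sets.\<close>

definition lap :: "('a::euclidean_space \<Rightarrow> real) \<Rightarrow> 'a \<Rightarrow> real" where
 "lap f x = (\<Sum>b\<in>Basis. pd b (pd b f) x)"

lemma smooth_lap: "smooth f \<Longrightarrow> smooth (lap f)"
 unfolding lap_def[abs_def] by (intro smooth_sum smooth_pd) auto

lemma test_lap: "test f \<Longrightarrow> test (lap f)"
 unfolding lap_def[abs_def] by (intro test_sum test_pd) auto

lemma pd_pd_mult:
 assumes f: "smooth f" and g: "smooth g" and b: "b \<in> Basis"
 shows "pd b (pd b (\<lambda>x. f x * g x)) x = pd b (pd b f) x * g x + 2 * (pd b f x * pd b g x) + f x * pd b (pd b g) x"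
proof -
 have "pd b (\<lambda>x. f x * g x) = (\<lambda>x. pd b f x * g x + f x * pd b g x)"
  by (auto simp: pd_mult[OF f g])
 then show ?thesis
  by (simp add: pd_add pd_mult smooth_mult smooth_pd f g b)
qed

lemma lap_mult:
 assumes f: "smooth f" and g: "smooth g"
 shows "lap (\<lambda>x. f x * g x) x = lap f x * g x + 2 * (\<Sum>b\<in>Basis. pd b f x * pd b g x) + f x * lap g x"
 unfolding lap_def
 by (simp add: pd_pd_mult[OF f g] sum.distrib sum_distrib_left sum_distrib_right)

lemma lap_reflect:
 assumes f: "smooth f" shows "lap (\<lambda>y. f (x - y)) y = lap f (x - y)"
 unfolding lap_def
proof (rule sum.cong[OF refl])
 fix b :: 'a assume b: "b \<in> Basis"
 have *: "pd b (\<lambda>y. f (x - y)) = (\<lambda>y. - 1 * pd b f (x - y))" by (auto simp: pd_reflect[OF f])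
 have "smooth (\<lambda>y. pd b f (x - y))"
  by (rule smooth_affine[OF smooth_pd[OF f b], of "\<lambda>y. x - y" uminus]) (auto intro!: derivative_eq_intros)
 from pd_cmult[OF this, of b "-1" y] show "pd b (pd b (\<lambda>y. f (x - y))) y = pd b (pd b f) (x - y)"
  unfolding * by (simp add: pd_reflect[OF smooth_pd[OF f b]])
qed

lemma ibp_lap:
 assumes f: "smooth f" and \<phi>: "test \<phi>"
 shows "(LBINT x. lap f x * \<phi> x) = (LBINT x. f x * lap \<phi> x)"
proof -
 have I: "integrable lborel (\<lambda>x. g x * \<psi> x)" if "smooth g" "test \<psi>" for g \<psi> :: "'a \<Rightarrow> real"
  using that by (intro test_integrable test_mult)
 have "(LBINT x. pd b (pd b f) x * \<phi> x) = (LBINT x. f x * pd b (pd b \<phi>) x)" if b: "b \<in> Basis" for b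
  using ibp_test[OF smooth_pd[OF f b] \<phi> b] ibp_test[OF f test_pd[OF \<phi> b] b] by simp
 then show ?thesis
  unfolding lap_def sum_distrib_left sum_distrib_right
  by (subst (1 2) Bochner_Integration.integral_sum) (auto intro!: I smooth_pd f test_pd \<phi>)
qed

section \<open>Decay and singular integrals in three dimensions\<close>

type_synonym R3 = "real^3"

lemma exp_minus_le:
 assumes "\<kappa> > 0" obtains C where "C > 0" "\<And>r::real. r \<ge> 0 \<Longrightarrow> exp (- \<kappa> * r) \<le> C / (1 + r\<^sup>2) ^ 3"
proof -
 \<comment> \<open>The sixth comes from (1 + \<kappa> r / 6)^6 \<le> exp (\<kappa> r); with this
   \<open>m\<close> one has m (1 + r) \<le> 1 + \<kappa> r / 6.\<close>
 define m where "m = min 1 (\<kappa> / 6)"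
 have m: "m > 0" "m \<le> 1" "m \<le> \<kappa> / 6" using assms by (auto simp: m_def)
 show thesis
 proof (rule that[of "1 / m ^ 6"])
  show "1 / m ^ 6 > 0" using m by simp
  fix r :: real assume r: "r \<ge> 0"
  have "m * (1 + r) \<le> 1 + \<kappa> * r / 6"
   using mult_right_mono[OF m(3) r] m by (simp add: distrib_left)
  then have "(m * (1 + r)) ^ 6 \<le> (1 + \<kappa> * r / 6) ^ 6" using m r by (intro power_mono) auto
  also have "\<dots> \<le> exp (\<kappa> * r)"
  proof -
   have "0 \<le> \<kappa> * r" using assms r by simp
   then show ?thesis using exp_ge_one_plus_x_over_n_power_n[of 6 "\<kappa> * r"] by simp
  qed
  finally have A: "(m * (1 + r)) ^ 6 \<le> exp (\<kappa> * r)" .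
  have "1 + r\<^sup>2 \<le> (1 + r)\<^sup>2" using r by (simp add: power2_sum)
  then have "(1 + r\<^sup>2) ^ 3 \<le> ((1 + r)\<^sup>2) ^ 3" by (intro power_mono) auto
  also have "\<dots> = (1 + r) ^ 6" by (simp flip: power_mult)
  finally have "m ^ 6 * (1 + r\<^sup>2) ^ 3 \<le> exp (\<kappa> * r)"
   using A m by (simp add: power_mult_distrib) (meson mult_left_mono order_trans zero_le_power less_imp_le)
  moreover have "(1 + r\<^sup>2) ^ 3 > 0" by (simp add: add_pos_nonneg)
  ultimately show "exp (- \<kappa> * r) \<le> 1 / m ^ 6 / (1 + r\<^sup>2) ^ 3"
   using m by (simp add: exp_minus field_simps)
 qed
qed

lemma ball_borel [measurable]: "ball (a::'a::euclidean_space) r \<in> sets borel"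
 by (simp add: borel_open)

lemma emeasure_ball_R3: "r \<ge> 0 \<Longrightarrow> emeasure lborel (ball (0::R3) r) = ennreal (unit_ball_vol 3 * r ^ 3)"
 using emeasure_ball[of r "0::R3"] by simp

text \<open>Both bounds come from a dyadic decomposition into balls.\<close>

lemma nn_integral_inverse_square:
 obtains C where "C > 0"
  "\<And>M. M > 0 \<Longrightarrow> (\<integral>\<^sup>+x. ennreal (indicator (ball 0 M) x / (norm (x::R3))\<^sup>2) \<partial>lborel) \<le> ennreal (C * M)"
proof (rule that[of "8 * unit_ball_vol 3"])
 show "8 * unit_ball_vol 3 > (0::real)" by simp
 fix M :: real assume M: "M > 0"
 \<comment> \<open>\<open>c j\<close> bounds 1/|x|^2 on the shell M/2^(j+1) \<le> |x| < M/2^j.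
   Against the volume of the ball of radius M/2^j this leaves 4 v M / 2^j, with v the volume of the
   unit ball.\<close>
 define c where "c j = 4 ^ (j + 1) / M\<^sup>2" for j :: nat
 have c0: "c j \<ge> 0" for j by (simp add: c_def)
 have pw: "ennreal (indicator (ball 0 M) x / (norm x)\<^sup>2) \<le> (\<Sum>j. ennreal (c j) * indicator (ball 0 (M / 2 ^ j)) x)" for x :: R3
 proof (cases "x \<noteq> 0 \<and> norm x < M")
  case True
  have "\<exists>j. M / 2 ^ j \<le> norm x"
  proof -
   obtain j where "(1/2::real) ^ j < norm x / M"
    using real_arch_pow_inv[of "norm x / M" "1/2"] True M by auto
   then show ?thesis using M by (intro exI[of _ j]) (auto simp: field_simps power_divide)
  qed
  then obtain j where j: "M / 2 ^ j \<le> norm x" "\<And>i. i < j \<Longrightarrow> \<not> M / 2 ^ i \<le> norm x"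
   using exists_least_iff[of "\<lambda>j. M / 2 ^ j \<le> norm x"] by blast
  then obtain i where i: "j = Suc i" using True by (cases j) auto
  have x: "norm x < M / 2 ^ i" "M / 2 ^ (i + 1) \<le> norm x" using j i by (auto simp: not_le)
  have "(M / 2 ^ (i + 1))\<^sup>2 \<le> (norm x)\<^sup>2" using x M by (intro power_mono) auto
  then have "1 / (norm x)\<^sup>2 \<le> 1 / (M / 2 ^ (i + 1))\<^sup>2" using M True by (intro divide_left_mono) auto
  also have "\<dots> = c i"
  proof -
   have "((2::real) ^ (i + 1))\<^sup>2 = 4 ^ (i + 1)"
    by (subst power_mult[symmetric], subst mult.commute, subst power_mult) simp
   then show ?thesis by (simp add: c_def power_divide)
  qed
  finally have "ennreal (indicator (ball 0 M) x / (norm x)\<^sup>2) \<le> ennreal (c i) * indicator (ball 0 (M / 2 ^ i)) x"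
   using True x by (simp add: ennreal_leI)
  also have "\<dots> \<le> (\<Sum>j. ennreal (c j) * indicator (ball 0 (M / 2 ^ j)) x)"
  proof -
   define f where "f j = ennreal (c j) * indicator (ball 0 (M / 2 ^ j)) x" for j
   show ?thesis using sum_le_suminf[of f "{i}"] by (simp add: f_def[symmetric])
  qed
  finally show ?thesis .
 qed auto
 have "(\<integral>\<^sup>+x. ennreal (indicator (ball 0 M) x / (norm (x::R3))\<^sup>2) \<partial>lborel) \<le>
   (\<integral>\<^sup>+x. (\<Sum>j. ennreal (c j) * indicator (ball (0::R3) (M / 2 ^ j)) x) \<partial>lborel)"
  by (intro nn_integral_mono pw)
 also have "\<dots> = (\<Sum>j. \<integral>\<^sup>+x. ennreal (c j) * indicator (ball (0::R3) (M / 2 ^ j)) x \<partial>lborel)"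
  by (rule nn_integral_suminf) measurable
 also have "\<dots> = (\<Sum>j. ennreal (4 * unit_ball_vol 3 * M * (1/2) ^ j))"
 proof (rule suminf_cong)
  fix j :: nat
  have "(\<integral>\<^sup>+x. ennreal (c j) * indicator (ball (0::R3) (M / 2 ^ j)) x \<partial>lborel) = ennreal (c j) * ennreal (unit_ball_vol 3 * (M / 2 ^ j) ^ 3)"
   using M by (subst nn_integral_cmult_indicator) (auto simp: emeasure_ball_R3)
  also have "\<dots> = ennreal (c j * (unit_ball_vol 3 * (M / 2 ^ j) ^ 3))"
   using M c0 by (simp add: ennreal_mult)
  also have "c j * (unit_ball_vol 3 * (M / 2 ^ j) ^ 3) = 4 * unit_ball_vol 3 * M * (1/2) ^ j"
  proof -
   define t where "t = (2::real) ^ j"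
   have "(4::real) ^ j = t * t" by (simp add: t_def flip: power_mult_distrib)
   then have "c j = 4 * (t * t) / M\<^sup>2" by (simp add: c_def)
   moreover have "(1/2::real) ^ j = 1 / t" "t > 0" by (auto simp: t_def power_divide)
   ultimately show ?thesis
    using M by (simp add: t_def[symmetric] field_simps power2_eq_square power3_eq_cube)
  qed
  finally show "(\<integral>\<^sup>+x. ennreal (c j) * indicator (ball (0::R3) (M / 2 ^ j)) x \<partial>lborel) = ennreal (4 * unit_ball_vol 3 * M * (1/2) ^ j)" .
 qed
 also have "\<dots> = ennreal (\<Sum>j. 4 * unit_ball_vol 3 * M * (1/2) ^ j)"
  using M by (intro suminf_ennreal2 summable_mult summable_geometric) auto
 also have "(\<Sum>j. 4 * unit_ball_vol 3 * M * (1/2::real) ^ j) = 4 * unit_ball_vol 3 * M * 2"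
  by (subst suminf_mult) (auto intro: summable_geometric simp: suminf_geometric)
 finally show "(\<integral>\<^sup>+x. ennreal (indicator (ball 0 M) x / (norm (x::R3))\<^sup>2) \<partial>lborel) \<le> ennreal (8 * unit_ball_vol 3 * M)"
  by (simp add: mult_ac)
qed

lemma integrable_japanese: "integrable lborel (\<lambda>x::R3. 1 / (1 + (norm x)\<^sup>2)\<^sup>2)"
proof (rule integrableI_bounded)
 \<comment> \<open>\<open>c j\<close> bounds the integrand where |x| \<ge> 2^j. Against the ball of
   radius 2^(j+1) this leaves (1/16)^j 8^(j+1) = 8 (1/2)^j times the volume of the unit
   ball.\<close>
 define c where "c j = (1/16::real) ^ j" for j :: nat
 have pw: "ennreal (norm (1 / (1 + (norm x)\<^sup>2)\<^sup>2)) \<le> (\<Sum>j. ennreal (c j) * indicator (ball 0 (2 ^ (j + 1))) x)" for x :: R3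
 proof -
  have "\<exists>i. norm x < 2 ^ (i + 1) \<and> 1 / (1 + (norm x)\<^sup>2)\<^sup>2 \<le> c i"
  proof (cases "norm x < 1")
   case True
   have "1 \<le> (1 + (norm x)\<^sup>2)\<^sup>2" by (simp add: one_le_power)
   then show ?thesis using True one_plus_norm2_pos[of x]
    by (intro exI[of _ 0]) (auto simp: c_def divide_le_eq_1)
  next
   case False
   obtain j where "norm x < 2 ^ j" using real_arch_pow[of 2 "norm x"] by auto
   then obtain j where j: "norm x < 2 ^ j" "\<And>i. i < j \<Longrightarrow> \<not> norm x < 2 ^ i"
    using exists_least_iff[of "\<lambda>j. norm x < 2 ^ j"] by blast
   then obtain i where i: "j = Suc i" using False by (cases j) auto
   have x: "2 ^ i \<le> norm x" "norm x < 2 ^ (i + 1)" using j i by (auto simp: not_less)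
   have "(2 ^ i)\<^sup>2 \<le> (norm x)\<^sup>2" using x by (intro power_mono) auto
   then have "(2 ^ i)\<^sup>2 \<le> 1 + (norm x)\<^sup>2" by linarith
   then have "((2 ^ i)\<^sup>2)\<^sup>2 \<le> (1 + (norm x)\<^sup>2)\<^sup>2" by (rule power_mono) simp
   also have "((2 ^ i)\<^sup>2)\<^sup>2 = (16::real) ^ i"
   proof -
    have "((2 ^ i)\<^sup>2)\<^sup>2 = ((2::real) ^ 4) ^ i"
     by (simp only: power_mult[symmetric]) (simp add: mult_ac)
    then show ?thesis by simp
   qed
   finally have "1 / (1 + (norm x)\<^sup>2)\<^sup>2 \<le> 1 / 16 ^ i"
    using one_plus_norm2_pos[of x] by (intro divide_left_mono) auto
   then show ?thesis using x(2) by (intro exI[of _ i]) (auto simp: c_def power_divide)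
  qed
  then obtain i where i: "norm x < 2 ^ (i + 1)" "1 / (1 + (norm x)\<^sup>2)\<^sup>2 \<le> c i" by blast
  have "ennreal (norm (1 / (1 + (norm x)\<^sup>2)\<^sup>2)) \<le> ennreal (c i) * indicator (ball 0 (2 ^ (i + 1))) x"
   using i by (simp add: ennreal_leI)
  also have "\<dots> \<le> (\<Sum>j. ennreal (c j) * indicator (ball 0 (2 ^ (j + 1))) x)"
  proof -
   define f where "f j = ennreal (c j) * indicator (ball 0 (2 ^ (j + 1))) x" for j
   have "f i \<le> (\<Sum>j. f j)" using sum_le_suminf[of f "{i}"] by simp
   then show ?thesis unfolding f_def .
  qed
  finally show ?thesis .
 qed
 have "(\<integral>\<^sup>+x. ennreal (norm (1 / (1 + (norm (x::R3))\<^sup>2)\<^sup>2)) \<partial>lborel) \<le>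
   (\<integral>\<^sup>+x. (\<Sum>j. ennreal (c j) * indicator (ball (0::R3) (2 ^ (j + 1))) x) \<partial>lborel)"
  by (intro nn_integral_mono pw)
 also have "\<dots> = (\<Sum>j. \<integral>\<^sup>+x. ennreal (c j) * indicator (ball (0::R3) (2 ^ (j + 1))) x \<partial>lborel)"
  by (rule nn_integral_suminf) measurable
 also have "\<dots> = (\<Sum>j. ennreal (8 * unit_ball_vol 3 * (1/2) ^ j))"
 proof (rule suminf_cong)
  fix j :: nat
  have "(\<integral>\<^sup>+x. ennreal (c j) * indicator (ball (0::R3) (2 ^ (j + 1))) x \<partial>lborel) = ennreal (c j) * ennreal (unit_ball_vol 3 * (2 ^ (j + 1)) ^ 3)"
   by (subst nn_integral_cmult_indicator) (auto simp: emeasure_ball_R3 simp del: power_Suc)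
  also have "\<dots> = ennreal (c j * (unit_ball_vol 3 * (2 ^ (j + 1)) ^ 3))"
   by (simp add: ennreal_mult c_def)
  also have "c j * (unit_ball_vol 3 * (2 ^ (j + 1)) ^ 3) = 8 * unit_ball_vol 3 * (1/2) ^ j"
  proof -
   have "((2::real) ^ (j + 1)) ^ 3 = 8 * 8 ^ j"
   proof -
    have "((2::real) ^ (j + 1)) ^ 3 = (2 ^ 3) ^ (j + 1)"
     by (simp only: power_mult[symmetric] mult.commute)
    then show ?thesis by simp
   qed
   moreover have "(1/16::real) ^ j * 8 ^ j = (1/2) ^ j" by (simp flip: power_mult_distrib)
   ultimately show ?thesis by (simp add: c_def)
  qed
  finally show "(\<integral>\<^sup>+x. ennreal (c j) * indicator (ball (0::R3) (2 ^ (j + 1))) x \<partial>lborel) = ennreal (8 * unit_ball_vol 3 * (1/2) ^ j)" .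
 qed
 also have "\<dots> = ennreal (\<Sum>j. 8 * unit_ball_vol 3 * (1/2) ^ j)"
  by (intro suminf_ennreal2 summable_mult summable_geometric) auto
 also have "\<dots> < \<infinity>" by simp
 finally show "(\<integral>\<^sup>+x. ennreal (norm (1 / (1 + (norm (x::R3))\<^sup>2)\<^sup>2)) \<partial>lborel) < \<infinity>" .
qed (auto intro!: borel_measurable_divide)

lemma integrable_inverse_square_ball: "integrable lborel (\<lambda>x::R3. indicator (ball 0 M) x / (norm x)\<^sup>2)"
proof (cases "M > 0")
 case True
 show ?thesis
 proof (rule integrableI_bounded)
  obtain C where C: "\<And>M. M > 0 \<Longrightarrow> (\<integral>\<^sup>+x. ennreal (indicator (ball 0 M) x / (norm (x::R3))\<^sup>2) \<partial>lborel) \<le> ennreal (C * M)"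
   using nn_integral_inverse_square by blast
  have "(\<integral>\<^sup>+x. ennreal (norm (indicator (ball 0 M) x / (norm (x::R3))\<^sup>2)) \<partial>lborel) = (\<integral>\<^sup>+x. ennreal (indicator (ball 0 M) x / (norm (x::R3))\<^sup>2) \<partial>lborel)"
   by simp
  also have "\<dots> \<le> ennreal (C * M)" by (rule C[OF True])
  also have "\<dots> < \<infinity>" by simp
  finally show "(\<integral>\<^sup>+x. ennreal (norm (indicator (ball 0 M) x / (norm (x::R3))\<^sup>2)) \<partial>lborel) < \<infinity>" .
 qed (auto intro!: borel_measurable_divide)
next
 case False
 then have "(\<lambda>x::R3. indicator (ball 0 M) x / (norm x)\<^sup>2) = (\<lambda>x. 0 :: real)"
  by (auto simp: indicator_def fun_eq_iff) (smt (verit) norm_ge_zero)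
 then show ?thesis by simp
qed

section \<open>The kernel and its regularisation\<close>

lemma AE_nonzero: "AE x in lborel. (x::'a::euclidean_space) \<noteq> a"
 by (rule AE_lborel_singleton)

text \<open>The mass that remains when -\<Delta> acts on 1 / sqrt (|x|^2 + e^2), which by scaling is
  the same for every e > 0. Its value is 4 \<pi>; it is left unevaluated and serves as the
  normalisation of the kernel.\<close>

definition c5 :: real where
 "c5 = (LBINT x. 3 / sqrt (1 + (norm (x::R3))\<^sup>2) ^ 5)"

lemma integrable_c5: "integrable lborel (\<lambda>x::R3. 3 / sqrt (1 + (norm x)\<^sup>2) ^ 5)"
proof (rule Bochner_Integration.integrable_bound)
 show "integrable lborel (\<lambda>x::R3. 3 * (1 / (1 + (norm x)\<^sup>2)\<^sup>2))"
  by (intro integrable_mult_right integrable_japanese)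
 show "AE x in lborel. norm (3 / sqrt (1 + (norm (x::R3))\<^sup>2) ^ 5) \<le> norm (3 * (1 / (1 + (norm x)\<^sup>2)\<^sup>2))"
 proof (intro always_eventually allI)
  fix x :: R3
  define r where "r = sqrt (1 + (norm x)\<^sup>2)"
  have r: "r \<ge> 1" "r\<^sup>2 = 1 + (norm x)\<^sup>2" by (auto simp: r_def)
  have "r ^ 4 \<le> r ^ 5" using r(1) by (intro power_increasing) auto
  then have "3 / r ^ 5 \<le> 3 / r ^ 4" using r(1) by (intro divide_left_mono) auto
  then show "norm (3 / sqrt (1 + (norm x)\<^sup>2) ^ 5) \<le> norm (3 * (1 / (1 + (norm x)\<^sup>2)\<^sup>2))"
   using r by (simp add: r_def[symmetric] r(2)[symmetric])
 qed
qed (auto intro!: borel_measurable_divide)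

lemma c5_pos: "c5 > 0"
proof -
 have pos: "3 / sqrt (1 + (norm (x::R3))\<^sup>2) ^ 5 > 0" for x
  using one_plus_norm2_pos[of x] by (intro divide_pos_pos zero_less_power) auto
 have "c5 \<ge> 0" unfolding c5_def by (intro Bochner_Integration.integral_nonneg) (use pos less_imp_le in blast)
 moreover have "c5 \<noteq> 0"
 proof
  assume "c5 = 0"
  then have "AE x in lborel. 3 / sqrt (1 + (norm (x::R3))\<^sup>2) ^ 5 = 0"
   unfolding c5_def using integrable_c5 pos
   by (subst (asm) integral_nonneg_eq_0_iff_AE) (auto simp: less_imp_le)
  then have "AE x in (lborel :: R3 measure). False" by eventually_elim (use pos less_irrefl in metis)
  then have "emeasure (lborel :: R3 measure) UNIV = 0" by (simp add: AE_iff_null null_sets_def)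
  then show False by simp
 qed
 ultimately show ?thesis by simp
qed

text \<open>The Yukawa kernel, the Green function of -\<Delta> + \<kappa>^2 on R^3. At the origin
  division by zero gives it the value 0.\<close>

definition Y :: "real \<Rightarrow> R3 \<Rightarrow> real" where
 "Y \<kappa> x = exp (- \<kappa> * norm x) / (c5 * norm x)"

text \<open>Replacing |x| by sqrt (|x|^2 + e^2) removes the singularity; for
  \<open>e \<noteq> 0\<close> the result is smooth.\<close>

definition Yr :: "real \<Rightarrow> real \<Rightarrow> R3 \<Rightarrow> real" where
 "Yr \<kappa> e x = exp (- \<kappa> * sqrt ((norm x)\<^sup>2 + e\<^sup>2)) / (c5 * sqrt ((norm x)\<^sup>2 + e\<^sup>2))"

lemma Y_measurable [measurable]: "Y \<kappa> \<in> borel_measurable borel"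
 unfolding Y_def by measurable

lemma Y_nonneg [simp]: "Y \<kappa> x \<ge> 0"
 using c5_pos by (simp add: Y_def)

lemma Y_even: "Y \<kappa> (- x) = Y \<kappa> x"
 by (simp add: Y_def)

lemma Y_le: "\<kappa> \<ge> 0 \<Longrightarrow> Y \<kappa> x \<le> 1 / (c5 * norm x)"
 unfolding Y_def using c5_pos by (intro divide_right_mono) auto

text \<open>One majorant \<open>w\<close>, up to powers of \<open>c5\<close>, dominates the kernel
  and its square: 1/|x|^2 in the unit ball, integrable in three dimensions, and outside a multiple
  of (1 + |x|^2)^(-2), which dominates the exponential.\<close>

lemma Y_integrable:
 assumes "\<kappa> > 0" shows "integrable lborel (Y \<kappa>)" "Y \<kappa> \<in> L2"
proof -
 obtain C where C: "C > 0" "\<And>r::real. r \<ge> 0 \<Longrightarrow> exp (- \<kappa> * r) \<le> C / (1 + r\<^sup>2) ^ 3"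
  using exp_minus_le[OF assms] by blast
 define w where "w x = indicator (ball 0 1) x / (norm x)\<^sup>2 + C * (1 / (1 + (norm x)\<^sup>2)\<^sup>2)" for x :: R3
 have w: "integrable lborel w"
  unfolding w_def by (intro Bochner_Integration.integrable_add integrable_mult_right integrable_japanese integrable_inverse_square_ball)
 have E: "exp (- \<kappa> * norm x) \<le> C * (1 / (1 + (norm x)\<^sup>2)\<^sup>2)" for x :: R3
 proof -
  have "(1 + (norm x)\<^sup>2)\<^sup>2 \<le> (1 + (norm x)\<^sup>2) ^ 3" by (intro power_increasing) auto
  then have "C / (1 + (norm x)\<^sup>2) ^ 3 \<le> C / (1 + (norm x)\<^sup>2)\<^sup>2"
   using C(1) one_plus_norm2_pos[of x] by (intro divide_left_mono) auto
  then show ?thesis using C(2)[of "norm x"] by simp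
 qed
 have e1: "exp (- \<kappa> * norm x) \<le> 1" for x :: R3 using assms by simp
 have wn: "w x \<ge> 0" for x using C by (simp add: w_def)
 have b: "exp (- \<kappa> * norm x) / norm x \<le> w x \<and> exp (- \<kappa> * norm x) / (norm x)\<^sup>2 \<le> w x" for x :: R3
 proof (cases "x = 0")
  case False
  show ?thesis
  proof (cases "norm x < 1")
   case True
   have "(norm x)\<^sup>2 \<le> norm x" using True by (simp add: power2_eq_square mult_left_le)
   then have "1 / norm x \<le> 1 / (norm x)\<^sup>2" using False by (intro divide_left_mono) auto
   moreover have "exp (- \<kappa> * norm x) / norm x \<le> 1 / norm x" "exp (- \<kappa> * norm x) / (norm x)\<^sup>2 \<le> 1 / (norm x)\<^sup>2"
    using e1 by (intro divide_right_mono; simp)+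
   moreover have "w x \<ge> 1 / (norm x)\<^sup>2" using True C by (simp add: w_def)
   ultimately show ?thesis by linarith
  next
   case F: False
   have n1: "1 \<le> norm x" using F by simp
   then have n2: "1 \<le> (norm x)\<^sup>2" by (rule one_le_power)
   have "exp (- \<kappa> * norm x) / norm x \<le> exp (- \<kappa> * norm x) / 1" "exp (- \<kappa> * norm x) / (norm x)\<^sup>2 \<le> exp (- \<kappa> * norm x) / 1"
    using n1 n2 by (intro frac_le; simp)+
   moreover have "exp (- \<kappa> * norm x) \<le> w x" using E[of x] F by (simp add: w_def)
   ultimately show ?thesis by auto
  qed
 qed (use wn in simp)
 show "integrable lborel (Y \<kappa>)"
 proof (rule Bochner_Integration.integrable_bound[of _ "\<lambda>x. w x / c5"])
  show "AE x in lborel. norm (Y \<kappa> x) \<le> norm (w x / c5)"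
  proof (intro always_eventually allI)
   fix x show "norm (Y \<kappa> x) \<le> norm (w x / c5)"
   proof -
    have "Y \<kappa> x = exp (- \<kappa> * norm x) / norm x / c5" by (simp add: Y_def)
    also have "\<dots> \<le> w x / c5" using b[of x] c5_pos by (intro divide_right_mono) auto
    finally show ?thesis using Y_nonneg[of \<kappa> x] c5_pos wn[of x] by simp
   qed
  qed
 qed (use w in auto)
 show "Y \<kappa> \<in> L2"
 proof (rule L2I)
  show "integrable lborel (\<lambda>x. (norm (Y \<kappa> x))\<^sup>2)"
  proof (rule Bochner_Integration.integrable_bound[of _ "\<lambda>x. w x / c5\<^sup>2"])
   show "AE x in lborel. norm ((norm (Y \<kappa> x))\<^sup>2) \<le> norm (w x / c5\<^sup>2)"
   proof (intro always_eventually allI)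
    fix x :: R3
    have "(exp (- \<kappa> * norm x))\<^sup>2 \<le> exp (- \<kappa> * norm x)"
     using e1[of x] by (simp add: power2_eq_square mult_left_le)
    then have "(exp (- \<kappa> * norm x))\<^sup>2 / (norm x)\<^sup>2 \<le> w x"
     using b[of x] by (meson divide_right_mono order_trans zero_le_power2)
    then have "(exp (- \<kappa> * norm x))\<^sup>2 / (norm x)\<^sup>2 / c5\<^sup>2 \<le> w x / c5\<^sup>2"
     by (intro divide_right_mono) auto
    then show "norm ((norm (Y \<kappa> x))\<^sup>2) \<le> norm (w x / c5\<^sup>2)"
     using wn[of x] by (simp add: Y_def power_divide power_mult_distrib mult_ac)
   qed
  qed (use w in auto)
 qed measurable
qed

lemma sqrt_norm_pos: "e \<noteq> 0 \<Longrightarrow> 0 < (norm x)\<^sup>2 + e\<^sup>2" for e :: real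
 by (simp add: add_nonneg_pos)

text \<open>In terms of r = sqrt (|x|^2 + e^2) everything in (\<kappa>^2 - \<Delta>)
  \<open>Yr\<close> cancels except what comes from the e^2 in |x|^2 = r^2 - e^2; for e = 0 the
  kernel would solve the homogeneous equation away from the origin.\<close>

lemma Yr_derivs:
 assumes e: "e \<noteq> 0" 
 shows Yr_smooth: "smooth (Yr \<kappa> e)"
  and pd_Yr: "b \<in> Basis \<Longrightarrow> pd b (Yr \<kappa> e) x =
   - (exp (- \<kappa> * sqrt ((norm x)\<^sup>2 + e\<^sup>2)) * (\<kappa> / sqrt ((norm x)\<^sup>2 + e\<^sup>2) ^ 2 + 1 / sqrt ((norm x)\<^sup>2 + e\<^sup>2) ^ 3)) * (x \<bullet> b) / c5"
  and lap_Yr: "\<kappa>\<^sup>2 * Yr \<kappa> e x - lap (Yr \<kappa> e) x =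
   e\<^sup>2 * exp (- \<kappa> * sqrt ((norm x)\<^sup>2 + e\<^sup>2)) * (\<kappa>\<^sup>2 / sqrt ((norm x)\<^sup>2 + e\<^sup>2) ^ 3
     + 3 * \<kappa> / sqrt ((norm x)\<^sup>2 + e\<^sup>2) ^ 4 + 3 / sqrt ((norm x)\<^sup>2 + e\<^sup>2) ^ 5) / c5"
proof -
 define s where "s x = (norm x)\<^sup>2 + e\<^sup>2" for x :: R3
 have s: "smooth s" unfolding s_def by (intro smooth_add smooth_norm2 smooth_const)
 have sp: "s x > 0" for x unfolding s_def by (rule sqrt_norm_pos[OF e])
 have pds: "pd b s x = 2 * (x \<bullet> b)" for b x
  unfolding s_def by (subst pd_add) (auto simp: smooth_norm2 smooth_const pd_norm2)
 \<comment> \<open>\<open>Yr\<close> is \<open>F\<close> of t = |x|^2 + e^2, and \<open>F1\<close>,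
   \<open>F2\<close> are the first two t-derivatives. Hence the partial derivative along b is 2 (x .
   b) \<open>F1\<close> and the Laplacian is 4 |x|^2 \<open>F2\<close> + 6
   \<open>F1\<close>.\<close>
 define F where "F t = exp (- \<kappa> * sqrt t) / (c5 * sqrt t)" for t
 define F1 where "F1 t = - (exp (- \<kappa> * sqrt t) * (\<kappa> / sqrt t ^ 2 + 1 / sqrt t ^ 3)) / (2 * c5)" for t
 define F2 where "F2 t = exp (- \<kappa> * sqrt t) * (\<kappa>\<^sup>2 / sqrt t ^ 3 + 3 * \<kappa> / sqrt t ^ 4 + 3 / sqrt t ^ 5) / (4 * c5)" for t
 note dr = DERIV_real_sqrt
 have dF: "(F has_real_derivative F1 t) (at t)" if "t > 0" for t
 proof -
  define r where "r = sqrt t"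
  have r: "r > 0" using that by (simp add: r_def)
  have "((\<lambda>r. exp (- \<kappa> * r) / (c5 * r)) has_real_derivative - (exp (- \<kappa> * r) * (\<kappa> / r + 1 / r\<^sup>2)) / c5) (at r)"
   using r c5_pos by (auto intro!: derivative_eq_intros simp: field_simps power2_eq_square)
  from DERIV_chain2[OF this[unfolded r_def] dr[OF that]] have D: "(F has_real_derivative
    - (exp (- \<kappa> * r) * (\<kappa> / r + 1 / r\<^sup>2)) / c5 * (inverse r / 2)) (at t)"
   by (simp add: F_def[abs_def] r_def)
  show ?thesis
   by (rule DERIV_cong[OF D]) (use r in \<open>simp add: F1_def r_def[symmetric] field_simps power2_eq_square power3_eq_cube\<close>)
 qed
 have dF1: "(F1 has_real_derivative F2 t) (at t)" if "t > 0" for t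
 proof -
  define r where "r = sqrt t"
  have r: "r > 0" using that by (simp add: r_def)
  have "((\<lambda>r. - (exp (- \<kappa> * r) * (\<kappa> / r ^ 2 + 1 / r ^ 3)) / (2 * c5)) has_real_derivative
    exp (- \<kappa> * r) * (\<kappa>\<^sup>2 / r ^ 2 + 3 * \<kappa> / r ^ 3 + 3 / r ^ 4) / (2 * c5)) (at r)"
   using r c5_pos by (auto intro!: derivative_eq_intros simp: field_simps) (simp add: algebra_simps eval_nat_numeral)
  from DERIV_chain2[OF this[unfolded r_def] dr[OF that]] have D: "(F1 has_real_derivative
    exp (- \<kappa> * r) * (\<kappa>\<^sup>2 / r ^ 2 + 3 * \<kappa> / r ^ 3 + 3 / r ^ 4) / (2 * c5) * (inverse r / 2)) (at t)"
   by (simp add: F1_def[abs_def] r_def)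
  show ?thesis
   by (rule DERIV_cong[OF D]) (use r in \<open>simp add: F2_def r_def[symmetric] field_simps eval_nat_numeral\<close>)
 qed
 have smF: "smooth (\<lambda>x. F (s x))"
 proof -
  have sq: "smooth (\<lambda>x. sqrt (s x))" by (rule smooth_compose1[OF s smooth1_sqrt]) (use sp in auto)
  have "smooth (\<lambda>x. exp (- \<kappa> * sqrt (s x)))"
   by (rule smooth_compose1[OF _ smooth1_exp[of UNIV]]) (use smooth_mult[OF smooth_const[of "- \<kappa>"] sq] in auto)
  moreover have "smooth (\<lambda>x. inverse (c5 * sqrt (s x)))"
   by (rule smooth_compose1[OF _ smooth1_inverse]) (use sp c5_pos in \<open>auto intro!: smooth_mult smooth_const sq\<close>)
  ultimately show ?thesis unfolding F_def divide_inverse by (rule smooth_mult)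
 qed
 have YF: "Yr \<kappa> e = (\<lambda>x. F (s x))" by (auto simp: Yr_def F_def s_def)
 show sm: "smooth (Yr \<kappa> e)" using smF by (simp add: YF)
 have p1: "pd b (Yr \<kappa> e) = (\<lambda>x. F1 (s x) * (2 * (x \<bullet> b)))" for b
  unfolding YF by (rule ext) (simp add: pd_compose1[OF s dF[OF sp]] pds)
 show "pd b (Yr \<kappa> e) x =
   - (exp (- \<kappa> * sqrt ((norm x)\<^sup>2 + e\<^sup>2)) * (\<kappa> / sqrt ((norm x)\<^sup>2 + e\<^sup>2) ^ 2 + 1 / sqrt ((norm x)\<^sup>2 + e\<^sup>2) ^ 3)) * (x \<bullet> b) / c5" if "b \<in> Basis"
  unfolding p1 F1_def s_def by simp
 have p2: "pd b (pd b (Yr \<kappa> e)) x = 4 * F2 (s x) * (x \<bullet> b)\<^sup>2 + 2 * F1 (s x)" if b: "b \<in> Basis" for b x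
 proof -
  have smF1: "((\<lambda>x. F1 (s x)) has_derivative (\<lambda>v. F2 (s x) * frechet_derivative s (at x) v)) (at x)"
   using diff_chain_at[OF smooth_has_derivative[OF s] dF1[OF sp, unfolded has_field_derivative_def]]
   by (simp add: o_def)
  have "((\<lambda>x. 2 * (x \<bullet> b)) has_derivative (\<lambda>v. 2 * (v \<bullet> b))) (at x)"
   by (auto intro!: derivative_eq_intros)
  from pd_eq[OF has_derivative_mult[OF smF1 this], of b]
  show ?thesis using pds[of b x, unfolded pd_def] b unfolding p1 by (simp add: power2_eq_square)
 qed
 show "\<kappa>\<^sup>2 * Yr \<kappa> e x - lap (Yr \<kappa> e) x =
   e\<^sup>2 * exp (- \<kappa> * sqrt ((norm x)\<^sup>2 + e\<^sup>2)) * (\<kappa>\<^sup>2 / sqrt ((norm x)\<^sup>2 + e\<^sup>2) ^ 3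
     + 3 * \<kappa> / sqrt ((norm x)\<^sup>2 + e\<^sup>2) ^ 4 + 3 / sqrt ((norm x)\<^sup>2 + e\<^sup>2) ^ 5) / c5"
 proof -
  have "lap (Yr \<kappa> e) x = 4 * F2 (s x) * (\<Sum>b\<in>Basis. (x \<bullet> b)\<^sup>2) + 6 * F1 (s x)"
   unfolding lap_def by (simp add: p2 sum.distrib sum_distrib_left)
  also have "(\<Sum>b\<in>Basis. (x \<bullet> b)\<^sup>2) = s x - e\<^sup>2"
   unfolding s_def power2_norm_eq_inner by (subst euclidean_inner) (simp add: power2_eq_square)
  finally have L: "lap (Yr \<kappa> e) x = 4 * F2 (s x) * (s x - e\<^sup>2) + 6 * F1 (s x)" .
  define r where "r = sqrt (s x)"
  have r: "r > 0" "s x = r\<^sup>2" using sp[of x] by (auto simp: r_def)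
  have alg: "\<kappa>\<^sup>2 * (E / (c5 * r)) - (4 * (E * (\<kappa>\<^sup>2 / r ^ 3 + 3 * \<kappa> / r ^ 4 + 3 / r ^ 5) / (4 * c5)) * (r\<^sup>2 - e\<^sup>2)
    + 6 * (- (E * (\<kappa> / r ^ 2 + 1 / r ^ 3)) / (2 * c5)))
   = e\<^sup>2 * E * (\<kappa>\<^sup>2 / r ^ 3 + 3 * \<kappa> / r ^ 4 + 3 / r ^ 5) / c5" for E
   using r(1) c5_pos by (simp add: field_simps) (simp add: algebra_simps eval_nat_numeral)
  have "sqrt ((norm x)\<^sup>2 + e\<^sup>2) = r" by (simp add: r_def s_def)
  then show ?thesis
   unfolding L using alg[of "exp (- \<kappa> * r)"] by (simp add: F1_def F2_def Yr_def r_def[symmetric] r(2)[symmetric]) 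
 qed
qed

lemma Yr_nonneg: "Yr \<kappa> e x \<ge> 0"
 using c5_pos by (simp add: Yr_def)

lemma Yr_le:
 assumes "\<kappa> \<ge> 0" "x \<noteq> 0" shows "Yr \<kappa> e x \<le> 1 / (c5 * norm x)"
proof -
 have "norm x \<le> sqrt ((norm x)\<^sup>2 + e\<^sup>2)" by (rule real_le_rsqrt) simp
 then have "1 / (c5 * sqrt ((norm x)\<^sup>2 + e\<^sup>2)) \<le> 1 / (c5 * norm x)"
  using c5_pos assms(2) by (intro divide_left_mono mult_left_mono mult_pos_pos) (auto simp: add_pos_nonneg)
 moreover have "Yr \<kappa> e x \<le> 1 / (c5 * sqrt ((norm x)\<^sup>2 + e\<^sup>2))"
  unfolding Yr_def using c5_pos assms(1) by (intro divide_right_mono) auto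
 ultimately show ?thesis by linarith
qed

text \<open>Since (1 + \<kappa> r) exp (- \<kappa> r) \<le> 1, the gradient is dominated by that of
  the Coulomb kernel, uniformly in \<kappa> and \<open>e\<close>. This uniformity makes the
  constants of the approximate resonances independent of \<kappa>.\<close>

lemma pd_Yr_le:
 assumes "\<kappa> \<ge> 0" "e \<noteq> 0" "x \<noteq> 0" and b: "b \<in> Basis"
 shows "\<bar>pd b (Yr \<kappa> e) x\<bar> \<le> 1 / (c5 * (norm x)\<^sup>2)"
proof -
 define r where "r = sqrt ((norm x)\<^sup>2 + e\<^sup>2)"
 have r: "norm x \<le> r" unfolding r_def by (rule real_le_rsqrt) simp
 have x0: "0 < norm x" using assms by simp
 with r have r0: "0 < r" by linarith
 have "(1 + \<kappa> * r) * exp (- \<kappa> * r) \<le> 1"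
  using exp_ge_add_one_self[of "\<kappa> * r"] by (simp add: exp_minus field_simps)
 then have E: "exp (- \<kappa> * r) * (\<kappa> / r ^ 2 + 1 / r ^ 3) \<le> 1 / r ^ 3"
 proof -
  have "exp (- \<kappa> * r) * (\<kappa> / r ^ 2 + 1 / r ^ 3) = ((1 + \<kappa> * r) * exp (- \<kappa> * r)) / r ^ 3"
   using r0 by (simp add: field_simps eval_nat_numeral)
  also have "\<dots> \<le> 1 / r ^ 3" using \<open>(1 + \<kappa> * r) * exp (- \<kappa> * r) \<le> 1\<close> r0 by (intro divide_right_mono) auto
  finally show ?thesis .
 qed
 have xb: "\<bar>x \<bullet> b\<bar> \<le> norm x" using Basis_le_norm[OF b] by simp
 have "\<bar>pd b (Yr \<kappa> e) x\<bar> = exp (- \<kappa> * r) * (\<kappa> / r ^ 2 + 1 / r ^ 3) * \<bar>x \<bullet> b\<bar> / c5"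
  using c5_pos r0 assms(1) by (simp add: pd_Yr[OF assms(2) b] r_def[symmetric] abs_mult)
 also have "\<dots> \<le> (1 / r ^ 3) * norm x / c5"
  using c5_pos r0 assms(1) by (intro divide_right_mono mult_mono E xb) auto
 also have "\<dots> \<le> (1 / (norm x) ^ 3) * norm x / c5"
  using c5_pos r x0 by (intro divide_right_mono mult_right_mono divide_left_mono power_mono) (auto simp: r0)
 also have "\<dots> = 1 / (c5 * (norm x)\<^sup>2)" using x0 by (simp add: power2_eq_square power3_eq_cube)
 finally show ?thesis .
qed

lemma integrable_test_over_norm2:
 fixes \<theta> :: "R3 \<Rightarrow> real"
 assumes "test \<theta>"
 shows "integrable lborel (\<lambda>y. \<bar>\<theta> y\<bar> / (norm y)\<^sup>2)" "integrable lborel (\<lambda>y. \<bar>\<theta> y\<bar> / norm y)"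
proof -
 obtain B where B: "B > 0" "\<And>x. \<bar>\<theta> x\<bar> \<le> B" using test_bounded[OF assms] by blast
 note [measurable] = test_measurable[OF assms]
 have I: "integrable lborel (\<lambda>y. B * (indicator (ball 0 1) y / (norm y)\<^sup>2) + \<bar>\<theta> y\<bar>)"
  by (intro Bochner_Integration.integrable_add integrable_mult_right integrable_inverse_square_ball integrable_abs test_integrable assms)
 have b: "\<bar>\<theta> y\<bar> / (norm y)\<^sup>2 \<le> B * (indicator (ball 0 1) y / (norm y)\<^sup>2) + \<bar>\<theta> y\<bar> \<and>
   \<bar>\<theta> y\<bar> / norm y \<le> B * (indicator (ball 0 1) y / (norm y)\<^sup>2) + \<bar>\<theta> y\<bar>" for y
 proof (cases "norm y < 1")
  case True
  have "\<bar>\<theta> y\<bar> / (norm y)\<^sup>2 \<le> B / (norm y)\<^sup>2" using B by (intro divide_right_mono) auto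
  moreover have "\<bar>\<theta> y\<bar> / norm y \<le> B / (norm y)\<^sup>2"
  proof (cases "y = 0")
   case False
   have "(norm y)\<^sup>2 \<le> norm y" using True by (simp add: power2_eq_square mult_left_le)
   then show ?thesis using B False by (intro frac_le) auto
  qed simp
  ultimately show ?thesis using True by (simp add: add_increasing2)
 next
  case False
  have n1: "1 \<le> norm y" using False by simp
  have n2: "1 \<le> (norm y)\<^sup>2" by (rule one_le_power[OF n1])
  have "\<bar>\<theta> y\<bar> / (norm y)\<^sup>2 \<le> \<bar>\<theta> y\<bar> / 1" "\<bar>\<theta> y\<bar> / norm y \<le> \<bar>\<theta> y\<bar> / 1" using n1 n2 by (intro frac_le; simp)+
  then show ?thesis using False by simp
 qed
 show "integrable lborel (\<lambda>y. \<bar>\<theta> y\<bar> / (norm y)\<^sup>2)" 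
  by (rule Bochner_Integration.integrable_bound[OF I]) (simp_all only: real_norm_def abs_divide abs_abs abs_power2 abs_norm_cancel, (measurable)?, intro always_eventually allI order_trans[OF conjunct1[OF b] abs_ge_self])
 show "integrable lborel (\<lambda>y. \<bar>\<theta> y\<bar> / norm y)"
  by (rule Bochner_Integration.integrable_bound[OF I]) (simp_all only: real_norm_def abs_divide abs_abs abs_power2 abs_norm_cancel, (measurable)?, intro always_eventually allI order_trans[OF conjunct2[OF b] abs_ge_self])
qed

lemma sqrt_scale: "e > 0 \<Longrightarrow> sqrt ((norm (e *\<^sub>R y))\<^sup>2 + e\<^sup>2) = e * sqrt (1 + (norm y)\<^sup>2)" for e :: real
proof -
 assume e: "e > 0"
 have "(norm (e *\<^sub>R y))\<^sup>2 + e\<^sup>2 = e\<^sup>2 * (1 + (norm y)\<^sup>2)" by (simp add: power_mult_distrib algebra_simps)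
 then show ?thesis using e by (simp add: real_sqrt_mult)
qed

lemma Yr_tendsto:
 assumes "x \<noteq> 0" and h: "h \<longlonglongrightarrow> 0"
 shows "(\<lambda>n. Yr \<kappa> (h n) x) \<longlonglongrightarrow> Y \<kappa> x"
proof -
 have "(\<lambda>n. Yr \<kappa> (h n) x) \<longlonglongrightarrow> exp (- \<kappa> * sqrt ((norm x)\<^sup>2 + 0\<^sup>2)) / (c5 * sqrt ((norm x)\<^sup>2 + 0\<^sup>2))"
  unfolding Yr_def using c5_pos assms by (intro tendsto_intros h) auto
 then show ?thesis by (simp add: Y_def)
qed

text \<open>The regularised kernels satisfy the resolvent equation up to an approximate identity,
 whose total mass is normalised by \<open>c5\<close>.\<close>

lemma Y_fundamental:
 fixes \<theta> :: "R3 \<Rightarrow> real"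
 assumes \<kappa>: "\<kappa> > 0" and \<theta>: "test \<theta>"
 shows "(LBINT y. Y \<kappa> y * (\<kappa>\<^sup>2 * \<theta> y - lap \<theta> y)) = \<theta> 0"
proof -
 define h where "h n = inverse (real (Suc n))" for n
 have h: "h n > 0" "h n \<le> 1" for n by (auto simp: h_def inverse_eq_divide)
 have h0: "h \<longlonglongrightarrow> 0" unfolding h_def by (rule LIMSEQ_inverse_real_of_nat)
 define \<eta> where "\<eta> y = \<kappa>\<^sup>2 * \<theta> y - lap \<theta> y" for y
 have \<eta>: "test \<eta>" unfolding \<eta>_def by (intro test_diff test_cmult test_lap \<theta>)
 note [measurable] = test_measurable[OF \<theta>] test_measurable[OF \<eta>]
  smooth_measurable[OF Yr_smooth]
 obtain B where B: "B > 0" "\<And>x. \<bar>\<theta> x\<bar> \<le> B" using test_bounded[OF \<theta>] by blast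
 have 1: "(\<lambda>n. LBINT y. Yr \<kappa> (h n) y * \<eta> y) \<longlonglongrightarrow> (LBINT y. Y \<kappa> y * \<eta> y)"
 proof (rule integral_dominated_convergence)
  show "integrable lborel (\<lambda>y. (\<bar>\<eta> y\<bar> / norm y) / c5)"
   by (intro integrable_divide_zero integrable_test_over_norm2 \<eta>)
  show "AE y in lborel. (\<lambda>n. Yr \<kappa> (h n) y * \<eta> y) \<longlonglongrightarrow> Y \<kappa> y * \<eta> y"
   using AE_nonzero[of 0] by eventually_elim (intro tendsto_intros Yr_tendsto h0)
  show "AE y in lborel. norm (Yr \<kappa> (h n) y * \<eta> y) \<le> (\<bar>\<eta> y\<bar> / norm y) / c5" for n
   using AE_nonzero[of 0]
  proof eventually_elim
   case (elim y)
   show ?case using mult_right_mono[OF Yr_le[OF less_imp_le[OF \<kappa>] elim, of "h n"], of "\<bar>\<eta> y\<bar>"] Yr_nonneg[of \<kappa> "h n" y]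
    by (simp add: abs_mult mult_ac)
  qed
  show "(\<lambda>y. Yr \<kappa> (h n) y * \<eta> y) \<in> borel_measurable lborel" for n
   using smooth_measurable[OF Yr_smooth[of "h n"]] h(1)[of n] by auto
 qed measurable
 \<comment> \<open>The rescaled residual of \<open>lap_Yr\<close>, including the Jacobian h^3. As h
   tends to 0 only its last summand survives, 3 (1 + |y|^2)^(-5/2) / \<open>c5\<close>, whose
   integral is 1.\<close>
 define q where "q n y = exp (- \<kappa> * h n * sqrt (1 + (norm y)\<^sup>2)) *
   ((\<kappa> * h n)\<^sup>2 / sqrt (1 + (norm y)\<^sup>2) ^ 3 + 3 * (\<kappa> * h n) / sqrt (1 + (norm y)\<^sup>2) ^ 4 + 3 / sqrt (1 + (norm y)\<^sup>2) ^ 5) / c5" for n and y :: R3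
 have 2: "(LBINT y. Yr \<kappa> (h n) y * \<eta> y) = (LBINT y. q n y * \<theta> (h n *\<^sub>R y))" for n
 proof -
  have hn: "h n \<noteq> 0" using h[of n] by simp
  note Ys = Yr_smooth[OF hn, of \<kappa>]
  have "(LBINT y. Yr \<kappa> (h n) y * \<eta> y) = (LBINT y. \<kappa>\<^sup>2 * (Yr \<kappa> (h n) y * \<theta> y) - Yr \<kappa> (h n) y * lap \<theta> y)"
   by (simp add: \<eta>_def algebra_simps)
  also have "\<dots> = \<kappa>\<^sup>2 * (LBINT y. Yr \<kappa> (h n) y * \<theta> y) - (LBINT y. lap (Yr \<kappa> (h n)) y * \<theta> y)"
   by (subst Bochner_Integration.integral_diff)
     (auto intro!: integrable_mult_right test_integrable test_mult Ys \<theta> test_lap simp: ibp_lap[OF Ys \<theta>])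
  also have "\<dots> = (LBINT y. \<kappa>\<^sup>2 * (Yr \<kappa> (h n) y * \<theta> y) - lap (Yr \<kappa> (h n)) y * \<theta> y)"
   by (subst Bochner_Integration.integral_diff)
     (auto intro!: integrable_mult_right test_integrable test_mult Ys \<theta> smooth_lap)
  also have "\<dots> = (LBINT y. (\<kappa>\<^sup>2 * Yr \<kappa> (h n) y - lap (Yr \<kappa> (h n)) y) * \<theta> y)"
   by (simp add: algebra_simps)
  also have "\<dots> = h n ^ 3 * (LBINT y. (\<kappa>\<^sup>2 * Yr \<kappa> (h n) (h n *\<^sub>R y) - lap (Yr \<kappa> (h n)) (h n *\<^sub>R y)) * \<theta> (h n *\<^sub>R y))"
   using lborel_integral_affine[of "\<lambda>y. (\<kappa>\<^sup>2 * Yr \<kappa> (h n) y - lap (Yr \<kappa> (h n)) y) * \<theta> y" "h n" 0] hn h(1)[of n]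
    smooth_measurable[OF Ys] smooth_measurable[OF smooth_lap[OF Ys]]
   by simp
  also have "\<dots> = (LBINT y. h n ^ 3 * ((\<kappa>\<^sup>2 * Yr \<kappa> (h n) (h n *\<^sub>R y) - lap (Yr \<kappa> (h n)) (h n *\<^sub>R y)) * \<theta> (h n *\<^sub>R y)))"
   by simp
  also have "\<dots> = (LBINT y. q n y * \<theta> (h n *\<^sub>R y))"
  proof (rule Bochner_Integration.integral_cong[OF refl])
   fix y :: R3
   define r where "r = sqrt (1 + (norm y)\<^sup>2)"
   have r: "r > 0" using one_plus_norm2_pos[of y] by (simp add: r_def)
   have "h n ^ 3 * (\<kappa>\<^sup>2 * Yr \<kappa> (h n) (h n *\<^sub>R y) - lap (Yr \<kappa> (h n)) (h n *\<^sub>R y)) = q n y"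
    unfolding lap_Yr[OF hn] sqrt_scale[OF h(1)] q_def r_def[symmetric]
    using h(1)[of n] r c5_pos by (simp add: field_simps) (simp add: eval_nat_numeral algebra_simps)
   then show "h n ^ 3 * ((\<kappa>\<^sup>2 * Yr \<kappa> (h n) (h n *\<^sub>R y) - lap (Yr \<kappa> (h n)) (h n *\<^sub>R y)) * \<theta> (h n *\<^sub>R y)) = q n y * \<theta> (h n *\<^sub>R y)"
    by (simp add: mult.assoc[symmetric])
  qed
  finally show ?thesis .
 qed
 have qb: "0 \<le> q n y \<and> q n y \<le> (4 * \<kappa> + 3) / c5 * (1 / (1 + (norm y)\<^sup>2)\<^sup>2)" for n y
 proof -
  define r where "r = sqrt (1 + (norm y)\<^sup>2)"
  have r: "r \<ge> 1" "r\<^sup>2 = 1 + (norm y)\<^sup>2" by (auto simp: r_def)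
  define t where "t = \<kappa> * h n"
  have t: "t > 0" "t \<le> \<kappa>" using \<kappa> h[of n] by (auto simp: t_def)
  define E where "E = exp (- \<kappa> * h n * r)"
  have E: "E > 0" "E \<le> 1" using t r by (auto simp: E_def t_def mult.assoc[symmetric])
  have Et: "E * (t * r) \<le> 1"
  proof -
   have "t * r \<le> exp (t * r)" using exp_ge_add_one_self[of "t * r"] by linarith
   moreover have "E = 1 / exp (t * r)" by (simp add: E_def t_def exp_minus inverse_eq_divide mult.assoc)
   ultimately show ?thesis by simp
  qed
  \<comment> \<open>Without the exponential this summand decays only like r^(-3), which is not
    integrable; E (t r) \<le> 1 buys one more power of r.\<close>
  have a: "E * (t\<^sup>2 / r ^ 3) \<le> \<kappa> * (1 / r ^ 4)"
  proof -
   have "E * (t\<^sup>2 / r ^ 3) = (E * (t * r)) * (t / r ^ 4)"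
    using r(1) by (simp add: field_simps eval_nat_numeral)
   also have "\<dots> \<le> 1 * (\<kappa> / r ^ 4)" using Et t r E by (intro mult_mono divide_right_mono) auto
   finally show ?thesis by simp
  qed
  have b: "E * (3 * t / r ^ 4) \<le> 3 * \<kappa> * (1 / r ^ 4)"
  proof -
   have "E * (3 * t / r ^ 4) \<le> 1 * (3 * \<kappa> / r ^ 4)" using E t r by (intro mult_mono divide_right_mono) auto
   then show ?thesis by simp
  qed
  have c: "E * (3 / r ^ 5) \<le> 3 * (1 / r ^ 4)"
  proof -
   have "r ^ 4 \<le> r ^ 5" using r(1) by (intro power_increasing) auto
   then have "3 / r ^ 5 \<le> 3 / r ^ 4" using r(1) by (intro divide_left_mono) auto
   then have "E * (3 / r ^ 5) \<le> 1 * (3 / r ^ 4)" using E r by (intro mult_mono) auto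
   then show ?thesis by simp
  qed
  have qe: "q n y = (E * (t\<^sup>2 / r ^ 3) + E * (3 * t / r ^ 4) + E * (3 / r ^ 5)) / c5"
   unfolding q_def r_def[symmetric] E_def t_def by (simp add: algebra_simps add_divide_distrib)
  have "q n y \<le> (\<kappa> * (1 / r ^ 4) + 3 * \<kappa> * (1 / r ^ 4) + 3 * (1 / r ^ 4)) / c5"
   unfolding qe using c5_pos by (intro divide_right_mono add_mono a b c) auto
  also have "\<dots> = (4 * \<kappa> + 3) / c5 * (1 / (r\<^sup>2)\<^sup>2)"
   by (simp add: algebra_simps add_divide_distrib flip: power_mult)
  finally have "q n y \<le> (4 * \<kappa> + 3) / c5 * (1 / (1 + (norm y)\<^sup>2)\<^sup>2)" by (simp add: r(2))
  moreover have "q n y \<ge> 0" unfolding qe using c5_pos E t r by (intro divide_nonneg_nonneg add_nonneg_nonneg mult_nonneg_nonneg) auto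
  ultimately show ?thesis by simp
 qed
 have 3: "(\<lambda>n. LBINT y. q n y * \<theta> (h n *\<^sub>R y)) \<longlonglongrightarrow> (LBINT y. 3 / sqrt (1 + (norm (y::R3))\<^sup>2) ^ 5 / c5 * \<theta> 0)"
 proof (rule integral_dominated_convergence)
  show "integrable lborel (\<lambda>y::R3. (4 * \<kappa> + 3) / c5 * (1 / (1 + (norm y)\<^sup>2)\<^sup>2) * B)"
   by (intro integrable_mult_left integrable_mult_right integrable_japanese)
  show "AE y in lborel. norm (q n y * \<theta> (h n *\<^sub>R y)) \<le> (4 * \<kappa> + 3) / c5 * (1 / (1 + (norm y)\<^sup>2)\<^sup>2) * B" for n
  proof (intro always_eventually allI)
   fix y :: R3
   have "\<bar>q n y\<bar> * \<bar>\<theta> (h n *\<^sub>R y)\<bar> \<le> ((4 * \<kappa> + 3) / c5 * (1 / (1 + (norm y)\<^sup>2)\<^sup>2)) * B"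
    using qb[of n y] B by (intro mult_mono) auto
   then show "norm (q n y * \<theta> (h n *\<^sub>R y)) \<le> (4 * \<kappa> + 3) / c5 * (1 / (1 + (norm y)\<^sup>2)\<^sup>2) * B"
    by (simp add: abs_mult)
  qed
  show "AE y in lborel. (\<lambda>n. q n y * \<theta> (h n *\<^sub>R y)) \<longlonglongrightarrow> 3 / sqrt (1 + (norm (y::R3))\<^sup>2) ^ 5 / c5 * \<theta> 0"
  proof (intro always_eventually allI)
   fix y :: R3
   have s: "sqrt (1 + (norm y)\<^sup>2) \<noteq> 0" using one_plus_norm2_pos[of y] by simp
   have "(\<lambda>n. q n y) \<longlonglongrightarrow> exp (- \<kappa> * 0 * sqrt (1 + (norm y)\<^sup>2)) *
     ((\<kappa> * 0)\<^sup>2 / sqrt (1 + (norm y)\<^sup>2) ^ 3 + 3 * (\<kappa> * 0) / sqrt (1 + (norm y)\<^sup>2) ^ 4 + 3 / sqrt (1 + (norm y)\<^sup>2) ^ 5) / c5"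
    unfolding q_def using c5_pos s by (intro tendsto_intros h0) auto
   moreover have "(\<lambda>n. \<theta> (h n *\<^sub>R y)) \<longlonglongrightarrow> \<theta> (0 *\<^sub>R y)"
   proof (rule isCont_tendsto_compose[of "0 *\<^sub>R y" \<theta>])
    show "isCont \<theta> (0 *\<^sub>R y)" using smooth_continuous[OF test_smooth[OF \<theta>], of UNIV]
     by (simp add: continuous_on_eq_continuous_at)
    show "(\<lambda>n. h n *\<^sub>R y) \<longlonglongrightarrow> 0 *\<^sub>R y" by (intro tendsto_intros h0)
   qed
   ultimately have "(\<lambda>n. q n y * \<theta> (h n *\<^sub>R y)) \<longlonglongrightarrow> exp (- \<kappa> * 0 * sqrt (1 + (norm y)\<^sup>2)) *
     ((\<kappa> * 0)\<^sup>2 / sqrt (1 + (norm y)\<^sup>2) ^ 3 + 3 * (\<kappa> * 0) / sqrt (1 + (norm y)\<^sup>2) ^ 4 + 3 / sqrt (1 + (norm y)\<^sup>2) ^ 5) / c5 * \<theta> (0 *\<^sub>R y)"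
    by (rule tendsto_mult)
   then show "(\<lambda>n. q n y * \<theta> (h n *\<^sub>R y)) \<longlonglongrightarrow> 3 / sqrt (1 + (norm (y::R3))\<^sup>2) ^ 5 / c5 * \<theta> 0" by simp
  qed
  show "(\<lambda>y. q n y * \<theta> (h n *\<^sub>R y)) \<in> borel_measurable lborel" for n
   unfolding q_def by measurable
 qed measurable
 have "(LBINT y. 3 / sqrt (1 + (norm (y::R3))\<^sup>2) ^ 5 / c5 * \<theta> 0) = \<theta> 0"
 proof -
  have "(LBINT y. 3 / sqrt (1 + (norm (y::R3))\<^sup>2) ^ 5 / c5 * \<theta> 0) = (LBINT y. 3 / sqrt (1 + (norm (y::R3))\<^sup>2) ^ 5) * (\<theta> 0 / c5)"
   by (subst integral_mult_left_zero[symmetric]) simp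
  also have "\<dots> = \<theta> 0" using c5_pos unfolding c5_def[symmetric] by simp
  finally show ?thesis .
 qed
 with 3 have "(\<lambda>n. LBINT y. Yr \<kappa> (h n) y * \<eta> y) \<longlonglongrightarrow> \<theta> 0" by (simp only: 2)
 from LIMSEQ_unique[OF 1 this] show ?thesis by (simp only: \<eta>_def)
qed

section \<open>Convolution with the Yukawa kernel\<close>

lemma loc_Y: "\<kappa> > 0 \<Longrightarrow> set_integrable lborel (cball 0 r) (Y \<kappa>)"
 by (rule integrable_set_integrable[OF Y_integrable(1)])

lemma cv_Y_eq: "test \<phi> \<Longrightarrow> cv (Y \<kappa>) \<phi> = cv \<phi> (Y \<kappa>)"
 by (rule cv_commute) (auto intro: smooth_measurable test_smooth)

lemma cv_Y_smooth: "\<kappa> > 0 \<Longrightarrow> test \<phi> \<Longrightarrow> smooth (cv (Y \<kappa>) \<phi>)"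
 unfolding cv_Y_eq by (rule cv_smooth[OF _ loc_Y]) auto

lemma pd_cv_Y: "\<kappa> > 0 \<Longrightarrow> test \<phi> \<Longrightarrow> b \<in> Basis \<Longrightarrow> pd b (cv (Y \<kappa>) \<phi>) = cv (Y \<kappa>) (pd b \<phi>)"
 by (simp add: cv_Y_eq test_pd pd_cv[OF _ loc_Y])

lemma partials_cv_Y:
 "\<kappa> > 0 \<Longrightarrow> test \<phi> \<Longrightarrow> bs \<in> lists Basis \<Longrightarrow> partials bs (cv (Y \<kappa>) \<phi>) = cv (Y \<kappa>) (partials bs \<phi>)"
 by (induction bs) (auto simp: pd_cv_Y test_partials)

lemma cv_Y_L2:
 fixes g :: "R3 \<Rightarrow> 'b::{banach,second_countable_topology}"
 assumes "\<kappa> > 0" "g \<in> L2" shows "cv (Y \<kappa>) g \<in> L2" "n2 (cv (Y \<kappa>) g) \<le> (LBINT x. Y \<kappa> x) * n2 g"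
 using young(2,3)[OF Y_integrable[OF assms(1)] assms(2)] by auto

text \<open>The second identity is \<open>Y_fundamental\<close> for the reflected test function; the
  first follows because the Laplacian may act on the factor \<phi> of the convolution.\<close>

lemma lap_cv_Y:
 assumes \<kappa>: "\<kappa> > 0" and \<phi>: "test \<phi>"
 shows "\<kappa>\<^sup>2 * cv (Y \<kappa>) \<phi> x - lap (cv (Y \<kappa>) \<phi>) x = \<phi> x"
  and "cv (Y \<kappa>) (\<lambda>x. \<kappa>\<^sup>2 * \<phi> x - lap \<phi> x) x = \<phi> x"
proof -
 have I: "integrable lborel (\<lambda>y. Y \<kappa> y * \<psi> (x - y))" if "test \<psi>" for \<psi>
  using L2_prod_integrable(1)[OF Y_integrable(2)[OF \<kappa>] test_L2[OF test_reflect[OF that]]] .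
 have C: "cv (Y \<kappa>) \<psi> x = (LBINT y. Y \<kappa> y * \<psi> (x - y))" if "test \<psi>" for \<psi>
  unfolding cv_Y_eq[OF that] by (simp add: cv_def mult.commute)
 have \<theta>: "test (\<lambda>y. \<phi> (x - y))" by (rule test_reflect[OF \<phi>])
 have t: "test (\<lambda>x. \<kappa>\<^sup>2 * \<phi> x - lap \<phi> x)" by (intro test_diff test_cmult test_lap \<phi>)
 show 2: "cv (Y \<kappa>) (\<lambda>x. \<kappa>\<^sup>2 * \<phi> x - lap \<phi> x) x = \<phi> x"
  using Y_fundamental[OF \<kappa> \<theta>] by (simp add: C[OF t] lap_reflect[OF test_smooth[OF \<phi>]])
 have "lap (cv (Y \<kappa>) \<phi>) x = (\<Sum>b\<in>Basis. cv (Y \<kappa>) (pd b (pd b \<phi>)) x)"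
  by (simp add: lap_def pd_cv_Y \<kappa> \<phi> test_pd)
 also have "\<dots> = (LBINT y. (\<Sum>b\<in>Basis. Y \<kappa> y * pd b (pd b \<phi>) (x - y)))"
  by (subst Bochner_Integration.integral_sum) (auto intro!: I test_pd \<phi> simp: C test_pd \<phi>)
 also have "\<dots> = cv (Y \<kappa>) (lap \<phi>) x"
  by (simp add: C test_lap \<phi> lap_def sum_distrib_left)
 finally have L: "lap (cv (Y \<kappa>) \<phi>) x = cv (Y \<kappa>) (lap \<phi>) x" .
 have "cv (Y \<kappa>) (\<lambda>x. \<kappa>\<^sup>2 * \<phi> x - lap \<phi> x) x = \<kappa>\<^sup>2 * cv (Y \<kappa>) \<phi> x - cv (Y \<kappa>) (lap \<phi>) x"
  using cv_diff[OF Y_integrable[OF \<kappa>] test_L2[OF test_cmult[OF \<phi>]] test_L2[OF test_lap[OF \<phi>]], of "\<kappa>\<^sup>2" x]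
   cv_cmult[of "Y \<kappa>" "\<kappa>\<^sup>2" \<phi> x] by simp
 then show "\<kappa>\<^sup>2 * cv (Y \<kappa>) \<phi> x - lap (cv (Y \<kappa>) \<phi>) x = \<phi> x" using 2 L by simp
qed

text \<open>The derivative is moved from \<phi> to the regularised kernel, so the bound involves the
  size of \<phi> and not its derivatives. The sources of the approximate resonances are controlled
  pointwise, but their derivatives are not.\<close>

lemma pd_cv_Y_le:
 assumes \<kappa>: "\<kappa> > 0" and \<phi>: "test \<phi>" and b: "b \<in> Basis"
 shows "\<bar>pd b (cv (Y \<kappa>) \<phi>) x\<bar> \<le> (LBINT y. \<bar>\<phi> (x - y)\<bar> / (norm y)\<^sup>2) / c5"
proof -
 define h where "h n = inverse (real (Suc n))" for n
 have h: "h n \<noteq> 0" for n by (auto simp: h_def)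
 have h0: "h \<longlonglongrightarrow> 0" unfolding h_def by (rule LIMSEQ_inverse_real_of_nat)
 define \<theta> where "\<theta> y = \<phi> (x - y)" for y
 have \<theta>: "test \<theta>" unfolding \<theta>_def by (rule test_reflect[OF \<phi>])
 define \<eta> where "\<eta> y = pd b \<phi> (x - y)" for y
 have \<eta>: "test \<eta>" unfolding \<eta>_def by (rule test_reflect[OF test_pd[OF \<phi> b]])
 have \<theta>\<eta>: "pd b \<theta> y = - \<eta> y" for y
  unfolding \<theta>_def \<eta>_def by (rule pd_reflect[OF test_smooth[OF \<phi>]])
 note [measurable] = test_measurable[OF \<theta>] test_measurable[OF \<eta>]
 have "pd b (cv (Y \<kappa>) \<phi>) x = (LBINT y. Y \<kappa> y * \<eta> y)"
  by (simp add: pd_cv_Y[OF \<kappa> \<phi> b] cv_Y_eq[OF test_pd[OF \<phi> b]] cv_def \<eta>_def mult.commute)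
 moreover have "(\<lambda>n. LBINT y. Yr \<kappa> (h n) y * \<eta> y) \<longlonglongrightarrow> (LBINT y. Y \<kappa> y * \<eta> y)"
 proof (rule integral_dominated_convergence)
  show "integrable lborel (\<lambda>y. (\<bar>\<eta> y\<bar> / norm y) / c5)"
   by (intro integrable_divide_zero integrable_test_over_norm2 \<eta>)
  show "AE y in lborel. (\<lambda>n. Yr \<kappa> (h n) y * \<eta> y) \<longlonglongrightarrow> Y \<kappa> y * \<eta> y"
   using AE_nonzero[of 0] by eventually_elim (intro tendsto_intros Yr_tendsto h0)
  show "AE y in lborel. norm (Yr \<kappa> (h n) y * \<eta> y) \<le> (\<bar>\<eta> y\<bar> / norm y) / c5" for n
   using AE_nonzero[of 0]
  proof eventually_elim
   case (elim y)
   show ?case using mult_right_mono[OF Yr_le[OF less_imp_le[OF \<kappa>] elim, of "h n"], of "\<bar>\<eta> y\<bar>"] Yr_nonneg[of \<kappa> "h n" y]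
    by (simp add: abs_mult mult_ac)
  qed
  show "(\<lambda>y. Yr \<kappa> (h n) y * \<eta> y) \<in> borel_measurable lborel" for n
   using smooth_measurable[OF Yr_smooth[OF h[of n]]] by auto
 qed measurable
 moreover have "\<bar>LBINT y. Yr \<kappa> (h n) y * \<eta> y\<bar> \<le> (LBINT y. \<bar>\<theta> y\<bar> / (norm y)\<^sup>2) / c5" for n
 proof -
  note Ys = Yr_smooth[OF h[of n], of \<kappa>]
  have "(LBINT y. Yr \<kappa> (h n) y * \<eta> y) = - (LBINT y. Yr \<kappa> (h n) y * pd b \<theta> y)"
   by (simp add: \<theta>\<eta>)
  also have "\<dots> = (LBINT y. pd b (Yr \<kappa> (h n)) y * \<theta> y)"
   using ibp_test[OF Ys \<theta> b] by simp
  also have "norm \<dots> \<le> (LBINT y. (\<bar>\<theta> y\<bar> / (norm y)\<^sup>2) / c5)"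
  proof (rule order_trans[OF integral_norm_bound integral_mono_AE])
   show "integrable lborel (\<lambda>y. norm (pd b (Yr \<kappa> (h n)) y * \<theta> y))"
    by (intro integrable_norm test_integrable test_mult smooth_pd Ys b \<theta>)
   show "integrable lborel (\<lambda>y. \<bar>\<theta> y\<bar> / (norm y)\<^sup>2 / c5)"
    by (intro integrable_divide_zero integrable_test_over_norm2 \<theta>)
   show "AE y in lborel. norm (pd b (Yr \<kappa> (h n)) y * \<theta> y) \<le> \<bar>\<theta> y\<bar> / (norm y)\<^sup>2 / c5"
    using AE_nonzero[of 0]
   proof eventually_elim
    case (elim y)
    show ?case using mult_right_mono[OF pd_Yr_le[OF less_imp_le[OF \<kappa>] h[of n] elim b], of "\<bar>\<theta> y\<bar>"]
     by (simp add: abs_mult mult_ac)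
   qed
  qed
  also have "(LBINT y. (\<bar>\<theta> y\<bar> / (norm y)\<^sup>2) / c5) = (LBINT y. \<bar>\<theta> y\<bar> / (norm y)\<^sup>2) / c5"
   by (rule integral_divide_zero)
  finally show ?thesis by simp
 qed
 ultimately show ?thesis
  unfolding \<theta>_def[symmetric] by (intro LIMSEQ_le_const2[OF tendsto_rabs]) auto
qed

section \<open>The free resolvent\<close>

text \<open>The outermost derivative is moved first and ends up innermost on \<open>f\<close>,
  whence the reversed list.\<close>

lemma ibp_partials:
 assumes "smooth f" "test \<phi>" "bs \<in> lists Basis"
 shows "(LBINT x. partials bs \<phi> x * f x) = (-1) ^ length bs * (LBINT x. \<phi> x * partials (rev bs) f x)"
 using assms(3,1)
proof (induction bs arbitrary: f)
 case (Cons b bs)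
 have "(LBINT x. partials (b # bs) \<phi> x * f x) = (LBINT x. f x * pd b (partials bs \<phi>) x)"
  by (simp add: mult.commute)
 also have "\<dots> = - (LBINT x. pd b f x * partials bs \<phi> x)"
  using ibp_test[OF Cons.prems test_partials[OF assms(2)], of bs b] Cons.hyps by simp
 also have "\<dots> = - (LBINT x. partials bs \<phi> x * pd b f x)" by (simp add: mult.commute)
 also have "\<dots> = - ((-1) ^ length bs * (LBINT x. \<phi> x * partials (rev bs) (pd b f) x))"
  using Cons.IH[OF smooth_pd[OF Cons.prems]] Cons.hyps by simp
 finally show ?case by (simp add: partials_snoc)
qed simp

lemma partials_diff:
 "smooth f \<Longrightarrow> smooth g \<Longrightarrow> bs \<in> lists Basis \<Longrightarrow> partials bs (\<lambda>x. f x - g x) = (\<lambda>x. partials bs f x - partials bs g x)"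
proof (induction bs)
 case (Cons b bs)
 then show ?case by (auto simp: pd_diff[OF smooth_partials smooth_partials])
qed simp

text \<open>Two integrations by parts turn the squared norm of a mixed second derivative of h = Y *
  \<phi> into the integral of the product of the two pure second derivatives. Summed over both
  directions this is the squared norm of \<Delta>h = \<kappa>^2 h - \<phi>. First derivatives are
  interpolated between \<open>h\<close> and the second ones.\<close>

lemma cv_Y_H2_bound:
 assumes \<kappa>: "\<kappa> > 0"
 obtains C where "\<And>\<phi> bs. test \<phi> \<Longrightarrow> bs \<in> lists Basis \<Longrightarrow> length bs \<le> 2 \<Longrightarrow>
  n2 (cv (Y \<kappa>) (partials bs \<phi>)) \<le> C * n2 \<phi>"
proof -
 define K where "K = (LBINT x. Y \<kappa> x)"
 have K0: "K \<ge> 0" unfolding K_def by (intro Bochner_Integration.integral_nonneg) simp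
 define C2 where "C2 = \<kappa>\<^sup>2 * K + 1"
 have C20: "C2 \<ge> 0" using K0 by (simp add: C2_def)
 have main: "n2 (cv (Y \<kappa>) (partials bs \<phi>)) \<le> (K + C2) * n2 \<phi>"
  if \<phi>: "test \<phi>" and bs: "bs \<in> lists Basis" "length bs \<le> 2" for \<phi> bs
 proof -
  define h where "h = cv (Y \<kappa>) \<phi>"
  have sm: "smooth h" unfolding h_def by (rule cv_Y_smooth[OF \<kappa> \<phi>])
  have L: "partials cs h \<in> L2" if "cs \<in> lists Basis" for cs
   unfolding h_def partials_cv_Y[OF \<kappa> \<phi> that] by (intro cv_Y_L2 \<kappa> test_L2 test_partials \<phi> that)
  have L0: "h \<in> L2" using L[of "[]"] by simp
  have L1: "pd b h \<in> L2" if "b \<in> Basis" for b using L[of "[b]"] that by simp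
  have L2': "pd b (pd c h) \<in> L2" if "b \<in> Basis" "c \<in> Basis" for b c using L[of "[b, c]"] that by simp
  have L3: "pd b (pd c (pd d h)) \<in> L2" if "b \<in> Basis" "c \<in> Basis" "d \<in> Basis" for b c d using L[of "[b, c, d]"] that by simp
  have P: "integrable lborel (\<lambda>x. f x * g x)" if "f \<in> L2" "g \<in> L2" for f g :: "R3 \<Rightarrow> real"
   using L2_prod_integrable(1)[OF that] .
  have h0: "n2 h \<le> K * n2 \<phi>" unfolding h_def K_def by (rule cv_Y_L2[OF \<kappa> test_L2[OF \<phi>]])
  have lapL: "lap h \<in> L2" unfolding lap_def[abs_def] by (intro L2_sum L2') auto
  have "lap h = (\<lambda>x. \<kappa>\<^sup>2 *\<^sub>R h x - \<phi> x)"
   using lap_cv_Y(1)[OF \<kappa> \<phi>] by (auto simp: h_def algebra_simps)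
  then have "n2 (lap h) \<le> \<kappa>\<^sup>2 * n2 h + n2 \<phi>"
   using L2_diff(2)[OF L2_scaleR_const(1)[OF L0] test_L2[OF \<phi>], of "\<kappa>\<^sup>2"] L2_scaleR_const(2)[OF L0, of "\<kappa>\<^sup>2"] by simp
  also have "\<dots> \<le> \<kappa>\<^sup>2 * (K * n2 \<phi>) + n2 \<phi>" using h0 by (intro add_mono mult_left_mono) auto
  finally have lap: "n2 (lap h) \<le> C2 * n2 \<phi>" by (simp add: C2_def algebra_simps)
  have mixed: "(n2 (pd b (pd c h)))\<^sup>2 = (LBINT x. pd c (pd c h) x * pd b (pd b h) x)"
   if b: "b \<in> Basis" and c: "c \<in> Basis" for b c
  proof -
   have "(n2 (pd b (pd c h)))\<^sup>2 = (LBINT x. pd b (pd c h) x * pd b (pd c h) x)"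
    unfolding n2_sq by (simp add: power2_eq_square)
   also have "\<dots> = - (LBINT x. pd c h x * pd b (pd b (pd c h)) x)"
    by (intro ibp smooth_pd sm b c P L1 L2' L3)
   also have "pd b (pd b (pd c h)) = pd c (pd b (pd b h))"
   proof -
    have "pd b (pd c h) = pd c (pd b h)" using pd_commute[OF sm b c] by auto
    moreover have "pd b (pd c (pd b h)) = pd c (pd b (pd b h))" using pd_commute[OF smooth_pd[OF sm b] b c] by auto
    ultimately show ?thesis by simp
   qed
   also have "- (LBINT x. pd c h x * pd c (pd b (pd b h)) x) = (LBINT x. pd c (pd c h) x * pd b (pd b h) x)"
    by (rule ibp[symmetric]) (intro smooth_pd sm b c P L1 L2' L3)+
   finally show ?thesis .
  qed
  have second: "n2 (pd b (pd c h)) \<le> C2 * n2 \<phi>" if b: "b \<in> Basis" and c: "c \<in> Basis" for b c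
  proof -
   have "(n2 (pd b (pd c h)))\<^sup>2 \<le> (\<Sum>c\<in>Basis. (n2 (pd b (pd c h)))\<^sup>2)"
    using c by (intro member_le_sum) auto
   also have "\<dots> \<le> (\<Sum>b\<in>Basis. \<Sum>c\<in>Basis. (n2 (pd b (pd c h)))\<^sup>2)"
    using b by (intro member_le_sum[of b Basis "\<lambda>b. \<Sum>c\<in>Basis. (n2 (pd b (pd c h)))\<^sup>2"] sum_nonneg) auto
   also have "\<dots> = (\<Sum>b\<in>Basis. \<Sum>c\<in>Basis. LBINT x. pd c (pd c h) x * pd b (pd b h) x)"
    by (intro sum.cong refl mixed)
   also have "\<dots> = (LBINT x. (\<Sum>b\<in>Basis. (\<Sum>c\<in>Basis. pd c (pd c h) x * pd b (pd b h) x)))"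
    by (subst Bochner_Integration.integral_sum, (intro Bochner_Integration.integrable_sum P L2'; assumption),
      intro sum.cong refl Bochner_Integration.integral_sum[symmetric] P L2'; assumption)
   also have "\<dots> = (n2 (lap h))\<^sup>2"
    unfolding n2_sq lap_def by (simp add: power2_eq_square sum_product mult.commute)
   also have "\<dots> \<le> (C2 * n2 \<phi>)\<^sup>2" by (intro power_mono lap) auto
   finally show ?thesis by (rule power2_le_imp_le) (use C20 in simp)
  qed
  have first: "n2 (pd b h) \<le> (K + C2) * n2 \<phi>" if b: "b \<in> Basis" for b
  proof -
   have "(n2 (pd b h))\<^sup>2 = (LBINT x. pd b h x * pd b h x)" unfolding n2_sq by (simp add: power2_eq_square)
   also have "\<dots> = - (LBINT x. h x * pd b (pd b h) x)"
    by (intro ibp smooth_pd sm b P L0 L1 L2')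
   also have "\<dots> \<le> n2 h * n2 (pd b (pd b h))"
    using L2_prod_integrable(2)[OF L0 L2'[OF b b]] by simp
   also have "\<dots> \<le> (K * n2 \<phi>) * (C2 * n2 \<phi>)"
    using K0 by (intro mult_mono h0 second b) auto
   also have "\<dots> \<le> ((K + C2) * n2 \<phi>)\<^sup>2"
   proof -
    have "K * C2 \<le> (K + C2)\<^sup>2" using K0 C20 by (simp add: power2_sum add_increasing2 mult_nonneg_nonneg add_increasing)
    then have "K * C2 * (n2 \<phi>)\<^sup>2 \<le> (K + C2)\<^sup>2 * (n2 \<phi>)\<^sup>2" by (intro mult_right_mono) auto
    then show ?thesis by (simp add: power_mult_distrib) (simp add: power2_eq_square mult_ac)
   qed
   finally show ?thesis by (rule power2_le_imp_le) (use K0 C20 in simp)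
  qed
  have le: "K * n2 \<phi> \<le> (K + C2) * n2 \<phi>" "C2 * n2 \<phi> \<le> (K + C2) * n2 \<phi>" using K0 C20 by (auto intro!: mult_right_mono)
  consider "bs = []" | b where "bs = [b]" | b c where "bs = [b, c]"
  proof (cases bs)
   case (Cons b cs)
   then show ?thesis using that bs(2) by (cases cs) auto
  qed (use that in auto)
  then have "n2 (partials bs h) \<le> (K + C2) * n2 \<phi>"
  proof cases
   case 1
   then show ?thesis using h0 le by simp
  next
   case (2 b)
   then show ?thesis using first bs by simp
  next
   case (3 b c)
   then show ?thesis using second[of b c] bs le by simp
  qed
  then show ?thesis unfolding h_def partials_cv_Y[OF \<kappa> \<phi> bs(1)] .
 qed
 show thesis by (rule that[OF main])
qed

text \<open>For test functions \<psi> tending to \<open>g\<close> the second-order bound makes the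
  derivatives of Y * \<psi> a Cauchy sequence; their limit is the weak derivative.\<close>

lemma cv_Y_weak_partial_real:
 fixes g :: "R3 \<Rightarrow> real"
 assumes \<kappa>: "\<kappa> > 0" and g: "g \<in> L2" and bs: "bs \<in> lists Basis" "length bs \<le> 2"
 obtains w where "w \<in> L2"
  "\<And>\<phi>. test \<phi> \<Longrightarrow> (LBINT x. partials bs \<phi> x * cv (Y \<kappa>) g x) = (-1) ^ length bs * (LBINT x. \<phi> x * w x)"
proof -
 obtain C where C: "\<And>\<phi> bs. test \<phi> \<Longrightarrow> bs \<in> lists Basis \<Longrightarrow> length bs \<le> 2 \<Longrightarrow>
  n2 (cv (Y \<kappa>) (partials bs \<phi>)) \<le> C * n2 \<phi>" using cv_Y_H2_bound[OF \<kappa>] by blast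
 obtain \<psi> where \<psi>: "\<And>n. test (\<psi> n)" "(\<lambda>n. n2 (\<lambda>x. \<psi> n x - g x)) \<longlonglongrightarrow> 0"
  using test_seq_L2[OF g] by blast
 note p = test_L2[OF \<psi>(1)]
 have rb: "rev bs \<in> lists Basis" "length (rev bs) \<le> 2" using bs by auto
 define W where "W n = cv (Y \<kappa>) (partials (rev bs) (\<psi> n))" for n
 have W: "W n \<in> L2" for n unfolding W_def by (intro cv_Y_L2 \<kappa> test_L2 test_partials \<psi> rb)
 have Wd: "n2 (\<lambda>x. W m x - W n x) \<le> \<bar>C\<bar> * n2 (\<lambda>x. \<psi> m x - \<psi> n x)" for m n
 proof -
  have "(\<lambda>x. W m x - W n x) = cv (Y \<kappa>) (partials (rev bs) (\<lambda>x. \<psi> m x - \<psi> n x))"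
   unfolding W_def partials_diff[OF test_smooth[OF \<psi>(1)] test_smooth[OF \<psi>(1)] rb(1)]
   using cv_diff[OF Y_integrable[OF \<kappa>] test_L2[OF test_partials[OF \<psi>(1) rb(1)]] test_L2[OF test_partials[OF \<psi>(1) rb(1)]]]
   by auto
  then have "n2 (\<lambda>x. W m x - W n x) \<le> C * n2 (\<lambda>x. \<psi> m x - \<psi> n x)"
   using C[OF test_diff[OF \<psi>(1) \<psi>(1)] rb] by simp
  also have "\<dots> \<le> \<bar>C\<bar> * n2 (\<lambda>x. \<psi> m x - \<psi> n x)" by (intro mult_right_mono) auto
  finally show ?thesis .
 qed
 obtain w where w: "w \<in> L2" "(\<lambda>n. n2 (\<lambda>x. W n x - w x)) \<longlonglongrightarrow> 0"
 proof (rule L2_complete[OF W])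
  fix e :: real assume "e > 0"
  define e' where "e' = e / (2 * (\<bar>C\<bar> + 1))"
  have e': "e' > 0" using \<open>e > 0\<close> by (simp add: e'_def)
  obtain N where N: "\<And>n. n \<ge> N \<Longrightarrow> n2 (\<lambda>x. \<psi> n x - g x) < e'"
   using LIMSEQ_D[OF \<psi>(2) e'] by auto
  have "n2 (\<lambda>x. W m x - W n x) < e" if "m \<ge> N" "n \<ge> N" for m n
  proof -
   have "n2 (\<lambda>x. \<psi> m x - \<psi> n x) \<le> n2 (\<lambda>x. \<psi> m x - g x) + n2 (\<lambda>x. g x - \<psi> n x)"
    by (rule n2_triangle[OF p g p])
   also have "\<dots> \<le> 2 * e'" using N[OF that(1)] N[OF that(2)] n2_commute[of g "\<psi> n"] by linarith
   finally have "\<bar>C\<bar> * n2 (\<lambda>x. \<psi> m x - \<psi> n x) \<le> \<bar>C\<bar> * (2 * e')" by (intro mult_left_mono) auto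
   also have "\<dots> < (\<bar>C\<bar> + 1) * (2 * e')" using e' by simp
   also have "\<dots> = e"
   proof -
    have "\<bar>C\<bar> + 1 \<noteq> 0" by linarith
    then show ?thesis by (simp add: e'_def field_simps)
   qed
   finally show ?thesis using Wd[of m n] by linarith
  qed
  then show "\<exists>N. \<forall>m\<ge>N. \<forall>n\<ge>N. n2 (\<lambda>x. W m x - W n x) < e" by blast
 qed
 show thesis
 proof (rule that[OF w(1)])
  fix \<phi> :: "R3 \<Rightarrow> real" assume \<phi>: "test \<phi>"
  define H where "H n = cv (Y \<kappa>) (\<psi> n)" for n
  have H: "H n \<in> L2" for n unfolding H_def by (intro cv_Y_L2 \<kappa> p)
  note g' = cv_Y_L2(1)[OF \<kappa> g]
  have Hlim: "(\<lambda>n. n2 (\<lambda>x. H n x - cv (Y \<kappa>) g x)) \<longlonglongrightarrow> 0"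
  proof (rule Lim_null_comparison[OF always_eventually])
   show "(\<lambda>n. (LBINT x. Y \<kappa> x) * n2 (\<lambda>x. \<psi> n x - g x)) \<longlonglongrightarrow> 0"
    by (rule tendsto_mult_right_zero[OF \<psi>(2)])
   have "(\<lambda>x. H n x - cv (Y \<kappa>) g x) = cv (Y \<kappa>) (\<lambda>x. \<psi> n x - g x)" for n
    using cv_diff[OF Y_integrable[OF \<kappa>] p g] by (auto simp: H_def)
   then show "\<forall>n. norm (n2 (\<lambda>x. H n x - cv (Y \<kappa>) g x)) \<le> (LBINT x. Y \<kappa> x) * n2 (\<lambda>x. \<psi> n x - g x)"
    using cv_Y_L2(2)[OF \<kappa> L2_diff(1)[OF p g]] by simp
  qed
  have A: "(LBINT x. partials bs \<phi> x * H n x) = (-1) ^ length bs * (LBINT x. \<phi> x * W n x)" for n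
   unfolding H_def W_def ibp_partials[OF cv_Y_smooth[OF \<kappa> \<psi>(1)] \<phi> bs(1)] partials_cv_Y[OF \<kappa> \<psi>(1) rb(1)] ..
  have B: "(\<lambda>n. LBINT x. partials bs \<phi> x * H n x) \<longlonglongrightarrow> (LBINT x. partials bs \<phi> x * cv (Y \<kappa>) g x)"
   using L2_tendsto_integral_const[OF H g' test_L2[OF test_partials[OF \<phi> bs(1)]] Hlim] by simp
  have D: "(\<lambda>n. (-1) ^ length bs * (LBINT x. \<phi> x * W n x)) \<longlonglongrightarrow> (-1) ^ length bs * (LBINT x. \<phi> x * w x)"
   using L2_tendsto_integral_const[OF W w(1) test_L2[OF \<phi>] w(2)] by (intro tendsto_mult_left) simp
  show "(LBINT x. partials bs \<phi> x * cv (Y \<kappa>) g x) = (-1) ^ length bs * (LBINT x. \<phi> x * w x)"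
   by (rule LIMSEQ_unique[OF B[unfolded A] D])
 qed
qed

lemma
 fixes g :: "R3 \<Rightarrow> complex"
 assumes "integrable lborel k" "k \<in> L2" "g \<in> L2"
 shows Re_cv: "Re (cv k g x) = cv k (\<lambda>x. Re (g x)) x" and Im_cv: "Im (cv k g x) = cv k (\<lambda>x. Im (g x)) x"
 using integral_Re[OF young(1)[OF assms, of x]] integral_Im[OF young(1)[OF assms, of x]]
 by (simp_all add: cv_def)

lemma L2_Complex:
 fixes u v :: "'a::euclidean_space \<Rightarrow> real"
 assumes "u \<in> L2" "v \<in> L2" shows "(\<lambda>x. Complex (u x) (v x)) \<in> L2"
proof -
 note [measurable] = L2_measurable[OF assms(1)] L2_measurable[OF assms(2)]
 have eq: "Complex (u x) (v x) = complex_of_real (u x) + \<i> * complex_of_real (v x)" for x by (simp add: complex_eq_iff)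
 have "integrable lborel (\<lambda>x. (norm (u x))\<^sup>2 + (norm (v x))\<^sup>2)"
  by (intro Bochner_Integration.integrable_add L2_integrable assms)
 then show ?thesis by (intro L2I) (auto simp: eq, auto simp: cmod_power2)
qed

lemma is_weak_partialI:
 assumes f: "f \<in> L2" and w: "w \<in> L2" and bs: "bs \<in> lists Basis"
  and Re: "\<And>\<phi>. test \<phi> \<Longrightarrow> (LBINT x. partials bs \<phi> x * Re (f x)) = (-1) ^ length bs * (LBINT x. \<phi> x * Re (w x))"
  and Im: "\<And>\<phi>. test \<phi> \<Longrightarrow> (LBINT x. partials bs \<phi> x * Im (f x)) = (-1) ^ length bs * (LBINT x. \<phi> x * Im (w x))"
 shows "is_weak_partial bs f w"
 unfolding is_weak_partial_def
proof
 fix \<phi> :: "'a \<Rightarrow> real" assume \<phi>: "test \<phi>"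
 note I = L2_scaleR_integrable(1)[OF test_L2[OF test_partials[OF \<phi> bs]] f] L2_scaleR_integrable(1)[OF test_L2[OF \<phi>] w]
 have R: "Re ((-1) ^ n * z) = (-1) ^ n * Re z" "Im ((-1) ^ n * z) = (-1) ^ n * Im z" for n z
  by (cases "even n"; simp)+
 show "(LBINT x. partials bs \<phi> x *\<^sub>R f x) = (- 1) ^ length bs * (LBINT x. \<phi> x *\<^sub>R w x)"
  using integral_Re[OF I(1)] integral_Re[OF I(2)] integral_Im[OF I(1)] integral_Im[OF I(2)] Re[OF \<phi>] Im[OF \<phi>]
  by (simp add: complex_eq_iff R)
qed

lemma cv_Y_sobolev:
 fixes g :: "R3 \<Rightarrow> complex"
 assumes \<kappa>: "\<kappa> > 0" and g: "g \<in> L2"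
 shows "cv (Y \<kappa>) g \<in> sobolev 2"
 unfolding sobolev_def
proof (intro CollectI conjI ballI impI)
 show f: "cv (Y \<kappa>) g \<in> L2" by (rule cv_Y_L2[OF \<kappa> g])
 fix bs :: "R3 list" assume bs: "bs \<in> lists Basis" "length bs \<le> 2"
 obtain u where u: "u \<in> L2"
  "\<And>\<phi>. test \<phi> \<Longrightarrow> (LBINT x. partials bs \<phi> x * cv (Y \<kappa>) (\<lambda>x. Re (g x)) x) = (-1) ^ length bs * (LBINT x. \<phi> x * u x)"
  using cv_Y_weak_partial_real[OF \<kappa> L2_Re_Im(1)[OF g] bs] by blast
 obtain v where v: "v \<in> L2"
  "\<And>\<phi>. test \<phi> \<Longrightarrow> (LBINT x. partials bs \<phi> x * cv (Y \<kappa>) (\<lambda>x. Im (g x)) x) = (-1) ^ length bs * (LBINT x. \<phi> x * v x)"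
  using cv_Y_weak_partial_real[OF \<kappa> L2_Re_Im(2)[OF g] bs] by blast
 show "\<exists>w\<in>L2. is_weak_partial bs (cv (Y \<kappa>) g) w"
 proof (rule bexI[of _ "\<lambda>x. Complex (u x) (v x)"])
  show "is_weak_partial bs (cv (Y \<kappa>) g) (\<lambda>x. Complex (u x) (v x))"
   by (rule is_weak_partialI[OF f L2_Complex[OF u(1) v(1)] bs(1)])
     (use u(2) v(2) in \<open>simp_all add: Re_cv[OF Y_integrable[OF \<kappa>] g] Im_cv[OF Y_integrable[OF \<kappa>] g]\<close>)
 qed (rule L2_Complex[OF u(1) v(1)])
qed

section \<open>The weak Laplacian and the resolvent equation\<close>

lemma sobolev_L2: "f \<in> sobolev k \<Longrightarrow> f \<in> L2"
 by (simp add: sobolev_def)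

lemma weak_partial:
 assumes "f \<in> sobolev 2" "b \<in> Basis"
 shows "weak_partial [b, b] f \<in> L2" "is_weak_partial [b, b] f (weak_partial [b, b] f)"
proof -
 have "\<exists>g. g \<in> L2 \<and> is_weak_partial [b, b] f g"
  using assms unfolding sobolev_def by force
 from someI_ex[OF this] show "weak_partial [b, b] f \<in> L2" "is_weak_partial [b, b] f (weak_partial [b, b] f)"
  unfolding weak_partial_def by auto
qed

lemma
 assumes f: "f \<in> sobolev 2"
 shows laplacian_L2: "laplacian f \<in> L2"
  and laplacian_weak: "test \<phi> \<Longrightarrow> (LBINT x. lap \<phi> x *\<^sub>R f x) = (LBINT x. \<phi> x *\<^sub>R laplacian f x)"
proof -
 show "laplacian f \<in> L2" unfolding laplacian_def[abs_def] by (intro L2_sum weak_partial f) auto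
 assume \<phi>: "test \<phi>"
 have "(LBINT x. lap \<phi> x *\<^sub>R f x) = (\<Sum>b\<in>Basis. LBINT x. pd b (pd b \<phi>) x *\<^sub>R f x)"
  unfolding lap_def scaleR_sum_left
  by (rule Bochner_Integration.integral_sum) (intro L2_scaleR_integrable test_L2 test_pd \<phi> sobolev_L2[OF f]; assumption)
 also have "\<dots> = (\<Sum>b\<in>Basis. LBINT x. \<phi> x *\<^sub>R weak_partial [b, b] f x)"
 proof (rule sum.cong[OF refl])
  fix b :: 'a assume "b \<in> Basis"
  from weak_partial(2)[OF f this] \<phi> show "(LBINT x. pd b (pd b \<phi>) x *\<^sub>R f x) = (LBINT x. \<phi> x *\<^sub>R weak_partial [b, b] f x)"
   by (simp add: is_weak_partial_def)
 qed
 also have "\<dots> = (LBINT x. \<phi> x *\<^sub>R laplacian f x)"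
  unfolding laplacian_def scaleR_sum_right
  by (rule Bochner_Integration.integral_sum[symmetric]) (intro L2_scaleR_integrable test_L2 \<phi> weak_partial f; assumption)
 finally show "(LBINT x. lap \<phi> x *\<^sub>R f x) = (LBINT x. \<phi> x *\<^sub>R laplacian f x)" .
qed

text \<open>\<open>laplacian\<close> is built from arbitrary choices of weak derivatives; testing
  identifies it, almost everywhere, with an explicit function.\<close>

lemma laplacian_unique:
 assumes f: "f \<in> sobolev 2" and L: "L \<in> L2"
  and eq: "\<And>\<phi>. test \<phi> \<Longrightarrow> (LBINT x. lap \<phi> x *\<^sub>R f x) = (LBINT x. \<phi> x *\<^sub>R L x)"
 shows "AE x in lborel. laplacian f x = L x"
proof -
 have "AE x in lborel. laplacian f x - L x = 0"
 proof (rule fundamental_lemma)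
  show "(\<lambda>x. laplacian f x - L x) \<in> L2" by (intro L2_diff laplacian_L2 f L)
  fix \<phi> :: "'a \<Rightarrow> real" assume \<phi>: "test \<phi>"
  show "(LBINT x. \<phi> x *\<^sub>R (laplacian f x - L x)) = 0"
   using eq[OF \<phi>] laplacian_weak[OF f \<phi>]
    L2_scaleR_integrable(1)[OF test_L2[OF \<phi>] laplacian_L2[OF f]] L2_scaleR_integrable(1)[OF test_L2[OF \<phi>] L]
   by (simp add: scaleR_diff_right)
 qed
 then show ?thesis by eventually_elim simp
qed

lemma test_resolvent_L2: "test \<phi> \<Longrightarrow> (\<lambda>x. \<kappa>\<^sup>2 * \<phi> x - lap \<phi> x) \<in> L2" for \<kappa> :: real
 by (intro test_L2 test_diff test_cmult test_lap)

text \<open>Convolution with the even kernel \<open>Y\<close> is symmetric and inverts \<kappa>^2 -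
  \<Delta> on test functions; the equation follows by testing.\<close>

lemma cv_Y_solves:
 fixes g :: "R3 \<Rightarrow> complex"
 assumes \<kappa>: "\<kappa> > 0" and g: "g \<in> L2"
 shows "AE x in lborel. - laplacian (cv (Y \<kappa>) g) x + complex_of_real (\<kappa>\<^sup>2) * cv (Y \<kappa>) g x = g x"
proof -
 let ?f = "cv (Y \<kappa>) g"
 have f: "?f \<in> L2" by (rule cv_Y_L2[OF \<kappa> g])
 define L where "L x = \<kappa>\<^sup>2 *\<^sub>R ?f x - g x" for x
 have "AE x in lborel. laplacian ?f x = L x"
 proof (rule laplacian_unique[OF cv_Y_sobolev[OF \<kappa> g]])
  show "L \<in> L2" unfolding L_def by (intro L2_diff L2_scaleR_const f g)
  fix \<phi> :: "R3 \<Rightarrow> real" assume \<phi>: "test \<phi>"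
  have A: "(LBINT x. (\<kappa>\<^sup>2 * \<phi> x - lap \<phi> x) *\<^sub>R ?f x) = (LBINT x. \<phi> x *\<^sub>R g x)"
   using cv_adjoint[OF Y_integrable[OF \<kappa>] Y_even test_resolvent_L2[OF \<phi>, of \<kappa>] g]
   by (simp add: lap_cv_Y(2)[OF \<kappa> \<phi>])
  have B: "(LBINT x. (\<kappa>\<^sup>2 * \<phi> x - lap \<phi> x) *\<^sub>R ?f x) =
    (LBINT x. \<phi> x *\<^sub>R (\<kappa>\<^sup>2 *\<^sub>R ?f x)) - (LBINT x. lap \<phi> x *\<^sub>R ?f x)"
   using L2_scaleR_integrable(1)[OF test_L2[OF \<phi>] L2_scaleR_const(1)[OF f, of "\<kappa>\<^sup>2"]]
    L2_scaleR_integrable(1)[OF test_L2[OF test_lap[OF \<phi>]] f]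
   by (subst Bochner_Integration.integral_diff[symmetric]) (auto simp: scaleR_diff_left mult.commute)
  have C: "(LBINT x. \<phi> x *\<^sub>R L x) = (LBINT x. \<phi> x *\<^sub>R (\<kappa>\<^sup>2 *\<^sub>R ?f x)) - (LBINT x. \<phi> x *\<^sub>R g x)"
   unfolding L_def scaleR_diff_right
   by (intro Bochner_Integration.integral_diff L2_scaleR_integrable test_L2 \<phi> L2_scaleR_const f g)
  show "(LBINT x. lap \<phi> x *\<^sub>R ?f x) = (LBINT x. \<phi> x *\<^sub>R L x)" unfolding C A[symmetric] B by simp
 qed
 then show ?thesis
  by eventually_elim (simp add: L_def scaleR_conv_of_real)
qed

text \<open>An arbitrary \<eta> is reached as (\<kappa>^2 - \<Delta>) \<Phi> with \<Phi> = Y *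
  \<eta>, but \<Phi> is not compactly supported. With the cutoff \<open>X n\<close> in front, the
  error terms contain derivatives of \<open>X n\<close> and are O(1/n) times square-integrable
  functions.\<close>

lemma resolvent_kernel_trivial:
 fixes d :: "R3 \<Rightarrow> real"
 assumes \<kappa>: "\<kappa> > 0" and d: "d \<in> L2"
  and z: "\<And>\<phi>. test \<phi> \<Longrightarrow> (LBINT x. (\<kappa>\<^sup>2 * \<phi> x - lap \<phi> x) * d x) = 0"
 shows "AE x in lborel. d x = 0"
proof (rule fundamental_lemma_real[OF d])
 fix \<eta> :: "R3 \<Rightarrow> real" assume \<eta>: "test \<eta>"
 define \<Phi> where "\<Phi> = cv (Y \<kappa>) \<eta>"
 have sm: "smooth \<Phi>" unfolding \<Phi>_def by (rule cv_Y_smooth[OF \<kappa> \<eta>])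
 have \<Phi>L: "\<Phi> \<in> L2" unfolding \<Phi>_def by (intro cv_Y_L2 \<kappa> test_L2 \<eta>)
 have p\<Phi>L: "pd b \<Phi> \<in> L2" if "b \<in> Basis" for b
  unfolding \<Phi>_def pd_cv_Y[OF \<kappa> \<eta> that] by (intro cv_Y_L2 \<kappa> test_L2 test_pd \<eta> that)
 obtain C where C: "C > 0" "\<And>L (z::R3) b. L \<ge> 1 \<Longrightarrow> b \<in> Basis \<Longrightarrow> \<bar>pd b (chi L) z\<bar> \<le> C / L"
  "\<And>L (z::R3) b. L \<ge> 1 \<Longrightarrow> b \<in> Basis \<Longrightarrow> \<bar>pd b (pd b (chi L)) z\<bar> \<le> C / (L * (1 + (norm z)\<^sup>2))"
  using chi_derivs[where 'a=R3] by metis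
 define X where "X n = (chi (real (Suc n)) :: R3 \<Rightarrow> real)" for n
 have X: "test (X n)" for n unfolding X_def by (rule chi_test) simp
 have X1: "\<bar>pd b (X n) z\<bar> \<le> C * inverse (real (Suc n))" if "b \<in> Basis" for b n z
  using C(2)[of "real (Suc n)" b z] that by (simp add: X_def divide_inverse)
 have X2: "\<bar>pd b (pd b (X n)) z\<bar> \<le> C * inverse (real (Suc n))" if "b \<in> Basis" for b n z
 proof -
  have "C / (real (Suc n) * (1 + (norm z)\<^sup>2)) \<le> C / (real (Suc n) * 1)"
   using C(1) by (intro divide_left_mono mult_left_mono mult_pos_pos) (auto simp: add_pos_nonneg)
  then show ?thesis using C(3)[of "real (Suc n)" b z] that by (simp add: X_def divide_inverse)
 qed
 define u where "u n x = X n x * \<Phi> x" for n x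
 have u: "test (u n)" for n unfolding u_def by (rule test_mult'[OF X sm])
 define G where "G n x = X n x * \<eta> x - 2 * (\<Sum>b\<in>Basis. pd b (X n) x * pd b \<Phi> x) - lap (X n) x * \<Phi> x" for n x
 have eq: "\<kappa>\<^sup>2 * u n x - lap (u n) x = G n x" for n x
 proof -
  have "\<kappa>\<^sup>2 * \<Phi> x - lap \<Phi> x = \<eta> x" unfolding \<Phi>_def by (rule lap_cv_Y[OF \<kappa> \<eta>])
  then have "X n x * \<eta> x = X n x * (\<kappa>\<^sup>2 * \<Phi> x) - X n x * lap \<Phi> x" by (simp add: algebra_simps)
  then show ?thesis unfolding u_def lap_mult[OF test_smooth[OF X] sm] G_def by (simp add: algebra_simps)
 qed
 have "(\<lambda>n. LBINT x. G n x * d x) \<longlonglongrightarrow> (LBINT x. \<eta> x * d x)"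
 proof (rule integral_dominated_convergence)
  note [measurable] = L2_measurable[OF d] test_measurable[OF \<eta>]
  show "(\<lambda>x. \<eta> x * d x) \<in> borel_measurable lborel" by measurable
  have "smooth (G n)" for n unfolding G_def[abs_def]
   by (intro smooth_diff smooth_mult smooth_sum smooth_const smooth_pd smooth_lap test_smooth X \<eta> sm) auto
  note [measurable] = smooth_measurable[OF this]
  show "(\<lambda>x. G n x * d x) \<in> borel_measurable lborel" for n by measurable
  show "integrable lborel (\<lambda>x. \<bar>\<eta> x\<bar> * \<bar>d x\<bar> + 2 * (\<Sum>b\<in>Basis. C * (\<bar>pd b \<Phi> x\<bar> * \<bar>d x\<bar>)) + 3 * C * (\<bar>\<Phi> x\<bar> * \<bar>d x\<bar>))"
   using L2_mult_integrable(1)[OF test_L2[OF \<eta>] d] L2_mult_integrable(1)[OF p\<Phi>L d] L2_mult_integrable(1)[OF \<Phi>L d]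
   by (intro Bochner_Integration.integrable_add integrable_mult_right Bochner_Integration.integrable_sum) auto
  have inv: "inverse (real (Suc n)) \<le> 1" for n by (simp add: inverse_eq_divide)
  have lapX: "\<bar>lap (X n) x\<bar> \<le> 3 * C * inverse (real (Suc n))" for n x
  proof -
   have "\<bar>lap (X n) x\<bar> \<le> (\<Sum>b\<in>(Basis::R3 set). C * inverse (real (Suc n)))"
    unfolding lap_def by (rule order_trans[OF sum_abs sum_mono]) (rule X2)
   then show ?thesis by simp
  qed
  show "AE x in lborel. norm (G n x * d x) \<le> \<bar>\<eta> x\<bar> * \<bar>d x\<bar> + 2 * (\<Sum>b\<in>Basis. C * (\<bar>pd b \<Phi> x\<bar> * \<bar>d x\<bar>)) + 3 * C * (\<bar>\<Phi> x\<bar> * \<bar>d x\<bar>)" for n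
  proof (intro always_eventually allI)
   fix x
   have Ci: "C * inverse (real (Suc n)) \<le> C" using C(1) inv[of n] by (intro mult_left_le) auto
   have a: "\<bar>X n x * \<eta> x\<bar> \<le> \<bar>\<eta> x\<bar>" by (simp add: abs_mult X_def mult_left_le_one_le)
   have b: "\<bar>\<Sum>b\<in>Basis. pd b (X n) x * pd b \<Phi> x\<bar> \<le> (\<Sum>b\<in>Basis. C * \<bar>pd b \<Phi> x\<bar>)"
   proof (rule order_trans[OF sum_abs sum_mono])
    fix b :: R3 assume "b \<in> Basis"
    then show "\<bar>pd b (X n) x * pd b \<Phi> x\<bar> \<le> C * \<bar>pd b \<Phi> x\<bar>"
     unfolding abs_mult using X1[of b n x] Ci by (intro mult_right_mono) auto
   qed
   have c: "\<bar>lap (X n) x * \<Phi> x\<bar> \<le> 3 * C * \<bar>\<Phi> x\<bar>"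
    unfolding abs_mult using lapX[of n x] Ci by (intro mult_right_mono) auto
   have "\<bar>G n x\<bar> \<le> \<bar>\<eta> x\<bar> + 2 * (\<Sum>b\<in>Basis. C * \<bar>pd b \<Phi> x\<bar>) + 3 * C * \<bar>\<Phi> x\<bar>"
    using a b c unfolding G_def by linarith
   then have "\<bar>G n x\<bar> * \<bar>d x\<bar> \<le> (\<bar>\<eta> x\<bar> + 2 * (\<Sum>b\<in>Basis. C * \<bar>pd b \<Phi> x\<bar>) + 3 * C * \<bar>\<Phi> x\<bar>) * \<bar>d x\<bar>"
    by (rule mult_right_mono) simp
   then show "norm (G n x * d x) \<le> \<bar>\<eta> x\<bar> * \<bar>d x\<bar> + 2 * (\<Sum>b\<in>Basis. C * (\<bar>pd b \<Phi> x\<bar> * \<bar>d x\<bar>)) + 3 * C * (\<bar>\<Phi> x\<bar> * \<bar>d x\<bar>)"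
    by (simp add: abs_mult algebra_simps sum_distrib_left sum_distrib_right)
  qed
  show "AE x in lborel. (\<lambda>n. G n x * d x) \<longlonglongrightarrow> \<eta> x * d x"
  proof (intro always_eventually allI tendsto_mult tendsto_const)
   fix x
   have Z: "(\<lambda>n. C' * inverse (real (Suc n))) \<longlonglongrightarrow> 0" for C' by (rule tendsto_mult_right_zero[OF LIMSEQ_inverse_real_of_nat])
   have "(\<lambda>n. pd b (X n) x) \<longlonglongrightarrow> 0" if "b \<in> Basis" for b
    by (rule Lim_null_comparison[OF always_eventually Z[of C]]) (use X1[OF that] in simp)
   then have b: "(\<lambda>n. 2 * (\<Sum>b\<in>Basis. pd b (X n) x * pd b \<Phi> x)) \<longlonglongrightarrow> 2 * (\<Sum>b\<in>Basis. 0 * pd b \<Phi> x)"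
    by (intro tendsto_intros) auto
   have "(\<lambda>n. lap (X n) x) \<longlonglongrightarrow> 0"
    by (rule Lim_null_comparison[OF always_eventually Z[of "3 * C"]]) (use lapX in simp)
   then have c: "(\<lambda>n. lap (X n) x * \<Phi> x) \<longlonglongrightarrow> 0 * \<Phi> x" by (intro tendsto_intros)
   have a: "(\<lambda>n. X n x * \<eta> x) \<longlonglongrightarrow> 1 * \<eta> x" unfolding X_def by (intro tendsto_mult chi_tendsto tendsto_const)
   show "(\<lambda>n. G n x) \<longlonglongrightarrow> \<eta> x"
    using tendsto_diff[OF tendsto_diff[OF a b] c] by (simp add: G_def)
  qed
 qed
 moreover have "(LBINT x. G n x * d x) = 0" for n
  using z[OF u[of n]] by (simp add: eq)
 ultimately show "(LBINT x. \<eta> x * d x) = 0" by (simp add: LIMSEQ_const_iff)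
qed

text \<open>The difference of \<open>f\<close> and the convolution is orthogonal to (\<kappa>^2 -
  \<Delta>) \<phi> for every test function, so \<open>resolvent_kernel_trivial\<close> applies to
  its real and imaginary parts.\<close>

lemma cv_Y_unique:
 fixes f w :: "R3 \<Rightarrow> complex"
 assumes \<kappa>: "\<kappa> > 0" and f: "f \<in> sobolev 2" and w: "w \<in> L2"
  and eq: "AE x in lborel. - laplacian f x + complex_of_real (\<kappa>\<^sup>2) * f x = w x"
 shows "AE x in lborel. f x = cv (Y \<kappa>) w x"
proof -
 let ?g = "cv (Y \<kappa>) w"
 note fL = sobolev_L2[OF f] and gL = cv_Y_L2(1)[OF \<kappa> w]
 have d: "(\<lambda>x. f x - ?g x) \<in> L2" by (intro L2_diff fL gL)
 have Z: "(LBINT x. (\<kappa>\<^sup>2 * \<phi> x - lap \<phi> x) *\<^sub>R (f x - ?g x)) = 0" if \<phi>: "test \<phi>" for \<phi>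
 proof -
  note r = test_resolvent_L2[OF \<phi>, of \<kappa>]
  have "(LBINT x. (\<kappa>\<^sup>2 * \<phi> x - lap \<phi> x) *\<^sub>R ?g x) = (LBINT x. \<phi> x *\<^sub>R w x)"
   using cv_adjoint[OF Y_integrable[OF \<kappa>] Y_even r w] by (simp add: lap_cv_Y(2)[OF \<kappa> \<phi>])
  moreover have "(LBINT x. (\<kappa>\<^sup>2 * \<phi> x - lap \<phi> x) *\<^sub>R f x) = (LBINT x. \<phi> x *\<^sub>R w x)"
  proof -
   have "(LBINT x. (\<kappa>\<^sup>2 * \<phi> x - lap \<phi> x) *\<^sub>R f x) =
     (LBINT x. \<phi> x *\<^sub>R (\<kappa>\<^sup>2 *\<^sub>R f x)) - (LBINT x. lap \<phi> x *\<^sub>R f x)"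
    using L2_scaleR_integrable(1)[OF test_L2[OF \<phi>] L2_scaleR_const(1)[OF fL, of "\<kappa>\<^sup>2"]]
     L2_scaleR_integrable(1)[OF test_L2[OF test_lap[OF \<phi>]] fL]
    by (subst Bochner_Integration.integral_diff[symmetric]) (auto simp: scaleR_diff_left mult.commute)
   also have "\<dots> = (LBINT x. \<phi> x *\<^sub>R (\<kappa>\<^sup>2 *\<^sub>R f x) - \<phi> x *\<^sub>R laplacian f x)"
    unfolding laplacian_weak[OF f \<phi>]
    by (intro Bochner_Integration.integral_diff[symmetric] L2_scaleR_integrable test_L2 \<phi> L2_scaleR_const fL laplacian_L2 f)
   also have "\<dots> = (LBINT x. \<phi> x *\<^sub>R w x)"
   proof (rule integral_cong_AE)
    note [measurable] = L2_measurable[OF fL] L2_measurable[OF laplacian_L2[OF f]] L2_measurable[OF w]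
     test_measurable[OF \<phi>]
    show "(\<lambda>x. \<phi> x *\<^sub>R (\<kappa>\<^sup>2 *\<^sub>R f x) - \<phi> x *\<^sub>R laplacian f x) \<in> borel_measurable lborel"
     "(\<lambda>x. \<phi> x *\<^sub>R w x) \<in> borel_measurable lborel" by measurable
    show "AE x in lborel. \<phi> x *\<^sub>R (\<kappa>\<^sup>2 *\<^sub>R f x) - \<phi> x *\<^sub>R laplacian f x = \<phi> x *\<^sub>R w x"
     using eq by eventually_elim (simp add: scaleR_conv_of_real flip: right_diff_distrib)
   qed
   finally show ?thesis .
  qed
  ultimately show ?thesis
   using L2_scaleR_integrable(1)[OF r fL] L2_scaleR_integrable(1)[OF r gL]
   by (simp add: scaleR_diff_right)
 qed
 have I: "integrable lborel (\<lambda>x. (\<kappa>\<^sup>2 * \<phi> x - lap \<phi> x) *\<^sub>R (f x - ?g x))" if "test \<phi>" for \<phi>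
  by (rule L2_scaleR_integrable(1)[OF test_resolvent_L2[OF that] d])
 have "AE x in lborel. Re (f x - ?g x) = 0"
 proof (rule resolvent_kernel_trivial[OF \<kappa> L2_Re_Im(1)[OF d]])
  fix \<phi> :: "R3 \<Rightarrow> real" assume "test \<phi>"
  from integral_Re[OF I[OF this]] Z[OF this]
  show "(LBINT x. (\<kappa>\<^sup>2 * \<phi> x - lap \<phi> x) * Re (f x - ?g x)) = 0" by simp
 qed
 moreover have "AE x in lborel. Im (f x - ?g x) = 0"
 proof (rule resolvent_kernel_trivial[OF \<kappa> L2_Re_Im(2)[OF d]])
  fix \<phi> :: "R3 \<Rightarrow> real" assume "test \<phi>"
  from integral_Im[OF I[OF this]] Z[OF this]
  show "(LBINT x. (\<kappa>\<^sup>2 * \<phi> x - lap \<phi> x) * Im (f x - ?g x)) = 0" by simp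
 qed
 ultimately show ?thesis by eventually_elim (simp add: complex_eq_iff)
qed

section \<open>The Birman--Schwinger operator\<close>

text \<open>With s^2 the potential, one factor \<open>s\<close> on each side of the resolvent makes
  the operator symmetric. The codomain stays general: the resolvent argument is complex, the almost
  maximisers are real.\<close>

definition BS :: "(R3 \<Rightarrow> real) \<Rightarrow> real \<Rightarrow> (R3 \<Rightarrow> 'b::{banach,second_countable_topology}) \<Rightarrow> R3 \<Rightarrow> 'b" where
 "BS s \<kappa> g x = s x *\<^sub>R cv (Y \<kappa>) (\<lambda>y. s y *\<^sub>R g y) x"

locale bounded_weight =
 fixes s :: "R3 \<Rightarrow> real" and B :: real
 assumes s_measurable [measurable]: "s \<in> borel_measurable borel"
  and s_nonneg: "0 \<le> s x" and s_le: "s x \<le> B" and B_pos: "B > 0"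
begin

lemma s_abs: "\<bar>s x\<bar> \<le> B" using s_nonneg s_le by simp

lemma sL2:
 fixes g :: "R3 \<Rightarrow> 'b::{banach,second_countable_topology}"
 assumes "g \<in> L2" shows "(\<lambda>x. s x *\<^sub>R g x) \<in> L2" "n2 (\<lambda>x. s x *\<^sub>R g x) \<le> B * n2 g"
 using L2_bounded_scaleR[OF assms s_measurable s_abs] by auto

lemma BS_L2:
 fixes g :: "R3 \<Rightarrow> 'b::{banach,second_countable_topology}"
 assumes "\<kappa> > 0" "g \<in> L2" shows "BS s \<kappa> g \<in> L2"
 unfolding BS_def[abs_def] by (intro sL2 cv_Y_L2 assms)

lemma BS_diff:
 fixes f g :: "R3 \<Rightarrow> 'b::{banach,second_countable_topology}"
 assumes "\<kappa> > 0" "f \<in> L2" "g \<in> L2"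
 shows "BS s \<kappa> (\<lambda>x. f x - g x) x = BS s \<kappa> f x - BS s \<kappa> g x"
 using cv_diff[OF Y_integrable[OF assms(1)] sL2(1)[OF assms(2)] sL2(1)[OF assms(3)], of x]
 by (simp add: BS_def scaleR_diff_right)

lemma BS_bound:
 fixes g :: "R3 \<Rightarrow> 'b::{banach,second_countable_topology}"
 assumes "\<kappa> > 0" "g \<in> L2" shows "n2 (BS s \<kappa> g) \<le> B * ((LBINT x. Y \<kappa> x) * (B * n2 g))"
proof -
 have "n2 (BS s \<kappa> g) \<le> B * n2 (cv (Y \<kappa>) (\<lambda>y. s y *\<^sub>R g y))"
  unfolding BS_def[abs_def] by (intro sL2 cv_Y_L2 assms)
 also have "\<dots> \<le> B * ((LBINT x. Y \<kappa> x) * n2 (\<lambda>y. s y *\<^sub>R g y))"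
  using B_pos by (intro mult_left_mono cv_Y_L2 sL2 assms) auto
 also have "\<dots> \<le> B * ((LBINT x. Y \<kappa> x) * (B * n2 g))"
  using B_pos by (intro mult_left_mono sL2 assms Bochner_Integration.integral_nonneg) auto
 finally show ?thesis .
qed

text \<open>If \<open>t K\<close> is a contraction, then with \<open>w = s f\<close> the equation
 \<open>(- \<Delta> - t s\<^sup>2 + \<kappa>\<^sup>2) f = g\<close> becomes the fixed point equation \<open>w = s Y g + t K w\<close>.\<close>

lemma resolvent_if_contraction:
 assumes \<kappa>: "\<kappa> > 0" and t: "t > 0" and q: "q \<ge> 0" and tq: "t * q < 1"
  and contr: "\<And>g :: R3 \<Rightarrow> complex. g \<in> L2 \<Longrightarrow> n2 (BS s \<kappa> g) \<le> q * n2 g"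
 shows "complex_of_real (- (\<kappa>\<^sup>2)) \<in> resolvent_set (sobolev 2) (schroedinger (\<lambda>x. t * (s x)\<^sup>2))"
proof -
 define J where "J = (LBINT x. Y \<kappa> x)"
 have J0: "J \<ge> 0" unfolding J_def by (intro Bochner_Integration.integral_nonneg) simp
 define r where "r = t * q"
 have r: "0 \<le> r" "r < 1" using t q tq by (auto simp: r_def)
 \<comment> \<open>Read off from f = Y * (g + t s W): \<open>J\<close> bounds the convolution, and
   the fixed point \<open>W\<close> has norm at most B J / (1 - r) times that of
   \<open>g\<close>.\<close>
 define C where "C = J * (1 + t * B * (B * J / (1 - r)))"
 have "\<exists>f\<in>sobolev 2. (AE x in lborel. schroedinger (\<lambda>x. t * (s x)\<^sup>2) f x - complex_of_real (- (\<kappa>\<^sup>2)) * f x = g x) \<and>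
      L2_norm f \<le> C * L2_norm g \<and>
      (\<forall>f'\<in>sobolev 2. (AE x in lborel. schroedinger (\<lambda>x. t * (s x)\<^sup>2) f' x - complex_of_real (- (\<kappa>\<^sup>2)) * f' x = g x) \<longrightarrow>
          (AE x in lborel. f' x = f x))"
  if g: "g \<in> L2" for g :: "R3 \<Rightarrow> complex"
 proof -
  note Yg = cv_Y_L2(1)[OF \<kappa> g]
  define a where "a x = s x *\<^sub>R cv (Y \<kappa>) g x" for x
  have a: "a \<in> L2" unfolding a_def by (rule sL2(1)[OF Yg])
  have an: "n2 a \<le> B * J * n2 g"
  proof -
   have "n2 a \<le> B * n2 (cv (Y \<kappa>) g)" unfolding a_def by (rule sL2(2)[OF Yg])
   also have "\<dots> \<le> B * (J * n2 g)" unfolding J_def using B_pos by (intro mult_left_mono cv_Y_L2 \<kappa> g) auto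
   finally show ?thesis by simp
  qed
  define T where "T w x = a x + t *\<^sub>R BS s \<kappa> w x" for w x
  have T: "T w \<in> L2" if "w \<in> L2" for w
   unfolding T_def by (intro L2_add a L2_scaleR_const BS_L2 \<kappa> that)
  have Td: "n2 (\<lambda>x. T u x - T w x) \<le> r * n2 (\<lambda>x. u x - w x)" if u: "u \<in> L2" and w: "w \<in> L2" for u w
  proof -
   have "(\<lambda>x. T u x - T w x) = (\<lambda>x. t *\<^sub>R BS s \<kappa> (\<lambda>x. u x - w x) x)"
    using BS_diff[OF \<kappa> u w] by (auto simp: T_def scaleR_diff_right)
   then have "n2 (\<lambda>x. T u x - T w x) = t * n2 (BS s \<kappa> (\<lambda>x. u x - w x))"
    using L2_scaleR_const(2)[OF BS_L2[OF \<kappa> L2_diff(1)[OF u w]], of t] t by simp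
   also have "\<dots> \<le> t * (q * n2 (\<lambda>x. u x - w x))" using t by (intro mult_left_mono contr L2_diff u w) auto
   finally show ?thesis by (simp add: r_def mult.assoc)
  qed
  have Tb: "n2 (T u) \<le> n2 a + r * n2 u" if u: "u \<in> L2" for u
  proof -
   have "n2 (T u) \<le> n2 a + n2 (\<lambda>x. t *\<^sub>R BS s \<kappa> u x)"
    unfolding T_def by (rule L2_add(2)[OF a L2_scaleR_const(1)[OF BS_L2[OF \<kappa> u]]])
   also have "n2 (\<lambda>x. t *\<^sub>R BS s \<kappa> u x) = t * n2 (BS s \<kappa> u)"
    using L2_scaleR_const(2)[OF BS_L2[OF \<kappa> u], of t] t by simp
   also have "\<dots> \<le> t * (q * n2 u)" using t by (intro mult_left_mono contr u) auto
   finally show ?thesis by (simp add: r_def mult.assoc)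
  qed
  define w where "w n = (T ^^ n) (\<lambda>x. 0)" for n
  have w: "w n \<in> L2" for n unfolding w_def by (induction n) (auto simp: L2_zero T)
  have wS: "w (Suc n) = T (w n)" for n by (simp add: w_def)
  \<comment> \<open>The fixed point of x \<mapsto> n2 a + r x, hence a bound that the iterates
    started at 0 never exceed.\<close>
  define M where "M = n2 a / (1 - r)"
  have M0: "M \<ge> 0" unfolding M_def using r by simp
  have Meq: "n2 a + r * M = M" using r by (simp add: M_def field_simps)
  have wb: "n2 (w n) \<le> M" for n
  proof (induction n)
   case 0 show ?case using M0 by (simp add: w_def L2_zero)
  next
   case (Suc n)
   have "n2 (w (Suc n)) \<le> n2 a + r * n2 (w n)" unfolding wS by (rule Tb[OF w])
   also have "\<dots> \<le> n2 a + r * M" using Suc r by (intro add_mono mult_left_mono) auto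
   finally show ?case by (simp add: Meq)
  qed
  have wd: "n2 (\<lambda>x. w (n + k) x - w n x) \<le> r ^ n * M" for n k
  proof (induction n)
   case 0 show ?case using wb[of k] by (simp add: w_def)
  next
   case (Suc n)
   have "n2 (\<lambda>x. w (Suc n + k) x - w (Suc n) x) \<le> r * n2 (\<lambda>x. w (n + k) x - w n x)"
    using Td[OF w[of "n + k"] w[of n]] by (simp add: wS)
   also have "\<dots> \<le> r * (r ^ n * M)" using Suc r by (intro mult_left_mono) auto
   finally show ?case by simp
  qed
  have rM: "(\<lambda>n. r ^ n * M) \<longlonglongrightarrow> 0"
   using tendsto_mult_left_zero[OF LIMSEQ_power_zero[of r]] r by simp
  obtain W where W: "W \<in> L2" "(\<lambda>n. n2 (\<lambda>x. w n x - W x)) \<longlonglongrightarrow> 0"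
  proof (rule L2_complete[OF w])
   fix e :: real assume "e > 0"
   then obtain N where N: "r ^ N * M < e / 2" using LIMSEQ_D[OF rM, of "e / 2"] M0 r by auto
   have "n2 (\<lambda>x. w m x - w n x) < e" if "m \<ge> N" "n \<ge> N" for m n
   proof -
    have "n2 (\<lambda>x. w m x - w N x) < e / 2" "n2 (\<lambda>x. w n x - w N x) < e / 2"
     using wd[of N "m - N"] wd[of N "n - N"] N that by auto
    then show ?thesis using n2_triangle[OF w[of m] w[of N] w[of n]] n2_commute[of "w N" "w n"] by linarith
   qed
   then show "\<exists>N. \<forall>m\<ge>N. \<forall>n\<ge>N. n2 (\<lambda>x. w m x - w n x) < e" by blast
  qed
  have Wn: "n2 W \<le> M"
   by (rule LIMSEQ_le_const2[OF n2_tendsto[OF w W(1,2)]]) (use wb in auto)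
  have "n2 (\<lambda>x. T W x - W x) \<le> 0"
  proof (rule LIMSEQ_le_const)
   show "(\<lambda>n. r * n2 (\<lambda>x. w n x - W x) + n2 (\<lambda>x. w (Suc n) x - W x)) \<longlonglongrightarrow> 0"
    using tendsto_add[OF tendsto_mult_right_zero[OF W(2), of r] LIMSEQ_Suc[OF W(2)]] by simp
   have "n2 (\<lambda>x. T W x - W x) \<le> r * n2 (\<lambda>x. w n x - W x) + n2 (\<lambda>x. w (Suc n) x - W x)" for n
    using n2_triangle[OF T[OF W(1)] w[of "Suc n"] W(1)] Td[OF W(1) w[of n]] n2_commute[of W "w n"]
    by (simp add: wS)
   then show "\<exists>N. \<forall>n\<ge>N. n2 (\<lambda>x. T W x - W x) \<le> r * n2 (\<lambda>x. w n x - W x) + n2 (\<lambda>x. w (Suc n) x - W x)" by blast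
  qed
  then have "AE x in lborel. T W x - W x = 0"
   by (intro n2_eq_0_AE L2_diff T W) (simp add: antisym)
  then have fixW: "AE x in lborel. T W x = W x" by eventually_elim simp
  \<comment> \<open>The candidate solution is f = Y * G. By construction s f = T W everywhere, hence
    s f = W almost everywhere, which turns t s W into the potential term t s^2 f.\<close>
  define G where "G x = g x + t *\<^sub>R (s x *\<^sub>R W x)" for x
  have tsW: "(\<lambda>x. t *\<^sub>R (s x *\<^sub>R W x)) \<in> L2" by (intro L2_scaleR_const sL2 W)
  have G: "G \<in> L2" unfolding G_def by (intro L2_add g tsW)
  define f where "f = cv (Y \<kappa>) G"
  have sf: "s x *\<^sub>R f x = T W x" for x
  proof -
   have "f x = cv (Y \<kappa>) g x + t *\<^sub>R cv (Y \<kappa>) (\<lambda>x. s x *\<^sub>R W x) x"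
    using cv_add[OF Y_integrable[OF \<kappa>] g tsW, of x] cv_cmult[of "Y \<kappa>" t "\<lambda>x. s x *\<^sub>R W x" x]
    by (simp add: f_def G_def[abs_def])
   then show ?thesis by (simp add: T_def a_def BS_def scaleR_add_right mult.commute)
  qed
  have fS: "f \<in> sobolev 2" unfolding f_def by (rule cv_Y_sobolev[OF \<kappa> G])
  show ?thesis
  proof (intro bexI[OF _ fS] conjI ballI impI)
   show "AE x in lborel. schroedinger (\<lambda>x. t * (s x)\<^sup>2) f x - complex_of_real (- (\<kappa>\<^sup>2)) * f x = g x"
    using cv_Y_solves[OF \<kappa> G, folded f_def] fixW
   proof eventually_elim
    case (elim x)
    have "complex_of_real (t * (s x)\<^sup>2) * f x = t *\<^sub>R (s x *\<^sub>R (s x *\<^sub>R f x))"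
     by (simp add: scaleR_conv_of_real power2_eq_square mult_ac)
    also have "\<dots> = t *\<^sub>R (s x *\<^sub>R W x)" by (simp add: sf elim(2))
    finally show ?case using elim(1) by (simp add: schroedinger_def G_def algebra_simps)
   qed
   have "n2 f \<le> J * n2 G" unfolding f_def J_def by (rule cv_Y_L2(2)[OF \<kappa> G])
   also have "\<dots> \<le> J * (n2 g + t * (B * n2 W))"
   proof (rule mult_left_mono[OF _ J0])
    have "n2 G \<le> n2 g + n2 (\<lambda>x. t *\<^sub>R (s x *\<^sub>R W x))" unfolding G_def by (rule L2_add(2)[OF g tsW])
    also have "n2 (\<lambda>x. t *\<^sub>R (s x *\<^sub>R W x)) = t * n2 (\<lambda>x. s x *\<^sub>R W x)"
     using L2_scaleR_const(2)[OF sL2(1)[OF W(1)], of t] t by simp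
    also have "\<dots> \<le> t * (B * n2 W)" using t by (intro mult_left_mono sL2 W) auto
    finally show "n2 G \<le> n2 g + t * (B * n2 W)" by simp
   qed
   also have "\<dots> \<le> J * (n2 g + t * (B * (B * J * n2 g / (1 - r))))"
   proof -
    have "n2 W \<le> B * J * n2 g / (1 - r)"
     using order_trans[OF Wn[unfolded M_def] divide_right_mono[OF an]] r by simp
    then show ?thesis using J0 t B_pos by (intro mult_left_mono add_left_mono) auto
   qed
   also have "\<dots> = C * n2 g" by (simp add: C_def algebra_simps)
   finally show "L2_norm f \<le> C * L2_norm g" by (simp add: L2_norm_n2)
  next
   fix f' assume f': "f' \<in> sobolev 2"
    and eq: "AE x in lborel. schroedinger (\<lambda>x. t * (s x)\<^sup>2) f' x - complex_of_real (- (\<kappa>\<^sup>2)) * f' x = g x"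
   note f'L = sobolev_L2[OF f'] and fL = sobolev_L2[OF fS]
   \<comment> \<open>Another solution \<open>f'\<close> gives another fixed point w' = s f'. The
     difference \<open>u\<close> satisfies u = t K u almost everywhere, so its norm is at most r
     times itself and vanishes; then \<open>f\<close> and \<open>f'\<close> are convolutions of
     functions that agree almost everywhere.\<close>
   define w' where "w' x = s x *\<^sub>R f' x" for x
   have w': "w' \<in> L2" unfolding w'_def by (rule sL2(1)[OF f'L])
   have tsw': "(\<lambda>x. t *\<^sub>R (s x *\<^sub>R w' x)) \<in> L2" by (intro L2_scaleR_const sL2 w')
   have e1: "AE x in lborel. f' x = cv (Y \<kappa>) (\<lambda>x. g x + t *\<^sub>R (s x *\<^sub>R w' x)) x"
   proof (rule cv_Y_unique[OF \<kappa> f' L2_add(1)[OF g tsw']], use eq in eventually_elim)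
    case (elim x)
    have "complex_of_real (t * (s x)\<^sup>2) * f' x = t *\<^sub>R (s x *\<^sub>R w' x)"
     by (simp add: w'_def scaleR_conv_of_real power2_eq_square mult_ac)
    then show ?case using elim by (simp add: schroedinger_def algebra_simps)
   qed
   define u where "u x = W x - w' x" for x
   have u: "u \<in> L2" unfolding u_def by (intro L2_diff W w')
   have su: "(\<lambda>x. s x *\<^sub>R u x) \<in> L2" by (rule sL2(1)[OF u])
   have diff: "cv (Y \<kappa>) G x - cv (Y \<kappa>) (\<lambda>x. g x + t *\<^sub>R (s x *\<^sub>R w' x)) x = t *\<^sub>R cv (Y \<kappa>) (\<lambda>x. s x *\<^sub>R u x) x" for x
   proof -
    have "cv (Y \<kappa>) G x - cv (Y \<kappa>) (\<lambda>x. g x + t *\<^sub>R (s x *\<^sub>R w' x)) x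
     = cv (Y \<kappa>) (\<lambda>x. G x - (g x + t *\<^sub>R (s x *\<^sub>R w' x))) x"
     by (rule cv_diff[OF Y_integrable[OF \<kappa>] G L2_add(1)[OF g tsw'], symmetric])
    also have "(\<lambda>x. G x - (g x + t *\<^sub>R (s x *\<^sub>R w' x))) = (\<lambda>x. t *\<^sub>R (s x *\<^sub>R u x))"
     by (auto simp: G_def u_def scaleR_diff_right)
    finally show ?thesis using cv_cmult[of "Y \<kappa>" t "\<lambda>x. s x *\<^sub>R u x" x] by simp
   qed
   have "AE x in lborel. u x = t *\<^sub>R BS s \<kappa> u x"
    using e1 fixW
   proof eventually_elim
    case (elim x)
    have "u x = s x *\<^sub>R (f x - f' x)" by (simp add: u_def w'_def scaleR_diff_right sf elim(2))
    also have "f x - f' x = t *\<^sub>R cv (Y \<kappa>) (\<lambda>x. s x *\<^sub>R u x) x" using diff[of x] elim(1) by (simp add: f_def)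
    finally show ?case by (simp add: BS_def mult.commute)
   qed
   from L2_cong_AE(2)[OF L2_measurable[OF u] L2_scaleR_const(1)[OF BS_L2[OF \<kappa> u]] this]
   have "n2 u = t * n2 (BS s \<kappa> u)"
    using L2_scaleR_const(2)[OF BS_L2[OF \<kappa> u], of t] t by simp
   also have "\<dots> \<le> t * (q * n2 u)" using t by (intro mult_left_mono contr u) auto
   finally have "(1 - r) * n2 u \<le> 0" by (simp add: r_def algebra_simps)
   then have "n2 u = 0" using r n2_nonneg[of u] by (simp add: mult_le_0_iff)
   from n2_eq_0_AE[OF u this] have "AE x in lborel. s x *\<^sub>R u x = 0" by eventually_elim simp
   from cv_cong_AE[OF this L2_measurable[OF su] _ Y_measurable]
   have "cv (Y \<kappa>) (\<lambda>x. s x *\<^sub>R u x) x = 0" for x by (simp add: cv_def)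
   with diff have "cv (Y \<kappa>) G x = cv (Y \<kappa>) (\<lambda>x. g x + t *\<^sub>R (s x *\<^sub>R w' x)) x" for x by simp
   then show "AE x in lborel. f' x = f x" using e1 by (auto simp: f_def)
  qed
 qed
 then show ?thesis unfolding resolvent_set_def by blast
qed

text \<open>Contraposition of \<open>resolvent_if_contraction\<close> with t = 1 + e and q = 1 - e,
  where t q = 1 - e^2 < 1. Passing to |g| does not decrease the norm of the image, since
  \<open>s\<close> and \<open>Y\<close> are nonnegative.\<close>

lemma almost_maximizer:
 assumes spec: "\<And>\<epsilon>. \<epsilon> > 0 \<Longrightarrow> spectrum (sobolev 2) (schroedinger (\<lambda>x. (1 + \<epsilon>) * (s x)\<^sup>2)) \<inter> complex_of_real ` {..<0} \<noteq> {}"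
  and e: "0 < e" "e < 1"
 obtains \<kappa> g where "\<kappa> > 0" "g \<in> L2" "\<And>x. g x \<ge> (0::real)" "n2 g = 1" "n2 (BS s \<kappa> g) \<ge> 1 - e"
proof -
 obtain l where l: "l < 0" "complex_of_real l \<in> spectrum (sobolev 2) (schroedinger (\<lambda>x. (1 + e) * (s x)\<^sup>2))"
  using spec[OF e(1)] by blast
 define \<kappa> where "\<kappa> = sqrt (- l)"
 have \<kappa>: "\<kappa> > 0" "l = - (\<kappa>\<^sup>2)" using l by (auto simp: \<kappa>_def)
 have "\<not> (\<forall>g :: R3 \<Rightarrow> complex. g \<in> L2 \<longrightarrow> n2 (BS s \<kappa> g) \<le> (1 - e) * n2 g)"
 proof
  assume *: "\<forall>g :: R3 \<Rightarrow> complex. g \<in> L2 \<longrightarrow> n2 (BS s \<kappa> g) \<le> (1 - e) * n2 g"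
  have "complex_of_real (- (\<kappa>\<^sup>2)) \<in> resolvent_set (sobolev 2) (schroedinger (\<lambda>x. (1 + e) * (s x)\<^sup>2))"
  proof (rule resolvent_if_contraction[OF \<kappa>(1), where q="1 - e"])
   show "(1 + e) * (1 - e) < 1" using e by (simp add: algebra_simps)
  qed (use * e in auto)
  then show False using l(2) \<kappa>(2) by (simp add: spectrum_def)
 qed
 then obtain g :: "R3 \<Rightarrow> complex" where g: "g \<in> L2" "n2 (BS s \<kappa> g) > (1 - e) * n2 g" by (auto simp: not_le)
 have n0: "n2 g > 0"
 proof (rule ccontr)
  assume "\<not> n2 g > 0"
  then have "n2 g = 0" using n2_nonneg[of g] by linarith
  then show False using BS_bound[OF \<kappa>(1) g(1)] g(2) by simp
 qed
 define k where "k x = (1 / n2 g) *\<^sub>R norm (g x)" for x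
 note gn = L2_norm_fun(1)[OF g(1)]
 have kL: "k \<in> L2" unfolding k_def by (rule L2_scaleR_const(1)[OF gn])
 have k1: "n2 k = 1" unfolding k_def using L2_scaleR_const(2)[OF gn, of "1 / n2 g"] n0 by (simp add: L2_norm_fun(2))
 have BSk: "BS s \<kappa> k x = (1 / n2 g) * BS s \<kappa> (\<lambda>x. norm (g x)) x" for x
  using cv_cmult[of "Y \<kappa>" "1 / n2 g" "\<lambda>y. s y *\<^sub>R norm (g y)" x]
  by (simp add: BS_def k_def mult_ac)
 have "norm (BS s \<kappa> g x) \<le> norm (BS s \<kappa> (\<lambda>x. norm (g x)) x)" for x
 proof -
  have "norm (cv (Y \<kappa>) (\<lambda>y. s y *\<^sub>R g y) x) \<le> cv (Y \<kappa>) (\<lambda>y. s y *\<^sub>R norm (g y)) x"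
   unfolding cv_def by (rule order_trans[OF integral_norm_bound]) (simp add: s_nonneg mult.assoc)
  then show ?thesis unfolding BS_def using s_nonneg[of x] by (auto intro!: mult_left_mono simp: abs_mult)
 qed
 then have "n2 (BS s \<kappa> g) \<le> n2 (BS s \<kappa> (\<lambda>x. norm (g x)))"
  by (intro L2_mono(2) BS_L2 \<kappa> gn L2_measurable[OF BS_L2[OF \<kappa>(1) g(1)]])
 also have "\<dots> = n2 g * n2 (BS s \<kappa> k)"
  using L2_scaleR_const(2)[OF BS_L2[OF \<kappa>(1) gn], of "1 / n2 g"] n0 by (simp add: BSk[abs_def])
 finally have "(1 - e) * n2 g < n2 (BS s \<kappa> k) * n2 g" using g(2) by (simp add: mult.commute)
 then have "n2 (BS s \<kappa> k) \<ge> 1 - e" using n0 by simp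
 then show thesis by (intro that[OF \<kappa>(1) kL _ k1]) (simp_all add: k_def)
qed

lemma of_real_cv: "cv k (\<lambda>x. complex_of_real (g x)) x = complex_of_real (cv k g x)"
 unfolding cv_def by (subst integral_complex_of_real[symmetric]) (simp add: scaleR_conv_of_real)

lemma of_real_L2: "g \<in> L2 \<Longrightarrow> (\<lambda>x. complex_of_real (g x)) \<in> L2" for g :: "R3 \<Rightarrow> real"
 by (auto simp: L2_def)

text \<open>The form of -\<Delta> - s^2 is evaluated at f = Y * (s g). As (-\<Delta> + \<kappa>^2) f
  = s g and s f = K g, with K the operator \<open>BS s \<kappa>\<close>, it equals <K g, g> minus
  \<kappa>^2 times the squared norm of f minus the squared norm of K g.\<close>

lemma form_bound:
 assumes nn: "nonneg_operator (sobolev 2) (schroedinger (\<lambda>x. (s x)\<^sup>2))"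
  and \<kappa>: "\<kappa> > 0" and g: "(g :: R3 \<Rightarrow> real) \<in> L2"
 shows "(n2 (BS s \<kappa> g))\<^sup>2 + \<kappa>\<^sup>2 * (n2 (cv (Y \<kappa>) (\<lambda>y. s y *\<^sub>R g y)))\<^sup>2 \<le> (LBINT x. BS s \<kappa> g x * g x)"
proof -
 define a where "a x = s x *\<^sub>R g x" for x
 have a: "a \<in> L2" unfolding a_def by (rule sL2(1)[OF g])
 define p where "p = cv (Y \<kappa>) a"
 have p: "p \<in> L2" unfolding p_def by (rule cv_Y_L2(1)[OF \<kappa> a])
 have BSp: "BS s \<kappa> g = (\<lambda>x. s x * p x)" by (auto simp: BS_def p_def a_def[abs_def])
 define f where "f x = complex_of_real (p x)" for x
 have f: "f = cv (Y \<kappa>) (\<lambda>x. complex_of_real (a x))" by (auto simp: f_def p_def of_real_cv)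
 have fS: "f \<in> sobolev 2" unfolding f by (rule cv_Y_sobolev[OF \<kappa> of_real_L2[OF a]])
 have "L2_inner f (schroedinger (\<lambda>x. (s x)\<^sup>2) f) = (LBINT x. complex_of_real (p x * a x - \<kappa>\<^sup>2 * (p x * p x) - (s x * p x) * (s x * p x)))"
  unfolding L2_inner_def
 proof (rule integral_cong_AE)
  note [measurable] = L2_measurable[OF p] L2_measurable[OF a] L2_measurable[OF laplacian_L2[OF fS]] L2_measurable[OF sobolev_L2[OF fS]]
  have cf: "cnj (f x) = f x" for x by (simp add: f_def)
  show "(\<lambda>x. cnj (f x) * schroedinger (\<lambda>x. (s x)\<^sup>2) f x) \<in> borel_measurable lborel"
   unfolding schroedinger_def cf by measurable
  show "(\<lambda>x. complex_of_real (p x * a x - \<kappa>\<^sup>2 * (p x * p x) - (s x * p x) * (s x * p x))) \<in> borel_measurable lborel"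
   by measurable
  show "AE x in lborel. cnj (f x) * schroedinger (\<lambda>x. (s x)\<^sup>2) f x = complex_of_real (p x * a x - \<kappa>\<^sup>2 * (p x * p x) - (s x * p x) * (s x * p x))"
   using cv_Y_solves[OF \<kappa> of_real_L2[OF a], folded f]
  proof eventually_elim
   case (elim x)
   then have L: "laplacian f x = complex_of_real (\<kappa>\<^sup>2) * complex_of_real (p x) - complex_of_real (a x)"
    by (simp add: f_def algebra_simps)
   show ?case unfolding schroedinger_def L by (simp add: f_def algebra_simps power2_eq_square)
  qed
 qed
 also have "\<dots> = complex_of_real (LBINT x. p x * a x - \<kappa>\<^sup>2 * (p x * p x) - (s x * p x) * (s x * p x))"
  by (rule integral_complex_of_real)
 finally have E: "L2_inner f (schroedinger (\<lambda>x. (s x)\<^sup>2) f) = complex_of_real (LBINT x. p x * a x - \<kappa>\<^sup>2 * (p x * p x) - (s x * p x) * (s x * p x))" .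
 have "L2_inner f (schroedinger (\<lambda>x. (s x)\<^sup>2) f) \<in> \<real>\<^sub>\<ge>\<^sub>0"
  using nn fS unfolding nonneg_operator_def by blast
 then have "0 \<le> (LBINT x. p x * a x - \<kappa>\<^sup>2 * (p x * p x) - (s x * p x) * (s x * p x))"
  unfolding E nonneg_Reals_of_real_iff .
 moreover have sp: "(\<lambda>x. s x * p x) \<in> L2" using sL2(1)[OF p] by simp
 ultimately have "0 \<le> (LBINT x. p x * a x) - \<kappa>\<^sup>2 * (LBINT x. p x * p x) - (LBINT x. (s x * p x) * (s x * p x))"
  using L2_prod_integrable(1)[OF p a] L2_prod_integrable(1)[OF p p] L2_prod_integrable(1)[OF sp sp] by simp
 moreover have "(LBINT x. p x * a x) = (LBINT x. BS s \<kappa> g x * g x)"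
  unfolding BSp a_def by (simp add: mult_ac)
 moreover have "(LBINT x. p x * p x) = (n2 p)\<^sup>2" "(LBINT x. (s x * p x) * (s x * p x)) = (n2 (BS s \<kappa> g))\<^sup>2"
  unfolding n2_sq BSp by (auto simp: power2_eq_square)
 ultimately show ?thesis by (simp add: p_def a_def[abs_def])
qed

text \<open>Write K for the operator; \<open>form_bound\<close> bounds the squared norm of K g, plus
  a \<kappa>^2 term, by <K g, g>. Cauchy--Schwarz gives contraction; expanding the squared norm of K
  g - g shows that an almost maximiser is almost fixed by K; the \<kappa>^2 term bounds \<kappa>
  along almost maximisers.\<close>

lemma BS_contraction:
 assumes nn: "nonneg_operator (sobolev 2) (schroedinger (\<lambda>x. (s x)\<^sup>2))"
  and \<kappa>: "\<kappa> > 0" and g: "(g :: R3 \<Rightarrow> real) \<in> L2"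
 shows "n2 (BS s \<kappa> g) \<le> n2 g"
  and "(n2 (\<lambda>x. BS s \<kappa> g x - g x))\<^sup>2 \<le> (n2 g)\<^sup>2 - (n2 (BS s \<kappa> g))\<^sup>2"
  and "\<kappa>\<^sup>2 * n2 (BS s \<kappa> g) \<le> B\<^sup>2 * n2 g"
proof -
 let ?K = "BS s \<kappa> g" and ?p = "cv (Y \<kappa>) (\<lambda>y. s y *\<^sub>R g y)"
 note KL = BS_L2[OF \<kappa> g]
 note fb = form_bound[OF nn \<kappa> g]
 have CS: "(LBINT x. ?K x * g x) \<le> n2 ?K * n2 g"
  using L2_prod_integrable(2)[OF KL g] by simp
 have p2: "\<kappa>\<^sup>2 * (n2 ?p)\<^sup>2 \<ge> 0" by simp
 have K1: "(n2 ?K)\<^sup>2 \<le> n2 ?K * n2 g" using fb CS p2 by linarith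
 show "n2 ?K \<le> n2 g"
 proof (cases "n2 ?K = 0")
  case False
  then have "n2 ?K > 0" using n2_nonneg[of ?K] by linarith
  then show ?thesis using K1 by (simp add: power2_eq_square)
 qed simp
 have "(n2 (\<lambda>x. ?K x - g x))\<^sup>2 = (LBINT x. (norm (?K x))\<^sup>2 + (norm (g x))\<^sup>2 - 2 * (?K x * g x))"
  unfolding n2_sq by (simp add: power2_diff algebra_simps)
 also have "\<dots> = (n2 ?K)\<^sup>2 + (n2 g)\<^sup>2 - 2 * (LBINT x. ?K x * g x)"
  unfolding n2_sq using L2_integrable[OF KL] L2_integrable[OF g] L2_prod_integrable(1)[OF KL g] by simp
 also have "\<dots> \<le> (n2 g)\<^sup>2 - (n2 ?K)\<^sup>2" using fb p2 by linarith
 finally show "(n2 (\<lambda>x. ?K x - g x))\<^sup>2 \<le> (n2 g)\<^sup>2 - (n2 ?K)\<^sup>2" .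
 have "n2 ?K \<le> B * n2 ?p" unfolding BS_def[abs_def] by (intro sL2 cv_Y_L2 \<kappa> g)
 then have "(n2 ?K)\<^sup>2 \<le> B\<^sup>2 * (n2 ?p)\<^sup>2" using power_mono[of "n2 ?K" "B * n2 ?p" 2] by (simp add: power_mult_distrib)
 then have "\<kappa>\<^sup>2 * (n2 ?K)\<^sup>2 \<le> B\<^sup>2 * (\<kappa>\<^sup>2 * (n2 ?p)\<^sup>2)"
  using mult_left_mono[of "(n2 ?K)\<^sup>2" "B\<^sup>2 * (n2 ?p)\<^sup>2" "\<kappa>\<^sup>2"] by (simp add: mult_ac)
 also have "\<dots> \<le> B\<^sup>2 * (n2 ?K * n2 g)"
 proof (rule mult_left_mono)
  show "\<kappa>\<^sup>2 * (n2 ?p)\<^sup>2 \<le> n2 ?K * n2 g" using fb CS zero_le_power2[of "n2 ?K"] by linarith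
 qed simp
 finally have "(\<kappa>\<^sup>2 * n2 ?K) * n2 ?K \<le> (B\<^sup>2 * n2 g) * n2 ?K" by (simp add: power2_eq_square mult_ac)
 then show "\<kappa>\<^sup>2 * n2 ?K \<le> B\<^sup>2 * n2 g"
  using n2_nonneg[of ?K] by (cases "n2 ?K = 0") (auto simp: mult_le_cancel_right)
qed

end

section \<open>Approximate zero energy resonances\<close>

lemma integrable_sandwich:
 fixes f F :: "'a::euclidean_space \<Rightarrow> real"
 assumes "f \<in> borel_measurable borel" "integrable lborel F" "\<And>x. 0 \<le> f x" "AE x in lborel. f x \<le> F x"
 shows "integrable lborel f" "(LBINT x. f x) \<le> (LBINT x. F x)"
proof -
 have "AE x in lborel. norm (f x) \<le> norm (F x)"
  using assms(4) by eventually_elim (use assms(3) in auto)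
 then show f: "integrable lborel f"
  using assms(1) by (intro Bochner_Integration.integrable_bound[OF assms(2)]) auto
 show "(LBINT x. f x) \<le> (LBINT x. F x)"
  by (rule integral_mono_AE[OF f assms(2,4)])
qed

text \<open>A common integrable majorant: the exponential comes from the decay of the potential, the
  other two factors from \<open>norm_ratio_le\<close>, which trades growth in \<open>x\<close> for
  growth in \<open>y\<close> and a singularity at y = x.\<close>

definition wexp :: "real \<Rightarrow> R3 \<Rightarrow> R3 \<Rightarrow> real" where
 "wexp b x y = exp (- b * norm y) * (1 + (norm y)\<^sup>2) * (1 + 1 / (norm (x - y))\<^sup>2)"

lemma wexp_nonneg: "0 \<le> wexp b x y"
 unfolding wexp_def by (intro mult_nonneg_nonneg add_nonneg_nonneg) auto

text \<open>The majorant C1 (2 j(y) + i(x - y)) separates decay in \<open>y\<close> from the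
  singularity at y = x; by translation invariance its integral does not depend on
  \<open>x\<close>.\<close>

lemma wexp_bound:
 assumes "b > 0"
 obtains C where "C > 0" "\<And>x. integrable lborel (wexp b x)" "\<And>x. (LBINT y. wexp b x y) \<le> C"
proof -
 obtain C1 where C1: "C1 > 0" "\<And>r::real. r \<ge> 0 \<Longrightarrow> exp (- b * r) \<le> C1 / (1 + r\<^sup>2) ^ 3"
  using exp_minus_le[OF assms] by blast
 define j where "j y = 1 / (1 + (norm y)\<^sup>2)\<^sup>2" for y :: R3
 define i where "i z = indicator (ball 0 1) z / (norm z)\<^sup>2" for z :: R3
 have jI: "integrable lborel j" unfolding j_def by (rule integrable_japanese)
 have iI: "integrable lborel i" unfolding i_def by (rule integrable_inverse_square_ball)
 have iR: "integrable lborel (\<lambda>y. i (x - y))" "(LBINT y. i (x - y)) = (LBINT y. i y)" for x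
  using lborel_integrable_reflect[OF iI] lborel_integral_reflect[OF borel_measurable_integrable[OF iI, simplified]] by auto
 have j1: "0 \<le> j y" "j y \<le> 1" for y
 proof -
  have "1 \<le> (1 + (norm y)\<^sup>2)\<^sup>2" by (simp add: one_le_power)
  then show "0 \<le> j y" "j y \<le> 1" by (auto simp: j_def divide_le_eq_1)
 qed
 have i0: "0 \<le> i z" for z by (simp add: i_def)
 have E: "exp (- b * norm y) * (1 + (norm y)\<^sup>2) \<le> C1 * j y" for y
 proof -
  define t where "t = 1 + (norm y)\<^sup>2"
  have t: "t > 0" unfolding t_def by (rule one_plus_norm2_pos)
  have "exp (- b * norm y) * t \<le> C1 / t ^ 3 * t"
   using C1(2)[of "norm y"] t by (intro mult_right_mono) (auto simp: t_def)
  also have "\<dots> = C1 * (1 / t\<^sup>2)" using t by (simp add: field_simps eval_nat_numeral)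
  finally show ?thesis by (simp add: t_def j_def)
 qed
 have Z: "1 + 1 / (norm z)\<^sup>2 \<le> 2 + i z" for z
 proof (cases "norm z < 1")
  case False
  then have "1 \<le> (norm z)\<^sup>2" by (intro one_le_power) simp
  then have "1 / (norm z)\<^sup>2 \<le> 1" using frac_le[of 1 1 1 "(norm z)\<^sup>2"] by simp
  then show ?thesis using i0[of z] by linarith
 qed (simp add: i_def)
 have le: "wexp b x y \<le> C1 * (2 * j y + i (x - y))" for x y
 proof -
  have "wexp b x y \<le> (C1 * j y) * (2 + i (x - y))"
   unfolding wexp_def using C1(1) j1(1)[of y] by (intro mult_mono E Z) (auto intro: add_nonneg_nonneg)
  also have "\<dots> = C1 * (2 * j y + j y * i (x - y))" by (simp add: algebra_simps)
  also have "\<dots> \<le> C1 * (2 * j y + 1 * i (x - y))"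
   using C1(1) by (intro mult_left_mono add_left_mono mult_right_mono j1 i0) auto
  finally show ?thesis by simp
 qed
 have F: "integrable lborel (\<lambda>y. C1 * (2 * j y + i (x - y)))" for x
  by (intro integrable_mult_right Bochner_Integration.integrable_add jI iR)
 have FI: "(LBINT y. C1 * (2 * j y + i (x - y))) = C1 * (2 * (LBINT y. j y) + (LBINT y. i y))" for x
  using jI iR by simp
 have "wexp b x \<in> borel_measurable borel" for x unfolding wexp_def[abs_def] by measurable
 note S = integrable_sandwich[OF this F wexp_nonneg always_eventually[OF allI[OF le]]]
 show thesis
 proof (rule that[of "max 1 (C1 * (2 * (LBINT y. j y) + (LBINT y. i y)))"])
  show "integrable lborel (wexp b x)" for x by (rule S(1))
  show "(LBINT y. wexp b x y) \<le> max 1 (C1 * (2 * (LBINT y. j y) + (LBINT y. i y)))" for x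
   using S(2)[of x] unfolding FI by simp
 qed simp
qed

lemma exp_le_wexp: "exp (- b * norm y) \<le> wexp b x y"
proof -
 have "exp (- b * norm y) * 1 * 1 \<le> wexp b x y"
  unfolding wexp_def by (intro mult_mono) auto
 then show ?thesis by simp
qed

lemma exp_over_square_le_wexp: "exp (- b * norm y) / (norm (x - y))\<^sup>2 \<le> wexp b x y"
proof -
 have "exp (- b * norm y) * 1 * (1 / (norm (x - y))\<^sup>2) \<le> wexp b x y"
  unfolding wexp_def by (intro mult_mono) auto
 then show ?thesis by simp
qed

text \<open>Both bounds rest on |x| / |x - y| \<le> 1 + |y| / |x - y| and on completing
  squares.\<close>

lemma norm_ratio_le:
 fixes x y :: R3 assumes "x \<noteq> y"
 shows "norm x / norm (x - y) \<le> (1 + (norm y)\<^sup>2) * (1 + 1 / (norm (x - y))\<^sup>2)"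
  and "(norm x)\<^sup>2 / (norm (x - y))\<^sup>2 \<le> 2 * ((1 + (norm y)\<^sup>2) * (1 + 1 / (norm (x - y))\<^sup>2))"
proof -
 define z where "z = norm (x - y)"
 define u where "u = 1 / z"
 have z: "z > 0" using assms by (simp add: z_def)
 have u: "u > 0" "z * u = 1" using z by (auto simp: u_def)
 have x: "norm x \<le> z + norm y" using norm_triangle_ineq[of "x - y" y] by (simp add: z_def)
 have ex: "(1 + (norm y)\<^sup>2) * (1 + u\<^sup>2) = 1 + (norm y)\<^sup>2 + u\<^sup>2 + (norm y * u)\<^sup>2"
  by (simp add: algebra_simps power_mult_distrib)
 have "norm x * u \<le> (z + norm y) * u" using x u by (intro mult_right_mono) auto
 also have "\<dots> = 1 + norm y * u" using u by (simp add: algebra_simps)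
 finally have xu: "norm x * u \<le> 1 + norm y * u" .
 have yu: "2 * (norm y * u) \<le> (norm y)\<^sup>2 + u\<^sup>2" using sum_squares_bound[of "norm y" u] by (simp add: mult.assoc)
 have "norm x * u \<le> (1 + (norm y)\<^sup>2) * (1 + u\<^sup>2)"
  unfolding ex using xu yu zero_le_power2[of "norm y * u"] zero_le_power2[of "norm y"] zero_le_power2[of u] mult_nonneg_nonneg[OF norm_ge_zero[of y] less_imp_le[OF u(1)]]
  by linarith
 then show "norm x / norm (x - y) \<le> (1 + (norm y)\<^sup>2) * (1 + 1 / (norm (x - y))\<^sup>2)"
  by (simp add: u_def z_def power_divide)
 have "(norm x * u)\<^sup>2 \<le> (1 + norm y * u)\<^sup>2" using xu u by (intro power_mono) auto
 also have "\<dots> \<le> 2 * (1 + (norm y * u)\<^sup>2)" using zero_le_power2[of "1 - norm y * u"] by (simp add: power2_sum power2_diff)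
 also have "\<dots> \<le> 2 * ((1 + (norm y)\<^sup>2) * (1 + u\<^sup>2))"
  unfolding ex using zero_le_power2[of "norm y"] zero_le_power2[of u] by simp
 finally show "(norm x)\<^sup>2 / (norm (x - y))\<^sup>2 \<le> 2 * ((1 + (norm y)\<^sup>2) * (1 + 1 / (norm (x - y))\<^sup>2))"
  by (simp add: u_def z_def power_divide)
qed

text \<open>Multiplied by |x| or |x|^2, the convolution integrals are dominated by a multiple of
  \<open>wexp\<close>, uniformly in \<open>x\<close>. The constant depends on \<open>A\<close> and
  \<open>b\<close> but not on \<kappa>, since the kernel is compared with the Coulomb kernel. Its
  factor 2 comes from the squared ratio.\<close>

lemma cv_Y_pointwise_bounds:
 assumes b: "b > 0" and A: "A > 0"
 obtains C where "C > 0"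
  "\<And>\<kappa> g x. \<kappa> > 0 \<Longrightarrow> test g \<Longrightarrow> (\<And>y. 0 \<le> g y \<and> g y \<le> A * exp (- b * norm y)) \<Longrightarrow> x \<noteq> 0 \<Longrightarrow>
    cv (Y \<kappa>) g x \<le> C / norm x"
  "\<And>\<kappa> g x c. \<kappa> > 0 \<Longrightarrow> test g \<Longrightarrow> (\<And>y. 0 \<le> g y \<and> g y \<le> A * exp (- b * norm y)) \<Longrightarrow> x \<noteq> 0 \<Longrightarrow> c \<in> Basis \<Longrightarrow>
    \<bar>pd c (cv (Y \<kappa>) g) x\<bar> \<le> C / (norm x)\<^sup>2"
proof -
 obtain W where W: "W > 0" "\<And>x. integrable lborel (wexp b x)" "\<And>x. (LBINT y. wexp b x y) \<le> W"
  using wexp_bound[OF b] by blast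
 show thesis
 proof (rule that[of "2 * A * W / c5"])
  show "2 * A * W / c5 > 0" using A W c5_pos by simp
 next
  fix \<kappa> :: real and g :: "R3 \<Rightarrow> real" and x :: R3
  assume \<kappa>: "\<kappa> > 0" and g: "test g" and le: "\<And>y. 0 \<le> g y \<and> g y \<le> A * exp (- b * norm y)" and x: "x \<noteq> 0"
  note [measurable] = test_measurable[OF g]
  have "norm x * cv (Y \<kappa>) g x = (LBINT y. norm x * (Y \<kappa> (x - y) * g y))"
   by (simp add: cv_def)
  also have "\<dots> \<le> (LBINT y. A / c5 * wexp b x y)"
  proof (rule integrable_sandwich(2))
   show "integrable lborel (\<lambda>y. A / c5 * wexp b x y)" by (intro integrable_mult_right W)
   show "0 \<le> norm x * (Y \<kappa> (x - y) * g y)" for y using le[of y] by simp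
   show "AE y in lborel. norm x * (Y \<kappa> (x - y) * g y) \<le> A / c5 * wexp b x y"
    using AE_nonzero[of x]
   proof eventually_elim
    case (elim y)
    have "norm x * (Y \<kappa> (x - y) * g y) \<le> norm x * (1 / (c5 * norm (x - y)) * (A * exp (- b * norm y)))"
     using le[of y] Y_le[OF less_imp_le[OF \<kappa>], of "x - y"] c5_pos by (intro mult_left_mono mult_mono) auto
    also have "\<dots> = A / c5 * (exp (- b * norm y) * (norm x / norm (x - y)))" by simp
    also have "\<dots> \<le> A / c5 * (exp (- b * norm y) * ((1 + (norm y)\<^sup>2) * (1 + 1 / (norm (x - y))\<^sup>2)))"
     using A c5_pos elim by (intro mult_left_mono norm_ratio_le) auto
    finally show ?case by (simp add: wexp_def mult.assoc)
   qed
  qed measurable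
  also have "\<dots> \<le> A / c5 * W" using W(3)[of x] A c5_pos by (simp add: mult_left_mono divide_right_mono)
  also have "\<dots> \<le> 2 * A * W / c5" using A W(1) c5_pos by (simp add: divide_right_mono)
  finally have F: "norm x * cv (Y \<kappa>) g x \<le> 2 * A * W / c5" .
  have "0 < norm x" using x by simp
  then show "cv (Y \<kappa>) g x \<le> 2 * A * W / c5 / norm x"
   using F by (subst pos_le_divide_eq) (simp_all only: mult.commute[of "norm x"])
 next
  fix \<kappa> :: real and g :: "R3 \<Rightarrow> real" and x c :: R3
  assume \<kappa>: "\<kappa> > 0" and g: "test g" and le: "\<And>y. 0 \<le> g y \<and> g y \<le> A * exp (- b * norm y)" and x: "x \<noteq> 0" and c: "c \<in> Basis"
  note [measurable] = test_measurable[OF g]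
  have "(norm x)\<^sup>2 * \<bar>pd c (cv (Y \<kappa>) g) x\<bar> \<le> (norm x)\<^sup>2 * ((LBINT y. \<bar>g (x - y)\<bar> / (norm y)\<^sup>2) / c5)"
   by (intro mult_left_mono pd_cv_Y_le \<kappa> g c) auto
  also have "(LBINT y. \<bar>g (x - y)\<bar> / (norm y)\<^sup>2) = (LBINT y. \<bar>g y\<bar> / (norm (x - y))\<^sup>2)"
   using lborel_integral_reflect[of "\<lambda>y. \<bar>g y\<bar> / (norm (x - y))\<^sup>2" x] by simp
  also have "(norm x)\<^sup>2 * ((LBINT y. \<bar>g y\<bar> / (norm (x - y))\<^sup>2) / c5) = (LBINT y. (norm x)\<^sup>2 / c5 * (\<bar>g y\<bar> / (norm (x - y))\<^sup>2))"
   by (subst integral_mult_right_zero) simp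
  also have "\<dots> \<le> (LBINT y. 2 * A / c5 * wexp b x y)"
  proof (rule integrable_sandwich(2))
   show "integrable lborel (\<lambda>y. 2 * A / c5 * wexp b x y)" by (intro integrable_mult_right W)
   show "0 \<le> (norm x)\<^sup>2 / c5 * (\<bar>g y\<bar> / (norm (x - y))\<^sup>2)" for y using c5_pos by simp
   show "AE y in lborel. (norm x)\<^sup>2 / c5 * (\<bar>g y\<bar> / (norm (x - y))\<^sup>2) \<le> 2 * A / c5 * wexp b x y"
    using AE_nonzero[of x]
   proof eventually_elim
    case (elim y)
    have "(norm x)\<^sup>2 / c5 * (\<bar>g y\<bar> / (norm (x - y))\<^sup>2) = 1 / c5 * (\<bar>g y\<bar> * ((norm x)\<^sup>2 / (norm (x - y))\<^sup>2))" by simp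
    also have "\<dots> \<le> 1 / c5 * ((A * exp (- b * norm y)) * (2 * ((1 + (norm y)\<^sup>2) * (1 + 1 / (norm (x - y))\<^sup>2))))"
     using le[of y] A c5_pos elim by (intro mult_left_mono mult_mono norm_ratio_le) auto
    finally show ?case by (simp add: wexp_def mult_ac)
   qed
  qed measurable
  also have "\<dots> \<le> 2 * A / c5 * W" using W(3)[of x] A c5_pos by (simp add: mult_left_mono divide_right_mono)
  finally have F: "(norm x)\<^sup>2 * \<bar>pd c (cv (Y \<kappa>) g) x\<bar> \<le> 2 * A / c5 * W" .
  have "0 < (norm x)\<^sup>2" using x by simp
  then show "\<bar>pd c (cv (Y \<kappa>) g) x\<bar> \<le> 2 * A * W / c5 / (norm x)\<^sup>2"
   using F by (subst pos_le_divide_eq) (simp_all add: mult.commute[of "(norm x)\<^sup>2"])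
 qed
qed

text \<open>Points of the ball of radius \<rho> have distance at most |x| + \<rho> from
  \<open>x\<close>, so there the kernel is at least its value at that distance and at the largest
  admissible \<kappa>. Of \<open>g\<close> only the lower bound \<open>c\<close> for its mass in the
  ball enters.\<close>

lemma cv_Y_lower_bound:
 assumes \<kappa>: "\<kappa> > 0" "\<kappa> \<le> \<kappa>m" and g: "test g" and g0: "\<And>y. 0 \<le> g y" and \<rho>: "\<rho> > 0"
  and c: "c \<le> (LBINT y. indicator (cball 0 \<rho>) y * g y)"
 shows "exp (- \<kappa>m * (norm x + \<rho>)) / (c5 * (norm x + \<rho>)) * c \<le> cv (Y \<kappa>) g x"
proof -
 define m where "m = exp (- \<kappa>m * (norm x + \<rho>)) / (c5 * (norm x + \<rho>))"
 have xr: "norm x + \<rho> > 0" using \<rho> by (simp add: add_nonneg_pos)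
 have m: "m \<ge> 0" unfolding m_def using c5_pos xr by simp
 note [measurable] = test_measurable[OF g]
 have "m * c \<le> m * (LBINT y. indicator (cball 0 \<rho>) y * g y)" using m c by (rule mult_left_mono[rotated])
 also have "\<dots> = (LBINT y. m * (indicator (cball 0 \<rho>) y * g y))" by simp
 also have "\<dots> \<le> (LBINT y. Y \<kappa> (x - y) *\<^sub>R g y)"
 proof (rule integrable_sandwich(2))
  show "integrable lborel (\<lambda>y. Y \<kappa> (x - y) *\<^sub>R g y)" by (rule young(1)[OF Y_integrable[OF \<kappa>(1)] test_L2[OF g]])
  show "0 \<le> m * (indicator (cball 0 \<rho>) y * g y)" for y using m g0 by simp
  show "AE y in lborel. m * (indicator (cball 0 \<rho>) y * g y) \<le> Y \<kappa> (x - y) *\<^sub>R g y"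
   using AE_nonzero[of x]
  proof eventually_elim
   case (elim y)
   show ?case
   proof (cases "norm y \<le> \<rho>")
    case True
    have z: "norm (x - y) > 0" "norm (x - y) \<le> norm x + \<rho>" using elim True norm_triangle_ineq4[of x y] by auto
    have "\<kappa> * norm (x - y) \<le> \<kappa>m * (norm x + \<rho>)" using \<kappa> z by (intro mult_mono) auto
    then have "m \<le> Y \<kappa> (x - y)"
     unfolding m_def Y_def using z c5_pos xr by (intro frac_le mult_left_mono) auto
    then show ?thesis using True g0[of y] by (simp add: mult_right_mono)
   qed (use g0 in simp)
  qed
 qed (auto intro!: borel_measurable_times borel_measurable_indicator)
 finally show ?thesis by (simp add: m_def cv_def)
qed

text \<open>\<open>C\<close> and \<open>m\<close> are fixed before \<delta>, while \<open>h\<close>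
  and \<open>g\<close> may change with it. The term \<kappa>^2 h of the resolvent equation has a
  favourable sign and is dropped, which leaves an inequality for - \<Delta>h; how well
  \<open>h\<close> solves the zero energy equation is measured by g - v h. The upper bounds exclude
  x = 0, where division by zero would make the first one read h 0 \<le> 0.\<close>

definition approx_resonance :: "(R3 \<Rightarrow> real) \<Rightarrow> real \<Rightarrow> (R3 \<Rightarrow> real) \<Rightarrow> bool" where
 "approx_resonance v C m \<longleftrightarrow> C > 0 \<and> m \<in> borel_measurable borel \<and> (\<forall>x. m x > 0) \<and>
  (\<forall>\<delta>>0. \<exists>h g. smooth h \<and> test g \<and> (\<forall>x. m x \<le> h x) \<and> (\<forall>x. x \<noteq> 0 \<longrightarrow> h x \<le> C / norm x) \<and>
    (\<forall>x. \<forall>c\<in>Basis. x \<noteq> 0 \<longrightarrow> \<bar>pd c h x\<bar> \<le> C / (norm x)\<^sup>2) \<and> (\<forall>x. - lap h x \<le> g x) \<and>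
    (\<lambda>x. g x - v x * h x) \<in> L2 \<and> n2 (\<lambda>x. g x - v x * h x) \<le> \<delta>)"

context bounded_weight
begin

text \<open>For an almost maximiser g0 put p = Y * (s g0), so that K g0 = s p, and S = s^2 p. As K
  g0 is close to g0, s (Y * S) = K (K g0) is close to K g0 = s p, whence S is close to s^2 (Y * S).
  The source is a truncated and mollified \<open>S\<close>; it inherits the decay of s^2, and its
  mass in a fixed ball is bounded from below because K g0 is not small.\<close>

lemma approximate_source:
 assumes nn: "nonneg_operator (sobolev 2) (schroedinger (\<lambda>x. (s x)\<^sup>2))"
  and spec: "\<And>\<epsilon>. \<epsilon> > 0 \<Longrightarrow> spectrum (sobolev 2) (schroedinger (\<lambda>x. (1 + \<epsilon>) * (s x)\<^sup>2)) \<inter> complex_of_real ` {..<0} \<noteq> {}"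
  and b: "b1 > 0" "b > 0" and sb: "\<And>x. (s x)\<^sup>2 \<le> b1 * exp (- b * norm x)"
 obtains A c \<rho> \<kappa>m where "A > 0" "c > 0" "\<rho> > 0"
  "\<And>\<delta>. \<delta> > 0 \<Longrightarrow> \<exists>\<kappa> g. 0 < \<kappa> \<and> \<kappa> \<le> \<kappa>m \<and> test g \<and> (\<forall>x. 0 \<le> g x \<and> g x \<le> A * exp (- b * norm x)) \<and>
    c \<le> (LBINT y. indicator (cball 0 \<rho>) y * g y) \<and> n2 (\<lambda>x. g x - (s x)\<^sup>2 * cv (Y \<kappa>) g x) \<le> \<delta>"
proof -
 obtain W where W: "W > 0" "\<And>x. integrable lborel (wexp b x)" "\<And>x. (LBINT y. wexp b x y) \<le> W"
  using wexp_bound[OF b(2)] by blast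
 \<comment> \<open>The pointwise bound of \<open>p\<close>: Cauchy--Schwarz with the normalised
   almost maximiser, and \<integral> s^2 Y^2 \<le> b1 W / c5^2.\<close>
 define C1 where "C1 = sqrt (b1 * W) / c5"
 have C1: "C1 > 0" using b W c5_pos by (simp add: C1_def)
 define ex where "ex x = exp (- b * norm x)" for x :: R3
 have exI: "integrable lborel ex"
 proof (rule integrable_sandwich(1)[OF _ W(2)[of 0]])
  show "ex \<in> borel_measurable borel" unfolding ex_def by measurable
  show "AE x in lborel. ex x \<le> wexp b 0 x" unfolding ex_def by (intro always_eventually allI exp_le_wexp)
 qed (simp add: ex_def)
 have ex0: "ex x > 0" for x by (simp add: ex_def)
 note [measurable] = borel_measurable_integrable[OF exI]
 have tail: "(\<lambda>n. LBINT x. indicator (cball 0 (real n)) x * (b1 * C1 * ex x)) \<longlonglongrightarrow> (LBINT x. b1 * C1 * ex x)"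
 proof (rule integral_dominated_convergence[where w="\<lambda>x. b1 * C1 * ex x"])
  show "integrable lborel (\<lambda>x. b1 * C1 * ex x)" by (intro integrable_mult_right exI)
  show "AE x in lborel. (\<lambda>n. indicator (cball 0 (real n)) x * (b1 * C1 * ex x)) \<longlonglongrightarrow> b1 * C1 * ex x"
  proof (rule always_eventually, rule allI, rule tendsto_eventually)
   fix x :: R3
   have "indicator (cball 0 (real n)) x * (b1 * C1 * ex x) = b1 * C1 * ex x" if "n \<ge> nat \<lceil>norm x\<rceil>" for n
   proof -
    have "norm x \<le> real n" using that by linarith
    then show ?thesis by simp
   qed
   then show "\<forall>\<^sub>F n in sequentially. indicator (cball 0 (real n)) x * (b1 * C1 * ex x) = b1 * C1 * ex x"
    unfolding eventually_sequentially by blast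
  qed
  show "AE x in lborel. norm (indicator (cball 0 (real n)) x * (b1 * C1 * ex x)) \<le> b1 * C1 * ex x" for n
   using b C1 ex0 by (auto simp: indicator_def less_imp_le)
 qed (auto intro!: borel_measurable_times borel_measurable_indicator)
 have "1 / (8 * C1) > 0" using C1 by simp
 from LIMSEQ_D[OF tail this] obtain n0 where "\<forall>n\<ge>n0.
   norm ((LBINT x. indicator (cball 0 (real n)) x * (b1 * C1 * ex x)) - (LBINT x. b1 * C1 * ex x)) < 1 / (8 * C1)"
  by blast
 from this[rule_format, of "Suc n0"] have n0: "\<bar>(LBINT x. indicator (cball 0 (real (Suc n0))) x * (b1 * C1 * ex x)) - (LBINT x. b1 * C1 * ex x)\<bar> < 1 / (8 * C1)"
  by (simp del: of_nat_Suc)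
 \<comment> \<open>Outside this ball the majorant b1 C1 exp (- b |x|) of \<open>S\<close> has mass
   below 1 / (8 C1). The successor makes the radius positive.\<close>
 define \<rho> where "\<rho> = real (Suc n0)"
 define I where "I = (indicator (cball (0::R3) \<rho>) :: R3 \<Rightarrow> real)"
 have I: "I \<in> L2" unfolding I_def by (rule indicator_L2) auto
 note [measurable] = L2_measurable[OF I]
 have I01: "0 \<le> I x" "I x \<le> 1" for x by (auto simp: I_def indicator_def)
 \<comment> \<open>The factor exp b pays for the mollification, which averages over points at
   distance at most 1.\<close>
 define A where "A = b1 * C1 * exp b"
 \<comment> \<open>The mass of \<open>S\<close> is at least 1 / (4 C1); the part outside the ball
   costs at most 1 / (8 C1), and half of the rest is given up when \<open>S\<close> is approximated
   by a test function.\<close>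
 define c where "c = 1 / (16 * C1)"
 have c: "c > 0" using C1 by (simp add: c_def)
 have A: "A > 0" using b C1 by (simp add: A_def)
 have main: "\<exists>\<kappa> g. 0 < \<kappa> \<and> \<kappa> \<le> 2 * B \<and> test g \<and> (\<forall>x. 0 \<le> g x \<and> g x \<le> A * exp (- b * norm x)) \<and>
    c \<le> (LBINT y. indicator (cball 0 \<rho>) y * g y) \<and> n2 (\<lambda>x. g x - (s x)\<^sup>2 * cv (Y \<kappa>) g x) \<le> \<delta>"
  if \<delta>: "\<delta> > 0" for \<delta>
 proof -
  define d where "d = \<delta> / (2 * B)"
  have d: "d > 0" using \<delta> B_pos by (simp add: d_def)
  \<comment> \<open>2 e \<le> d^2 gives 1 - (1 - e)^2 \<le> d^2, so K g - g has norm at most d; and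
    e \<le> 1/2 keeps the norm of K g at least 1/2, which bounds \<kappa> from above and the mass
    from below.\<close>
  define e where "e = min (1/2) (d\<^sup>2 / 2)"
  have e: "0 < e" "e \<le> 1/2" "2 * e \<le> d\<^sup>2" using d by (auto simp: e_def)
  obtain \<kappa> g where \<kappa>: "\<kappa> > 0" and g: "g \<in> L2" "\<And>x. g x \<ge> (0::real)" "n2 g = 1" and Kg: "n2 (BS s \<kappa> g) \<ge> 1 - e"
   using almost_maximizer[OF spec, of e] e by auto
  define k where "k = BS s \<kappa> g"
  have k: "k \<in> L2" unfolding k_def by (rule BS_L2[OF \<kappa> g(1)])
  have kn: "n2 k \<ge> 1 - e" "n2 k \<ge> 1/2" "n2 k \<le> 1"
   using Kg e BS_contraction(1)[OF nn \<kappa> g(1)] g(3) by (auto simp: k_def)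
  have kg: "n2 (\<lambda>x. k x - g x) \<le> d"
  proof (rule power2_le_imp_le)
   have "(1 - e)\<^sup>2 \<le> (n2 k)\<^sup>2" using kn e by (intro power_mono) auto
   then have "(n2 (\<lambda>x. k x - g x))\<^sup>2 \<le> 1 - (1 - e)\<^sup>2"
    using BS_contraction(2)[OF nn \<kappa> g(1)] g(3) by (simp add: k_def)
   also have "\<dots> \<le> d\<^sup>2" 
  proof -
   have "1 - (1 - e)\<^sup>2 = 2 * e - e\<^sup>2" by (simp add: power2_eq_square algebra_simps)
   then show ?thesis using e(3) zero_le_power2[of e] by linarith
  qed
   finally show "(n2 (\<lambda>x. k x - g x))\<^sup>2 \<le> d\<^sup>2" .
  qed (use d in simp)
  have \<kappa>B: "\<kappa> \<le> 2 * B"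
  proof (rule power2_le_imp_le)
   have "\<kappa>\<^sup>2 * (1/2) \<le> \<kappa>\<^sup>2 * n2 k" using kn by (intro mult_left_mono) auto
   also have "\<dots> \<le> B\<^sup>2" using BS_contraction(3)[OF nn \<kappa> g(1)] g(3) by (simp add: k_def)
   finally have "\<kappa>\<^sup>2 \<le> 2 * B\<^sup>2" by simp
   moreover have "(2 * B)\<^sup>2 = 4 * B\<^sup>2" by (simp add: power_mult_distrib)
   ultimately show "\<kappa>\<^sup>2 \<le> (2 * B)\<^sup>2" using zero_le_power2[of B] by linarith
  qed (use B_pos in simp)
  define p where "p = cv (Y \<kappa>) (\<lambda>y. s y *\<^sub>R g y)"
  have pL: "p \<in> L2" unfolding p_def by (intro cv_Y_L2 \<kappa> sL2 g)
  have ks: "k x = s x * p x" for x by (simp add: k_def BS_def p_def)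
  have p0: "0 \<le> p x" for x unfolding p_def cv_def
   by (intro Bochner_Integration.integral_nonneg) (simp add: s_nonneg g)
  have pC: "p x \<le> C1" for x
  proof -
   have q: "(\<lambda>y. s y *\<^sub>R Y \<kappa> (x - y)) \<in> L2" by (rule sL2(1)[OF L2_reflect(1)[OF Y_integrable(2)[OF \<kappa>]]])
   have "p x = (LBINT y. (s y *\<^sub>R Y \<kappa> (x - y)) * g y)" by (simp add: p_def cv_def mult_ac)
   also have "\<dots> \<le> n2 (\<lambda>y. s y *\<^sub>R Y \<kappa> (x - y)) * n2 g"
    using L2_prod_integrable(2)[OF q g(1)] by linarith
   also have "\<dots> \<le> C1"
   proof -
    have "(LBINT y. (norm (s y *\<^sub>R Y \<kappa> (x - y)))\<^sup>2) \<le> (LBINT y. b1 / c5\<^sup>2 * wexp b x y)"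
    proof (rule integrable_sandwich(2))
     note [measurable] = L2_measurable[OF q]
     show "(\<lambda>y. (norm (s y *\<^sub>R Y \<kappa> (x - y)))\<^sup>2) \<in> borel_measurable borel" by measurable
     show "integrable lborel (\<lambda>y. b1 / c5\<^sup>2 * wexp b x y)" by (intro integrable_mult_right W)
     show "AE y in lborel. (norm (s y *\<^sub>R Y \<kappa> (x - y)))\<^sup>2 \<le> b1 / c5\<^sup>2 * wexp b x y"
     proof (intro always_eventually allI)
      fix y
      have "(Y \<kappa> (x - y))\<^sup>2 \<le> (1 / (c5 * norm (x - y)))\<^sup>2"
       using Y_le[OF less_imp_le[OF \<kappa>], of "x - y"] by (intro power_mono) auto
      then have "(norm (s y *\<^sub>R Y \<kappa> (x - y)))\<^sup>2 \<le> (b1 * exp (- b * norm y)) * (1 / (c5 * norm (x - y)))\<^sup>2"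
       using sb[of y] b by (simp add: power_mult_distrib) (intro mult_mono; simp)
      also have "\<dots> = b1 / c5\<^sup>2 * (exp (- b * norm y) / (norm (x - y))\<^sup>2)" by (simp add: power_divide power_mult_distrib)
      also have "\<dots> \<le> b1 / c5\<^sup>2 * wexp b x y" using b by (intro mult_left_mono exp_over_square_le_wexp) auto
      finally show "(norm (s y *\<^sub>R Y \<kappa> (x - y)))\<^sup>2 \<le> b1 / c5\<^sup>2 * wexp b x y" .
     qed
    qed simp
    also have "\<dots> \<le> b1 / c5\<^sup>2 * W" using W(3)[of x] b by (simp add: mult_left_mono divide_right_mono)
    finally have "n2 (\<lambda>y. s y *\<^sub>R Y \<kappa> (x - y)) \<le> sqrt (b1 / c5\<^sup>2 * W)" unfolding n2_def by (rule real_sqrt_le_mono)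
    also have "\<dots> = C1" using c5_pos by (simp add: C1_def real_sqrt_divide)
    finally show ?thesis using g(3) by simp
   qed
   finally show ?thesis .
  qed
  define S where "S x = s x * k x" for x
  have S: "S \<in> L2" using sL2(1)[OF k] by (simp add: S_def[abs_def])
  note [measurable] = L2_measurable[OF S]
  have Sp: "S x = (s x)\<^sup>2 * p x" for x by (simp add: S_def ks power2_eq_square)
  have S0: "0 \<le> S x" for x using p0 by (simp add: Sp)
  have Sle: "S x \<le> b1 * C1 * ex x" for x
   using mult_mono[OF sb[of x] pC[of x]] p0[of x] b by (simp add: Sp ex_def mult_ac)
  have SI: "integrable lborel S"
   by (rule integrable_sandwich(1)[of S "\<lambda>x. b1 * C1 * ex x"]) (use S0 Sle exI in \<open>auto intro!: integrable_mult_right\<close>)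
  have IS: "integrable lborel (\<lambda>x. I x * S x)" by (rule L2_prod_integrable(1)[OF I S])
  have "1/4 \<le> (n2 k)\<^sup>2" using power_mono[OF kn(2), of 2] by (simp add: power2_eq_square)
  also have "(n2 k)\<^sup>2 \<le> (LBINT x. C1 * S x)"
   unfolding n2_sq
  proof (rule integral_mono[OF L2_integrable[OF k]])
   show "integrable lborel (\<lambda>x. C1 * S x)" by (intro integrable_mult_right SI)
   show "(norm (k x))\<^sup>2 \<le> C1 * S x" for x
    using mult_right_mono[OF pC[of x] S0[of x]] by (simp add: ks Sp power2_eq_square mult_ac)
  qed
  finally have "1 / (4 * C1) \<le> (LBINT x. S x)" using C1 by (simp add: field_simps)
  moreover have "(LBINT x. S x) - (LBINT x. I x * S x) \<le> 1 / (8 * C1)"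
  proof -
   have IE: "integrable lborel (\<lambda>x. I x * (b1 * C1 * ex x))"
    by (rule integrable_sandwich(1)[of _ "\<lambda>x. b1 * C1 * ex x"])
      (use I01 b C1 ex0 exI in \<open>auto simp: less_imp_le mult_left_le_one_le\<close>)
   have "(LBINT x. S x) - (LBINT x. I x * S x) = (LBINT x. (1 - I x) * S x)"
    using SI IS by (simp add: algebra_simps)
   also have "\<dots> \<le> (LBINT x. (1 - I x) * (b1 * C1 * ex x))"
   proof (rule integral_mono)
    show "integrable lborel (\<lambda>x. (1 - I x) * S x)" using SI IS by (simp add: left_diff_distrib)
    show "integrable lborel (\<lambda>x. (1 - I x) * (b1 * C1 * ex x))" using IE exI by (simp add: left_diff_distrib)
    show "(1 - I x) * S x \<le> (1 - I x) * (b1 * C1 * ex x)" for x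
     using Sle[of x] I01 by (intro mult_left_mono) auto
   qed
   also have "\<dots> = (LBINT x. b1 * C1 * ex x) - (LBINT x. I x * (b1 * C1 * ex x))"
    using IE exI by (simp add: left_diff_distrib)
   also have "\<dots> \<le> 1 / (8 * C1)" using n0 unfolding I_def \<rho>_def by linarith
   finally show ?thesis .
  qed
  ultimately have IS2: "2 * c \<le> (LBINT x. I x * S x)"
   using C1 by (simp add: c_def field_simps)
  define J where "J = (LBINT x. Y \<kappa> x)"
  have J0: "J \<ge> 0" unfolding J_def by (intro Bochner_Integration.integral_nonneg) simp
  \<comment> \<open>The accuracy with which the test function \<open>G\<close> follows
    \<open>S\<close>: the first term serves the residual, the second the mass in the ball.\<close>
  define e' where "e' = min (\<delta> / (2 * (1 + B * B * J))) (c / (1 + n2 I))"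
  have pos: "1 + B * B * J > 0" "1 + n2 I > 0" using J0 B_pos by (auto intro!: add_pos_nonneg)
  have e': "e' > 0" "e' * (1 + B * B * J) \<le> \<delta> / 2" "e' * n2 I \<le> c"
  proof -
   show "e' > 0" using \<delta> c pos by (simp add: e'_def)
   have "e' \<le> \<delta> / (2 * (1 + B * B * J))" by (simp add: e'_def)
   then show "e' * (1 + B * B * J) \<le> \<delta> / 2" using pos by (simp add: field_simps)
   have "e' \<le> c / (1 + n2 I)" by (simp add: e'_def)
   then have "e' * (1 + n2 I) \<le> c" using pos by (simp add: field_simps)
   then show "e' * n2 I \<le> c" using \<open>e' > 0\<close> by (simp add: algebra_simps)
  qed
  define Sr where "Sr n x = indicator (cball 0 (real n)) x * S x" for n and x :: R3
  have Srm: "Sr n \<in> borel_measurable borel" for n unfolding Sr_def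
   by (auto intro!: borel_measurable_times borel_measurable_indicator)
  have Sr0: "0 \<le> Sr n x" "Sr n x \<le> S x" for n x using S0[of x] by (auto simp: Sr_def indicator_def)
  have lim: "AE x in lborel. (\<lambda>n. Sr n x) \<longlonglongrightarrow> S x"
  proof (rule always_eventually, rule allI, rule tendsto_eventually)
   fix x :: R3
   show "\<forall>\<^sub>F n in sequentially. Sr n x = S x"
    using eventually_ge_at_top[of "nat \<lceil>norm x\<rceil>"]
   proof eventually_elim
    case (elim n)
    then have "norm x \<le> real n" by linarith
    then show ?case by (simp add: Sr_def)
   qed
  qed
  have Srle: "\<bar>Sr n x\<bar> \<le> S x" for n x using Sr0[of n x] by simp
  note DC = L2_dominated_convergence[OF Srm L2_measurable[OF S] S lim Srle]
  obtain r where r: "n2 (\<lambda>x. Sr r x - S x) < e' / 2"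
   using LIMSEQ_D[OF DC(3), of "e' / 2"] e' by auto
  obtain n where n: "n2 (\<lambda>x. cv (moll n) (Sr r) x - Sr r x) < e' / 2"
   using LIMSEQ_D[OF moll_tendsto[OF DC(1)[of r]], of "e' / 2"] e' by auto
  define G where "G = cv (moll n) (Sr r)"
  have Gt: "test G"
   unfolding G_def by (rule cv_moll_test[OF L2_set_integrable[OF DC(1)] Srm, of "real r"]) (simp add: Sr_def)
  note GL = test_L2[OF Gt]
  have GS: "n2 (\<lambda>x. G x - S x) < e'"
   using n2_triangle[OF GL DC(1)[of r] S] n r by (simp add: G_def)
  have Gb: "0 \<le> G x \<and> G x \<le> A * exp (- b * norm x)" for x
  proof
   show "0 \<le> G x" unfolding G_def by (rule moll_nonneg_cv) (rule Sr0)
   have "\<bar>G x - 0\<bar> \<le> A * exp (- b * norm x)"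
    unfolding G_def
   proof (rule moll_bound[OF Srm])
    fix y assume y: "norm (x - y) \<le> inverse (real (Suc n))"
    have "inverse (real (Suc n)) \<le> 1" by (simp add: inverse_eq_divide)
    then have "norm x \<le> norm y + 1" using y norm_triangle_ineq[of "x - y" y] by simp
    then have "- b * norm y \<le> b + - b * norm x" using mult_left_mono[of "norm x" "norm y + 1" b] b by (simp add: algebra_simps)
    then have "ex y \<le> exp b * exp (- b * norm x)" unfolding ex_def by (simp flip: exp_add)
    then have "b1 * C1 * ex y \<le> b1 * C1 * (exp b * exp (- b * norm x))" using b C1 by (intro mult_left_mono) auto
    then show "\<bar>Sr r y - 0\<bar> \<le> A * exp (- b * norm x)"
     using Sr0[of r y] Sle[of y] by (simp add: A_def mult.assoc)
   qed (use A young(1)[OF test_integrable[OF moll_test] test_L2[OF moll_test] DC(1)] in auto)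
   then show "G x \<le> A * exp (- b * norm x)" by simp
  qed
  have GI: "c \<le> (LBINT x. I x * G x)"
  proof -
   have "(LBINT x. I x * (G x - S x)) = (LBINT x. I x * G x) - (LBINT x. I x * S x)"
    using L2_prod_integrable(1)[OF I GL] IS by (simp add: right_diff_distrib)
   moreover have "\<bar>LBINT x. I x * (G x - S x)\<bar> \<le> n2 I * n2 (\<lambda>x. G x - S x)"
    by (rule L2_prod_integrable(2)[OF I L2_diff(1)[OF GL S]])
   moreover have "n2 I * n2 (\<lambda>x. G x - S x) \<le> n2 I * e'" using GS by (intro mult_left_mono) auto
   ultimately show ?thesis using IS2 e'(3) by (simp add: mult.commute)
  qed
  have "n2 (\<lambda>x. G x - (s x)\<^sup>2 * cv (Y \<kappa>) G x) \<le> \<delta>"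
  proof -
   define D where "D x = S x - G x" for x
   have D: "D \<in> L2" unfolding D_def by (intro L2_diff S GL)
   have Dn: "n2 D \<le> e'" using GS n2_commute[of S G] by (simp add: D_def[abs_def])
   define E where "E = BS s \<kappa> (\<lambda>x. k x - g x)"
   have kgL: "(\<lambda>x. k x - g x) \<in> L2" by (intro L2_diff k g)
   have EL: "E \<in> L2" unfolding E_def by (rule BS_L2[OF \<kappa> kgL])
   have En: "n2 E \<le> d" unfolding E_def using BS_contraction(1)[OF nn \<kappa> kgL] kg by simp
   define F where "F x = s x *\<^sub>R (s x *\<^sub>R cv (Y \<kappa>) D x)" for x
   have FL: "F \<in> L2" unfolding F_def by (intro sL2 cv_Y_L2 \<kappa> D)
   have Fn: "n2 F \<le> B * (B * (J * e'))"
   proof -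
    have "n2 F \<le> B * n2 (\<lambda>x. s x *\<^sub>R cv (Y \<kappa>) D x)" unfolding F_def by (intro sL2 cv_Y_L2 \<kappa> D)
    also have "\<dots> \<le> B * (B * n2 (cv (Y \<kappa>) D))" using B_pos by (intro mult_left_mono sL2 cv_Y_L2 \<kappa> D) auto
    also have "\<dots> \<le> B * (B * (J * n2 D))" unfolding J_def using B_pos by (intro mult_left_mono cv_Y_L2 \<kappa> D) auto
    also have "\<dots> \<le> B * (B * (J * e'))" using B_pos J0 by (intro mult_left_mono Dn) auto
    finally show ?thesis .
   qed
   \<comment> \<open>Three sources of error: \<open>D\<close> is the approximation of
     \<open>S\<close> by \<open>G\<close>, \<open>F\<close> is its image under s^2 Y, and s E is the
     failure of the almost maximiser to be fixed by the operator.\<close>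
   have "G x - (s x)\<^sup>2 * cv (Y \<kappa>) G x = F x - (D x + s x *\<^sub>R E x)" for x
   proof -
    have e1: "cv (Y \<kappa>) D x = cv (Y \<kappa>) S x - cv (Y \<kappa>) G x"
     unfolding D_def by (rule cv_diff[OF Y_integrable[OF \<kappa>] S GL])
    have e2: "E x = s x * cv (Y \<kappa>) S x - s x * p x"
     unfolding E_def using BS_diff[OF \<kappa> k g(1), of x] by (simp add: BS_def S_def[abs_def] p_def)
    show ?thesis unfolding F_def e1 e2 D_def Sp by (simp add: algebra_simps power2_eq_square)
   qed
   then have "n2 (\<lambda>x. G x - (s x)\<^sup>2 * cv (Y \<kappa>) G x) = n2 (\<lambda>x. F x - (D x + s x *\<^sub>R E x))" by simp
   also have "\<dots> \<le> n2 F + n2 (\<lambda>x. D x + s x *\<^sub>R E x)" by (intro L2_diff FL L2_add D sL2 EL)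
   also have "\<dots> \<le> n2 F + (n2 D + n2 (\<lambda>x. s x *\<^sub>R E x))" by (intro add_left_mono L2_add D sL2 EL)
   also have "\<dots> \<le> B * (B * (J * e')) + (e' + B * d)"
   proof -
    have "n2 (\<lambda>x. s x *\<^sub>R E x) \<le> B * n2 E" by (rule sL2(2)[OF EL])
    also have "\<dots> \<le> B * d" using B_pos En by simp
    finally show ?thesis using Fn Dn by linarith
   qed
   also have "\<dots> = e' * (1 + B * B * J) + \<delta> / 2" using B_pos by (simp add: d_def algebra_simps)
   also have "\<dots> \<le> \<delta>" using e'(2) by linarith
   finally show ?thesis .
  qed
  then show ?thesis using \<kappa> \<kappa>B Gt Gb GI unfolding I_def by blast
 qed
 show thesis by (rule that[OF A c _ main]) (simp_all add: \<rho>_def)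
qed

lemma approximate_resonance:
 assumes nn: "nonneg_operator (sobolev 2) (schroedinger (\<lambda>x. (s x)\<^sup>2))"
  and spec: "\<And>\<epsilon>. \<epsilon> > 0 \<Longrightarrow> spectrum (sobolev 2) (schroedinger (\<lambda>x. (1 + \<epsilon>) * (s x)\<^sup>2)) \<inter> complex_of_real ` {..<0} \<noteq> {}"
  and b: "b1 > 0" "b > 0" and sb: "\<And>x. (s x)\<^sup>2 \<le> b1 * exp (- b * norm x)"
 obtains C m where "approx_resonance (\<lambda>x. (s x)\<^sup>2) C m"
proof -
 obtain A c \<rho> \<kappa>m where A: "A > 0" "c > 0" "\<rho> > 0"
  "\<And>\<delta>. \<delta> > 0 \<Longrightarrow> \<exists>\<kappa> g. 0 < \<kappa> \<and> \<kappa> \<le> \<kappa>m \<and> test g \<and> (\<forall>x. 0 \<le> g x \<and> g x \<le> A * exp (- b * norm x)) \<and>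
    c \<le> (LBINT y. indicator (cball 0 \<rho>) y * g y) \<and> n2 (\<lambda>x. g x - (s x)\<^sup>2 * cv (Y \<kappa>) g x) \<le> \<delta>"
  using approximate_source[OF nn spec b sb] by blast
 obtain C where C: "C > 0"
  "\<And>\<kappa> g x. \<kappa> > 0 \<Longrightarrow> test g \<Longrightarrow> (\<And>y. 0 \<le> g y \<and> g y \<le> A * exp (- b * norm y)) \<Longrightarrow> x \<noteq> 0 \<Longrightarrow>
    cv (Y \<kappa>) g x \<le> C / norm x"
  "\<And>\<kappa> g x c. \<kappa> > 0 \<Longrightarrow> test g \<Longrightarrow> (\<And>y. 0 \<le> g y \<and> g y \<le> A * exp (- b * norm y)) \<Longrightarrow> x \<noteq> 0 \<Longrightarrow> c \<in> Basis \<Longrightarrow>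
    \<bar>pd c (cv (Y \<kappa>) g) x\<bar> \<le> C / (norm x)\<^sup>2"
  using cv_Y_pointwise_bounds[OF b(2) A(1)] by blast
 \<comment> \<open>The bound of \<open>cv_Y_lower_bound\<close> at the largest \<kappa>: the sources
   change with \<delta>, this function does not.\<close>
 define m where "m x = exp (- \<kappa>m * (norm x + \<rho>)) / (c5 * (norm x + \<rho>)) * c" for x :: R3
 show thesis
 proof (rule that[of C m], unfold approx_resonance_def, intro conjI allI impI C(1))
  show "m \<in> borel_measurable borel" unfolding m_def by measurable
  show "m x > 0" for x unfolding m_def using A c5_pos by (simp add: add_nonneg_pos)
  fix \<delta> :: real assume "\<delta> > 0"
  from A(4)[OF this] obtain \<kappa> g where g: "0 < \<kappa>" "\<kappa> \<le> \<kappa>m" "test g" "\<And>x. 0 \<le> g x \<and> g x \<le> A * exp (- b * norm x)"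
   "c \<le> (LBINT y. indicator (cball 0 \<rho>) y * g y)" "n2 (\<lambda>x. g x - (s x)\<^sup>2 * cv (Y \<kappa>) g x) \<le> \<delta>" by blast
  define h where "h = cv (Y \<kappa>) g"
  have low: "m x \<le> h x" for x
   unfolding m_def h_def by (rule cv_Y_lower_bound[OF g(1-3) _ A(3) g(5)]) (use g(4) in blast)
  have h0: "0 \<le> h x" for x unfolding h_def cv_def
   by (intro Bochner_Integration.integral_nonneg) (use g(4) in simp)
  have lapn: "- lap h x \<le> g x" for x
  proof -
   have "\<kappa>\<^sup>2 * h x - lap h x = g x" unfolding h_def by (rule lap_cv_Y[OF g(1,3)])
   moreover have "0 \<le> \<kappa>\<^sup>2 * h x" using h0 by simp
   ultimately show ?thesis by linarith
  qed
  have "(\<lambda>x. g x - s x *\<^sub>R (s x *\<^sub>R h x)) \<in> L2"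
   unfolding h_def by (intro L2_diff sL2 cv_Y_L2 test_L2 g)
  then have L: "(\<lambda>x. g x - (s x)\<^sup>2 * h x) \<in> L2" by (simp add: power2_eq_square mult.assoc)
  show "\<exists>h g. smooth h \<and> test g \<and> (\<forall>x. m x \<le> h x) \<and> (\<forall>x. x \<noteq> 0 \<longrightarrow> h x \<le> C / norm x) \<and>
    (\<forall>x. \<forall>c\<in>Basis. x \<noteq> 0 \<longrightarrow> \<bar>pd c h x\<bar> \<le> C / (norm x)\<^sup>2) \<and> (\<forall>x. - lap h x \<le> g x) \<and>
    (\<lambda>x. g x - (s x)\<^sup>2 * h x) \<in> L2 \<and> n2 (\<lambda>x. g x - (s x)\<^sup>2 * h x) \<le> \<delta>"
  proof (rule exI[of _ h], rule exI[of _ g], intro conjI allI ballI impI)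
   show "smooth h" unfolding h_def by (rule cv_Y_smooth[OF g(1,3)])
   show "h x \<le> C / norm x" if "x \<noteq> 0" for x unfolding h_def by (rule C(2)[OF g(1,3,4) that])
   show "\<bar>pd c h x\<bar> \<le> C / (norm x)\<^sup>2" if "c \<in> Basis" "x \<noteq> 0" for x c
    unfolding h_def by (rule C(3)[OF g(1,3,4) that(2,1)])
  qed (use low lapn L g(3) g(6)[folded h_def] in auto)
 qed
qed

end

section \<open>Zero modes of a nonnegative form\<close>

text \<open>The weak equation for \<open>a\<close>, tested against reflected translates of the
  mollifier, says that mollification commutes with the Laplacian.\<close>

lemma lap_cv_moll:
 fixes a :: "'a::euclidean_space \<Rightarrow> real"
 assumes a: "a \<in> L2" and \<Lambda>: "\<Lambda> \<in> L2"
  and eq: "\<And>\<phi>. test \<phi> \<Longrightarrow> (LBINT x. lap \<phi> x * a x) = (LBINT x. \<phi> x * \<Lambda> x)"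
 shows "lap (cv (moll k) a) = cv (moll k) \<Lambda>"
proof
 fix x :: 'a
 note pd = pd_cv[OF _ L2_set_integrable[OF a] L2_measurable[OF a]]
 have I: "integrable lborel (\<lambda>y. \<theta> (x - y) * a y)" if "test \<theta>" for \<theta>
  by (rule L2_prod_integrable(1)[OF test_L2[OF test_reflect[OF that]] a])
 have "lap (cv (moll k) a) x = (\<Sum>b\<in>Basis. cv (pd b (pd b (moll k))) a x)"
  unfolding lap_def by (simp add: pd moll_test test_pd)
 also have "\<dots> = (LBINT y. (\<Sum>b\<in>Basis. pd b (pd b (moll k)) (x - y) * a y))"
  by (subst Bochner_Integration.integral_sum) (auto simp: cv_def intro!: I test_pd moll_test)
 also have "\<dots> = (LBINT y. lap (\<lambda>y. moll k (x - y)) y * a y)"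
  by (simp add: lap_reflect[OF test_smooth[OF moll_test]] lap_def sum_distrib_right)
 also have "\<dots> = cv (moll k) \<Lambda> x"
  unfolding eq[OF test_reflect[OF moll_test]] by (simp add: cv_def)
 finally show "lap (cv (moll k) a) x = cv (moll k) \<Lambda> x" .
qed

text \<open>The shift of the index by 2 matches the cutoffs of
  \<open>energy_approximation\<close>.\<close>

lemma chi_mult_L2:
 fixes a :: "'a::euclidean_space \<Rightarrow> real"
 assumes a: "a \<in> L2"
 shows "(\<lambda>x. chi L x * a x) \<in> L2" "(\<lambda>n. n2 (\<lambda>x. chi (real (n + 2)) x * a x - a x)) \<longlonglongrightarrow> 0"
proof -
 show L: "(\<lambda>x. chi L x * a x) \<in> L2" for L
  using L2_bounded_scaleR(1)[OF a smooth_measurable[OF chi_smooth], of L 1] by simp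
 show "(\<lambda>n. n2 (\<lambda>x. chi (real (n + 2)) x * a x - a x)) \<longlonglongrightarrow> 0"
 proof (rule L2_dominated_convergence(3)[OF L2_measurable[OF L] L2_measurable[OF a] L2_norm_fun(1)[OF a]])
  show "AE x in lborel. (\<lambda>n. chi (real (n + 2)) x * a x) \<longlonglongrightarrow> a x"
  proof (rule always_eventually, rule allI)
   fix x
   have "(\<lambda>n. chi (real (Suc (Suc n))) x * a x) \<longlonglongrightarrow> 1 * a x"
    by (intro tendsto_intros LIMSEQ_Suc[OF chi_tendsto])
   then show "(\<lambda>n. chi (real (n + 2)) x * a x) \<longlonglongrightarrow> a x" by (simp add: add.commute)
  qed
 qed (simp add: abs_mult mult_left_le_one_le)
qed

lemma bounded_loc_L2:
 fixes k :: "'a::euclidean_space \<Rightarrow> real"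
 assumes "k \<in> borel_measurable borel" "\<And>x. \<bar>k x\<bar> \<le> B"
 shows "(\<lambda>x. indicator (cball 0 r) x * k x) \<in> L2"
 using L2_bounded_scaleR(1)[OF indicator_L2[OF borel_closed[OF closed_cball] bounded_cball] assms, of 0 r]
 by (simp add: mult.commute)

text \<open>Young's inequality with weight \<open>N\<close>. For cutoffs whose gradient is O(1/N)
  the cross term costs a fraction 1/N of the main energy and N times 1/N^2 of the squared norm, and
  both vanish in the limit.\<close>

lemma sum_squares_weighted:
 fixes p q :: real assumes "N > 0"
 shows "(p + q)\<^sup>2 \<le> (1 + 1 / N) * p\<^sup>2 + (1 + N) * q\<^sup>2" "- (2 * (p * q)) \<le> p\<^sup>2 / N + N * q\<^sup>2"
proof -
 have "0 \<le> (p - N * q)\<^sup>2 / N" "0 \<le> (p + N * q)\<^sup>2 / N" using assms by auto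
 then have A: "2 * (p * q) \<le> p\<^sup>2 / N + N * q\<^sup>2" "- (2 * (p * q)) \<le> p\<^sup>2 / N + N * q\<^sup>2"
  using assms by (simp_all add: power2_eq_square field_simps)
 show "- (2 * (p * q)) \<le> p\<^sup>2 / N + N * q\<^sup>2" by (rule A(2))
 show "(p + q)\<^sup>2 \<le> (1 + 1 / N) * p\<^sup>2 + (1 + N) * q\<^sup>2"
  using A(1) by (simp add: power2_sum algebra_simps)
qed

text \<open>The Dirichlet energy of a cutoff, mollified function, truncated by any contraction \<open>F\<close>, is
 asymptotically at most \<open>- \<integral> a \<Delta>a\<close>. This replaces the calculus of Sobolev functions.\<close>

lemma energy_approximation:
 fixes a :: "'a::euclidean_space \<Rightarrow> real"
 assumes a: "a \<in> L2" and \<Lambda>: "\<Lambda> \<in> L2"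
  and eq: "\<And>\<phi>. test \<phi> \<Longrightarrow> (LBINT x. lap \<phi> x * a x) = (LBINT x. \<phi> x * \<Lambda> x)"
 obtains v \<alpha> where "\<forall>n. smooth (v n) \<and> v n \<in> L2 \<and> n2 (\<lambda>x. v n x - a x) \<le> (1/2) ^ n"
  "\<alpha> \<longlonglongrightarrow> - (LBINT x. a x * \<Lambda> x)"
  "\<forall>n F F'. smooth1 UNIV F \<and> (\<forall>t. (F has_real_derivative F' t) (at t)) \<and> (\<forall>t. \<bar>F t\<bar> \<le> \<bar>t\<bar>) \<and> (\<forall>t. \<bar>F' t\<bar> \<le> 1) \<longrightarrow>
   (LBINT x. (\<Sum>b\<in>Basis. (pd b (\<lambda>x. chi (real (n + 2)) x * F (v n x)) x)\<^sup>2)) \<le> \<alpha> n"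
proof -
 have "\<exists>k. n2 (\<lambda>x. cv (moll k) a x - a x) < (1/2) ^ n \<and> n2 (\<lambda>x. cv (moll k) \<Lambda> x - \<Lambda> x) < (1/2) ^ n" for n
 proof -
  have p: "(1/2::real) ^ n > 0" by simp
  obtain k1 where k1: "\<And>k. k \<ge> k1 \<Longrightarrow> n2 (\<lambda>x. cv (moll k) a x - a x) < (1/2) ^ n"
   using LIMSEQ_D[OF moll_tendsto[OF a] p] by auto
  obtain k2 where k2: "\<And>k. k \<ge> k2 \<Longrightarrow> n2 (\<lambda>x. cv (moll k) \<Lambda> x - \<Lambda> x) < (1/2) ^ n"
   using LIMSEQ_D[OF moll_tendsto[OF \<Lambda>] p] by auto
  show ?thesis using k1[of "max k1 k2"] k2[of "max k1 k2"] by (intro exI[of _ "max k1 k2"]) auto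
 qed
 then obtain k where k: "\<And>n. n2 (\<lambda>x. cv (moll (k n)) a x - a x) < (1/2) ^ n" "\<And>n. n2 (\<lambda>x. cv (moll (k n)) \<Lambda> x - \<Lambda> x) < (1/2) ^ n"
  by metis
 \<comment> \<open>Both errors are below (1/2)^n; at this rate \<open>v n\<close> also converges to
   \<open>a\<close> almost everywhere, by \<open>n2_tendsto_AE\<close>.\<close>
 define v where "v n = cv (moll (k n)) a" for n
 have lapv: "lap (v n) = cv (moll (k n)) \<Lambda>" for n unfolding v_def by (rule lap_cv_moll[OF a \<Lambda> eq])
 have sm: "smooth (v n)" for n
  unfolding v_def by (rule cv_smooth[OF moll_test L2_set_integrable[OF a] L2_measurable[OF a]])
 have vL: "v n \<in> L2" for n unfolding v_def by (rule moll_young(1)[OF a])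
 have lL: "lap (v n) \<in> L2" for n unfolding lapv by (rule moll_young(1)[OF \<Lambda>])
 have va: "n2 (\<lambda>x. v n x - a x) \<le> (1/2) ^ n" for n using k(1)[of n] by (simp add: v_def)
 have half: "(\<lambda>n. (1/2::real) ^ n) \<longlonglongrightarrow> 0" by (rule LIMSEQ_power_zero) simp
 have valim: "(\<lambda>n. n2 (\<lambda>x. v n x - a x)) \<longlonglongrightarrow> 0"
  by (rule Lim_null_comparison[OF always_eventually half]) (use va in simp)
 have lvlim: "(\<lambda>n. n2 (\<lambda>x. lap (v n) x - \<Lambda> x)) \<longlonglongrightarrow> 0"
  by (rule Lim_null_comparison[OF always_eventually half]) (use k(2) in \<open>simp add: lapv less_imp_le\<close>)
 obtain C where C: "C > 0" "\<And>L (z::'a) b. L \<ge> 1 \<Longrightarrow> b \<in> Basis \<Longrightarrow> \<bar>pd b (chi L) z\<bar> \<le> C / L"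
  using chi_derivs[where 'a='a] by metis
 \<comment> \<open>Starting at 2 keeps 1 - 1/N positive, by which the energy bound is
   divided.\<close>
 define N where "N n = real (n + 2)" for n
 have N: "N n \<ge> 2" "N n > 0" "N n \<ge> 1" for n by (auto simp: N_def)
 define X where "X n = (chi (N n) :: 'a \<Rightarrow> real)" for n
 have X: "test (X n)" for n unfolding X_def by (rule chi_test[OF N(2)])
 note Xs = test_smooth[OF X]
 have X01: "0 \<le> X n x" "X n x \<le> 1" for n x by (auto simp: X_def)
 have Xlim: "(\<lambda>n. X n x) \<longlonglongrightarrow> 1" for x
  using LIMSEQ_Suc[OF chi_tendsto[of x]] by (simp add: X_def N_def add.commute)
 define D where "D = real DIM('a)"
 have D0: "D \<ge> 0" by (simp add: D_def)
 have dX: "(\<Sum>b\<in>Basis. (pd b (X n) x)\<^sup>2) \<le> D * C\<^sup>2 / (N n)\<^sup>2" for n x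
 proof -
  have "(\<Sum>b\<in>Basis. (pd b (X n) x)\<^sup>2) \<le> (\<Sum>b\<in>(Basis::'a set). (C / N n)\<^sup>2)"
  proof (rule sum_mono)
   fix b :: 'a assume "b \<in> Basis"
   then have "\<bar>pd b (X n) x\<bar> \<le> C / N n" unfolding X_def by (rule C(2)[OF N(3)])
   then show "(pd b (X n) x)\<^sup>2 \<le> (C / N n)\<^sup>2" using power_mono[of "\<bar>pd b (X n) x\<bar>" "C / N n" 2] by simp
  qed
  then show ?thesis by (simp add: D_def power_divide)
 qed
 have I: "integrable lborel (\<lambda>x. \<phi> x * f x)" if "test \<phi>" "smooth f" for \<phi> f :: "'a \<Rightarrow> real"
  by (rule test_integrable[OF test_mult'[OF that]])
 \<comment> \<open>Testing \<Delta>v against X^2 v bounds the localised energy \<open>Q\<close>: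
   once the cross term is absorbed, (1 - 1/N) Q \<le> R, and \<open>R\<close> tends to - \<integral>
   a \<Lambda>.\<close>
 define R where "R n = - (LBINT x. (X n x * X n x * v n x) * lap (v n) x) + D * C\<^sup>2 / N n * (n2 (v n))\<^sup>2" for n
 define Q where "Q n = (LBINT x. (X n x)\<^sup>2 * (\<Sum>b\<in>Basis. (pd b (v n) x)\<^sup>2))" for n
 have v2: "integrable lborel (\<lambda>x. c * (v n x)\<^sup>2)" for n c
  using L2_integrable[OF vL[of n]] by simp
 have v2n: "(LBINT x. c * (v n x)\<^sup>2) = c * (n2 (v n))\<^sup>2" for n c
  unfolding n2_sq by simp
 have XX: "test (\<lambda>x. X n x * X n x * v n x)" for n by (intro test_mult' X Xs sm)
 have sQ: "smooth (\<lambda>x. \<Sum>b\<in>Basis. (pd b (v n) x)\<^sup>2)" for n by (intro smooth_sum smooth_power smooth_pd sm) auto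
 have IQ: "integrable lborel (\<lambda>x. (X n x)\<^sup>2 * (\<Sum>b\<in>Basis. (pd b (v n) x)\<^sup>2))" for n
  unfolding power2_eq_square[of "X n _"] mult.assoc by (intro I X smooth_mult Xs sQ)
 have Q: "(1 - 1 / N n) * Q n \<le> R n" for n
 proof -
  have "(LBINT x. (X n x * X n x * v n x) * lap (v n) x) =
    (\<Sum>b\<in>Basis. LBINT x. pd b (pd b (v n)) x * (X n x * X n x * v n x))"
   unfolding lap_def sum_distrib_left
   by (subst Bochner_Integration.integral_sum) (intro I XX smooth_pd sm, assumption+, simp add: mult.commute)
  also have "\<dots> = (\<Sum>b\<in>Basis. - (LBINT x. pd b (v n) x * (2 * (X n x * pd b (X n) x) * v n x + (X n x)\<^sup>2 * pd b (v n) x)))"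
  proof (rule sum.cong[OF refl])
   fix b :: 'a assume b: "b \<in> Basis"
   have "pd b (\<lambda>x. X n x * X n x * v n x) x = 2 * (X n x * pd b (X n) x) * v n x + (X n x)\<^sup>2 * pd b (v n) x" for x
    by (simp add: pd_mult Xs sm smooth_mult power2_eq_square)
   then show "(LBINT x. pd b (pd b (v n)) x * (X n x * X n x * v n x)) = - (LBINT x. pd b (v n) x * (2 * (X n x * pd b (X n) x) * v n x + (X n x)\<^sup>2 * pd b (v n) x))"
    using ibp_test[OF smooth_pd[OF sm b] XX b] by simp
  qed
  also have "\<dots> = - (LBINT x. (\<Sum>b\<in>Basis. pd b (v n) x * (2 * (X n x * pd b (X n) x) * v n x + (X n x)\<^sup>2 * pd b (v n) x)))"
  proof -
   have "integrable lborel (\<lambda>x. pd b (v n) x * (2 * (X n x * pd b (X n) x) * v n x + (X n x)\<^sup>2 * pd b (v n) x))" if b: "b \<in> Basis" for b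
   proof -
    have "integrable lborel (\<lambda>x. X n x * (pd b (v n) x * (2 * pd b (X n) x * v n x + X n x * pd b (v n) x)))"
     by (intro I X smooth_mult smooth_add smooth_const smooth_pd sm Xs b)
    then show ?thesis by (simp add: power2_eq_square algebra_simps)
   qed
   then show ?thesis by (subst Bochner_Integration.integral_sum) (auto simp: sum_negf)
  qed
  finally have E: "(LBINT x. (\<Sum>b\<in>Basis. pd b (v n) x * (2 * (X n x * pd b (X n) x) * v n x + (X n x)\<^sup>2 * pd b (v n) x)))
    = - (LBINT x. (X n x * X n x * v n x) * lap (v n) x)" by simp
  have pw: "(X n x)\<^sup>2 * (\<Sum>b\<in>Basis. (pd b (v n) x)\<^sup>2) \<le>
    (\<Sum>b\<in>Basis. pd b (v n) x * (2 * (X n x * pd b (X n) x) * v n x + (X n x)\<^sup>2 * pd b (v n) x))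
    + (X n x)\<^sup>2 * (\<Sum>b\<in>Basis. (pd b (v n) x)\<^sup>2) / N n + D * C\<^sup>2 / N n * (v n x)\<^sup>2" for x
  proof -
   have "(\<Sum>b\<in>Basis. - (2 * ((X n x * pd b (v n) x) * (pd b (X n) x * v n x)))) \<le>
     (\<Sum>b\<in>Basis. (X n x * pd b (v n) x)\<^sup>2 / N n + N n * (pd b (X n) x * v n x)\<^sup>2)"
    by (intro sum_mono sum_squares_weighted N)
   also have "\<dots> = (X n x)\<^sup>2 * (\<Sum>b\<in>Basis. (pd b (v n) x)\<^sup>2) / N n + N n * (v n x)\<^sup>2 * (\<Sum>b\<in>Basis. (pd b (X n) x)\<^sup>2)"
    by (simp add: sum.distrib power_mult_distrib sum_distrib_left sum_divide_distrib mult_ac)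
   also have "N n * (v n x)\<^sup>2 * (\<Sum>b\<in>Basis. (pd b (X n) x)\<^sup>2) \<le> N n * (v n x)\<^sup>2 * (D * C\<^sup>2 / (N n)\<^sup>2)"
    using N(2)[of n] by (intro mult_left_mono dX) auto
   also have "\<dots> = D * C\<^sup>2 / N n * (v n x)\<^sup>2" using N(2)[of n] by (simp add: power2_eq_square)
   finally have "(\<Sum>b\<in>Basis. - (2 * ((X n x * pd b (v n) x) * (pd b (X n) x * v n x)))) \<le>
     (X n x)\<^sup>2 * (\<Sum>b\<in>Basis. (pd b (v n) x)\<^sup>2) / N n + D * C\<^sup>2 / N n * (v n x)\<^sup>2" by simp
   moreover have "(\<Sum>b\<in>Basis. pd b (v n) x * (2 * (X n x * pd b (X n) x) * v n x + (X n x)\<^sup>2 * pd b (v n) x)) =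
     (X n x)\<^sup>2 * (\<Sum>b\<in>Basis. (pd b (v n) x)\<^sup>2) - (\<Sum>b\<in>Basis. - (2 * ((X n x * pd b (v n) x) * (pd b (X n) x * v n x))))"
    by (simp add: sum_distrib_left sum_subtractf[symmetric] power2_eq_square algebra_simps sum.distrib sum_negf)
   ultimately show ?thesis by linarith
  qed
  have IE: "integrable lborel (\<lambda>x. \<Sum>b\<in>Basis. pd b (v n) x * (2 * (X n x * pd b (X n) x) * v n x + (X n x)\<^sup>2 * pd b (v n) x))"
  proof (rule Bochner_Integration.integrable_sum)
   fix b :: 'a assume b: "b \<in> Basis"
   have "integrable lborel (\<lambda>x. X n x * (pd b (v n) x * (2 * pd b (X n) x * v n x + X n x * pd b (v n) x)))"
    by (intro I X smooth_mult smooth_add smooth_const smooth_pd sm Xs b)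
   then show "integrable lborel (\<lambda>x. pd b (v n) x * (2 * (X n x * pd b (X n) x) * v n x + (X n x)\<^sup>2 * pd b (v n) x))"
    by (simp add: power2_eq_square algebra_simps)
  qed
  have "Q n \<le> (LBINT x. (\<Sum>b\<in>Basis. pd b (v n) x * (2 * (X n x * pd b (X n) x) * v n x + (X n x)\<^sup>2 * pd b (v n) x))
    + (X n x)\<^sup>2 * (\<Sum>b\<in>Basis. (pd b (v n) x)\<^sup>2) / N n + D * C\<^sup>2 / N n * (v n x)\<^sup>2)"
   unfolding Q_def by (intro integral_mono IQ Bochner_Integration.integrable_add IE integrable_divide_zero v2 pw)
  also have "\<dots> = - (LBINT x. (X n x * X n x * v n x) * lap (v n) x) + Q n / N n + D * C\<^sup>2 / N n * (n2 (v n))\<^sup>2"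
   using IE IQ[of n] v2[of "D * C\<^sup>2 / N n" n] E v2n[of "D * C\<^sup>2 / N n" n]
   by (simp add: Q_def)
  finally have "Q n \<le> R n + Q n / N n" by (simp add: R_def)
  then show ?thesis by (simp add: left_diff_distrib)
 qed
 \<comment> \<open>Passing from X F(v) to \<open>Q\<close> costs another weighted inequality; |F'|
   \<le> 1 and |F t| \<le> |t| make the result independent of \<open>F\<close>. Since (1 + N) / N^2
   tends to 0, the limit is that of \<open>R\<close>.\<close>
 define \<alpha> where "\<alpha> n = (1 + 1 / N n) * (R n / (1 - 1 / N n)) + (1 + N n) * (D * C\<^sup>2 / (N n)\<^sup>2) * (n2 (v n))\<^sup>2" for n
 have bound: "(LBINT x. (\<Sum>b\<in>Basis. (pd b (\<lambda>x. X n x * F (v n x)) x)\<^sup>2)) \<le> \<alpha> n"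
  if F: "smooth1 UNIV F" "\<And>t. (F has_real_derivative F' t) (at t)" "\<And>t. \<bar>F t\<bar> \<le> \<bar>t\<bar>" "\<And>t. \<bar>F' t\<bar> \<le> 1" for n F F'
 proof -
  have smF: "smooth (\<lambda>x. F (v n x))" by (rule smooth_compose1[OF sm F(1)]) simp
  have pdF: "pd b (\<lambda>x. X n x * F (v n x)) x = X n x * (F' (v n x) * pd b (v n) x) + pd b (X n) x * F (v n x)" for b x
   by (simp add: pd_mult[OF Xs smF] pd_compose1[OF sm F(2)])
  have T: "test (\<lambda>x. X n x * F (v n x))" by (rule test_mult'[OF X smF])
  have IP: "integrable lborel (\<lambda>x. \<Sum>b\<in>Basis. (pd b (\<lambda>x. X n x * F (v n x)) x)\<^sup>2)"
   unfolding power2_eq_square by (intro Bochner_Integration.integrable_sum I test_pd T smooth_pd test_smooth) auto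
  have pw: "(\<Sum>b\<in>Basis. (pd b (\<lambda>x. X n x * F (v n x)) x)\<^sup>2) \<le>
    (1 + 1 / N n) * ((X n x)\<^sup>2 * (\<Sum>b\<in>Basis. (pd b (v n) x)\<^sup>2)) + (1 + N n) * (D * C\<^sup>2 / (N n)\<^sup>2) * (v n x)\<^sup>2" for x
  proof -
   have "(pd b (\<lambda>x. X n x * F (v n x)) x)\<^sup>2 \<le> (1 + 1 / N n) * ((X n x)\<^sup>2 * (pd b (v n) x)\<^sup>2) + (1 + N n) * ((pd b (X n) x)\<^sup>2 * (v n x)\<^sup>2)" for b
   proof -
    have "(pd b (\<lambda>x. X n x * F (v n x)) x)\<^sup>2 \<le>
     (1 + 1 / N n) * (X n x * (F' (v n x) * pd b (v n) x))\<^sup>2 + (1 + N n) * (pd b (X n) x * F (v n x))\<^sup>2"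
     unfolding pdF by (rule sum_squares_weighted(1)[OF N(2)])
    also have "\<dots> \<le> (1 + 1 / N n) * ((X n x)\<^sup>2 * (pd b (v n) x)\<^sup>2) + (1 + N n) * ((pd b (X n) x)\<^sup>2 * (v n x)\<^sup>2)"
    proof -
     have "(F' (v n x))\<^sup>2 \<le> 1" using power_mono[OF F(4)[of "v n x"], of 2] by simp
     then have "(F' (v n x))\<^sup>2 * (pd b (v n) x)\<^sup>2 \<le> 1 * (pd b (v n) x)\<^sup>2" by (intro mult_right_mono) auto
     moreover have "(F (v n x))\<^sup>2 \<le> (v n x)\<^sup>2" using power_mono[OF F(3)[of "v n x"], of 2] by simp
     ultimately show ?thesis unfolding power_mult_distrib
      using N(2)[of n] by (intro add_mono mult_left_mono) auto
    qed
    finally show ?thesis .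
   qed
   then have "(\<Sum>b\<in>Basis. (pd b (\<lambda>x. X n x * F (v n x)) x)\<^sup>2) \<le>
     (\<Sum>b\<in>Basis. (1 + 1 / N n) * ((X n x)\<^sup>2 * (pd b (v n) x)\<^sup>2) + (1 + N n) * ((pd b (X n) x)\<^sup>2 * (v n x)\<^sup>2))"
    by (intro sum_mono)
   also have "\<dots> = (1 + 1 / N n) * ((X n x)\<^sup>2 * (\<Sum>b\<in>Basis. (pd b (v n) x)\<^sup>2)) + (1 + N n) * ((\<Sum>b\<in>Basis. (pd b (X n) x)\<^sup>2) * (v n x)\<^sup>2)"
    by (simp only: sum.distrib sum_distrib_left sum_distrib_right)
   also have "\<dots> \<le> (1 + 1 / N n) * ((X n x)\<^sup>2 * (\<Sum>b\<in>Basis. (pd b (v n) x)\<^sup>2)) + (1 + N n) * ((D * C\<^sup>2 / (N n)\<^sup>2) * (v n x)\<^sup>2)"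
    using N(2)[of n] by (intro add_left_mono mult_left_mono mult_right_mono dX) auto
   finally show ?thesis by (simp only: mult.assoc)
  qed
  have "(LBINT x. (\<Sum>b\<in>Basis. (pd b (\<lambda>x. X n x * F (v n x)) x)\<^sup>2)) \<le>
    (LBINT x. (1 + 1 / N n) * ((X n x)\<^sup>2 * (\<Sum>b\<in>Basis. (pd b (v n) x)\<^sup>2)) + (1 + N n) * (D * C\<^sup>2 / (N n)\<^sup>2) * (v n x)\<^sup>2)"
   by (intro integral_mono IP pw Bochner_Integration.integrable_add integrable_mult_right IQ v2)
  also have "\<dots> = (1 + 1 / N n) * Q n + (1 + N n) * (D * C\<^sup>2 / (N n)\<^sup>2) * (n2 (v n))\<^sup>2"
   by (subst Bochner_Integration.integral_add) (intro integrable_mult_right IQ v2, rule v2, simp only: v2n, simp only: Q_def integral_mult_right_zero)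
  also have "\<dots> \<le> \<alpha> n"
  proof -
   have "1 - 1 / N n > 0" using N(1)[of n] by (simp add: field_simps)
   then have "Q n \<le> R n / (1 - 1 / N n)" using Q[of n] by (simp add: pos_le_divide_eq mult.commute)
   then show ?thesis unfolding \<alpha>_def using N(2)[of n] by (intro add_right_mono mult_left_mono) auto
  qed
  finally show ?thesis .
 qed
 have invN: "(\<lambda>n. 1 / N n) \<longlonglongrightarrow> 0"
 proof -
  have "(\<lambda>n. inverse (real (Suc (Suc n)))) \<longlonglongrightarrow> 0" by (rule LIMSEQ_Suc[OF LIMSEQ_inverse_real_of_nat])
  then show ?thesis by (simp add: N_def inverse_eq_divide add.commute)
 qed
 have \<alpha>lim: "\<alpha> \<longlonglongrightarrow> - (LBINT x. a x * \<Lambda> x)"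
 proof -
  have nv: "(\<lambda>n. (n2 (v n))\<^sup>2) \<longlonglongrightarrow> (n2 a)\<^sup>2" by (intro tendsto_power n2_tendsto[OF vL a valim])
  have XvL: "(\<lambda>x. X n x * X n x * v n x) \<in> L2" for n by (rule test_L2[OF XX])
  have Xv: "(\<lambda>n. n2 (\<lambda>x. X n x * X n x * v n x - a x)) \<longlonglongrightarrow> 0"
  proof -
   note [measurable] = L2_measurable[OF a] smooth_measurable[OF Xs]
   have XXle: "\<bar>X n x * X n x\<bar> \<le> 1" for n x using X01[of n x] by (simp add: mult_le_one)
   have XaL: "(\<lambda>x. X n x * X n x * a x) \<in> L2" for n
    using L2_bounded_scaleR(1)[OF a _ XXle] by simp
   have "(\<lambda>n. n2 (\<lambda>x. X n x * X n x * a x - a x)) \<longlonglongrightarrow> 0"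
   proof (rule L2_dominated_convergence(3)[where w="\<lambda>x. \<bar>a x\<bar>"])
    show "(\<lambda>x. \<bar>a x\<bar>) \<in> L2" using L2_norm_fun(1)[OF a] by simp
    show "AE x in lborel. (\<lambda>n. X n x * X n x * a x) \<longlonglongrightarrow> a x"
    proof (intro always_eventually allI)
     fix x
     have "(\<lambda>n. X n x * X n x * a x) \<longlonglongrightarrow> 1 * 1 * a x" by (intro tendsto_intros Xlim)
     then show "(\<lambda>n. X n x * X n x * a x) \<longlonglongrightarrow> a x" by simp
    qed
    show "\<bar>X n x * X n x * a x\<bar> \<le> \<bar>a x\<bar>" for n x
     using mult_right_mono[OF XXle[of n x], of "\<bar>a x\<bar>"] by (simp add: abs_mult)
   qed auto
   from tendsto_add[OF valim this] have lim: "(\<lambda>n. n2 (\<lambda>x. v n x - a x) + n2 (\<lambda>x. X n x * X n x * a x - a x)) \<longlonglongrightarrow> 0" by simp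
   have "n2 (\<lambda>x. X n x * X n x * v n x - a x) \<le> n2 (\<lambda>x. v n x - a x) + n2 (\<lambda>x. X n x * X n x * a x - a x)" for n
   proof -
    have "n2 (\<lambda>x. X n x * X n x * v n x - a x) \<le> n2 (\<lambda>x. X n x * X n x * v n x - X n x * X n x * a x) + n2 (\<lambda>x. X n x * X n x * a x - a x)"
     by (rule n2_triangle[OF XvL XaL a])
    also have "n2 (\<lambda>x. X n x * X n x * v n x - X n x * X n x * a x) = n2 (\<lambda>x. (X n x * X n x) *\<^sub>R (v n x - a x))"
     by (simp add: right_diff_distrib)
    also have "\<dots> \<le> 1 * n2 (\<lambda>x. v n x - a x)"
     by (rule L2_bounded_scaleR(2)[OF L2_diff(1)[OF vL a] _ XXle]) measurable
    finally show ?thesis by simp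
   qed
   then show ?thesis by (intro Lim_null_comparison[OF always_eventually lim]) simp
  qed
  have J: "(\<lambda>n. LBINT x. (X n x * X n x * v n x) * lap (v n) x) \<longlonglongrightarrow> (LBINT x. a x * \<Lambda> x)"
   using L2_tendsto_integral[OF XvL a lL \<Lambda> Xv lvlim] by simp
  have "(\<lambda>n. - (LBINT x. (X n x * X n x * v n x) * lap (v n) x) + D * C\<^sup>2 * (1 / N n) * (n2 (v n))\<^sup>2)
    \<longlonglongrightarrow> - (LBINT x. a x * \<Lambda> x) + D * C\<^sup>2 * 0 * (n2 a)\<^sup>2"
   by (intro tendsto_add tendsto_mult tendsto_minus tendsto_const J invN nv)
  then have Rlim: "R \<longlonglongrightarrow> - (LBINT x. a x * \<Lambda> x)" unfolding R_def by simp
  have "(\<lambda>n. (1 + 1 / N n) * (R n / (1 - 1 / N n)) + (D * C\<^sup>2 * (1 / N n) * (1 / N n) + D * C\<^sup>2 * (1 / N n)) * (n2 (v n))\<^sup>2)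
    \<longlonglongrightarrow> (1 + 0) * (- (LBINT x. a x * \<Lambda> x) / (1 - 0)) + (D * C\<^sup>2 * 0 * 0 + D * C\<^sup>2 * 0) * (n2 a)\<^sup>2"
   by (intro tendsto_add tendsto_mult tendsto_divide tendsto_diff tendsto_const Rlim invN nv) simp
  moreover have "(1 + N n) * (D * C\<^sup>2 / (N n)\<^sup>2) = D * C\<^sup>2 * (1 / N n) * (1 / N n) + D * C\<^sup>2 * (1 / N n)" for n
   using N(2)[of n] by (simp add: power2_eq_square field_simps)
  ultimately show ?thesis unfolding \<alpha>_def by simp
 qed
 show thesis
  by (rule that[of v, OF _ \<alpha>lim]) (use sm vL va bound[unfolded X_def N_def] in blast)+
qed

lemma L2_loc_mult_test:
 fixes W \<phi> :: "'a::euclidean_space \<Rightarrow> real"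
 assumes W: "\<And>r. (\<lambda>x. indicator (cball 0 r) x * W x) \<in> L2" and \<phi>: "test \<phi>"
 shows "(\<lambda>x. W x * \<phi> x) \<in> L2"
proof -
 obtain r where r: "\<And>x. norm x > r \<Longrightarrow> \<phi> x = 0" using test_supportE[OF \<phi>] by blast
 obtain B where B: "\<And>x. \<bar>\<phi> x\<bar> \<le> B" using test_bounded[OF \<phi>] by blast
 have "(\<lambda>x. \<phi> x *\<^sub>R (indicator (cball 0 r) x * W x)) \<in> L2"
  by (rule L2_bounded_scaleR(1)[OF W test_measurable[OF \<phi>] B])
 moreover have "(\<lambda>x. \<phi> x *\<^sub>R (indicator (cball 0 r) x * W x)) = (\<lambda>x. W x * \<phi> x)"
 proof
  fix x show "\<phi> x *\<^sub>R (indicator (cball 0 r) x * W x) = W x * \<phi> x"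
   using r[of x] by (cases "norm x > r") auto
 qed
 ultimately show ?thesis by metis
qed

lemma test_sobolev:
 fixes \<phi> :: "'a::euclidean_space \<Rightarrow> real"
 assumes \<phi>: "test \<phi>"
 shows "(\<lambda>x. complex_of_real (\<phi> x)) \<in> sobolev k"
  and "k = 2 \<Longrightarrow> AE x in lborel. laplacian (\<lambda>x. complex_of_real (\<phi> x)) x = complex_of_real (lap \<phi> x)"
proof -
 have L: "(\<lambda>x. complex_of_real (\<psi> x)) \<in> L2" if "test \<psi>" for \<psi> :: "'a \<Rightarrow> real"
  using test_L2[OF that] by (auto simp: L2_def)
 show S: "(\<lambda>x. complex_of_real (\<phi> x)) \<in> sobolev k" for k
  unfolding sobolev_def
 proof (intro CollectI conjI ballI impI L \<phi>)
  fix bs :: "'a list" assume bs: "bs \<in> lists Basis"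
  then have rb: "rev bs \<in> lists Basis" by auto
  show "\<exists>g\<in>L2. is_weak_partial bs (\<lambda>x. complex_of_real (\<phi> x)) g"
  proof (rule bexI[of _ "\<lambda>x. complex_of_real (partials (rev bs) \<phi> x)"])
   show "is_weak_partial bs (\<lambda>x. complex_of_real (\<phi> x)) (\<lambda>x. complex_of_real (partials (rev bs) \<phi> x))"
    by (rule is_weak_partialI[OF L[OF \<phi>] L[OF test_partials[OF \<phi> rb]] bs])
      (simp_all add: ibp_partials[OF test_smooth[OF \<phi>] _ bs])
  qed (rule L[OF test_partials[OF \<phi> rb]])
 qed
 show "AE x in lborel. laplacian (\<lambda>x. complex_of_real (\<phi> x)) x = complex_of_real (lap \<phi> x)"
 proof (rule laplacian_unique[OF S L[OF test_lap[OF \<phi>]]])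
  fix \<psi> :: "'a \<Rightarrow> real" assume \<psi>: "test \<psi>"
  have "(LBINT x. lap \<psi> x *\<^sub>R complex_of_real (\<phi> x)) = (LBINT x. complex_of_real (\<phi> x * lap \<psi> x))"
   by (simp add: scaleR_conv_of_real mult.commute)
  also have "\<dots> = complex_of_real (LBINT x. lap \<phi> x * \<psi> x)"
   unfolding integral_complex_of_real ibp_lap[OF test_smooth[OF \<phi>] \<psi>] ..
  also have "\<dots> = (LBINT x. \<psi> x *\<^sub>R complex_of_real (lap \<phi> x))"
   unfolding integral_complex_of_real[symmetric] by (simp add: scaleR_conv_of_real mult.commute)
  finally show "(LBINT x. lap \<psi> x *\<^sub>R complex_of_real (\<phi> x)) = (LBINT x. \<psi> x *\<^sub>R complex_of_real (lap \<phi> x))" .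
 qed
qed

lemma dirichlet_test:
 assumes \<phi>: "test \<phi>" and \<psi>: "test \<psi>"
 shows "integrable lborel (\<lambda>x. \<Sum>b\<in>Basis. pd b \<phi> x * pd b \<psi> x)"
  and "(LBINT x. (\<Sum>b\<in>Basis. pd b \<phi> x * pd b \<psi> x)) = - (LBINT x. \<phi> x * lap \<psi> x)"
proof -
 have I: "integrable lborel (\<lambda>x. f x * g x)" if "test f" "test g" for f g :: "'a \<Rightarrow> real"
  by (intro test_integrable test_mult' that test_smooth)
 show "integrable lborel (\<lambda>x. \<Sum>b\<in>Basis. pd b \<phi> x * pd b \<psi> x)"
  by (intro Bochner_Integration.integrable_sum I test_pd \<phi> \<psi>)
 have "(LBINT x. (\<Sum>b\<in>Basis. pd b \<phi> x * pd b \<psi> x)) = (\<Sum>b\<in>Basis. LBINT x. pd b \<phi> x * pd b \<psi> x)"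
  by (intro Bochner_Integration.integral_sum I test_pd \<phi> \<psi>)
 also have "\<dots> = (\<Sum>b\<in>Basis. - (LBINT x. \<phi> x * pd b (pd b \<psi>) x))"
  by (intro sum.cong refl ibp_test test_smooth test_pd \<phi> \<psi>)
 also have "\<dots> = - (LBINT x. \<phi> x * lap \<psi> x)"
  unfolding lap_def sum_distrib_left
  by (subst Bochner_Integration.integral_sum) (auto intro!: I test_pd \<phi> \<psi> simp: sum_negf)
 finally show "(LBINT x. (\<Sum>b\<in>Basis. pd b \<phi> x * pd b \<psi> x)) = - (LBINT x. \<phi> x * lap \<psi> x)" .
qed

text \<open>The form is evaluated at a test function, so local square integrability of
  \<open>W\<close> makes the potential term finite; the classical Laplacian and integration by parts
  give the Dirichlet energy.\<close>

lemma form_inequality: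
 fixes W \<phi> :: "'a::euclidean_space \<Rightarrow> real"
 assumes nn: "nonneg_operator (sobolev 2) (schroedinger W)"
  and Wm [measurable]: "W \<in> borel_measurable borel"
  and W: "\<And>r. (\<lambda>x. indicator (cball 0 r) x * W x) \<in> L2" and \<phi>: "test \<phi>"
 shows "integrable lborel (\<lambda>x. W x * (\<phi> x)\<^sup>2)" "(LBINT x. W x * (\<phi> x)\<^sup>2) \<le> (LBINT x. (\<Sum>b\<in>Basis. (pd b \<phi> x)\<^sup>2))"
proof -
 define f where "f x = complex_of_real (\<phi> x)" for x
 have fS: "f \<in> sobolev 2" unfolding f_def by (rule test_sobolev[OF \<phi>])
 have lf: "AE x in lborel. laplacian f x = complex_of_real (lap \<phi> x)" unfolding f_def by (rule test_sobolev(2)[OF \<phi>]) simp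
 show I: "integrable lborel (\<lambda>x. W x * (\<phi> x)\<^sup>2)"
  using L2_prod_integrable(1)[OF L2_loc_mult_test[OF W \<phi>] test_L2[OF \<phi>]] by (simp add: power2_eq_square mult.assoc)
 have I2: "integrable lborel (\<lambda>x. \<phi> x * lap \<phi> x)" by (intro test_integrable test_mult' test_smooth test_lap \<phi>)
 have "L2_inner f (schroedinger W f) = (LBINT x. complex_of_real (- (\<phi> x * lap \<phi> x) - W x * (\<phi> x)\<^sup>2))"
  unfolding L2_inner_def
 proof (rule integral_cong_AE)
  note [measurable] = test_measurable[OF \<phi>] test_measurable[OF test_lap[OF \<phi>]]
   L2_measurable[OF laplacian_L2[OF fS]] L2_measurable[OF sobolev_L2[OF fS]]
  have cf: "cnj (f x) = f x" for x by (simp add: f_def)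
  show "(\<lambda>x. cnj (f x) * schroedinger W f x) \<in> borel_measurable lborel" unfolding schroedinger_def cf by measurable
  show "(\<lambda>x. complex_of_real (- (\<phi> x * lap \<phi> x) - W x * (\<phi> x)\<^sup>2)) \<in> borel_measurable lborel" by measurable
  show "AE x in lborel. cnj (f x) * schroedinger W f x = complex_of_real (- (\<phi> x * lap \<phi> x) - W x * (\<phi> x)\<^sup>2)"
   using lf
  proof eventually_elim
   case (elim x)
   show ?case unfolding schroedinger_def elim by (simp add: f_def algebra_simps power2_eq_square)
  qed
 qed
 also have "\<dots> = complex_of_real (LBINT x. - (\<phi> x * lap \<phi> x) - W x * (\<phi> x)\<^sup>2)" by (rule integral_complex_of_real)
 finally have E: "L2_inner f (schroedinger W f) = complex_of_real (LBINT x. - (\<phi> x * lap \<phi> x) - W x * (\<phi> x)\<^sup>2)" .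
 have "L2_inner f (schroedinger W f) \<in> \<real>\<^sub>\<ge>\<^sub>0" using nn fS unfolding nonneg_operator_def by blast
 then have "0 \<le> (LBINT x. - (\<phi> x * lap \<phi> x) - W x * (\<phi> x)\<^sup>2)" unfolding E nonneg_Reals_of_real_iff .
 then have "(LBINT x. W x * (\<phi> x)\<^sup>2) \<le> - (LBINT x. \<phi> x * lap \<phi> x)" using I I2 by simp
 then show "(LBINT x. W x * (\<phi> x)\<^sup>2) \<le> (LBINT x. (\<Sum>b\<in>Basis. (pd b \<phi> x)\<^sup>2))"
  unfolding dirichlet_test(2)[OF \<phi> \<phi>, symmetric] by (simp add: power2_eq_square)
qed

text \<open>A smooth substitute for |t|. Subtracting \<open>e\<close> makes it vanish at 0, so that
  |F t| \<le> |t| and |F'| \<le> 1 hold, the conditions on \<open>F\<close> in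
  \<open>energy_approximation\<close>.\<close>

definition sqabs :: "real \<Rightarrow> real \<Rightarrow> real" where
 "sqabs e t = sqrt (t\<^sup>2 + e\<^sup>2) - e"

lemma sqabs:
 assumes "e > 0"
 shows "smooth1 UNIV (sqabs e)" "(sqabs e has_real_derivative t / sqrt (t\<^sup>2 + e\<^sup>2)) (at t)"
  "\<bar>sqabs e t\<bar> \<le> \<bar>t\<bar>" "\<bar>t / sqrt (t\<^sup>2 + e\<^sup>2)\<bar> \<le> 1" "\<bar>sqabs e t - \<bar>t\<bar>\<bar> \<le> e"
proof -
 have pos: "t\<^sup>2 + e\<^sup>2 > 0" for t :: real using assms by (simp add: add_nonneg_pos)
 have id: "smooth (\<lambda>t::real. t)" using smooth_coord[of "1::real"] by simp
 have "smooth (\<lambda>t::real. sqrt (t\<^sup>2 + e\<^sup>2))"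
  by (rule smooth_compose1[OF _ smooth1_sqrt]) (use pos in \<open>auto intro!: smooth_add smooth_power smooth_const id\<close>)
 then have "smooth (sqabs e)" unfolding sqabs_def[abs_def] by (intro smooth_diff smooth_const)
 then show "smooth1 UNIV (sqabs e)" by (rule smooth_imp_smooth1)
 show "(sqabs e has_real_derivative t / sqrt (t\<^sup>2 + e\<^sup>2)) (at t)"
  unfolding sqabs_def[abs_def] using pos[of t]
  by (auto intro!: derivative_eq_intros simp: inverse_eq_divide)
 have up: "sqrt (t\<^sup>2 + e\<^sup>2) \<le> \<bar>t\<bar> + e"
  using assms by (intro real_le_lsqrt) (auto simp: power2_sum)
 have low: "\<bar>t\<bar> \<le> sqrt (t\<^sup>2 + e\<^sup>2)" "e \<le> sqrt (t\<^sup>2 + e\<^sup>2)"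
  by (rule real_le_rsqrt; simp)+
 show "\<bar>sqabs e t\<bar> \<le> \<bar>t\<bar>" "\<bar>sqabs e t - \<bar>t\<bar>\<bar> \<le> e" unfolding sqabs_def using up low assms by linarith+
 show "\<bar>t / sqrt (t\<^sup>2 + e\<^sup>2)\<bar> \<le> 1" using low(1) pos[of t] by (simp add: abs_divide)
qed

text \<open>A zero energy state of a nonnegative form minimises it, and so does its absolute value.\<close>

lemma abs_of_zero_mode:
 fixes a V :: "'a::euclidean_space \<Rightarrow> real"
 assumes a: "a \<in> L2" and Vm [measurable]: "V \<in> borel_measurable borel" and V0: "\<And>x. 0 \<le> V x"
  and Vloc: "\<And>r. (\<lambda>x. indicator (cball 0 r) x * V x) \<in> L2" and Va: "(\<lambda>x. V x * a x) \<in> L2"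
  and eq: "\<And>\<phi>. test \<phi> \<Longrightarrow> (LBINT x. lap \<phi> x * a x) = (LBINT x. \<phi> x * - (V x * a x))"
  and form: "\<And>\<phi>. test \<phi> \<Longrightarrow> (LBINT x. V x * (\<phi> x)\<^sup>2) \<le> (LBINT x. (\<Sum>b\<in>Basis. (pd b \<phi> x)\<^sup>2))"
  and u: "test u"
 shows "(LBINT x. \<bar>a x\<bar> * (- lap u x - V x * u x)) = 0"
proof -
 note [measurable] = L2_measurable[OF a]
 have VaL: "(\<lambda>x. - (V x * a x)) \<in> L2" by (rule L2_minus(1)[OF Va])
 obtain v \<alpha> where v0: "\<forall>n. smooth (v n) \<and> v n \<in> L2 \<and> n2 (\<lambda>x. v n x - a x) \<le> (1/2) ^ n"
  and \<alpha>: "\<alpha> \<longlonglongrightarrow> - (LBINT x. a x * - (V x * a x))"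
  and en: "\<forall>n F F'. smooth1 UNIV F \<and> (\<forall>t. (F has_real_derivative F' t) (at t)) \<and> (\<forall>t. \<bar>F t\<bar> \<le> \<bar>t\<bar>) \<and> (\<forall>t. \<bar>F' t\<bar> \<le> 1) \<longrightarrow>
   (LBINT x. (\<Sum>b\<in>Basis. (pd b (\<lambda>x. chi (real (n + 2)) x * F (v n x)) x)\<^sup>2)) \<le> \<alpha> n"
  by (rule energy_approximation[OF a VaL eq]) (assumption, rule that, assumption+)
 then have v: "\<And>n. smooth (v n)" "\<And>n. v n \<in> L2" "\<And>n. n2 (\<lambda>x. v n x - a x) \<le> (1/2) ^ n" by blast+
 note [measurable] = smooth_measurable[OF v(1)]
 define X where "X n = (chi (real (n + 2)) :: 'a \<Rightarrow> real)" for n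
 have X: "test (X n)" for n unfolding X_def by (rule chi_test) simp
 note [measurable] = test_measurable[OF X]
 have X01: "0 \<le> X n x" "X n x \<le> 1" for n x by (auto simp: X_def)
 have Xlim: "(\<lambda>n. X n x) \<longlonglongrightarrow> 1" for x
  using LIMSEQ_Suc[OF chi_tendsto[of x]] by (simp add: X_def add.commute)
 \<comment> \<open>\<open>sqabs\<close> differs from the absolute value by up to \<open>e n\<close>
   on the whole support of \<open>X n\<close>, whose norm is unbounded in \<open>n\<close>; hence
   the normalisation.\<close>
 define e where "e n = (1/2) ^ n / (1 + n2 (X n))" for n
 have e: "e n > 0" "e n \<le> (1/2) ^ n" "e n * n2 (X n) \<le> (1/2) ^ n" for n
 proof -
  have p: "1 + n2 (X n) > 0" "1 \<le> 1 + n2 (X n)" using n2_nonneg[of "X n"] by linarith+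
  have p3: "n2 (X n) / (1 + n2 (X n)) \<le> 1" unfolding pos_divide_le_eq[OF p(1)] by simp
  show "e n > 0" using p(1) by (simp add: e_def)
  show "e n \<le> (1/2) ^ n" using mult_imp_div_pos_le[OF p(1), of "(1/2) ^ n" "(1/2) ^ n"] mult_left_mono[OF p(2), of "(1/2) ^ n"] by (simp add: e_def)
  have "(1/2) ^ n * (n2 (X n) / (1 + n2 (X n))) \<le> (1/2) ^ n * 1" using p3 by (intro mult_left_mono) auto
  moreover have "e n * n2 (X n) = (1/2) ^ n * (n2 (X n) / (1 + n2 (X n)))" unfolding e_def times_divide_eq_right times_divide_eq_left ..
  ultimately show "e n * n2 (X n) \<le> (1/2) ^ n" by simp
 qed
 have half: "(\<lambda>n. (1/2::real) ^ n) \<longlonglongrightarrow> 0" by (rule LIMSEQ_power_zero) simp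
 define P where "P n x = X n x * sqabs (e n) (v n x)" for n x
 have smF: "smooth (\<lambda>x. sqabs (e n) (v n x))" for n by (rule smooth_compose1[OF v(1) sqabs(1)[OF e(1)]]) simp
 have P: "test (P n)" for n unfolding P_def by (rule test_mult'[OF X smF])
 note [measurable] = test_measurable[OF P]
 have PE: "(LBINT x. (\<Sum>b\<in>Basis. (pd b (P n) x)\<^sup>2)) \<le> \<alpha> n" for n
  unfolding P_def X_def by (rule en[rule_format, where F' = "\<lambda>t. t / sqrt (t\<^sup>2 + (e n)\<^sup>2)"]) (intro conjI allI sqabs e)
 have Pd: "\<bar>P n x - \<bar>a x\<bar>\<bar> \<le> e n * X n x + \<bar>v n x - a x\<bar> + \<bar>X n x * \<bar>a x\<bar> - \<bar>a x\<bar>\<bar>" for n x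
 proof -
  have "P n x - \<bar>a x\<bar> = X n x * (sqabs (e n) (v n x) - \<bar>v n x\<bar>) + X n x * (\<bar>v n x\<bar> - \<bar>a x\<bar>) + (X n x * \<bar>a x\<bar> - \<bar>a x\<bar>)"
   by (simp add: P_def algebra_simps)
  also have "\<bar>\<dots>\<bar> \<le> \<bar>X n x * (sqabs (e n) (v n x) - \<bar>v n x\<bar>)\<bar> + \<bar>X n x * (\<bar>v n x\<bar> - \<bar>a x\<bar>)\<bar> + \<bar>X n x * \<bar>a x\<bar> - \<bar>a x\<bar>\<bar>"
   by linarith
  also have "\<bar>X n x * (sqabs (e n) (v n x) - \<bar>v n x\<bar>)\<bar> \<le> X n x * e n"
   unfolding abs_mult using X01 by (intro mult_mono sqabs e) auto
  also have "\<bar>X n x * (\<bar>v n x\<bar> - \<bar>a x\<bar>)\<bar> \<le> 1 * \<bar>v n x - a x\<bar>"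
   unfolding abs_mult using X01 by (intro mult_mono) auto
  finally show ?thesis by (simp add: mult.commute)
 qed
 define \<psi> where "\<psi> x = \<bar>a x\<bar>" for x
 have \<psi>L: "\<psi> \<in> L2" unfolding \<psi>_def using L2_norm_fun(1)[OF a] by simp
 note [measurable] = L2_measurable[OF \<psi>L]
 have XaL: "(\<lambda>x. X n x * \<psi> x) \<in> L2" for n unfolding X_def by (rule chi_mult_L2[OF \<psi>L])
 note Xa = chi_mult_L2(2)[OF \<psi>L, folded X_def]
 have Plim: "(\<lambda>n. n2 (\<lambda>x. P n x - \<psi> x)) \<longlonglongrightarrow> 0"
 proof (rule Lim_null_comparison)
  show "(\<lambda>n. (1/2) ^ n + (1/2) ^ n + n2 (\<lambda>x. X n x * \<psi> x - \<psi> x)) \<longlonglongrightarrow> 0"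
   using tendsto_add[OF tendsto_add[OF half half] Xa] by simp
  have "n2 (\<lambda>x. P n x - \<psi> x) \<le> (1/2) ^ n + (1/2) ^ n + n2 (\<lambda>x. X n x * \<psi> x - \<psi> x)" for n
  proof -
   define f1 where "f1 x = e n *\<^sub>R X n x" for x
   define f2 where "f2 x = norm (v n x - a x)" for x
   define f3 where "f3 x = norm (X n x * \<psi> x - \<psi> x)" for x
   have f1: "f1 \<in> L2" "n2 f1 = e n * n2 (X n)"
    unfolding f1_def using L2_scaleR_const[OF test_L2[OF X], of "e n" n] e(1)[of n] by auto
   have f2: "f2 \<in> L2" "n2 f2 = n2 (\<lambda>x. v n x - a x)"
    unfolding f2_def using L2_norm_fun[of "\<lambda>x. v n x - a x"] L2_diff(1)[OF v(2) a] by auto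
   have f3: "f3 \<in> L2" "n2 f3 = n2 (\<lambda>x. X n x * \<psi> x - \<psi> x)"
    unfolding f3_def using L2_norm_fun[of "\<lambda>x. X n x * \<psi> x - \<psi> x"] L2_diff(1)[OF XaL \<psi>L] by auto
   have "n2 (\<lambda>x. P n x - \<psi> x) \<le> n2 (\<lambda>x. f1 x + f2 x + f3 x)"
   proof (rule L2_mono(2))
    show "(\<lambda>x. f1 x + f2 x + f3 x) \<in> L2" by (intro L2_add f1 f2 f3)
    show "norm (P n x - \<psi> x) \<le> norm (f1 x + f2 x + f3 x)" for x
     using order_trans[OF Pd[of n x] abs_ge_self] by (simp add: f1_def f2_def f3_def \<psi>_def)
   qed measurable
   also have "\<dots> \<le> n2 f1 + n2 f2 + n2 f3"
    using L2_add(2)[OF L2_add(1)[OF f1(1) f2(1)] f3(1)] L2_add(2)[OF f1(1) f2(1)] by linarith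
   also have "\<dots> \<le> (1/2) ^ n + (1/2) ^ n + n2 (\<lambda>x. X n x * \<psi> x - \<psi> x)"
    using f1 f2 f3 e(3)[of n] v(3)[of n] by linarith
   finally show ?thesis .
  qed
  then show "\<forall>\<^sub>F n in sequentially. norm (n2 (\<lambda>x. P n x - \<psi> x)) \<le> (1/2) ^ n + (1/2) ^ n + n2 (\<lambda>x. X n x * \<psi> x - \<psi> x)"
   by simp
 qed
 have elim0: "(\<lambda>n. e n) \<longlonglongrightarrow> 0"
  by (rule Lim_null_comparison[OF always_eventually half]) (use e in \<open>auto simp: less_imp_le\<close>)
 have PAE: "AE x in lborel. (\<lambda>n. P n x) \<longlonglongrightarrow> \<psi> x"
 proof -
  have "AE x in lborel. (\<lambda>n. v n x) \<longlonglongrightarrow> a x"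
   by (rule n2_tendsto_AE[OF v(2) a, where C=1]) (use v(3) in simp)
  then show ?thesis
  proof eventually_elim
   case (elim x)
   have "(\<lambda>n. e n * X n x + \<bar>v n x - a x\<bar> + \<bar>X n x * \<bar>a x\<bar> - \<bar>a x\<bar>\<bar>) \<longlonglongrightarrow> 0 * 1 + \<bar>a x - a x\<bar> + \<bar>1 * \<bar>a x\<bar> - \<bar>a x\<bar>\<bar>"
    by (intro tendsto_intros elim Xlim elim0)
   then have g0: "(\<lambda>n. e n * X n x + \<bar>v n x - a x\<bar> + \<bar>X n x * \<bar>a x\<bar> - \<bar>a x\<bar>\<bar>) \<longlonglongrightarrow> 0" by simp
   have "(\<lambda>n. P n x - \<psi> x) \<longlonglongrightarrow> 0"
   proof (rule Lim_null_comparison[OF always_eventually g0], rule allI)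
    show "norm (P n x - \<psi> x) \<le> e n * X n x + \<bar>v n x - a x\<bar> + \<bar>X n x * \<bar>a x\<bar> - \<bar>a x\<bar>\<bar>" for n
     using Pd[of n x] unfolding \<psi>_def real_norm_def .
   qed
   then show ?case by (rule LIM_zero_cancel)
  qed
 qed
 define w where "w x = - lap u x - V x * u x" for x
 have Vu: "(\<lambda>x. V x * u x) \<in> L2" by (rule L2_loc_mult_test[OF Vloc u])
 have wL: "w \<in> L2" unfolding w_def by (intro L2_diff L2_minus test_L2 test_lap u Vu)
 define B where "B = (LBINT x. \<psi> x * w x)"
 define Bn where "Bn n = (LBINT x. P n x * w x)" for n
 have Blim: "Bn \<longlonglongrightarrow> B"
  using L2_tendsto_integral_const[OF test_L2[OF P] \<psi>L wL Plim] unfolding Bn_def B_def by (simp add: mult.commute)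
 define q where "q = (LBINT x. (\<Sum>b\<in>Basis. (pd b u x)\<^sup>2)) - (LBINT x. V x * (u x)\<^sup>2)"
 define S where "S n x = sqrt (V x) * P n x" for n x
 have VP: "(\<lambda>x. V x * P n x) \<in> L2" for n by (rule L2_loc_mult_test[OF Vloc P])
 have IVP: "integrable lborel (\<lambda>x. V x * (P n x)\<^sup>2)" for n
  using L2_prod_integrable(1)[OF VP test_L2[OF P]] by (simp add: power2_eq_square mult.assoc)
 have S2: "(norm (S n x))\<^sup>2 = V x * (P n x)\<^sup>2" for n x using V0[of x] by (simp add: S_def power_mult_distrib)
 have SL: "S n \<in> L2" for n
 proof (rule L2I)
  show "S n \<in> borel_measurable borel" unfolding S_def by measurable
  show "integrable lborel (\<lambda>x. (norm (S n x))\<^sup>2)" unfolding S2 by (rule IVP)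
 qed
 \<comment> \<open>The form inequality at P + t u, in the limit. On the left Fatou's lemma keeps the
   full potential energy of \<psi>, on the right the energy bound \<alpha> converges to the same
   number, so that only the linear and quadratic terms in \<open>t\<close> are left over.\<close>
 have key: "(LBINT x. V x * (\<psi> x)\<^sup>2) \<le> (LBINT x. V x * (\<psi> x)\<^sup>2) + 2 * t * B + t\<^sup>2 * q" for t
 proof -
  have ineq: "(n2 (S n))\<^sup>2 \<le> \<alpha> n + 2 * t * Bn n + t\<^sup>2 * q" for n
  proof -
   have Ptu: "test (\<lambda>x. P n x + t * u x)" by (intro test_add P test_cmult u)
   have "(LBINT x. V x * (P n x + t * u x)\<^sup>2) = (LBINT x. V x * (P n x)\<^sup>2 + 2 * t * (P n x * (V x * u x)) + t\<^sup>2 * (V x * (u x)\<^sup>2))"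
    by (simp add: power2_sum power_mult_distrib algebra_simps)
   also have "\<dots> = (LBINT x. V x * (P n x)\<^sup>2) + 2 * t * (LBINT x. P n x * (V x * u x)) + t\<^sup>2 * (LBINT x. V x * (u x)\<^sup>2)"
    using IVP L2_prod_integrable(1)[OF test_L2[OF P] Vu, of n] L2_prod_integrable(1)[OF Vu test_L2[OF u]]
    by (simp add: power2_eq_square mult.assoc)
   finally have L: "(LBINT x. V x * (P n x + t * u x)\<^sup>2) = (n2 (S n))\<^sup>2 + 2 * t * (LBINT x. P n x * (V x * u x)) + t\<^sup>2 * (LBINT x. V x * (u x)\<^sup>2)"
    unfolding n2_sq S2 .
   have "(\<Sum>b\<in>Basis. (pd b (\<lambda>x. P n x + t * u x) x)\<^sup>2) = (\<Sum>b\<in>Basis. pd b (P n) x * pd b (P n) x) + 2 * t * (\<Sum>b\<in>Basis. pd b (P n) x * pd b u x) + t\<^sup>2 * (\<Sum>b\<in>Basis. pd b u x * pd b u x)" for x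
   proof -
    have "pd b (\<lambda>x. P n x + t * u x) x = pd b (P n) x + t * pd b u x" for b
     using pd_add[OF test_smooth[OF P] test_smooth[OF test_cmult[OF u]]] pd_cmult[OF test_smooth[OF u]] by simp
    then show ?thesis by (simp add: power2_eq_square algebra_simps sum.distrib sum_distrib_left)
   qed
   then have "(LBINT x. (\<Sum>b\<in>Basis. (pd b (\<lambda>x. P n x + t * u x) x)\<^sup>2)) =
     (LBINT x. (\<Sum>b\<in>Basis. pd b (P n) x * pd b (P n) x)) + 2 * t * (LBINT x. (\<Sum>b\<in>Basis. pd b (P n) x * pd b u x)) + t\<^sup>2 * (LBINT x. (\<Sum>b\<in>Basis. pd b u x * pd b u x))"
    using dirichlet_test(1)[OF P P, of n n] dirichlet_test(1)[OF P u, of n] dirichlet_test(1)[OF u u] by simp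
   also have "\<dots> \<le> \<alpha> n + 2 * t * - (LBINT x. P n x * lap u x) + t\<^sup>2 * (LBINT x. (\<Sum>b\<in>Basis. (pd b u x)\<^sup>2))"
    using PE[of n] dirichlet_test(2)[OF P u, of n] by (simp add: power2_eq_square)
   finally have ub: "(n2 (S n))\<^sup>2 + 2 * t * (LBINT x. P n x * (V x * u x)) + t\<^sup>2 * (LBINT x. V x * (u x)\<^sup>2)
     \<le> \<alpha> n + 2 * t * - (LBINT x. P n x * lap u x) + t\<^sup>2 * (LBINT x. (\<Sum>b\<in>Basis. (pd b u x)\<^sup>2))"
    using form[OF Ptu] L by linarith
   have "Bn n = - (LBINT x. P n x * lap u x) - (LBINT x. P n x * (V x * u x))"
   proof -
    have "Bn n = (LBINT x. - (P n x * lap u x) - P n x * (V x * u x))"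
     unfolding Bn_def w_def by (simp add: algebra_simps)
    then show ?thesis
     using L2_prod_integrable(1)[OF test_L2[OF P] Vu, of n] L2_prod_integrable(1)[OF test_L2[OF P] test_L2[OF test_lap[OF u]], of n]
     by simp
   qed
   then have "2 * t * Bn n = 2 * t * - (LBINT x. P n x * lap u x) - 2 * t * (LBINT x. P n x * (V x * u x))"
    by (simp only: right_diff_distrib)
   moreover have "t\<^sup>2 * q = t\<^sup>2 * (LBINT x. (\<Sum>b\<in>Basis. (pd b u x)\<^sup>2)) - t\<^sup>2 * (LBINT x. V x * (u x)\<^sup>2)"
    unfolding q_def by (rule right_diff_distrib)
   ultimately show ?thesis using ub by linarith
  qed
  have a2: "- (LBINT x. a x * - (V x * a x)) = (LBINT x. V x * (\<psi> x)\<^sup>2)"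
   by (simp add: \<psi>_def power2_eq_square mult_ac)
  have lim: "(\<lambda>n. \<alpha> n + 2 * t * Bn n + t\<^sup>2 * q) \<longlonglongrightarrow> (LBINT x. V x * (\<psi> x)\<^sup>2) + 2 * t * B + t\<^sup>2 * q"
   by (intro tendsto_intros \<alpha>[unfolded a2] Blim)
  show ?thesis
  proof (rule field_le_epsilon)
   fix d :: real assume "d > 0"
   define M where "M = (LBINT x. V x * (\<psi> x)\<^sup>2) + 2 * t * B + t\<^sup>2 * q"
   have "\<forall>\<^sub>F n in sequentially. \<alpha> n + 2 * t * Bn n + t\<^sup>2 * q < M + d"
    by (rule order_tendstoD(2)[OF lim]) (use \<open>d > 0\<close> in \<open>simp add: M_def\<close>)
   then obtain n0 where n0: "\<And>n. n \<ge> n0 \<Longrightarrow> \<alpha> n + 2 * t * Bn n + t\<^sup>2 * q \<le> M + d"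
    unfolding eventually_sequentially by (meson less_imp_le)
   have Mle: "(n2 (S n))\<^sup>2 \<le> M + d" if "n \<ge> n0" for n using n0[OF that] ineq[of n] by linarith
   have M0: "M + d \<ge> 0" using Mle[of n0] zero_le_power2[of "n2 (S n0)"] by linarith
   have Sle: "n2 (S n) \<le> sqrt (M + d)" if "n \<ge> n0" for n using Mle[OF that] by (rule real_le_rsqrt)
   have "AE x in lborel. (\<lambda>n. S n x) \<longlonglongrightarrow> sqrt (V x) * \<psi> x"
    using PAE by eventually_elim (auto simp: S_def intro!: tendsto_intros)
   from L2_Fatou(2)[OF SL _ this Sle] have "n2 (\<lambda>x. sqrt (V x) * \<psi> x) \<le> sqrt (M + d)" by simp
   then have "(n2 (\<lambda>x. sqrt (V x) * \<psi> x))\<^sup>2 \<le> (sqrt (M + d))\<^sup>2" by (rule power_mono) simp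
   moreover have "(n2 (\<lambda>x. sqrt (V x) * \<psi> x))\<^sup>2 = (LBINT x. V x * (\<psi> x)\<^sup>2)"
    unfolding n2_sq using V0 by (simp add: power_mult_distrib)
   ultimately show "(LBINT x. V x * (\<psi> x)\<^sup>2) \<le> (LBINT x. V x * (\<psi> x)\<^sup>2) + 2 * t * B + t\<^sup>2 * q + d"
    using M0 by (simp add: M_def)
  qed
 qed
 have "B = 0"
 proof (rule ccontr)
  assume "B \<noteq> 0"
  \<comment> \<open>\<open>key\<close> says 0 \<le> 2 t B + t^2 q for all t. Division by
    \<open>q\<close> may fail, so \<open>q\<close> is replaced by the larger, positive
    \<open>r\<close>; the choice t = - B / r then makes the right-hand side negative unless B =
    0.\<close>
  define r where "r = \<bar>q\<bar> + 1"
  have r: "r > 0" "q < r" by (auto simp: r_def)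
  define t where "t = - B / r"
  have "t\<^sup>2 * q \<le> t\<^sup>2 * r" using r by (intro mult_left_mono) auto
  also have "t\<^sup>2 * r = B\<^sup>2 / r" using r by (simp add: t_def power2_eq_square)
  finally have "2 * t * B + t\<^sup>2 * q \<le> - (B\<^sup>2 / r)" using r by (simp add: t_def power2_eq_square)
  moreover have "B\<^sup>2 / r > 0" using \<open>B \<noteq> 0\<close> r by simp
  ultimately show False using key[of t] by linarith
 qed
 then show ?thesis by (simp add: B_def \<psi>_def w_def)
qed

text \<open>The convolution of a test function with \<open>a\<close> is constant along \<open>b\<close> and tends to zero at infinity.\<close>

lemma zero_weak_derivative_L2:
 fixes a :: "'a::euclidean_space \<Rightarrow> real"
 assumes a: "a \<in> L2" and b: "b \<in> Basis"
  and z: "\<And>u. test u \<Longrightarrow> (LBINT x. a x * pd b u x) = 0"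
 shows "AE x in lborel. a x = 0"
proof (rule fundamental_lemma_real[OF a])
 fix u :: "'a \<Rightarrow> real" assume u: "test u"
 define U where "U t = (LBINT x. u (x + t *\<^sub>R b) * a x)" for t :: real
 define a' where "a' y = a (- y)" for y
 have a': "a' \<in> L2" using L2_reflect(1)[OF a, of 0] by (simp add: a'_def[abs_def])
 note [measurable] = L2_measurable[OF a] test_measurable[OF u]
 have cvU: "cv \<theta> a' x = (LBINT y. \<theta> (x + y) * a y)" if [measurable]: "\<theta> \<in> borel_measurable borel" for \<theta> x
  unfolding cv_def a'_def using lborel_integral_reflect[of "\<lambda>y. \<theta> (x + y) * a y" 0] by simp
 note pdc = pd_cv[OF u L2_set_integrable[OF a'] L2_measurable[OF a'] b]
 have "pd b (cv u a') x = 0" for x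
 proof -
  define \<theta> where "\<theta> y = u (y - - x)" for y
  have A: "((\<lambda>y. y - - x) has_derivative (\<lambda>v. v)) (at y)" for y by (auto intro!: derivative_eq_intros)
  have sm: "smooth \<theta>" unfolding \<theta>_def by (rule smooth_affine[OF test_smooth[OF u] A])
  obtain r where r: "\<And>x. norm x > r \<Longrightarrow> u x = 0" using test_supportE[OF u] by blast
  have "\<theta> y = 0" if "norm y > r + norm x" for y
   unfolding \<theta>_def by (rule r) (use that norm_triangle_ineq2[of y "- x"] in simp)
  then have \<theta>: "test \<theta>" using sm by (auto simp: test_functions_iff)
  have "pd b \<theta> y = pd b u (x + y)" for y
  proof -
   have "pd b \<theta> y = (\<Sum>c\<in>Basis. (b \<bullet> c) * pd c u (y - - x))"
    unfolding \<theta>_def by (rule pd_affine[OF test_smooth[OF u] A])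
   also have "\<dots> = (\<Sum>c\<in>Basis. if c = b then pd c u (y - - x) else 0)"
    using b by (intro sum.cong) (auto simp: inner_Basis)
   finally show ?thesis using b by (simp add: add.commute)
  qed
  then have "pd b (cv u a') x = (LBINT y. a y * pd b \<theta> y)"
   using cvU[OF smooth_measurable[OF smooth_pd[OF test_smooth[OF u] b]], of x] by (simp add: pdc mult.commute)
  then show ?thesis using z[OF \<theta>] by simp
 qed
 then have d0: "((\<lambda>t. cv u a' (0 + t *\<^sub>R b)) has_real_derivative 0) (at t)" for t
  using smooth_line_deriv[OF cv_smooth[OF u L2_set_integrable[OF a'] L2_measurable[OF a']], of 0 b t] by simp
 have cons: "cv u a' (t *\<^sub>R b) = cv u a' 0" for t
  using DERIV_isconst_all[of "\<lambda>t. cv u a' (0 + t *\<^sub>R b)" t 0] d0 by simp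
 have Ucv: "U t = cv u a' (t *\<^sub>R b)" for t
  unfolding U_def cvU[OF test_measurable[OF u]] by (simp add: add.commute)
 obtain r where r: "r > 0" "\<And>x. norm x > r \<Longrightarrow> u x = 0" using test_supportE[OF u] by blast
 \<comment> \<open>A ball that contains the support of the translate of \<open>u\<close>. It runs
   off to infinity, so the norm of \<open>a\<close> on it tends to zero.\<close>
 define i where "i n x = (indicator {x. norm (x + real n *\<^sub>R b) \<le> r} x :: real)" for n x
 have im: "i n \<in> borel_measurable borel" for n unfolding i_def by measurable
 have "(\<lambda>n. n2 (\<lambda>x. i n x * a x - 0)) \<longlonglongrightarrow> 0" and iL: "\<And>n. (\<lambda>x. i n x * a x) \<in> L2"
 proof -
  have lim: "AE x in lborel. (\<lambda>n. i n x * a x) \<longlonglongrightarrow> 0"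
  proof (rule always_eventually, rule allI, rule tendsto_eventually)
   fix x
   have "i n x * a x = 0" if "n \<ge> nat \<lceil>norm x + r + 1\<rceil>" for n
   proof -
    have "real n \<ge> norm x + r + 1" using that by linarith
    then have "norm (real n *\<^sub>R b) \<ge> norm x + r + 1" using b by simp
    then have "norm (x + real n *\<^sub>R b) > r" using norm_diff_ineq[of "real n *\<^sub>R b" x] by (simp add: add.commute)
    then show ?thesis by (simp add: i_def)
   qed
   then show "\<forall>\<^sub>F n in sequentially. i n x * a x = 0" unfolding eventually_sequentially by blast
  qed
  have le: "\<bar>i n x * a x\<bar> \<le> \<bar>a x\<bar>" for n x by (auto simp: i_def indicator_def)
  have aL: "(\<lambda>x. \<bar>a x\<bar>) \<in> L2" using L2_norm_fun(1)[OF a] by simp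
  have m: "(\<lambda>x. i n x * a x) \<in> borel_measurable borel" for n using im[of n] by measurable
  note D = L2_dominated_convergence[OF m _ aL lim le]
  show "(\<lambda>n. n2 (\<lambda>x. i n x * a x - 0)) \<longlonglongrightarrow> 0" by (rule D(3)) simp
  show "\<And>n. (\<lambda>x. i n x * a x) \<in> L2" by (rule D(1)) simp
 qed
 then have lim: "(\<lambda>n. n2 u * n2 (\<lambda>x. i n x * a x)) \<longlonglongrightarrow> 0" using tendsto_mult_right_zero by fastforce
 have "\<bar>U (real n)\<bar> \<le> n2 u * n2 (\<lambda>x. i n x * a x)" for n
 proof -
  have uL: "(\<lambda>x. u (x + real n *\<^sub>R b)) \<in> L2" "n2 (\<lambda>x. u (x + real n *\<^sub>R b)) = n2 u"
  proof -
   note t = test_L2[OF u]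
   have E: "(\<lambda>x. u (x + real n *\<^sub>R b)) = (\<lambda>x. (\<lambda>y. u (0 - y)) (- (real n *\<^sub>R b) - x))" by (auto simp: algebra_simps)
   show "(\<lambda>x. u (x + real n *\<^sub>R b)) \<in> L2" "n2 (\<lambda>x. u (x + real n *\<^sub>R b)) = n2 u"
    unfolding E using L2_reflect[OF L2_reflect(1)[OF t, of 0], of "- (real n *\<^sub>R b)"] L2_reflect(2)[OF t, of 0] by auto
  qed
  have "U (real n) = (LBINT x. u (x + real n *\<^sub>R b) * (i n x * a x))"
   unfolding U_def by (intro Bochner_Integration.integral_cong refl) (use r(2) in \<open>auto simp: i_def indicator_def not_le\<close>)
  then show ?thesis using L2_prod_integrable(2)[OF uL(1) iL[of n]] uL(2) by simp
 qed
 then have "\<bar>cv u a' 0\<bar> \<le> n2 u * n2 (\<lambda>x. i n x * a x)" for n using Ucv cons by metis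
 then have "\<bar>cv u a' 0\<bar> \<le> 0" by (intro LIMSEQ_le_const[OF lim]) auto
 then show "(LBINT x. u x * a x) = 0"
  using cvU[OF test_measurable[OF u], of 0] by simp
qed

section \<open>The three-particle problem\<close>

lemma sum_Basis_prod:
 fixes f :: "'a::euclidean_space \<times> 'b::euclidean_space \<Rightarrow> 'c::comm_monoid_add"
 shows "(\<Sum>b\<in>Basis. f b) = (\<Sum>b\<in>Basis. f (b, 0)) + (\<Sum>b\<in>Basis. f (0, b))"
proof -
 have "inj_on (\<lambda>u. (u::'a, 0::'b)) Basis" "inj_on (\<lambda>u. (0::'a, u::'b)) Basis"
  by (auto intro!: inj_onI)
 moreover have "(\<lambda>u. (u::'a, 0::'b)) ` Basis \<inter> (\<lambda>u. (0::'a, u::'b)) ` Basis = {}"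
  using nonzero_Basis by fastforce
 ultimately show ?thesis
  unfolding Basis_prod_def by (subst sum.union_disjoint) (auto simp: sum.reindex)
qed

lemma Basis_prod_memI: "b \<in> Basis \<Longrightarrow> (b, 0) \<in> Basis" "b \<in> Basis \<Longrightarrow> (0, b) \<in> Basis"
 by (auto simp: Basis_prod_def)

lemma sum_inner_Basis: "b \<in> Basis \<Longrightarrow> (\<Sum>c\<in>Basis. (b \<bullet> c) * f c) = (f b :: real)"
proof -
 assume b: "b \<in> Basis"
 then have "(\<Sum>c\<in>Basis. (b \<bullet> c) * f c) = (\<Sum>c\<in>Basis. if c = b then f c else 0)"
  by (intro sum.cong) (auto simp: inner_Basis)
 with b show ?thesis by simp
qed

lemma has_derivative_fst_snd:
 "(fst has_derivative fst) (at z)" "(snd has_derivative snd) (at z)"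
 by (intro bounded_linear_imp_has_derivative bounded_linear_fst bounded_linear_snd)+

lemma fst_snd_borel [measurable]:
 "fst \<in> borel_measurable (borel :: ('a::euclidean_space \<times> 'b::euclidean_space) measure)"
 "snd \<in> borel_measurable (borel :: ('a::euclidean_space \<times> 'b::euclidean_space) measure)"
 by (intro borel_measurable_continuous_onI continuous_intros)+

lemma smooth_fst: "smooth h \<Longrightarrow> smooth (\<lambda>z. h (fst z))"
 by (rule smooth_affine[OF _ has_derivative_fst_snd(1)])

lemma pd_fst:
 fixes h :: "'a::euclidean_space \<Rightarrow> real"
 assumes h: "smooth h" and b: "b \<in> Basis"
 shows "pd (b, 0) (\<lambda>z::'a \<times> 'b::euclidean_space. h (fst z)) = (\<lambda>z. pd b h (fst z))"
  and "pd (0, b') (\<lambda>z::'a \<times> 'b. h (fst z)) = (\<lambda>z. 0)"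
 by (intro ext, subst pd_affine[OF h has_derivative_fst_snd(1)], simp add: sum_inner_Basis[OF b])+

lemma lap_fst:
 fixes h :: "'a::euclidean_space \<Rightarrow> real"
 assumes h: "smooth h"
 shows "lap (\<lambda>z::'a \<times> 'b::euclidean_space. h (fst z)) z = lap h (fst z)"
proof -
 obtain b0 :: 'a where b0: "b0 \<in> Basis" using nonempty_Basis by blast
 have "(\<Sum>b\<in>Basis. pd (b, 0) (pd (b, 0) (\<lambda>z::'a \<times> 'b. h (fst z))) z) = (\<Sum>b\<in>Basis. pd b (pd b h) (fst z))"
  by (intro sum.cong refl) (simp add: pd_fst h smooth_pd)
 then show ?thesis unfolding lap_def sum_Basis_prod by (simp add: pd_fst(2)[OF h b0])
qed

lemma slice_test:
 fixes P :: "'a::euclidean_space \<times> 'b::euclidean_space \<Rightarrow> real"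
 assumes P: "test P"
 shows "test (\<lambda>x. P (x, y))" "b \<in> Basis \<Longrightarrow> pd b (\<lambda>x. P (x, y)) x = pd (b, 0) P (x, y)"
proof -
 have A: "((\<lambda>x. (x, y)) has_derivative (\<lambda>x. (x, 0))) (at x)" for x :: 'a
  by (auto intro!: derivative_eq_intros)
 obtain r where r: "\<And>z. norm z > r \<Longrightarrow> P z = 0" using test_supportE[OF P] by blast
 have "P (x, y) = 0" if "norm x > r" for x
  using that norm_fst_le[of x y] by (intro r) simp
 then show "test (\<lambda>x. P (x, y))"
  using smooth_affine[OF test_smooth[OF P] A] by (auto simp: test_functions_iff)
 show "pd b (\<lambda>x. P (x, y)) x = pd (b, 0) P (x, y)" if "b \<in> Basis"
  unfolding pd_affine[OF test_smooth[OF P] A] by (rule sum_inner_Basis) (rule Basis_prod_memI[OF that])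
qed

lemma nn_integral_lborel_fst:
 fixes F :: "'a::euclidean_space \<times> 'b::euclidean_space \<Rightarrow> ennreal"
 assumes [measurable]: "F \<in> borel_measurable borel"
 shows "(\<integral>\<^sup>+z. F z \<partial>lborel) = (\<integral>\<^sup>+x. \<integral>\<^sup>+y. F (x, y) \<partial>lborel \<partial>lborel)"
proof -
 have "F \<in> borel_measurable (lborel \<Otimes>\<^sub>M lborel)" unfolding lborel_prod by simp
 from lborel.nn_integral_fst[OF this] show ?thesis unfolding lborel_prod by simp
qed

lemma nn_integral_prod:
 fixes f :: "'a::euclidean_space \<Rightarrow> ennreal" and g :: "'b::euclidean_space \<Rightarrow> ennreal"
 assumes [measurable]: "f \<in> borel_measurable borel" "g \<in> borel_measurable borel"
 shows "(\<integral>\<^sup>+z. f (fst z) * g (snd z) \<partial>lborel) = (\<integral>\<^sup>+x. f x \<partial>lborel) * (\<integral>\<^sup>+y. g y \<partial>lborel)"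
 by (subst nn_integral_lborel_fst) (simp_all add: nn_integral_cmult nn_integral_multc)

lemma prod_L2:
 fixes f :: "'a::euclidean_space \<Rightarrow> real" and g :: "'b::euclidean_space \<Rightarrow> real"
 assumes f: "f \<in> L2" and g: "g \<in> L2"
 shows "(\<lambda>z. f (fst z) * g (snd z)) \<in> L2" "n2 (\<lambda>z. f (fst z) * g (snd z)) \<le> n2 f * n2 g"
proof -
 note [measurable] = L2_measurable[OF f] L2_measurable[OF g]
 have le: "(\<integral>\<^sup>+z. ennreal ((norm (f (fst z) * g (snd z)))\<^sup>2) \<partial>(lborel :: ('a \<times> 'b) measure)) \<le> ennreal ((n2 f * n2 g)\<^sup>2)"
 proof -
  have "(\<integral>\<^sup>+z. ennreal ((norm (f (fst z) * g (snd z)))\<^sup>2) \<partial>(lborel :: ('a \<times> 'b) measure))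
   = (\<integral>\<^sup>+z. ennreal ((norm (f (fst z)))\<^sup>2) * ennreal ((norm (g (snd z)))\<^sup>2) \<partial>(lborel :: ('a \<times> 'b) measure))"
   by (simp add: norm_mult power_mult_distrib ennreal_mult)
  also have "\<dots> = ennreal ((n2 f)\<^sup>2) * ennreal ((n2 g)\<^sup>2)"
   by (subst nn_integral_prod[of "\<lambda>x. ennreal ((norm (f x))\<^sup>2)" "\<lambda>x. ennreal ((norm (g x))\<^sup>2)"])
     (simp_all only: nn_integral_L2[OF f] nn_integral_L2[OF g], measurable)
  finally show ?thesis by (simp add: power_mult_distrib ennreal_mult)
 qed
 have m: "(\<lambda>z. f (fst z) * g (snd z)) \<in> borel_measurable (borel :: ('a \<times> 'b) measure)"
  by (intro borel_measurable_times measurable_compose[OF fst_snd_borel(1)] measurable_compose[OF fst_snd_borel(2)] L2_measurable f g)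
 show "(\<lambda>z. f (fst z) * g (snd z)) \<in> L2" by (rule L2_nnI(1)[OF m le]) simp
 show "n2 (\<lambda>z. f (fst z) * g (snd z)) \<le> n2 f * n2 g" by (rule L2_nnI(2)[OF m le]) simp
qed

text \<open>For fixed x the map y \<mapsto> p x + q y is a dilation followed by a translation, so
  the inner integral does not depend on x. In Jacobi coordinates r1 - r3 and r2 - r3 have this
  form.\<close>

lemma nn_integral_shear:
 fixes A f :: "'a::euclidean_space \<Rightarrow> ennreal"
 assumes [measurable]: "A \<in> borel_measurable borel" "f \<in> borel_measurable borel" and q: "q \<noteq> 0"
 shows "(\<integral>\<^sup>+z. A (fst z) * f (p *\<^sub>R fst z + q *\<^sub>R snd z) \<partial>lborel)
  = ennreal (inverse (\<bar>q\<bar> ^ DIM('a))) * ((\<integral>\<^sup>+x. A x \<partial>lborel) * (\<integral>\<^sup>+x. f x \<partial>lborel))"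
proof -
 define c where "c = ennreal (inverse (\<bar>q\<bar> ^ DIM('a)))"
 have c: "c * ennreal (\<bar>q\<bar> ^ DIM('a)) = 1" using q by (simp add: c_def flip: ennreal_mult'')
 have inner: "(\<integral>\<^sup>+y. f (t + q *\<^sub>R y) \<partial>lborel) = c * (\<integral>\<^sup>+x. f x \<partial>lborel)" for t
 proof -
  have "c * (\<integral>\<^sup>+x. f x \<partial>lborel) = (c * ennreal (\<bar>q\<bar> ^ DIM('a))) * (\<integral>\<^sup>+y. f (t + q *\<^sub>R y) \<partial>lborel)"
   by (subst lborel_nn_integral_affine[OF _ q, of f t]) (simp_all add: mult.assoc)
  then show ?thesis by (simp add: c)
 qed
 have "(\<integral>\<^sup>+z. A (fst z) * f (p *\<^sub>R fst z + q *\<^sub>R snd z) \<partial>lborel) = (\<integral>\<^sup>+x. A x * (c * (\<integral>\<^sup>+x. f x \<partial>lborel)) \<partial>lborel)"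
  by (subst nn_integral_lborel_fst) (simp_all add: nn_integral_cmult inner)
 also have "\<dots> = c * ((\<integral>\<^sup>+x. A x \<partial>lborel) * (\<integral>\<^sup>+x. f x \<partial>lborel))"
  by (subst nn_integral_multc) (simp_all add: mult_ac)
 finally show ?thesis by (simp add: c_def)
qed

text \<open>The error profile left behind when derivatives fall on the cutoff: 1/|x| from the
  approximate resonance and 1/(1 + |z|^2) from the second derivatives of \<open>chi\<close>,
  restricted to a ball that contains the support of \<open>chi L\<close>.\<close>

definition om :: "real \<Rightarrow> R3 \<times> R3 \<Rightarrow> real" where
 "om L z = indicator (cball 0 (exp L)) z / (norm (fst z) * (1 + (norm z)\<^sup>2))"

lemma dyadic_shell:
 fixes z :: "'a::real_normed_vector"
 assumes L: "L \<ge> 1" and z: "norm z \<le> exp L"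
 obtains k :: nat where "k \<le> nat \<lfloor>2 * L\<rfloor>" "norm z < 2 ^ (k + 1)" "4 ^ k \<le> 1 + (norm z)\<^sup>2"
proof -
 \<comment> \<open>The maximum assigns all points of the unit ball to the shell k = 0.\<close>
 define t where "t = max 1 (norm z)"
 have t: "t \<ge> 1" "norm z \<le> t" "t \<le> exp L" using L z by (auto simp: t_def)
 have ex: "\<exists>n. t < 2 ^ n" using real_arch_pow[of 2 t] by auto
 define n where "n = (LEAST n. t < 2 ^ n)"
 have n: "t < 2 ^ n" unfolding n_def by (rule LeastI_ex[OF ex])
 then have "n \<noteq> 0" using t by (intro notI) simp
 then obtain k where k: "n = k + 1" by (cases n) auto
 have kt: "2 ^ k \<le> t" using not_less_Least[of k "\<lambda>n. t < 2 ^ n"] k unfolding n_def[symmetric] by simp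
 \<comment> \<open>From sqrt e \<le> 2 and 2^k \<le> e^L follows the crude bound k \<le> 2 L on the
   number of shells.\<close>
 have "exp (1/2::real) \<le> 2"
 proof (rule power2_le_imp_le)
  have "(exp (1/2::real))\<^sup>2 = exp 1" by (simp flip: exp_double)
  then show "(exp (1/2::real))\<^sup>2 \<le> 2\<^sup>2" using exp_le by simp
 qed simp
 then have "exp (1/2) ^ k \<le> (2::real) ^ k" by (intro power_mono) auto
 then have "exp (real k * (1/2)) \<le> exp L" unfolding exp_of_nat_mult using kt t by linarith
 then have "real k \<le> 2 * L" by simp
 then have k2: "k \<le> nat \<lfloor>2 * L\<rfloor>" by linarith
 have "(4::real) ^ k = (2 ^ k)\<^sup>2" by (simp add: power2_eq_square flip: power_mult_distrib)
 also have "\<dots> \<le> t\<^sup>2" using kt by (intro power_mono) auto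
 also have "\<dots> \<le> 1 + (norm z)\<^sup>2" by (simp add: t_def max_def)
 finally show thesis using that[OF k2 _ ] n t k by simp
qed

text \<open>On the shell number k one has (1 + |z|^2)^(-2) \<le> 16^(-k), and both components lie in
  the ball of radius 2^(k+1). The majorant is a sum of products of a function of x and a function of
  y, so its integral factorises.\<close>

lemma om_le:
 assumes L: "L \<ge> 1"
 shows "(om L z)\<^sup>2 \<le> (\<Sum>k\<le>nat \<lfloor>2 * L\<rfloor>. (1/16) ^ k *
  ((indicator (ball 0 (2 ^ (k + 1))) (fst z) / (norm (fst z))\<^sup>2) * indicator (ball 0 (2 ^ (k + 1))) (snd z)))"
  (is "_ \<le> sum ?f _")
proof (cases "norm z \<le> exp L")
 case False
 then have "om L z = 0" by (simp add: om_def)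
 moreover have "0 \<le> sum ?f {..nat \<lfloor>2 * L\<rfloor>}" by (intro sum_nonneg) auto
 ultimately show ?thesis by simp
next
 case True
 obtain k where k: "k \<le> nat \<lfloor>2 * L\<rfloor>" "norm z < 2 ^ (k + 1)" "4 ^ k \<le> 1 + (norm z)\<^sup>2"
  using dyadic_shell[OF L True] by metis
 define a where "a = 1 + (norm z)\<^sup>2"
 have a: "a > 0" unfolding a_def by (rule one_plus_norm2_pos)
 have "norm (fst z) < 2 ^ (k + 1)" "norm (snd z) < 2 ^ (k + 1)"
  using k(2) norm_fst_le[of "fst z" "snd z"] norm_snd_le[of "snd z" "fst z"] by simp_all
 then have f: "?f k = (1/16) ^ k * (1 / (norm (fst z))\<^sup>2)" by simp
 have "(om L z)\<^sup>2 = (1 / a\<^sup>2) * (1 / (norm (fst z))\<^sup>2)"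
  using True by (simp add: om_def a_def power_divide power_mult_distrib)
 also have "\<dots> \<le> (1/16) ^ k * (1 / (norm (fst z))\<^sup>2)"
 proof (intro mult_right_mono)
  have "(16::real) ^ k = (4 ^ k)\<^sup>2" by (simp add: power2_eq_square flip: power_mult_distrib)
  also have "\<dots> \<le> a\<^sup>2" using k(3) by (intro power_mono) (auto simp: a_def)
  finally have "1 / a\<^sup>2 \<le> 1 / 16 ^ k" by (intro divide_left_mono) (use a in auto)
  then show "1 / a\<^sup>2 \<le> (1/16) ^ k" by (simp add: power_one_over)
 qed simp
 also have "\<dots> = ?f k" by (rule f[symmetric])
 also have "\<dots> \<le> sum ?f {..nat \<lfloor>2 * L\<rfloor>}" by (intro member_le_sum) (use k in auto)
 finally show ?thesis .
qed

text \<open>Each of the \<open>O(L)\<close> dyadic shells contributes equally, so that dividing by \<open>L\<close> beats the growth.\<close>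

lemma om_L2:
 obtains C where "C > 0" "\<And>L. L \<ge> 1 \<Longrightarrow> om L \<in> L2" "\<And>L. L \<ge> 1 \<Longrightarrow> n2 (om L) \<le> C * sqrt L"
proof -
 obtain C where C: "C > 0"
  "\<And>M. M > 0 \<Longrightarrow> (\<integral>\<^sup>+x. ennreal (indicator (ball 0 M) x / (norm (x::R3))\<^sup>2) \<partial>lborel) \<le> ennreal (C * M)"
  using nn_integral_inverse_square by metis
 define v where "v = unit_ball_vol (3::real)"
 have v: "v > 0" by (simp add: v_def)
 define C' where "C' = sqrt (48 * C * v)"
 have C': "C' > 0" using C v by (simp add: C'_def)
 have om_m: "om L \<in> borel_measurable borel" for L unfolding om_def
  by (intro borel_measurable_divide borel_measurable_indicator borel_closed closed_cball borel_measurable_continuous_onI continuous_intros)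
 have le: "(\<integral>\<^sup>+z. ennreal ((norm (om L z))\<^sup>2) \<partial>lborel) \<le> ennreal ((C' * sqrt L)\<^sup>2)" if L: "L \<ge> 1" for L
 proof -
  define K where "K = nat \<lfloor>2 * L\<rfloor>"
  define F where "F k x = ennreal (indicator (ball 0 (2 ^ (k + 1))) x / (norm (x::R3))\<^sup>2)" for k :: nat and x
  define G where "G k x = ennreal (indicator (ball 0 (2 ^ (k + 1))) (x::R3))" for k :: nat and x
  have [measurable]: "F k \<in> borel_measurable borel" "G k \<in> borel_measurable borel" for k
   unfolding F_def G_def by measurable
  have "ennreal ((norm (om L z))\<^sup>2) \<le> (\<Sum>k\<le>K. ennreal ((1/16) ^ k) * (F k (fst z) * G k (snd z)))" for z
  proof -
   have "ennreal ((norm (om L z))\<^sup>2) \<le> ennreal (\<Sum>k\<le>K. (1/16) ^ k *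
     ((indicator (ball 0 (2 ^ (k + 1))) (fst z) / (norm (fst z))\<^sup>2) * indicator (ball 0 (2 ^ (k + 1))) (snd z)))"
    using om_le[OF L, of z] unfolding K_def by (intro ennreal_leI) simp
   also have "\<dots> = (\<Sum>k\<le>K. ennreal ((1/16) ^ k) * (F k (fst z) * G k (snd z)))"
    unfolding F_def G_def by (subst sum_ennreal[symmetric]) (auto simp flip: ennreal_mult)
   finally show ?thesis .
  qed
  then have "(\<integral>\<^sup>+z. ennreal ((norm (om L z))\<^sup>2) \<partial>lborel) \<le> (\<integral>\<^sup>+z. (\<Sum>k\<le>K. ennreal ((1/16) ^ k) * (F k (fst z) * G k (snd z))) \<partial>lborel)"
   by (intro nn_integral_mono)
  also have "\<dots> = (\<Sum>k\<le>K. ennreal ((1/16) ^ k) * ((\<integral>\<^sup>+x. F k x \<partial>lborel) * (\<integral>\<^sup>+x. G k x \<partial>lborel)))"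
   by (subst nn_integral_sum) (simp_all add: nn_integral_cmult nn_integral_prod)
  \<comment> \<open>16^(-k), times C 2^(k+1) from the x-integral, times v 8^(k+1) from the y-ball,
    is 16 C v for every k.\<close>
  also have "\<dots> \<le> (\<Sum>k\<le>K. ennreal (16 * C * v))"
  proof (rule sum_mono)
   fix k
   have G: "(\<integral>\<^sup>+x. G k x \<partial>lborel) = ennreal (v * (2 ^ (k + 1)) ^ 3)"
    unfolding G_def v_def by (simp add: ennreal_indicator emeasure_ball_R3)
   have F: "(\<integral>\<^sup>+x. F k x \<partial>lborel) \<le> ennreal (C * 2 ^ (k + 1))" unfolding F_def by (rule C(2)) simp
   have "ennreal ((1/16) ^ k) * ((\<integral>\<^sup>+x. F k x \<partial>lborel) * (\<integral>\<^sup>+x. G k x \<partial>lborel))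
     \<le> ennreal ((1/16) ^ k) * (ennreal (C * 2 ^ (k + 1)) * ennreal (v * (2 ^ (k + 1)) ^ 3))"
    unfolding G by (intro mult_left_mono mult_right_mono F) auto
   also have "\<dots> = ennreal ((1/16) ^ k * ((C * 2 ^ (k + 1)) * (v * (2 ^ (k + 1)) ^ 3)))"
   proof -
    have p: "0 \<le> C * 2 ^ (k + 1)" "0 \<le> v * (2 ^ (k + 1)) ^ 3" "0 \<le> (1/16::real) ^ k" using C v by auto
    show ?thesis by (simp only: ennreal_mult[OF p(1,2)] ennreal_mult[OF p(3) mult_nonneg_nonneg[OF p(1,2)]])
   qed
   also have "(1/16) ^ k * ((C * 2 ^ (k + 1)) * (v * (2 ^ (k + 1)) ^ 3)) = 16 * C * v"
   proof -
    have "(2::real) ^ (k + 1) * (2 ^ (k + 1)) ^ 3 = (2 ^ (k + 1)) ^ 4" by (simp add: power4_eq_xxxx power3_eq_cube)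
    also have "\<dots> = (2 ^ 4) ^ (k + 1)" by (simp only: power_mult[symmetric] mult.commute)
    finally have "(2::real) ^ (k + 1) * (2 ^ (k + 1)) ^ 3 = 16 * 16 ^ k" by simp
    moreover have "(1/16) ^ k * ((C * 2 ^ (k + 1)) * (v * (2 ^ (k + 1)) ^ 3)) = (1/16) ^ k * C * v * ((2::real) ^ (k + 1) * (2 ^ (k + 1)) ^ 3)"
     by (simp only: mult_ac)
    ultimately show ?thesis by (simp add: power_one_over)
   qed
   finally show "ennreal ((1/16) ^ k) * ((\<integral>\<^sup>+x. F k x \<partial>lborel) * (\<integral>\<^sup>+x. G k x \<partial>lborel)) \<le> ennreal (16 * C * v)" .
  qed
  also have "\<dots> = ennreal (real (K + 1) * (16 * C * v))"
   using C v by (simp add: ennreal_mult ennreal_of_nat_eq_real_of_nat)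
  also have "\<dots> \<le> ennreal ((C' * sqrt L)\<^sup>2)"
  proof (rule ennreal_leI)
   have "real (K + 1) \<le> 3 * L" using L by (simp add: K_def) linarith
   then have "real (K + 1) * (16 * C * v) \<le> 3 * L * (16 * C * v)" using C v by (intro mult_right_mono) auto
   also have "\<dots> = (C' * sqrt L)\<^sup>2" using C v L by (simp add: C'_def power_mult_distrib)
   finally show "real (K + 1) * (16 * C * v) \<le> (C' * sqrt L)\<^sup>2" .
  qed
  finally show ?thesis .
 qed
 show thesis
  by (rule that[OF C']; rule L2_nnI[OF om_m le]) (use C' in auto)
qed

text \<open>The equation for \<open>\<psi>\<close> is tested against the approximate resonance times a logarithmic cutoff.\<close>

lemma resonance_excludes:
 fixes \<psi> W :: "R3 \<times> R3 \<Rightarrow> real" and v :: "R3 \<Rightarrow> real"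
 assumes \<psi>: "\<psi> \<in> L2" "\<And>z. 0 \<le> \<psi> z"
  and vm [measurable]: "v \<in> borel_measurable borel" and v: "\<And>x. 0 \<le> v x" "\<And>x. v x \<le> B"
  and Wm [measurable]: "W \<in> borel_measurable borel" and W0: "\<And>z. 0 \<le> W z"
  and Wloc: "\<And>r. (\<lambda>z. indicator (cball 0 r) z * W z) \<in> L2"
  and harm: "\<And>u. test u \<Longrightarrow> (LBINT z. \<psi> z * (- lap u z - (v (fst z) + W z) * u z)) = 0"
  and approx: "approx_resonance v C m"
 shows "AE z in lborel. W z * \<psi> z = 0"
proof -
 have C: "C > 0" and mm [measurable]: "m \<in> borel_measurable borel" and m: "\<And>x. m x > 0"
  using approx by (auto simp: approx_resonance_def)
 obtain Cx where Cx: "Cx > 0"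
  "\<And>L (z::R3 \<times> R3) b. L \<ge> 1 \<Longrightarrow> b \<in> Basis \<Longrightarrow> \<bar>pd b (chi L) z\<bar> \<le> Cx * \<bar>z \<bullet> b\<bar> / (L * (1 + (norm z)\<^sup>2))"
  "\<And>L (z::R3 \<times> R3) b. L \<ge> 1 \<Longrightarrow> b \<in> Basis \<Longrightarrow> \<bar>pd b (pd b (chi L)) z\<bar> \<le> Cx / (L * (1 + (norm z)\<^sup>2))"
  using chi_derivs[where 'a="R3 \<times> R3"] by metis
 obtain Co where Co: "Co > 0" "\<And>L. L \<ge> 1 \<Longrightarrow> om L \<in> L2" "\<And>L. L \<ge> 1 \<Longrightarrow> n2 (om L) \<le> Co * sqrt L"
  using om_L2 by metis
 \<comment> \<open>Twelve is twice the three x-directions of the mixed first-order terms, plus six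
   directions for the Laplacian of the cutoff.\<close>
 define K where "K = 12 * (Cx * C)"
 have K: "K > 0" using Cx C by (simp add: K_def)
 note [measurable] = L2_measurable[OF \<psi>(1)]
 \<comment> \<open>The upper bounds on \<open>h\<close> exclude x = 0, which is a null set of
   R^6.\<close>
 have AE0: "AE z in (lborel :: (R3 \<times> R3) measure). fst z \<noteq> 0"
 proof -
  have "(\<integral>\<^sup>+z. indicator {0} (fst z) * (1::ennreal) \<partial>(lborel :: (R3 \<times> R3) measure)) = 0"
   by (subst nn_integral_prod[of "indicator {0}" "\<lambda>_. 1"]) (auto simp: )
  then have "AE z in (lborel :: (R3 \<times> R3) measure). indicator {0} (fst z) * (1::ennreal) = 0"
   by (subst (asm) nn_integral_0_iff_AE) auto
  then show ?thesis by eventually_elim (auto simp: indicator_def split: if_splits)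
 qed
 have main: "integrable lborel (\<lambda>z. \<psi> z * (W z * (m (fst z) * chi L z)))"
   "(LBINT z. \<psi> z * (W z * (m (fst z) * chi L z))) \<le> n2 \<psi> * (K / L * (Co * sqrt L))" if L: "L \<ge> 1" for L
 proof -
  define X where "X = (chi L :: R3 \<times> R3 \<Rightarrow> real)"
  have X: "test X" unfolding X_def by (rule chi_test) (use L in simp)
  note Xs = test_smooth[OF X]
  note [measurable] = smooth_measurable[OF Xs]
  have X01: "0 \<le> X z" "X z \<le> 1" for z by (auto simp: X_def)
  have Xout: "X z = 0" if "norm z \<ge> exp L" for z
   unfolding X_def
  proof (rule chi_eq_0)
   have "(exp L)\<^sup>2 \<le> (norm z)\<^sup>2" using that by (intro power_mono) auto
   then show "exp (2 * L) \<le> 1 + (norm z)\<^sup>2" unfolding exp_double by linarith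
  qed (use L in simp)
  \<comment> \<open>The residual depends on x alone and need not be square integrable over R^6. The
    cutoff confines y to this ball; the norm of \<open>i\<close> is the price, and \<delta> pays for
    it.\<close>
  define i where "i = (indicator (ball 0 (exp L)) :: R3 \<Rightarrow> real)"
  have iL: "i \<in> L2" unfolding i_def by (rule indicator_L2) auto
  have step: "integrable lborel (\<lambda>z. \<psi> z * (W z * (m (fst z) * X z))) \<and>
    (LBINT z. \<psi> z * (W z * (m (fst z) * X z))) \<le> n2 \<psi> * (\<delta> * n2 i + K / L * (Co * sqrt L))" if \<delta>: "\<delta> > 0" for \<delta>
  proof -
   obtain h g where h: "smooth h" and g: "test g" and mh: "\<And>x. m x \<le> h x"
    and hC: "\<And>x. x \<noteq> 0 \<Longrightarrow> h x \<le> C / norm x"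
    and dh: "\<And>x c. c \<in> Basis \<Longrightarrow> x \<noteq> 0 \<Longrightarrow> \<bar>pd c h x\<bar> \<le> C / (norm x)\<^sup>2"
    and lh: "\<And>x. - lap h x \<le> g x"
    and dL0: "(\<lambda>x. g x - v x * h x) \<in> L2" and dn0: "n2 (\<lambda>x. g x - v x * h x) \<le> \<delta>"
    using approx[unfolded approx_resonance_def, THEN conjunct2, THEN conjunct2, THEN conjunct2, rule_format, OF \<delta>] by blast
   define d where "d x = \<bar>g x - v x * h x\<bar>" for x
   have dL: "d \<in> L2" "n2 d \<le> \<delta>" unfolding d_def using L2_norm_fun[of "\<lambda>x. g x - v x * h x"] dL0 dn0 by auto
   define H where "H z = h (fst z)" for z :: "R3 \<times> R3"
   have H: "smooth H" unfolding H_def by (rule smooth_fst[OF h])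
   have h0: "h x > 0" for x using m[of x] mh[of x] by linarith
   define u where "u z = X z * H z" for z
   have u: "test u" unfolding u_def by (rule test_mult'[OF X H])
   note [measurable] = test_measurable[OF u] L2_measurable[OF dL(1)]
   \<comment> \<open>In the product rule for X h the undifferentiated cutoff multiplies - \<Delta>h
     - v h, which is at most the residual \<open>d\<close>; all other terms carry a derivative of
     the cutoff and are bounded by multiples of \<open>om\<close>.\<close>
   have pw: "- lap u z - v (fst z) * u z \<le> X z * d (fst z) + K / L * om L z" if x: "fst z \<noteq> 0" for z
   proof -
    obtain b0 :: R3 where b0: "b0 \<in> Basis" using nonempty_Basis by blast
    define x where "x = fst z"
    have nx: "norm x > 0" using x by (simp add: x_def)
    define q where "q = Cx * C / L * om L z"
    have q0: "q \<ge> 0" using Cx C L by (simp add: q_def om_def)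
    have pos: "L * (1 + (norm z)\<^sup>2) > 0" using L one_plus_norm2_pos[of z] by simp
    have omz: "om L z = 1 / (norm x * (1 + (norm z)\<^sup>2))" if "norm z \<le> exp L" using that by (simp add: om_def x_def)
    have out: "pd b X z = 0" "pd b (pd b X) z = 0" if "norm z > exp L" for b
     using pd_eq_0_outside[of "exp L" X z b] pd_eq_0_outside[of "exp L" "pd b X" z b]
      pd_eq_0_outside[of "exp L" X _ b] Xout that by auto
    \<comment> \<open>Here \<open>\<bar>z \<bullet> (b, 0)\<bar>\<close> is at most |x| and reduces
      the 1/|x|^2 of the gradient of \<open>h\<close> to 1/|x|.\<close>
    have c1: "\<bar>pd (b, 0) X z * pd b h x\<bar> \<le> q" if b: "b \<in> Basis" for b
    proof (cases "norm z \<le> exp L")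
     case True
     have "\<bar>pd (b, 0) X z\<bar> \<le> Cx * \<bar>z \<bullet> (b, 0)\<bar> / (L * (1 + (norm z)\<^sup>2))"
      unfolding X_def by (rule Cx(2)[OF L Basis_prod_memI(1)[OF b]])
     also have "\<bar>z \<bullet> (b, 0)\<bar> \<le> norm x" using Basis_le_norm[OF b, of x] by (simp add: x_def inner_prod_def)
     then have "Cx * \<bar>z \<bullet> (b, 0)\<bar> / (L * (1 + (norm z)\<^sup>2)) \<le> Cx * norm x / (L * (1 + (norm z)\<^sup>2))"
      using Cx pos by (intro divide_right_mono mult_left_mono) auto
     finally have "\<bar>pd (b, 0) X z * pd b h x\<bar> \<le> (Cx * norm x / (L * (1 + (norm z)\<^sup>2))) * (C / (norm x)\<^sup>2)"
      unfolding abs_mult using dh[OF b, of x] nx Cx pos by (intro mult_mono) auto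
     also have "\<dots> = q" unfolding q_def omz[OF True] using nx pos L
      by (simp add: power2_eq_square mult_ac)
     finally show ?thesis .
    qed (use out q0 in auto)
    have c2: "\<bar>H z * pd b (pd b X) z\<bar> \<le> q" if b: "b \<in> Basis" for b
    proof (cases "norm z \<le> exp L")
     case True
     have "\<bar>H z * pd b (pd b X) z\<bar> \<le> (C / norm x) * (Cx / (L * (1 + (norm z)\<^sup>2)))"
      unfolding abs_mult X_def using h0[of x] hC[of x] nx C Cx(3)[OF L b, of z]
      by (intro mult_mono) (auto simp: H_def x_def)
     also have "\<dots> = q" unfolding q_def omz[OF True] using nx pos L by (simp add: mult_ac)
     finally show ?thesis .
    qed (use out q0 in auto)
    have "\<bar>\<Sum>b\<in>(Basis::R3 set). pd (b, 0) X z * pd b h x\<bar> \<le> (\<Sum>b\<in>(Basis::R3 set). q)"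
     by (rule order_trans[OF sum_abs]) (intro sum_mono c1)
    then have s1: "\<bar>\<Sum>b\<in>(Basis::R3 set). pd (b, 0) X z * pd b h x\<bar> \<le> 3 * q" by simp
    have "\<bar>\<Sum>b\<in>(Basis::(R3 \<times> R3) set). H z * pd b (pd b X) z\<bar> \<le> (\<Sum>b\<in>(Basis::(R3 \<times> R3) set). q)"
     by (rule order_trans[OF sum_abs]) (intro sum_mono c2)
    then have s2: "\<bar>H z * lap X z\<bar> \<le> 6 * q" by (simp add: lap_def sum_distrib_left)
    have cr: "(\<Sum>b\<in>Basis. pd b X z * pd b H z) = (\<Sum>b\<in>Basis. pd (b, 0) X z * pd b h x)"
    proof -
     have "pd (b, 0) H z = pd b h x" if "b \<in> Basis" for b unfolding H_def pd_fst(1)[OF h that] x_def ..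
     moreover have "pd (0, b) H z = 0" for b unfolding H_def pd_fst(2)[OF h b0] ..
     ultimately show ?thesis unfolding sum_Basis_prod by simp
    qed
    have lapH: "lap H z = lap h x" unfolding H_def x_def by (rule lap_fst[OF h])
    have lapu: "lap u z = lap X z * H z + 2 * (\<Sum>b\<in>Basis. pd (b, 0) X z * pd b h x) + X z * lap h x"
     unfolding u_def lap_mult[OF Xs H] cr lapH ..
    have "X z * (- lap h x - v x * h x) \<le> X z * d x"
     using lh[of x] X01(1)[of z] by (intro mult_left_mono) (auto simp: d_def)
    moreover have "- lap u z - v (fst z) * u z = X z * (- lap h x - v x * h x) - H z * lap X z - 2 * (\<Sum>b\<in>Basis. pd (b, 0) X z * pd b h x)"
     unfolding lapu by (simp add: u_def H_def x_def algebra_simps)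
    moreover have "K / L * om L z = 12 * q" by (simp add: K_def q_def)
    ultimately show ?thesis using s1 s2 unfolding x_def by linarith
   qed
   define D1 where "D1 z = X z * d (fst z)" for z
   have pL: "(\<lambda>z. d (fst z) * i (snd z)) \<in> L2" "n2 (\<lambda>z. d (fst z) * i (snd z)) \<le> n2 d * n2 i"
    by (rule prod_L2[OF dL(1) iL])+
   have D1m: "D1 \<in> borel_measurable borel" unfolding D1_def by measurable
   have D1le: "norm (D1 z) \<le> norm (d (fst z) * i (snd z))" for z
   proof (cases "norm (snd z) < exp L")
    case True
    then have "i (snd z) = 1" by (simp add: i_def)
    then show ?thesis using X01[of z] by (simp add: D1_def abs_mult mult_left_le_one_le)
   next
    case False
    then have "X z = 0" using norm_snd_le[of "snd z" "fst z"] by (intro Xout) simp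
    then show ?thesis by (simp add: D1_def)
   qed
   have D1L: "D1 \<in> L2" by (rule L2_mono(1)[OF D1m pL(1) D1le])
   have "n2 D1 \<le> n2 d * n2 i" using L2_mono(2)[OF D1m pL(1) D1le] pL(2) by linarith
   also have "\<dots> \<le> \<delta> * n2 i" by (intro mult_right_mono dL) simp
   finally have D1n: "n2 D1 \<le> \<delta> * n2 i" .
   have oL: "(\<lambda>z. (K / L) *\<^sub>R om L z) \<in> L2" "n2 (\<lambda>z. (K / L) *\<^sub>R om L z) = K / L * n2 (om L)"
    using L2_scaleR_const[OF Co(2)[OF L], of "K / L"] K L by auto
   define S where "S z = D1 z + (K / L) *\<^sub>R om L z" for z
   have SL: "S \<in> L2" unfolding S_def by (intro L2_add D1L oL)
   have Sn: "n2 S \<le> \<delta> * n2 i + K / L * (Co * sqrt L)"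
   proof -
    have "n2 S \<le> n2 D1 + K / L * n2 (om L)" unfolding S_def oL(2)[symmetric] by (rule L2_add(2)[OF D1L oL(1)])
    also have "K / L * n2 (om L) \<le> K / L * (Co * sqrt L)" using K L by (intro mult_left_mono Co) auto
    finally show ?thesis using D1n by linarith
   qed
   have vu: "(\<lambda>z. v (fst z) * u z) \<in> L2"
    using L2_bounded_scaleR(1)[OF test_L2[OF u], of "\<lambda>z. v (fst z)" B] v by simp
   have Wu: "(\<lambda>z. W z * u z) \<in> L2" by (rule L2_loc_mult_test[OF Wloc u])
   define T where "T z = - lap u z - v (fst z) * u z" for z
   have TL: "T \<in> L2" unfolding T_def by (intro L2_diff L2_minus test_L2 test_lap u vu)
   have I1: "integrable lborel (\<lambda>z. \<psi> z * T z)" "integrable lborel (\<lambda>z. \<psi> z * (W z * u z))" "integrable lborel (\<lambda>z. \<psi> z * S z)"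
    by (intro L2_prod_integrable \<psi> TL Wu SL)+
   have "(LBINT z. \<psi> z * T z) - (LBINT z. \<psi> z * (W z * u z)) = (LBINT z. \<psi> z * T z - \<psi> z * (W z * u z))"
    using I1 by simp
   also have "\<dots> = (LBINT z. \<psi> z * (- lap u z - (v (fst z) + W z) * u z))"
    by (simp add: T_def algebra_simps)
   finally have "(LBINT z. \<psi> z * (W z * u z)) = (LBINT z. \<psi> z * T z)" unfolding harm[OF u] by simp
   also have "\<dots> \<le> (LBINT z. \<psi> z * S z)"
   proof (rule integral_mono_AE[OF I1(1,3)])
    show "AE z in lborel. \<psi> z * T z \<le> \<psi> z * S z"
     using AE0
    proof eventually_elim
     case (elim z)
     show ?case using pw[OF elim] \<psi>(2)[of z] by (intro mult_left_mono) (auto simp: T_def S_def D1_def)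
    qed
   qed
   also have "\<dots> \<le> n2 \<psi> * n2 S" using L2_prod_integrable(2)[OF \<psi>(1) SL] by linarith
   also have "\<dots> \<le> n2 \<psi> * (\<delta> * n2 i + K / L * (Co * sqrt L))" using Sn by (intro mult_left_mono) auto
   finally have U: "(LBINT z. \<psi> z * (W z * u z)) \<le> n2 \<psi> * (\<delta> * n2 i + K / L * (Co * sqrt L))" .
   \<comment> \<open>\<open>u\<close> contains \<open>h\<close>, which depends on \<delta>.
     Nonnegativity of \<open>W\<close> and \<psi> permits replacing \<open>h\<close> by its lower
     bound \<open>m\<close>, so that afterwards \<delta> occurs on the right-hand side only.\<close>
   have mu: "0 \<le> m (fst z) * X z" "m (fst z) * X z \<le> u z" for z
    using m[of "fst z"] X01(1)[of z] mult_right_mono[OF mh[of "fst z"] X01(1)[of z]]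
    by (auto simp: u_def H_def mult.commute less_imp_le)
   have WX: "(\<lambda>z. W z * (m (fst z) * X z)) \<in> L2"
   proof (rule L2_mono(1)[OF _ Wu])
    show "norm (W z * (m (fst z) * X z)) \<le> norm (W z * u z)" for z
    proof -
     have "W z * (m (fst z) * X z) \<le> W z * u z" "0 \<le> W z * (m (fst z) * X z)"
      using mu[of z] W0[of z] by (auto intro!: mult_left_mono mult_nonneg_nonneg)
     then show ?thesis by simp
    qed
   qed measurable
   have I2: "integrable lborel (\<lambda>z. \<psi> z * (W z * (m (fst z) * X z)))" by (rule L2_prod_integrable(1)[OF \<psi>(1) WX])
   moreover have "(LBINT z. \<psi> z * (W z * (m (fst z) * X z))) \<le> (LBINT z. \<psi> z * (W z * u z))"
    using mu W0 \<psi>(2) by (intro integral_mono I1 I2 mult_left_mono) auto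
   ultimately show ?thesis using U by linarith
  qed
  show "integrable lborel (\<lambda>z. \<psi> z * (W z * (m (fst z) * chi L z)))" using step[of 1] by (simp add: X_def)
  show "(LBINT z. \<psi> z * (W z * (m (fst z) * chi L z))) \<le> n2 \<psi> * (K / L * (Co * sqrt L))"
  proof (rule field_le_epsilon)
   fix e :: real assume e: "e > 0"
   \<comment> \<open>With L fixed, \<delta> is chosen as e / (1 + Q), so that its contribution
     \<delta> Q is at most e.\<close>
   define Q where "Q = n2 \<psi> * n2 i"
   have Q: "Q \<ge> 0" by (simp add: Q_def)
   have "n2 \<psi> * (e / (1 + Q) * n2 i + K / L * (Co * sqrt L)) = e * (Q / (1 + Q)) + n2 \<psi> * (K / L * (Co * sqrt L))"
    by (simp add: Q_def algebra_simps)
   also have "e * (Q / (1 + Q)) \<le> e * 1" using e Q by (intro mult_left_mono) (auto simp: divide_le_eq)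
   finally show "(LBINT z. \<psi> z * (W z * (m (fst z) * chi L z))) \<le> n2 \<psi> * (K / L * (Co * sqrt L)) + e"
    using step[of "e / (1 + Q)"] e Q by (simp add: X_def)
  qed
 qed
 define J where "J n z = \<psi> z * (W z * (m (fst z) * chi (real (Suc n)) z))" for n z
 have J0: "0 \<le> J n z" for n z using \<psi>(2)[of z] W0[of z] m[of "fst z"] by (simp add: J_def less_imp_le)
 \<comment> \<open>Square roots turn the integrals into squared norms, so that
   \<open>L2_Fatou\<close> applies.\<close>
 define f where "f n z = sqrt (J n z)" for n z
 have Ji: "integrable lborel (J n)" for n unfolding J_def by (rule main) simp
 have Jm: "J n \<in> borel_measurable borel" for n using borel_measurable_integrable[OF Ji] by simp
 have f2: "(norm (f n z))\<^sup>2 = J n z" for n z using J0 by (simp add: f_def)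
 have fL: "f n \<in> L2" for n
 proof (rule L2I)
  show "f n \<in> borel_measurable borel" unfolding f_def using Jm[of n] by measurable
  show "integrable lborel (\<lambda>z. (norm (f n z))\<^sup>2)" unfolding f2 by (rule Ji)
 qed
 define G where "G z = sqrt (\<psi> z * (W z * m (fst z)))" for z
 have Gm: "G \<in> borel_measurable borel" unfolding G_def by measurable
 have lim: "AE z in lborel. (\<lambda>n. f n z) \<longlonglongrightarrow> G z"
 proof (intro always_eventually allI)
  fix z
  have "(\<lambda>n. f n z) \<longlonglongrightarrow> sqrt (\<psi> z * (W z * (m (fst z) * 1)))"
   unfolding f_def J_def by (intro tendsto_intros chi_tendsto)
  then show "(\<lambda>n. f n z) \<longlonglongrightarrow> G z" by (simp add: G_def)
 qed
 define c where "c = n2 \<psi> * (K * Co)"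
 have fn: "(n2 (f n))\<^sup>2 \<le> c * sqrt (inverse (real (Suc n)))" for n
 proof -
  define l where "l = real (Suc n)"
  have l: "l \<ge> 1" by (simp add: l_def)
  have "(n2 (f n))\<^sup>2 \<le> n2 \<psi> * (K / l * (Co * sqrt l))"
   unfolding n2_sq f2 J_def l_def[symmetric] by (rule main(2)[OF l])
  also have "\<dots> = c * (sqrt l / l)" by (simp add: c_def)
  also have "sqrt l / l = sqrt (inverse l)"
  proof -
   have "sqrt l * sqrt l = l" "sqrt l > 0" using l by auto
   then show ?thesis unfolding real_sqrt_inverse using l by (simp add: divide_simps)
  qed
  finally show ?thesis by (simp add: l_def)
 qed
 have "n2 G \<le> e \<and> G \<in> L2" if e: "e > 0" for e
 proof -
  have "(\<lambda>n. c * sqrt (inverse (real (Suc n)))) \<longlonglongrightarrow> c * sqrt 0"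
   by (intro tendsto_intros LIMSEQ_inverse_real_of_nat)
  then have "\<forall>\<^sub>F n in sequentially. c * sqrt (inverse (real (Suc n))) < e\<^sup>2"
   using e by (intro order_tendstoD) auto
  then obtain N where N: "\<And>n. n \<ge> N \<Longrightarrow> c * sqrt (inverse (real (Suc n))) < e\<^sup>2"
   unfolding eventually_sequentially by blast
  have le: "n2 (f n) \<le> e" if "n \<ge> N" for n
  proof (rule power2_le_imp_le)
   show "(n2 (f n))\<^sup>2 \<le> e\<^sup>2" using fn[of n] N[OF that] by linarith
  qed (use e in simp)
  show ?thesis using L2_Fatou[OF fL Gm lim le] by simp
 qed
 note Ge = this
 have "n2 G = 0" using Ge field_le_epsilon[of "n2 G" 0] by (intro antisym) auto
 then have "AE z in lborel. G z = 0" using Ge[of 1] by (intro n2_eq_0_AE) auto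
 then show ?thesis
 proof eventually_elim
  case (elim z)
  then show ?case using m[of "fst z"] by (auto simp: G_def)
 qed
qed

text \<open>The three-dimensional inequality holds on every slice of fixed y, and integrating over y
  by Fubini's theorem leaves exactly the x-derivatives on the right.\<close>

lemma form_slices:
 fixes P :: "R3 \<times> R3 \<Rightarrow> real" and v :: "R3 \<Rightarrow> real"
 assumes P: "test P"
  and vm [measurable]: "v \<in> borel_measurable borel" and v: "\<And>x. 0 \<le> v x" "\<And>x. v x \<le> B"
  and form: "\<And>\<phi>. test \<phi> \<Longrightarrow> (LBINT x. v x * (\<phi> x)\<^sup>2) \<le> (LBINT x. (\<Sum>b\<in>Basis. (pd b \<phi> x)\<^sup>2))"
 shows "integrable lborel (\<lambda>z. v (fst z) * (P z)\<^sup>2)" "integrable lborel (\<lambda>z. \<Sum>b\<in>Basis. (pd (b, 0) P z)\<^sup>2)"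
  "(LBINT z. v (fst z) * (P z)\<^sup>2) \<le> (LBINT z. (\<Sum>b\<in>Basis. (pd (b, 0) P z)\<^sup>2))"
proof -
 have vP: "integrable lborel (\<lambda>x. k x * (Q x)\<^sup>2)"
  if "test Q" "k \<in> borel_measurable borel" "\<And>x. \<bar>k x\<bar> \<le> B" for Q k :: "'z::euclidean_space \<Rightarrow> real"
  using L2_prod_integrable(1)[OF L2_bounded_scaleR(1)[OF test_L2[OF that(1)] that(2,3)] test_L2[OF that(1)]]
  by (simp add: power2_eq_square mult.assoc)
 have dP: "integrable lborel (\<lambda>x. \<Sum>b\<in>S. (pd b Q x)\<^sup>2)" if "test Q" "S \<subseteq> Basis" for Q :: "'z::euclidean_space \<Rightarrow> real" and S
  unfolding power2_eq_square
  by (intro Bochner_Integration.integrable_sum test_integrable test_mult' test_pd that test_smooth) (use that in auto)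
 have vf: "(\<lambda>z. v (fst z)) \<in> borel_measurable (borel :: (R3 \<times> R3) measure)" by (rule measurable_compose[OF fst_snd_borel(1) vm])
 show I1: "integrable lborel (\<lambda>z. v (fst z) * (P z)\<^sup>2)" by (rule vP[OF P vf]) (use v in simp)
 have "(\<Sum>b\<in>Basis. (pd (b, 0) P z)\<^sup>2) = (\<Sum>b\<in>(\<lambda>b. (b, 0)) ` Basis. (pd b P z)\<^sup>2)" for z
  by (subst sum.reindex) (auto simp: inj_on_def)
 then show I2: "integrable lborel (\<lambda>z. \<Sum>b\<in>Basis. (pd (b, 0) P z)\<^sup>2)"
  using dP[OF P, of "(\<lambda>b. (b, 0)) ` Basis"] by (simp add: Basis_prod_def)
 define F where "F z = (\<Sum>b\<in>Basis. (pd (b, 0) P z)\<^sup>2) - v (fst z) * (P z)\<^sup>2" for z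
 have "integrable lborel F" unfolding F_def by (intro Bochner_Integration.integrable_diff I1 I2)
 then have FI: "integrable (lborel \<Otimes>\<^sub>M lborel) (case_prod (\<lambda>x y. F (x, y)))" unfolding case_prod_eta lborel_prod .
 have "0 \<le> (LBINT x. F (x, y))" for y
 proof -
  note s = slice_test[OF P, where y=y]
  have "(LBINT x. F (x, y)) = (LBINT x. (\<Sum>b\<in>Basis. (pd b (\<lambda>x. P (x, y)) x)\<^sup>2) - v x * (P (x, y))\<^sup>2)"
   unfolding F_def by (intro Bochner_Integration.integral_cong refl arg_cong2[where f="(-)"] sum.cong) (simp_all add: s(2))
  also have "\<dots> = (LBINT x. (\<Sum>b\<in>Basis. (pd b (\<lambda>x. P (x, y)) x)\<^sup>2)) - (LBINT x. v x * (P (x, y))\<^sup>2)"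
   by (intro Bochner_Integration.integral_diff dP[OF s(1)] vP[OF s(1) vm]) (use v in auto)
  finally show ?thesis using form[OF s(1)] by simp
 qed
 then have "0 \<le> (LBINT y. LBINT x. F (x, y))" by (rule Bochner_Integration.integral_nonneg)
 also have "\<dots> = (LBINT z. F z)" using lborel_pair.integral_snd[OF FI] unfolding case_prod_eta lborel_prod .
 also have "\<dots> = (LBINT z. (\<Sum>b\<in>Basis. (pd (b, 0) P z)\<^sup>2)) - (LBINT z. v (fst z) * (P z)\<^sup>2)"
  unfolding F_def by (rule Bochner_Integration.integral_diff[OF I2 I1])
 finally show "(LBINT z. v (fst z) * (P z)\<^sup>2) \<le> (LBINT z. (\<Sum>b\<in>Basis. (pd (b, 0) P z)\<^sup>2))" by simp
qed

text \<open>If only the pair potential acts, the \<open>x\<close>-energy alone compensates it, which leaves no \<open>y\<close>-energy.\<close>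

lemma two_body_zero_mode:
 fixes a :: "R3 \<times> R3 \<Rightarrow> real" and v :: "R3 \<Rightarrow> real"
 assumes a: "a \<in> L2"
  and vm [measurable]: "v \<in> borel_measurable borel" and v: "\<And>x. 0 \<le> v x" "\<And>x. v x \<le> B"
  and eq: "\<And>\<phi>. test \<phi> \<Longrightarrow> (LBINT z. lap \<phi> z * a z) = (LBINT z. \<phi> z * - (v (fst z) * a z))"
  and form: "\<And>\<phi>. test \<phi> \<Longrightarrow> (LBINT x. v x * (\<phi> x)\<^sup>2) \<le> (LBINT x. (\<Sum>b\<in>Basis. (pd b \<phi> x)\<^sup>2))"
 shows "AE z in lborel. a z = 0"
proof -
 have vf: "(\<lambda>z. v (fst z)) \<in> borel_measurable (borel :: (R3 \<times> R3) measure)" by (rule measurable_compose[OF fst_snd_borel(1) vm])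
 have vL: "(\<lambda>z. v (fst z) * f z) \<in> L2" "n2 (\<lambda>z. v (fst z) * f z) \<le> B * n2 f" if "f \<in> L2" for f :: "R3 \<times> R3 \<Rightarrow> real"
  using L2_bounded_scaleR[OF that vf, of B] v by auto
 obtain w \<alpha> where w0: "\<forall>n. smooth (w n) \<and> w n \<in> L2 \<and> n2 (\<lambda>z. w n z - a z) \<le> (1/2) ^ n"
  and \<alpha>: "\<alpha> \<longlonglongrightarrow> - (LBINT z. a z * - (v (fst z) * a z))"
  and en: "\<forall>n F F'. smooth1 UNIV F \<and> (\<forall>t. (F has_real_derivative F' t) (at t)) \<and> (\<forall>t. \<bar>F t\<bar> \<le> \<bar>t\<bar>) \<and> (\<forall>t. \<bar>F' t\<bar> \<le> 1) \<longrightarrow>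
   (LBINT x. (\<Sum>b\<in>Basis. (pd b (\<lambda>x. chi (real (n + 2)) x * F (w n x)) x)\<^sup>2)) \<le> \<alpha> n"
  by (rule energy_approximation[OF a L2_minus(1)[OF vL(1)[OF a]] eq]) (assumption, rule that, assumption+)
 have w: "\<And>n. smooth (w n)" "\<And>n. w n \<in> L2" "\<And>n. n2 (\<lambda>z. w n z - a z) \<le> (1/2) ^ n" using w0 by blast+
 define X where "X n = (chi (real (n + 2)) :: R3 \<times> R3 \<Rightarrow> real)" for n
 have X: "test (X n)" for n unfolding X_def by (rule chi_test) simp
 note Xm = test_measurable[OF X]
 have X01: "0 \<le> X n z" "X n z \<le> 1" for n z by (auto simp: X_def)
 have Xb: "\<bar>X n z\<bar> \<le> 1" for n z using X01[of n z] by simp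
 have half: "(\<lambda>n. (1/2::real) ^ n) \<longlonglongrightarrow> 0" by (rule LIMSEQ_power_zero) simp
 define P where "P n z = X n z * w n z" for n z
 have P: "test (P n)" for n unfolding P_def by (rule test_mult'[OF X w(1)])
 have idF: "smooth1 UNIV (\<lambda>t::real. t)" using smooth_coord[of "1::real"] by (intro smooth_imp_smooth1) simp
 have PE: "(LBINT z. (\<Sum>b\<in>Basis. (pd b (P n) z)\<^sup>2)) \<le> \<alpha> n" for n
  unfolding P_def X_def by (rule en[rule_format, where F' = "\<lambda>_. 1"]) (use idF in auto)
 have XaL: "(\<lambda>z. X n z * a z) \<in> L2" for n unfolding X_def by (rule chi_mult_L2[OF a])
 note Xa = chi_mult_L2(2)[OF a, folded X_def]
 have Plim: "(\<lambda>n. n2 (\<lambda>z. P n z - a z)) \<longlonglongrightarrow> 0"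
 proof (rule Lim_null_comparison[OF always_eventually], rule allI)
  show "(\<lambda>n. (1/2) ^ n + n2 (\<lambda>z. X n z * a z - a z)) \<longlonglongrightarrow> 0" using tendsto_add[OF half Xa] by simp
  show "norm (n2 (\<lambda>z. P n z - a z)) \<le> (1/2) ^ n + n2 (\<lambda>z. X n z * a z - a z)" for n
  proof -
   have "n2 (\<lambda>z. P n z - a z) \<le> n2 (\<lambda>z. P n z - X n z * a z) + n2 (\<lambda>z. X n z * a z - a z)"
    by (rule n2_triangle[OF test_L2[OF P] XaL a])
   also have "n2 (\<lambda>z. P n z - X n z * a z) = n2 (\<lambda>z. X n z *\<^sub>R (w n z - a z))"
    by (simp add: P_def right_diff_distrib)
   also have "\<dots> \<le> 1 * n2 (\<lambda>z. w n z - a z)" by (rule L2_bounded_scaleR(2)[OF L2_diff(1)[OF w(2) a] Xm Xb])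
   finally show ?thesis using w(3)[of n] by simp
  qed
 qed
 have vPlim: "(\<lambda>n. n2 (\<lambda>z. v (fst z) * P n z - v (fst z) * a z)) \<longlonglongrightarrow> 0"
 proof (rule Lim_null_comparison[OF always_eventually], rule allI)
  show "(\<lambda>n. B * n2 (\<lambda>z. P n z - a z)) \<longlonglongrightarrow> 0" using tendsto_mult_left[OF Plim, of B] by simp
  show "norm (n2 (\<lambda>z. v (fst z) * P n z - v (fst z) * a z)) \<le> B * n2 (\<lambda>z. P n z - a z)" for n
   using vL(2)[OF L2_diff(1)[OF test_L2[OF P] a], of n] by (simp add: right_diff_distrib)
 qed
 define \<beta> where "\<beta> n = (LBINT z. v (fst z) * (P n z)\<^sup>2)" for n
 have "(\<lambda>n. LBINT z. P n z * (v (fst z) * P n z)) \<longlonglongrightarrow> (LBINT z. a z * (v (fst z) * a z))"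
  using L2_tendsto_integral[OF test_L2[OF P] a vL(1)[OF test_L2[OF P]] vL(1)[OF a] Plim vPlim] by simp
 then have "\<beta> \<longlonglongrightarrow> (LBINT z. a z * (v (fst z) * a z))"
  unfolding \<beta>_def by (simp add: power2_eq_square mult_ac)
 \<comment> \<open>The bound \<alpha> on the total energy and the potential energy \<beta> have the
   same limit. Since \<beta> is dominated by the x-energy alone, the difference bounds the
   y-energy.\<close>
 from tendsto_diff[OF \<alpha> this] have \<alpha>\<beta>: "(\<lambda>n. \<alpha> n - \<beta> n) \<longlonglongrightarrow> 0" by simp
 \<comment> \<open>A single y-direction is followed: one vanishing weak partial derivative already
   forces an \<open>L2\<close> function to vanish.\<close>
 obtain b0 :: R3 where b0: "b0 \<in> Basis" using nonempty_Basis by blast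
 have b1: "(0::R3, b0) \<in> Basis" by (rule Basis_prod_memI(2)[OF b0])
 have py: "n2 (pd (0, b0) (P n)) \<le> sqrt (\<alpha> n - \<beta> n)" for n
 proof (rule real_le_rsqrt)
  have fs2: "integrable lborel (\<lambda>z. \<Sum>b\<in>Basis. (pd (b, 0) (P n) z)\<^sup>2)"
   by (rule form_slices(2)[OF P vm v form])
  have fs3: "\<beta> n \<le> (LBINT z. (\<Sum>b\<in>Basis. (pd (b, 0) (P n) z)\<^sup>2))"
   unfolding \<beta>_def by (rule form_slices(3)[OF P vm v form])
  have I0: "integrable lborel (\<lambda>z. (pd (0, b0) (P n) z)\<^sup>2)"
   unfolding power2_eq_square by (intro test_integrable test_mult' test_pd[OF P b1] test_smooth[OF test_pd[OF P b1]])
  have I: "integrable lborel (\<lambda>z. \<Sum>b\<in>Basis. (pd b (P n) z)\<^sup>2)"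
   using dirichlet_test(1)[OF P P, of n n] by (simp add: power2_eq_square)
  have "(n2 (pd (0, b0) (P n)))\<^sup>2 + (LBINT z. (\<Sum>b\<in>Basis. (pd (b, 0) (P n) z)\<^sup>2))
   = (LBINT z. (pd (0, b0) (P n) z)\<^sup>2 + (\<Sum>b\<in>Basis. (pd (b, 0) (P n) z)\<^sup>2))"
   unfolding n2_sq real_norm_def power2_abs by (subst Bochner_Integration.integral_add[OF I0 fs2]) simp
  also have "\<dots> \<le> (LBINT z. (\<Sum>b\<in>Basis. (pd b (P n) z)\<^sup>2))"
  proof (rule integral_mono[OF Bochner_Integration.integrable_add[OF I0 fs2] I])
   show "(pd (0, b0) (P n) z)\<^sup>2 + (\<Sum>b\<in>Basis. (pd (b, 0) (P n) z)\<^sup>2) \<le> (\<Sum>b\<in>Basis. (pd b (P n) z)\<^sup>2)" for z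
    unfolding sum_Basis_prod using member_le_sum[OF b0, of "\<lambda>b. (pd (0, b) (P n) z)\<^sup>2"] by simp
  qed
  finally show "(n2 (pd (0, b0) (P n)))\<^sup>2 \<le> \<alpha> n - \<beta> n" using PE[of n] fs3 by linarith
 qed
 show ?thesis
 proof (rule zero_weak_derivative_L2[OF a b1])
  fix u :: "R3 \<times> R3 \<Rightarrow> real" assume u: "test u"
  have "(\<lambda>n. LBINT z. pd (0, b0) u z * P n z) \<longlonglongrightarrow> (LBINT z. pd (0, b0) u z * a z)"
   using L2_tendsto_integral_const[OF test_L2[OF P] a test_L2[OF test_pd[OF u b1]] Plim] by simp
  moreover have "(\<lambda>n. LBINT z. pd (0, b0) u z * P n z) \<longlonglongrightarrow> 0"
  proof (rule Lim_null_comparison[OF always_eventually], rule allI)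
   have "(\<lambda>n. sqrt (\<alpha> n - \<beta> n) * n2 u) \<longlonglongrightarrow> sqrt 0 * n2 u" by (intro tendsto_intros \<alpha>\<beta>)
   then show "(\<lambda>n. sqrt (\<alpha> n - \<beta> n) * n2 u) \<longlonglongrightarrow> 0" by simp
   show "norm (LBINT z. pd (0, b0) u z * P n z) \<le> sqrt (\<alpha> n - \<beta> n) * n2 u" for n
   proof -
    have "(LBINT z. pd (0, b0) u z * P n z) = - (LBINT z. pd (0, b0) (P n) z * u z)"
     using ibp_test[OF test_smooth[OF P] u b1, of n] by (simp add: mult.commute)
    then have "norm (LBINT z. pd (0, b0) u z * P n z) \<le> n2 (pd (0, b0) (P n)) * n2 u"
     using L2_prod_integrable(2)[OF test_L2[OF test_pd[OF P b1]] test_L2[OF u], of n] by simp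
    also have "\<dots> \<le> sqrt (\<alpha> n - \<beta> n) * n2 u" by (intro mult_right_mono py) simp
    finally show ?thesis .
   qed
  qed
  ultimately show "(LBINT z. a z * pd (0, b0) u z) = 0"
   using LIMSEQ_unique by (fastforce simp: mult.commute)
 qed
qed

text \<open>The absolute value serves to show W |a| = 0, which is the same as W a = 0; the equation
  for \<open>a\<close> itself then contains the pair potential alone.\<close>

lemma three_body_zero_mode:
 fixes a W :: "R3 \<times> R3 \<Rightarrow> real" and v :: "R3 \<Rightarrow> real"
 assumes a: "a \<in> L2"
  and vm [measurable]: "v \<in> borel_measurable borel" and v: "\<And>x. 0 \<le> v x" "\<And>x. v x \<le> B"
  and Wm [measurable]: "W \<in> borel_measurable borel" and W0: "\<And>z. 0 \<le> W z"
  and Wloc: "\<And>r. (\<lambda>z. indicator (cball 0 r) z * W z) \<in> L2"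
  and Va: "(\<lambda>z. (v (fst z) + W z) * a z) \<in> L2"
  and eq: "\<And>\<phi>. test \<phi> \<Longrightarrow> (LBINT z. lap \<phi> z * a z) = (LBINT z. \<phi> z * - ((v (fst z) + W z) * a z))"
  and form3: "\<And>\<phi>. test \<phi> \<Longrightarrow> (LBINT x. v x * (\<phi> x)\<^sup>2) \<le> (LBINT x. (\<Sum>b\<in>Basis. (pd b \<phi> x)\<^sup>2))"
  and form6: "\<And>\<phi>. test \<phi> \<Longrightarrow> (LBINT z. (v (fst z) + W z) * (\<phi> z)\<^sup>2) \<le> (LBINT z. (\<Sum>b\<in>Basis. (pd b \<phi> z)\<^sup>2))"
  and approx: "approx_resonance v C m"
 shows "AE z in lborel. a z = 0"
proof -
 have vf [measurable]: "(\<lambda>z. v (fst z)) \<in> borel_measurable (borel :: (R3 \<times> R3) measure)" by (rule measurable_compose[OF fst_snd_borel(1) vm])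
 note [measurable] = L2_measurable[OF a]
 have Vm: "(\<lambda>z. v (fst z) + W z) \<in> borel_measurable borel" by (intro borel_measurable_add vf Wm)
 have V0: "0 \<le> v (fst z) + W z" for z using v W0 by simp
 have Vloc: "(\<lambda>z. indicator (cball 0 r) z * (v (fst z) + W z)) \<in> L2" for r
 proof -
  have "(\<lambda>z::R3 \<times> R3. indicator (cball 0 r) z * v (fst z)) \<in> L2" by (rule bounded_loc_L2[OF vf]) (use v in simp)
  from L2_add(1)[OF this Wloc[of r]] show ?thesis by (simp add: algebra_simps)
 qed
 have "AE z in lborel. W z * \<bar>a z\<bar> = 0"
 proof (rule resonance_excludes[OF _ _ vm v Wm W0 Wloc _ approx])
  show "(\<lambda>z. \<bar>a z\<bar>) \<in> L2" using L2_norm_fun(1)[OF a] by simp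
  show "(LBINT z. \<bar>a z\<bar> * (- lap u z - (v (fst z) + W z) * u z)) = 0" if "test u" for u
   by (rule abs_of_zero_mode[OF a Vm V0 Vloc Va eq form6 that])
 qed auto
 then have Wa: "AE z in lborel. W z * a z = 0" by eventually_elim auto
 show ?thesis
 proof (rule two_body_zero_mode[OF a vm v _ form3])
  fix \<phi> :: "R3 \<times> R3 \<Rightarrow> real" assume \<phi>: "test \<phi>"
  note pm = test_measurable[OF \<phi>]
  have "(LBINT z. \<phi> z * - ((v (fst z) + W z) * a z)) = (LBINT z. \<phi> z * - (v (fst z) * a z))"
  proof (rule integral_cong_AE)
   show "(\<lambda>z. \<phi> z * - ((v (fst z) + W z) * a z)) \<in> borel_measurable lborel" "(\<lambda>z. \<phi> z * - (v (fst z) * a z)) \<in> borel_measurable lborel"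
    unfolding measurable_lborel2 by (intro borel_measurable_times borel_measurable_uminus pm Vm vf L2_measurable[OF a])+
   show "AE z in lborel. \<phi> z * - ((v (fst z) + W z) * a z) = \<phi> z * - (v (fst z) * a z)"
    using Wa by eventually_elim (auto simp: distrib_right)
  qed
  then show "(LBINT z. lap \<phi> z * a z) = (LBINT z. \<phi> z * - (v (fst z) * a z))" using eq[OF \<phi>] by simp
 qed
qed

section \<open>The outer pair potentials on R^6\<close>

lemma L2_plus_Linf_measurable: "U \<in> L2_plus_Linf_vanishing \<Longrightarrow> U \<in> borel_measurable borel"
 by (auto simp: L2_plus_Linf_vanishing_def Linf_vanishing_def dest: L2_measurable)

lemma shear_borel: "(\<lambda>z. p *\<^sub>R fst z + q *\<^sub>R snd z) \<in> borel_measurable (borel :: ('a::euclidean_space \<times> 'a) measure)"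
 by (intro borel_measurable_continuous_onI continuous_intros)

text \<open>The bounded summand is locally square integrable at once. For the other one, enlarging
  the ball to the cylinder |x| \<le> r brings the integral into the form of
  \<open>nn_integral_shear\<close>.\<close>

lemma L2_plus_Linf_shear:
 fixes U :: "'a::euclidean_space \<Rightarrow> real"
 assumes U: "U \<in> L2_plus_Linf_vanishing" and q: "q \<noteq> 0"
 shows "(\<lambda>z. indicator (cball 0 r) z * U (p *\<^sub>R fst z + q *\<^sub>R snd z)) \<in> L2"
proof -
 obtain f g where f: "f \<in> L2" and gm [measurable]: "g \<in> borel_measurable borel" and gb: "bounded (range g)" and Ueq: "U = (\<lambda>x. f x + g x)"
  using U by (auto simp: L2_plus_Linf_vanishing_def Linf_vanishing_def)
 obtain B where B: "\<And>x. \<bar>g x\<bar> \<le> B" using gb unfolding bounded_iff by auto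
 define D where "D z = p *\<^sub>R fst z + q *\<^sub>R snd z" for z :: "'a \<times> 'a"
 have D: "D \<in> borel_measurable borel" unfolding D_def by (rule shear_borel)
 have g: "(\<lambda>z. indicator (cball 0 r) z * g (D z)) \<in> L2"
  by (rule bounded_loc_L2[OF measurable_compose[OF D gm] B])
 define k where "k = inverse (\<bar>q\<bar> ^ DIM('a)) * (measure lborel (cball (0::'a) r) * (n2 f)\<^sup>2)"
 have k: "k \<ge> 0" by (simp add: k_def)
 have fL: "(\<lambda>z. indicator (cball 0 r) z * f (D z)) \<in> L2"
 proof (rule L2_nnI(1))
  show "(\<lambda>z. indicator (cball 0 r) z * f (D z)) \<in> borel_measurable borel"
   by (intro borel_measurable_times borel_measurable_indicator measurable_compose[OF D L2_measurable[OF f]]) auto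
  have A: "(indicator (cball 0 r) :: 'a \<Rightarrow> ennreal) \<in> borel_measurable borel" by (intro borel_measurable_indicator borel_closed closed_cball)
  have F: "(\<lambda>x. ennreal ((norm (f x))\<^sup>2)) \<in> borel_measurable borel" using L2_measurable[OF f] by measurable
  have "(\<integral>\<^sup>+z. ennreal ((norm (indicator (cball 0 r) z * f (D z)))\<^sup>2) \<partial>lborel)
   \<le> (\<integral>\<^sup>+z. indicator (cball 0 r) (fst z) * ennreal ((norm (f (D z)))\<^sup>2) \<partial>lborel)"
  proof (rule nn_integral_mono)
   fix z :: "'a \<times> 'a"
   have "norm (fst z) \<le> norm z" using norm_fst_le[of "fst z" "snd z"] by simp
   then show "ennreal ((norm (indicator (cball 0 r) z * f (D z)))\<^sup>2) \<le> indicator (cball 0 r) (fst z) * ennreal ((norm (f (D z)))\<^sup>2)"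
    by (auto simp: indicator_def)
  qed
  also have "\<dots> = ennreal (inverse (\<bar>q\<bar> ^ DIM('a))) * ((\<integral>\<^sup>+x. indicator (cball (0::'a) r) x \<partial>lborel) * (\<integral>\<^sup>+x. ennreal ((norm (f x))\<^sup>2) \<partial>lborel))"
   unfolding D_def by (rule nn_integral_shear[OF A F q])
  also have "(\<integral>\<^sup>+x. indicator (cball (0::'a) r) x \<partial>lborel) = ennreal (measure lborel (cball (0::'a) r))"
   using emeasure_eq_ennreal_measure[of lborel "cball (0::'a) r"] emeasure_bounded_finite[of "cball (0::'a) r"] by simp
  also have "ennreal (inverse (\<bar>q\<bar> ^ DIM('a))) * (ennreal (measure lborel (cball (0::'a) r)) * (\<integral>\<^sup>+x. ennreal ((norm (f x))\<^sup>2) \<partial>lborel)) = ennreal k"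
   unfolding nn_integral_L2[OF f] k_def by (simp add: ennreal_mult)
  also have "\<dots> = ennreal ((sqrt k)\<^sup>2)" using k by simp
  finally show "(\<integral>\<^sup>+z. ennreal ((norm (indicator (cball 0 r) z * f (D z)))\<^sup>2) \<partial>lborel) \<le> ennreal ((sqrt k)\<^sup>2)" .
 qed (use k in simp)
 show ?thesis using L2_add(1)[OF fL g] by (simp add: Ueq D_def algebra_simps)
qed

text \<open>Carries properties of the pair potentials that hold almost everywhere on R^3 over to
  R^6. The preimage of a null set has measure a constant times \<infinity> times 0, which is 0 in
  \<open>ennreal\<close>.\<close>

lemma AE_shear:
 fixes Q :: "'a::euclidean_space \<Rightarrow> bool"
 assumes "AE x in lborel. Q x" and q: "q \<noteq> 0"
 shows "AE z in lborel. Q (p *\<^sub>R fst z + q *\<^sub>R snd z)"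
proof -
 obtain N where N: "N \<in> null_sets lborel" "{x \<in> space lborel. \<not> Q x} \<subseteq> N"
  using assms(1) unfolding eventually_ae_filter by blast
 have Ns: "N \<in> sets borel" and N0: "emeasure lborel N = 0" using N by (auto simp: null_sets_def)
 have F: "(indicator N :: 'a \<Rightarrow> ennreal) \<in> borel_measurable borel" using Ns by simp
 have "(\<integral>\<^sup>+z. 1 * indicator N (p *\<^sub>R fst z + q *\<^sub>R snd z) \<partial>lborel) = (0::ennreal)"
  using nn_integral_shear[OF borel_measurable_const F q, of 1 p] Ns N0 by simp
 then have "AE z in lborel. 1 * indicator N (p *\<^sub>R fst z + q *\<^sub>R snd z) = (0::ennreal)"
  by (subst (asm) nn_integral_0_iff_AE) (use measurable_compose[OF shear_borel F] in auto)
 then show ?thesis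
 proof eventually_elim
  case (elim z)
  then show ?case using N(2) by (auto simp: indicator_def split: if_splits)
 qed
qed

theorem theorem3:
  fixes hbar m1 m2 m3 :: real
    and V12 V13 V23 :: "real^3 \<Rightarrow> real"
    and \<psi>0 :: "(real^3) \<times> (real^3) \<Rightarrow> complex"
  assumes "hbar > 0" and "m1 > 0" and "m2 > 0" and "m3 > 0"
    and "V12 \<in> borel_measurable borel"
    and "\<exists>b1>0. \<exists>b2>0. \<forall>x. 0 \<le> V12 (alpha hbar m1 m2 *\<^sub>R x) \<and>
           V12 (alpha hbar m1 m2 *\<^sub>R x) \<le> b1 * exp (- b2 * norm x)"
    and "nonneg_operator (sobolev 2) (h12 hbar m1 m2 V12 0)"
    and "\<forall>\<epsilon>>0. spectrum (sobolev 2) (h12 hbar m1 m2 V12 \<epsilon>) \<inter> complex_of_real ` {..<0} \<noteq> {}"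
    and "V13 \<in> L2_plus_Linf_vanishing" and "V23 \<in> L2_plus_Linf_vanishing"
    and "AE r in lborel. 0 \<le> V13 r" and "AE r in lborel. 0 \<le> V23 r"
    and "\<not> (AE r in lborel. V23 r = 0)"
    and "nonneg_operator (sobolev 2) (hamiltonian hbar m1 m2 m3 V12 V13 V23)"
    and "\<psi>0 \<in> sobolev 2"
    and "AE z in lborel. hamiltonian hbar m1 m2 m3 V12 V13 V23 \<psi>0 z = 0"
  shows "AE z in lborel. \<psi>0 z = 0"
proof -
 define v where "v x = V12 (alpha hbar m1 m2 *\<^sub>R x)" for x
 obtain b1 b2 where b: "b1 > 0" "b2 > 0" and v0: "\<And>x. 0 \<le> v x" and vexp: "\<And>x. v x \<le> b1 * exp (- b2 * norm x)"
  using assms(6) unfolding v_def by blast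
 have vb: "v x \<le> b1" for x
 proof -
  have "b1 * exp (- b2 * norm x) \<le> b1 * 1" using b by (intro mult_left_mono) auto
  then show ?thesis using vexp[of x] by simp
 qed
 have vm: "v \<in> borel_measurable borel"
  unfolding v_def by (rule measurable_compose[OF _ assms(5)]) simp
 define s where "s x = sqrt (v x)" for x
 have s2: "(s x)\<^sup>2 = v x" for x using v0 by (simp add: s_def)
 interpret bounded_weight s "sqrt b1"
  by unfold_locales (use vm vb v0 b in \<open>auto simp: s_def[abs_def]\<close>)
 have h12: "h12 hbar m1 m2 V12 \<epsilon> = schroedinger (\<lambda>x. (1 + \<epsilon>) * (s x)\<^sup>2)" for \<epsilon>
  unfolding h12_def s2 v_def ..
 have nn3: "nonneg_operator (sobolev 2) (schroedinger v)"
  using assms(7) unfolding h12 s2 by simp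
 obtain C m where approx: "approx_resonance v C m"
 proof (rule approximate_resonance[of b1 b2])
  show "nonneg_operator (sobolev 2) (schroedinger (\<lambda>x. (s x)\<^sup>2))" using nn3 unfolding s2 .
  show "spectrum (sobolev 2) (schroedinger (\<lambda>x. (1 + \<epsilon>) * (s x)\<^sup>2)) \<inter> complex_of_real ` {..<0} \<noteq> {}" if "\<epsilon> > 0" for \<epsilon>
   using assms(8) that unfolding h12 by blast
 qed (use b vexp that in \<open>auto simp only: s2\<close>)
 have vloc: "(\<lambda>x. indicator (cball 0 r) x * v x) \<in> L2" for r
  by (rule bounded_loc_L2[OF vm]) (use v0 vb in simp)
 note form3 = form_inequality(2)[OF nn3 vm vloc]
 \<comment> \<open>The coefficient of y is the same in r1 - r3 and r2 - r3, and it is nonzero, so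
   both are covered by the shear lemmas.\<close>
 define q where "q = - beta hbar m1 m2 m3"
 have q: "q \<noteq> 0" using assms(1-4) by (simp add: q_def beta_def M12_def)
 define p13 where "p13 = - (m2 / (m1 + m2) * alpha hbar m1 m2)"
 define p23 where "p23 = m1 / (m1 + m2) * alpha hbar m1 m2"
 define A where "A z = V13 (p13 *\<^sub>R fst z + q *\<^sub>R snd z)" for z
 define A' where "A' z = V23 (p23 *\<^sub>R fst z + q *\<^sub>R snd z)" for z
 have Am: "A \<in> borel_measurable borel" "A' \<in> borel_measurable borel"
  unfolding A_def A'_def by (intro measurable_compose[OF shear_borel] L2_plus_Linf_measurable assms)+
 have Aloc: "(\<lambda>z. indicator (cball 0 r) z * A z) \<in> L2" "(\<lambda>z. indicator (cball 0 r) z * A' z) \<in> L2" for r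
  unfolding A_def A'_def by (intro L2_plus_Linf_shear assms q)+
 have A0: "AE z in lborel. 0 \<le> A z" "AE z in lborel. 0 \<le> A' z"
  unfolding A_def A'_def by (intro AE_shear assms q)+
 have vf: "(\<lambda>z. v (fst z)) \<in> borel_measurable (borel :: (R3 \<times> R3) measure)" by (rule measurable_compose[OF fst_snd_borel(1) vm])
 define U where "U z = v (fst z) + A z + A' z" for z
 have ham: "hamiltonian hbar m1 m2 m3 V12 V13 V23 = schroedinger U"
 proof -
  have "(\<lambda>(x, y). V12 (alpha hbar m1 m2 *\<^sub>R x) + V13 (diff13 hbar m1 m2 m3 x y) + V23 (diff23 hbar m1 m2 m3 x y)) = U"
   by (auto simp: fun_eq_iff U_def v_def A_def A'_def diff13_def diff23_def p13_def p23_def q_def)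
  then show ?thesis unfolding hamiltonian_def by simp
 qed
 \<comment> \<open>V13 and V23 are nonnegative only almost everywhere; the maxima make
   \<open>W\<close> nonnegative everywhere and change the potential on a null set only.\<close>
 define W where "W z = max 0 (A z) + max 0 (A' z)" for z
 have W0: "0 \<le> W z" for z by (simp add: W_def)
 have Wm: "W \<in> borel_measurable borel" unfolding W_def by (intro borel_measurable_add borel_measurable_max borel_measurable_const Am)
 define V where "V z = v (fst z) + W z" for z
 have VU: "AE z in lborel. U z = V z" using A0 by eventually_elim (simp add: U_def V_def W_def)
 have Um: "U \<in> borel_measurable borel" unfolding U_def by (intro borel_measurable_add vf Am)
 have Vm: "V \<in> borel_measurable borel" unfolding V_def by (intro borel_measurable_add vf Wm)
 have Wloc: "(\<lambda>z. indicator (cball 0 r) z * W z) \<in> L2" for r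
 proof (rule L2_mono(1))
  show "(\<lambda>z. norm (indicator (cball 0 r) z * A z) + norm (indicator (cball 0 r) z * A' z)) \<in> L2"
   by (intro L2_add L2_norm_fun Aloc)
  show "(\<lambda>z. indicator (cball 0 r) z * W z) \<in> borel_measurable borel"
   by (intro borel_measurable_times borel_measurable_indicator Wm) auto
  show "norm (indicator (cball 0 r) z * W z) \<le> norm (norm (indicator (cball 0 r) z * A z) + norm (indicator (cball 0 r) z * A' z))" for z
   by (auto simp: W_def indicator_def)
 qed
 have Uloc: "(\<lambda>z. indicator (cball 0 r) z * U z) \<in> L2" for r
 proof -
  have "(\<lambda>z::R3 \<times> R3. indicator (cball 0 r) z * v (fst z)) \<in> L2" by (rule bounded_loc_L2[OF vf]) (use v0 vb in simp)
  from L2_add(1)[OF L2_add(1)[OF this Aloc(1)[of r]] Aloc(2)[of r]] show ?thesis by (simp add: U_def algebra_simps)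
 qed
 have nn6: "nonneg_operator (sobolev 2) (schroedinger U)" using assms(14) unfolding ham .
 have form6: "(LBINT z. (v (fst z) + W z) * (\<phi> z)\<^sup>2) \<le> (LBINT z. (\<Sum>b\<in>Basis. (pd b \<phi> z)\<^sup>2))"
  if \<phi>: "test \<phi>" for \<phi> :: "R3 \<times> R3 \<Rightarrow> real"
 proof -
  note pm = test_measurable[OF \<phi>]
  have "(LBINT z. (v (fst z) + W z) * (\<phi> z)\<^sup>2) = (LBINT z. U z * (\<phi> z)\<^sup>2)"
  proof (rule integral_cong_AE)
   show "(\<lambda>z. (v (fst z) + W z) * (\<phi> z)\<^sup>2) \<in> borel_measurable lborel" "(\<lambda>z. U z * (\<phi> z)\<^sup>2) \<in> borel_measurable lborel"
    unfolding measurable_lborel2 by (intro borel_measurable_times borel_measurable_power borel_measurable_add pm vf Wm Um)+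
   show "AE z in lborel. (v (fst z) + W z) * (\<phi> z)\<^sup>2 = U z * (\<phi> z)\<^sup>2" using VU by eventually_elim (simp add: V_def)
  qed
  then show ?thesis using form_inequality(2)[OF nn6 Um Uloc \<phi>] by simp
 qed
 have \<psi>L: "\<psi>0 \<in> L2" by (rule sobolev_L2[OF assms(15)])
 note LL = laplacian_L2[OF assms(15)]
 have lapV: "AE z in lborel. laplacian \<psi>0 z = - (V z *\<^sub>R \<psi>0 z)"
  using assms(16) VU
 proof eventually_elim
  case (elim z)
  then show ?case by (simp add: ham schroedinger_def scaleR_conv_of_real neg_eq_iff_add_eq_0 eq_neg_iff_add_eq_0)
 qed
 \<comment> \<open>\<open>T\<close> stands for the real or the imaginary part. The potential is
   real, so each part satisfies the same weak equation.\<close>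
 have component: "AE z in lborel. T (\<psi>0 z) = 0"
  if T: "bounded_linear T" and TL: "\<And>f :: R3 \<times> R3 \<Rightarrow> complex. f \<in> L2 \<Longrightarrow> (\<lambda>z. T (f z)) \<in> L2" for T :: "complex \<Rightarrow> real"
 proof -
  have Ts: "T (c *\<^sub>R x) = c * T x" "T (- x) = - T x" for c x
   using linear_scale[OF bounded_linear.linear[OF T]] linear_neg[OF bounded_linear.linear[OF T]] by auto
  note a = TL[OF \<psi>L]
  have Vam: "(\<lambda>z. V z * T (\<psi>0 z)) \<in> borel_measurable borel" by (intro borel_measurable_times Vm L2_measurable[OF a])
  have LV: "AE z in lborel. T (laplacian \<psi>0 z) = - (V z * T (\<psi>0 z))"
   using lapV by eventually_elim (simp add: Ts)
  \<comment> \<open>Square integrability of the potential times the zero mode is read off from the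
    equation, since the Laplacian of \<psi>0 lies in \<open>L2\<close>.\<close>
  have Va: "(\<lambda>z. V z * T (\<psi>0 z)) \<in> L2"
  proof (rule L2_cong_AE(1)[OF Vam L2_minus(1)[OF TL[OF LL]]])
   show "AE z in lborel. V z * T (\<psi>0 z) = - T (laplacian \<psi>0 z)" using LV by eventually_elim simp
  qed
  show ?thesis
  proof (rule three_body_zero_mode[OF a vm v0 vb Wm W0 Wloc Va[unfolded V_def] _ form3 form6 approx])
   fix \<phi> :: "R3 \<times> R3 \<Rightarrow> real" assume \<phi>: "test \<phi>"
   have Tint: "T (LBINT z. \<theta> z *\<^sub>R f z) = (LBINT z. \<theta> z * T (f z))"
    if "test \<theta>" "f \<in> L2" for \<theta> and f :: "R3 \<times> R3 \<Rightarrow> complex"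
    using integral_bounded_linear[OF T L2_scaleR_integrable(1)[OF test_L2[OF that(1)] that(2)]] by (simp add: Ts)
   have "(LBINT z. lap \<phi> z * T (\<psi>0 z)) = (LBINT z. \<phi> z * T (laplacian \<psi>0 z))"
    using Tint[OF test_lap[OF \<phi>] \<psi>L] Tint[OF \<phi> LL] laplacian_weak[OF assms(15) \<phi>] by simp
   also have "\<dots> = (LBINT z. \<phi> z * - ((v (fst z) + W z) * T (\<psi>0 z)))"
   proof (rule integral_cong_AE)
    note pm = test_measurable[OF \<phi>]
    show "(\<lambda>z. \<phi> z * T (laplacian \<psi>0 z)) \<in> borel_measurable lborel"
     "(\<lambda>z. \<phi> z * - ((v (fst z) + W z) * T (\<psi>0 z))) \<in> borel_measurable lborel"
     unfolding measurable_lborel2 V_def[symmetric]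
     by (intro borel_measurable_times borel_measurable_uminus pm Vam L2_measurable[OF TL[OF LL]])+
    show "AE z in lborel. \<phi> z * T (laplacian \<psi>0 z) = \<phi> z * - ((v (fst z) + W z) * T (\<psi>0 z))"
     using LV by eventually_elim (simp add: V_def)
   qed
   finally show "(LBINT z. lap \<phi> z * T (\<psi>0 z)) = (LBINT z. \<phi> z * - ((v (fst z) + W z) * T (\<psi>0 z)))" .
  qed auto
 qed
 have "AE z in lborel. Re (\<psi>0 z) = 0" "AE z in lborel. Im (\<psi>0 z) = 0"
  by (rule component[OF bounded_linear_Re L2_Re_Im(1)] component[OF bounded_linear_Im L2_Re_Im(2)]; assumption)+
 then show ?thesis by eventually_elim (simp add: complex_eq_iff)
qed

end
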